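(* Let $M$ be a smooth $m$-dimensional manifold, let $\mathcal G\subset\mathcal D(M)$ be a tame Lie pseudogroup acting on $M$, with associated integer $n^*\ge 1$, and let $J^n=J^n(M,p)$ denote the bundle of $n$-jets of $p$-dimensional submanifolds of $M$, with canonical projections $\widetilde\pi^{n+k}_n\colon J^{n+k}\to J^n$. Let $n\ge n^*$ be an integer and suppose that $\mathcal G$ acts locally freely at $z_o^{(n)}\in J^n$. Then for every integer $k\ge 0$, $\mathcal G$ acts locally freely at every $z_o^{(n+k)}\in J^{n+k}$ with $\widetilde\pi^{n+k}_n(z_o^{(n+k)})=z_o^{(n)}$.
   Context: **Diffeomorphism jets.** $\mathcal D=\mathcal D(M)$ is the pseudogroup of all local diffeomorphisms $\varphi$ of $M$ with open domain $\mathrm{dom}\,\varphi\subset M$. $\mathcal D^{(n)}$ is the bundle of their $n$-jets $j^n_z\varphi$, $z\in\mathrm{dom}\,\varphi$, with source map $\sigma^n(j^n_z\varphi)=z$ and target map $\tau^n(j^n_z\varphi)=\varphi(z)$. It is a groupoid under $j^n_{\varphi(z)}\psi\cdot j^n_z\varphi=j^n_z(\psi\circ\varphi)$. The identity jet at $z$ is $\mathbb I^{(n)}_z=j^n_z\mathrm{id}$. Local coordinates on $\mathcal D^{(n)}$ are $(z,Z^{(n)})$, with $Z^a_{b_1\cdots b_k}=\partial^k\varphi^a/\partial z^{b_1}\cdots\partial z^{b_k}(z)$, $0\le k\le n$. **Prolongation of submanifolds of $\mathcal D^{(n)}$.** The prolongation $\mathrm{pr}^{(1)}\mathcal R\subset\mathcal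 D^{(n+1)}$ of a submanifold $\mathcal R\subset\mathcal D^{(n)}$ consists of the jets $j^{n+1}_z\varphi$ such that $j^n_z\varphi\in\mathcal R$ and $(j^n\varphi)_*(T_zM)\subset T_{j^n_z\varphi}\mathcal R$, where $j^n\varphi$ is the local section $w\mapsto j^n_w\varphi$ of $\sigma^n$. $\mathrm{pr}^{(k)}$ denotes the $k$-fold repeated prolongation. **Lie pseudogroup.** For $\mathcal G\subset\mathcal D$ let $\mathcal G^{(n)}\subset\mathcal D^{(n)}$ be the set of $n$-jets of elements of $\mathcal G$. $\mathcal G$ is a Lie pseudogroup if $\varphi,\psi\in\mathcal G$ implies $\varphi\circ\psi^{-1}\in\mathcal G$ where defined, and there is an integer $n^*\ge1$ such that for all $n\ge n^*$: 1. $\mathcal G^{(n)}\subset\mathcal D^{(n)}$ is a smooth, embedded subbundle (over $M$ via $\sigma^n$); 2. every $\varphi\in\mathcal D$ with $j^n_z\varphi\in\mathcal G^{(n)}$ for all $z\in\mathrm{dom}\,\varphi$ belongs to $\mathcal G$; 3. $\mathcal G^{(n)}=\mathrm{pr}^{(n-n^* )}\mathcal G^{(n^* )}$. **Tameness.** A $\mathcal G$ vector field is a locally defined smooth vector field $\mathbf v$ on $M$ whose flow maps at all fixed times $t$ belong to $\mathcal G$. An $n$-jet at $z$ of a vector field $\sum_a\zeta^a\partial/\partial z^a$, with derivative coordinates $\zeta^a_{b_1\cdots b_k}$, $0\le k\le n$, satisfies the infinitesimal determining equations of order $n$ if the vector $\sum_{a}\sum_{0\le k\le n}\zeta^a_{b_1\cdots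 b_k}\,\partial/\partial Z^a_{b_1\cdots b_k}$ at $\mathbb I^{(n)}_z$ is tangent to $\mathcal G^{(n)}$; that is, the jet satisfies the linearization at the identity jet of the local equations defining $\mathcal G^{(n)}$. $\mathcal G$ is tame if, for all $n\ge n^*$, every such $n$-jet is the $n$-jet of some $\mathcal G$ vector field. **Submanifold jets and prolonged action.** $J^n=J^n(M,p)$ is the $n$th order (extended) jet bundle: the equivalence classes of $p$-dimensional submanifolds of $M$ under $n$th order contact at a point ($p$ fixed, $J^0=M$), with projection $\widetilde\pi^n_o\colon J^n\to M$. Local diffeomorphisms preserve $n$th order contact, so $\mathcal D$ acts on $J^n$. This induces an action $g^{(n)}\cdot z^{(n)}$ of $\mathcal D^{(n)}$ on $J^n$, defined when $\sigma^n(g^{(n)})=\widetilde\pi^n_o(z^{(n)})$: if $g^{(n)}=j^n_z\varphi$ and $z^{(n)}$ is the $n$-jet of a submanifold $S$ at $z$, then $g^{(n)}\cdot z^{(n)}$ is the $n$-jet of $\varphi(S)$ at $\varphi(z)$. **Freeness.** For $z^{(n)}\in J^n$ over $z\in M$, the isotropy subgroup is $$\mathcal G^{(n)}_{z^{(n)}}=\{g^{(n)}\in\mathcal G^{(n)}\mid \sigma^n(g^{(n)})=\tau^n(g^{(n)})=z,\ g^{(n)}\cdot z^{(n)}=z^{(n)}\}.$$ For $n\ge n^*$ it is a Lie group. $\mathcal G$ acts freely at $z^{(n)}$ if $\mathcal G^{(n)}_{z^{(n)}}=\{\mathbb I^{(n)}_z\}$, and locally freely at $z^{(n)}$ if $\mathcal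 G^{(n)}_{z^{(n)}}$ is discrete. *)

theory Defs
  imports "HOL-Analysis.Analysis"
begin

section \<open>Smooth calculus on coordinate spaces\<close>

text \<open>
  The dimension of the jet bundles grows with the order of the jets, so coordinate spaces cannot
  be finite-dimensional types.  For a finite index set \<open>I\<close>, the space \<open>\<real>\<^sup>I\<close> consists of the functions
  on the whole index type that vanish off \<open>I\<close>, with the product topology; for \<open>I = {..<m}\<close>
  it is the carrier of the library's \<open>Euclidean_space m\<close>.
\<close>

definition coord_space :: "'i set \<Rightarrow> ('i \<Rightarrow> real) set" where
  "coord_space I = {x. \<forall>i. i \<notin> I \<longrightarrow> x i = 0}"

text \<open>The iterated partial derivative along \<open>i\<^sub>1, \<dots>, i\<^sub>k\<close>; the last index is applied first.\<close>

primrec ipartial :: "'i list \<Rightarrow> (('i \<Rightarrow> real) \<Rightarrow> real) \<Rightarrow> ('i \<Rightarrow> real) \<Rightarrow> real" where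
  "ipartial [] F = F"
| "ipartial (i # js) F = (\<lambda>x. deriv (\<lambda>t. ipartial js F (x(i := t))) (x i))"

text \<open>\<open>C\<^sup>\<infinity>\<close> on an open subset \<open>U\<close> of \<open>\<real>\<^sup>I\<close>: all iterated partials exist and are continuous.\<close>

definition smooth_real_on :: "'i set \<Rightarrow> ('i \<Rightarrow> real) set \<Rightarrow> (('i \<Rightarrow> real) \<Rightarrow> real) \<Rightarrow> bool" where
  "smooth_real_on I U F \<longleftrightarrow>
     (\<forall>js. set js \<subseteq> I \<longrightarrow>
        continuous_on U (ipartial js F) \<and>
        (\<forall>i\<in>I. \<forall>x\<in>U. (\<lambda>t. ipartial js F (x(i := t))) differentiable (at (x i))))"

definition smooth_map_on ::
    "'i set \<Rightarrow> ('i \<Rightarrow> real) set \<Rightarrow> 'j set \<Rightarrow> (('i \<Rightarrow> real) \<Rightarrow> 'j \<Rightarrow> real) \<Rightarrow> bool" where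
  "smooth_map_on I U J F \<longleftrightarrow>
     F ` U \<subseteq> coord_space J \<and> (\<forall>j\<in>J. smooth_real_on I U (\<lambda>x. F x j))"


section \<open>Smooth manifolds\<close>

type_synonym ('x, 'i) chart = "'x set \<times> ('x \<Rightarrow> 'i \<Rightarrow> real)"

abbreviation cinv :: "('x, 'i) chart \<Rightarrow> ('i \<Rightarrow> real) \<Rightarrow> 'x" where
  "cinv c \<equiv> inv_into (fst c) (snd c)"

definition points :: "('x, 'i) chart set \<Rightarrow> 'x set" where
  "points A = \<Union> (fst ` A)"

definition smooth_atlas :: "'i set \<Rightarrow> ('x, 'i) chart set \<Rightarrow> bool" where
  "smooth_atlas I A \<longleftrightarrow>
     finite I \<and>
     (\<forall>c\<in>A. inj_on (snd c) (fst c) \<and>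
        openin (top_of_set (coord_space I)) (snd c ` fst c)) \<and>
     (\<forall>c\<in>A. \<forall>d\<in>A.
        openin (top_of_set (coord_space I)) (snd c ` (fst c \<inter> fst d)) \<and>
        smooth_map_on I (snd c ` (fst c \<inter> fst d)) I (snd d \<circ> cinv c))"

text \<open>The manifold topology is the one determined by the atlas.\<close>

definition atlas_topology :: "'i set \<Rightarrow> ('x, 'i) chart set \<Rightarrow> 'x topology" where
  "atlas_topology I A = topology_generated_by
     {W. \<exists>c\<in>A. W \<subseteq> fst c \<and> openin (top_of_set (coord_space I)) (snd c ` W)}"

definition smooth_manifold :: "'i set \<Rightarrow> ('x, 'i) chart set \<Rightarrow> bool" where
  "smooth_manifold I A \<longleftrightarrow>
     smooth_atlas I A \<and>
     Hausdorff_space (atlas_topology I A) \<and> second_countable (atlas_topology I A)"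

text \<open>The charts of the maximal atlas containing \<open>A\<close>.\<close>

definition admissible_chart :: "'i set \<Rightarrow> ('x, 'i) chart set \<Rightarrow> ('x, 'i) chart \<Rightarrow> bool" where
  "admissible_chart I A c \<longleftrightarrow> fst c \<subseteq> points A \<and> smooth_atlas I (insert c A)"

text \<open>
  Smoothness of a map on an arbitrary subset \<open>S\<close> of a manifold: near every point of \<open>S\<close> its
  coordinate expression is the restriction of a smooth map on an open set.  This is the usual
  notion when \<open>S\<close> is open or an embedded submanifold.
\<close>

definition smooth_between ::
    "'i set \<Rightarrow> ('x, 'i) chart set \<Rightarrow> 'j set \<Rightarrow> ('y, 'j) chart set \<Rightarrow> 'x set \<Rightarrow> ('x \<Rightarrow> 'y) \<Rightarrow> bool" where
  "smooth_between I A J B S f \<longleftrightarrow>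
     (\<forall>x\<in>S. \<exists>c\<in>A. \<exists>d\<in>B. \<exists>W F.
        x \<in> fst c \<and> f x \<in> fst d \<and>
        openin (top_of_set (coord_space I)) W \<and> snd c x \<in> W \<and>
        smooth_map_on I W J F \<and>
        (\<forall>y\<in>S \<inter> fst c. snd c y \<in> W \<longrightarrow> f y \<in> fst d \<and> snd d (f y) = F (snd c y)))"

definition diffeo_on ::
    "'i set \<Rightarrow> ('x, 'i) chart set \<Rightarrow> 'x set \<Rightarrow> 'j set \<Rightarrow> ('y, 'j) chart set \<Rightarrow> 'y set \<Rightarrow> ('x \<Rightarrow> 'y) \<Rightarrow> bool" where
  "diffeo_on I A S J B T f \<longleftrightarrow>
     bij_betw f S T \<and> smooth_between I A J B S f \<and> smooth_between J B I A T (inv_into S f)"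

definition prod_atlas ::
    "('x, 'i) chart set \<Rightarrow> ('y, 'j) chart set \<Rightarrow> ('x \<times> 'y, 'i + 'j) chart set" where
  "prod_atlas A B =
     {(fst c \<times> fst d, \<lambda>(x, y). case_sum (snd c x) (snd d y)) | c d. c \<in> A \<and> d \<in> B}"

definition embedded_submanifold :: "'i set \<Rightarrow> ('x, 'i) chart set \<Rightarrow> nat \<Rightarrow> 'x set \<Rightarrow> bool" where
  "embedded_submanifold I A q S \<longleftrightarrow>
     S \<subseteq> points A \<and>
     (\<forall>x\<in>S. \<exists>c K. admissible_chart I A c \<and> x \<in> fst c \<and> K \<subseteq> I \<and> card K = q \<and>
        snd c ` (S \<inter> fst c) = {y \<in> snd c ` fst c. \<forall>i\<in>I - K. y i = 0})"

text \<open>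
  The tangent space of \<open>R\<close> at \<open>r\<close>, in the coordinates of the chart \<open>c\<close>: the velocities at \<open>0\<close> of
  the smooth curves in \<open>R\<close> through \<open>r\<close>.
\<close>

definition tangent_space :: "'i set \<Rightarrow> ('x, 'i) chart \<Rightarrow> 'x set \<Rightarrow> 'x \<Rightarrow> ('i \<Rightarrow> real) set" where
  "tangent_space I c R r =
     {v \<in> coord_space I. \<exists>e>0. \<exists>\<gamma>.
        \<gamma> 0 = r \<and> (\<forall>t\<in>{-e<..<e}. \<gamma> t \<in> R \<inter> fst c) \<and>
        (\<forall>i\<in>I. (\<forall>k. \<forall>t\<in>{-e<..<e}. ((deriv ^^ k) (\<lambda>s. snd c (\<gamma> s) i)) differentiable (at t)) \<and>
               ((\<lambda>s. snd c (\<gamma> s) i) has_real_derivative v i) (at 0))}"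

text \<open>The image of the tangent vector \<open>u\<close> at \<open>x\<close> under the differential of \<open>f\<close>, in the charts
  \<open>c\<close> (source) and \<open>d\<close> (target).\<close>

definition pushforward ::
    "'i set \<Rightarrow> ('x, 'i) chart \<Rightarrow> ('y, 'j) chart \<Rightarrow> ('x \<Rightarrow> 'y) \<Rightarrow> 'x \<Rightarrow> ('i \<Rightarrow> real) \<Rightarrow> 'j \<Rightarrow> real" where
  "pushforward I c d f x u =
     (\<lambda>j. \<Sum>i\<in>I. u i * ipartial [i] (\<lambda>y. snd d (f (cinv c y)) j) (snd c x))"


section \<open>Local diffeomorphisms and their jets\<close>

text \<open>
  From here on \<open>M = points A\<close> is the \<open>m\<close>-dimensional manifold with atlas \<open>A\<close> over the index set
  \<open>{..<m}\<close>.  Locally defined maps are partial functions; the empty map is a local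
  diffeomorphism.
\<close>

type_synonym 'a pmap = "'a \<Rightarrow> 'a option"

definition local_diffeos :: "nat \<Rightarrow> ('a, nat) chart set \<Rightarrow> 'a pmap set" where
  "local_diffeos m A =
     {\<phi>. openin (atlas_topology {..<m} A) (dom \<phi>) \<and> openin (atlas_topology {..<m} A) (ran \<phi>) \<and>
         diffeo_on {..<m} A (dom \<phi>) {..<m} A (ran \<phi>) (\<lambda>x. the (\<phi> x))}"

definition pmap_inv :: "'a pmap \<Rightarrow> 'a pmap" where
  "pmap_inv \<phi> = (\<lambda>y. if y \<in> ran \<phi> then Some (THE x. \<phi> x = Some y) else None)"

definition id_pmap :: "('a, nat) chart set \<Rightarrow> 'a pmap" where
  "id_pmap A = (\<lambda>x. if x \<in> points A then Some x else None)"

text \<open>Partial derivatives commute, so sorted lists represent the multi-indices of order at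
  most \<open>n\<close>.\<close>

definition multi_idx :: "nat \<Rightarrow> nat \<Rightarrow> nat list set" where
  "multi_idx m n = {bs. sorted bs \<and> set bs \<subseteq> {..<m} \<and> length bs \<le> n}"

definition coord_rep :: "('a, nat) chart \<Rightarrow> ('a, nat) chart \<Rightarrow> 'a pmap \<Rightarrow> (nat \<Rightarrow> real) \<Rightarrow> nat \<Rightarrow> real" where
  "coord_rep c d \<phi> = (\<lambda>x. snd d (the (\<phi> (cinv c x))))"

definition same_jet :: "nat \<Rightarrow> ('a, nat) chart set \<Rightarrow> nat \<Rightarrow> 'a \<Rightarrow> 'a pmap \<Rightarrow> 'a pmap \<Rightarrow> bool" where
  "same_jet m A n z \<phi> \<psi> \<longleftrightarrow>
     z \<in> dom \<phi> \<inter> dom \<psi> \<and> \<phi> z = \<psi> z \<and>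
     (\<forall>c\<in>A. \<forall>d\<in>A. z \<in> fst c \<longrightarrow> the (\<phi> z) \<in> fst d \<longrightarrow>
        (\<forall>a<m. \<forall>bs\<in>multi_idx m n.
           ipartial bs (\<lambda>x. coord_rep c d \<phi> x a) (snd c z) =
           ipartial bs (\<lambda>x. coord_rep c d \<psi> x a) (snd c z)))"

text \<open>A jet is the pair of its source and its class of local diffeomorphisms.\<close>

type_synonym 'a djet = "'a \<times> 'a pmap set"

definition djet :: "nat \<Rightarrow> ('a, nat) chart set \<Rightarrow> nat \<Rightarrow> 'a \<Rightarrow> 'a pmap \<Rightarrow> 'a djet" where
  "djet m A n z \<phi> = (z, {\<psi> \<in> local_diffeos m A. same_jet m A n z \<phi> \<psi>})"

abbreviation djet_source :: "'a djet \<Rightarrow> 'a" where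
  "djet_source \<equiv> fst"

abbreviation djet_rep :: "'a djet \<Rightarrow> 'a pmap" where
  "djet_rep g \<equiv> (SOME \<phi>. \<phi> \<in> snd g)"

definition djet_target :: "'a djet \<Rightarrow> 'a" where
  "djet_target g = (THE w. \<exists>\<phi>\<in>snd g. \<phi> (djet_source g) = Some w)"

text \<open>The set \<open>\<G>\<^sup>(\<^sup>n\<^sup>)\<close> of \<open>n\<close>-jets of elements of \<open>G\<close>; for \<open>G = \<D>\<close> this is \<open>\<D>\<^sup>(\<^sup>n\<^sup>)\<close>.\<close>

definition djets_of :: "nat \<Rightarrow> ('a, nat) chart set \<Rightarrow> nat \<Rightarrow> 'a pmap set \<Rightarrow> 'a djet set" where
  "djets_of m A n G = {djet m A n z \<phi> | z \<phi>. \<phi> \<in> G \<and> z \<in> dom \<phi>}"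

definition djets :: "nat \<Rightarrow> ('a, nat) chart set \<Rightarrow> nat \<Rightarrow> 'a djet set" where
  "djets m A n = djets_of m A n (local_diffeos m A)"

text \<open>Coordinates on \<open>\<D>\<^sup>(\<^sup>n\<^sup>)\<close>: the index \<open>Inl b\<close> stands for \<open>z\<^sup>b\<close> and \<open>Inr (a, [b\<^sub>1, \<dots>, b\<^sub>k])\<close> for
  the derivative coordinate \<open>Z\<^sup>a\<close> with lower indices \<open>b\<^sub>1 \<le> \<dots> \<le> b\<^sub>k\<close>.\<close>

type_synonym jidx = "nat + nat \<times> nat list"

definition djet_idx :: "nat \<Rightarrow> nat \<Rightarrow> jidx set" where
  "djet_idx m n = {..<m} <+> ({..<m} \<times> multi_idx m n)"

definition djet_chart ::
    "nat \<Rightarrow> ('a, nat) chart set \<Rightarrow> nat \<Rightarrow> ('a, nat) chart \<Rightarrow> ('a, nat) chart \<Rightarrow> ('a djet, jidx) chart" where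
  "djet_chart m A n c d =
     ({g \<in> djets m A n. djet_source g \<in> fst c \<and> djet_target g \<in> fst d},
      \<lambda>g i. if i \<in> djet_idx m n
        then (case i of
                Inl b \<Rightarrow> snd c (djet_source g) b
              | Inr (a, bs) \<Rightarrow>
                  ipartial bs (\<lambda>x. coord_rep c d (djet_rep g) x a) (snd c (djet_source g)))
        else 0)"

definition djet_atlas :: "nat \<Rightarrow> ('a, nat) chart set \<Rightarrow> nat \<Rightarrow> ('a djet, jidx) chart set" where
  "djet_atlas m A n = {djet_chart m A n c d | c d. c \<in> A \<and> d \<in> A}"


section \<open>Prolongation and Lie pseudogroups\<close>

definition prolong1 :: "nat \<Rightarrow> ('a, nat) chart set \<Rightarrow> nat \<Rightarrow> 'a djet set \<Rightarrow> 'a djet set" where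
  "prolong1 m A n R =
     {djet m A (Suc n) z \<phi> | z \<phi>.
        \<phi> \<in> local_diffeos m A \<and> z \<in> dom \<phi> \<and> djet m A n z \<phi> \<in> R \<and>
        (\<forall>c\<in>A. \<forall>d\<in>A. z \<in> fst c \<longrightarrow> the (\<phi> z) \<in> fst d \<longrightarrow>
           pushforward {..<m} c (djet_chart m A n c d) (\<lambda>w. djet m A n w \<phi>) z
             ` coord_space {..<m}
           \<subseteq> tangent_space (djet_idx m n) (djet_chart m A n c d) R (djet m A n z \<phi>))}"

primrec prolong :: "nat \<Rightarrow> ('a, nat) chart set \<Rightarrow> nat \<Rightarrow> nat \<Rightarrow> 'a djet set \<Rightarrow> 'a djet set" where
  "prolong m A n 0 R = R"
| "prolong m A n (Suc k) R = prolong1 m A (n + k) (prolong m A n k R)"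

text \<open>An embedded submanifold of \<open>\<D>\<^sup>(\<^sup>n\<^sup>)\<close> that the source map makes a locally trivial smooth
  fibre bundle over all of \<open>M\<close>; the model fibre near \<open>z\<close> is the fibre over \<open>z\<close>.\<close>

definition smooth_subbundle :: "nat \<Rightarrow> ('a, nat) chart set \<Rightarrow> nat \<Rightarrow> 'a djet set \<Rightarrow> bool" where
  "smooth_subbundle m A n R \<longleftrightarrow>
     (\<exists>q. embedded_submanifold (djet_idx m n) (djet_atlas m A n) q R) \<and>
     djet_source ` R = points A \<and>
     (\<forall>z\<in>points A. \<exists>U \<Phi>.
        openin (atlas_topology {..<m} A) U \<and> z \<in> U \<and>
        diffeo_on (djet_idx m n) (djet_atlas m A n) {g \<in> R. djet_source g \<in> U}
          ({..<m} <+> djet_idx m n) (prod_atlas A (djet_atlas m A n))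
          (U \<times> {g \<in> R. djet_source g = z}) \<Phi> \<and>
        (\<forall>g\<in>R. djet_source g \<in> U \<longrightarrow> fst (\<Phi> g) = djet_source g))"

definition lie_pseudogroup :: "nat \<Rightarrow> ('a, nat) chart set \<Rightarrow> nat \<Rightarrow> 'a pmap set \<Rightarrow> bool" where
  "lie_pseudogroup m A nstar G \<longleftrightarrow>
     G \<subseteq> local_diffeos m A \<and>
     (\<forall>\<phi>\<in>G. \<forall>\<psi>\<in>G. \<phi> \<circ>\<^sub>m pmap_inv \<psi> \<in> G) \<and>
     1 \<le> nstar \<and>
     (\<forall>n\<ge>nstar.
        smooth_subbundle m A n (djets_of m A n G) \<and>
        (\<forall>\<phi>\<in>local_diffeos m A. (\<forall>z\<in>dom \<phi>. djet m A n z \<phi> \<in> djets_of m A n G) \<longrightarrow> \<phi> \<in> G) \<and>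
        djets_of m A n G = prolong m A nstar (n - nstar) (djets_of m A nstar G))"


section \<open>Vector fields and tameness\<close>

text \<open>
  A smooth vector field on the open set \<open>N\<close> is given by its components \<open>X c x\<close> in every chart \<open>c\<close>
  around every \<open>x \<in> N\<close>, related by the Jacobians of the coordinate changes.
\<close>

type_synonym 'a vfield = "('a, nat) chart \<Rightarrow> 'a \<Rightarrow> nat \<Rightarrow> real"

definition vector_field_on :: "nat \<Rightarrow> ('a, nat) chart set \<Rightarrow> 'a set \<Rightarrow> 'a vfield \<Rightarrow> bool" where
  "vector_field_on m A N X \<longleftrightarrow>
     openin (atlas_topology {..<m} A) N \<and>
     (\<forall>c\<in>A. smooth_map_on {..<m} (snd c ` (fst c \<inter> N)) {..<m} (\<lambda>y. X c (cinv c y))) \<and>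
     (\<forall>c\<in>A. \<forall>d\<in>A. \<forall>x\<in>fst c \<inter> fst d \<inter> N.
        X d x = pushforward {..<m} c d (\<lambda>w. w) x (X c x))"

definition integral_curve ::
    "nat \<Rightarrow> ('a, nat) chart set \<Rightarrow> 'a set \<Rightarrow> 'a vfield \<Rightarrow> real set \<Rightarrow> (real \<Rightarrow> 'a) \<Rightarrow> bool" where
  "integral_curve m A N X T \<gamma> \<longleftrightarrow>
     (\<forall>s\<in>T. \<gamma> s \<in> N \<and>
        (\<forall>c\<in>A. \<gamma> s \<in> fst c \<longrightarrow>
           (\<forall>\<^sub>F r in at s. \<gamma> r \<in> fst c) \<and>
           (\<forall>a<m. ((\<lambda>r. snd c (\<gamma> r) a) has_real_derivative X c (\<gamma> s) a) (at s))))"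

definition flows_to ::
    "nat \<Rightarrow> ('a, nat) chart set \<Rightarrow> 'a set \<Rightarrow> 'a vfield \<Rightarrow> real \<Rightarrow> 'a \<Rightarrow> 'a \<Rightarrow> bool" where
  "flows_to m A N X t x y \<longleftrightarrow>
     (\<exists>a b \<gamma>. 0 \<in> {a<..<b} \<and> t \<in> {a<..<b} \<and> integral_curve m A N X {a<..<b} \<gamma> \<and>
        \<gamma> 0 = x \<and> \<gamma> t = y)"

text \<open>The time-\<open>t\<close> flow map, on its maximal domain.\<close>

definition flow_map ::
    "nat \<Rightarrow> ('a, nat) chart set \<Rightarrow> 'a set \<Rightarrow> 'a vfield \<Rightarrow> real \<Rightarrow> 'a pmap" where
  "flow_map m A N X t = (\<lambda>x. if \<exists>y. flows_to m A N X t x y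
                             then Some (THE y. flows_to m A N X t x y) else None)"

definition pseudogroup_vfield ::
    "nat \<Rightarrow> ('a, nat) chart set \<Rightarrow> 'a pmap set \<Rightarrow> 'a set \<Rightarrow> 'a vfield \<Rightarrow> bool" where
  "pseudogroup_vfield m A G N X \<longleftrightarrow>
     vector_field_on m A N X \<and> (\<forall>t. flow_map m A N X t \<in> G)"

text \<open>
  The \<open>n\<close>-jet at \<open>z\<close> with derivative coordinates \<open>\<zeta> (a, bs)\<close> in the chart \<open>c\<close> satisfies the
  infinitesimal determining equations; both source and target coordinates are those of \<open>c\<close>, and
  the tangent vector at the identity jet has no \<open>\<partial>/\<partial>z\<^sup>b\<close> components.
\<close>

definition inf_determining ::
    "nat \<Rightarrow> ('a, nat) chart set \<Rightarrow> 'a pmap set \<Rightarrow> nat \<Rightarrow> 'a \<Rightarrow> ('a, nat) chart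
     \<Rightarrow> (nat \<times> nat list \<Rightarrow> real) \<Rightarrow> bool" where
  "inf_determining m A G n z c \<zeta> \<longleftrightarrow>
     case_sum (\<lambda>b. 0) \<zeta>
       \<in> tangent_space (djet_idx m n) (djet_chart m A n c c) (djets_of m A n G)
           (djet m A n z (id_pmap A))"

definition tame :: "nat \<Rightarrow> ('a, nat) chart set \<Rightarrow> nat \<Rightarrow> 'a pmap set \<Rightarrow> bool" where
  "tame m A nstar G \<longleftrightarrow>
     (\<forall>n\<ge>nstar. \<forall>c\<in>A. \<forall>z\<in>fst c. \<forall>\<zeta>. inf_determining m A G n z c \<zeta> \<longrightarrow>
        (\<exists>N X. pseudogroup_vfield m A G N X \<and> z \<in> N \<and>
           (\<forall>a<m. \<forall>bs\<in>multi_idx m n.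
              ipartial bs (\<lambda>y. X c (cinv c y) a) (snd c z) = \<zeta> (a, bs))))"


section \<open>Jets of submanifolds\<close>

text \<open>In the chart \<open>c\<close> the set \<open>S\<close> is the graph of \<open>f\<close>, a smooth function of the coordinates with
  index in \<open>K\<close>, with values in the remaining coordinates.\<close>

definition coord_proj :: "'i set \<Rightarrow> ('i \<Rightarrow> real) \<Rightarrow> 'i \<Rightarrow> real" where
  "coord_proj K x = (\<lambda>i. if i \<in> K then x i else 0)"

definition is_graph_in ::
    "nat \<Rightarrow> ('a, nat) chart \<Rightarrow> nat set \<Rightarrow> ((nat \<Rightarrow> real) \<Rightarrow> nat \<Rightarrow> real) \<Rightarrow> 'a set \<Rightarrow> bool" where
  "is_graph_in m c K f S \<longleftrightarrow>
     smooth_map_on K (coord_proj K ` snd c ` fst c) ({..<m} - K) f \<and>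
     S \<inter> fst c = {x \<in> fst c. \<forall>j\<in>{..<m} - K. snd c x j = f (coord_proj K (snd c x)) j}"

text \<open>Contact of order \<open>n\<close> at \<open>z\<close>: in suitable local coordinates both submanifolds are graphs of
  functions with the same derivatives up to order \<open>n\<close> at (the projection of) \<open>z\<close>.\<close>

definition contact ::
    "nat \<Rightarrow> ('a, nat) chart set \<Rightarrow> nat \<Rightarrow> nat \<Rightarrow> 'a \<Rightarrow> 'a set \<Rightarrow> 'a set \<Rightarrow> bool" where
  "contact m A p n z S S' \<longleftrightarrow>
     z \<in> S \<inter> S' \<and>
     (\<exists>c K f f'. admissible_chart {..<m} A c \<and> z \<in> fst c \<and> K \<subseteq> {..<m} \<and> card K = p \<and>
        is_graph_in m c K f S \<and> is_graph_in m c K f' S' \<and>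
        (\<forall>j\<in>{..<m} - K. \<forall>bs. set bs \<subseteq> K \<and> length bs \<le> n \<longrightarrow>
           ipartial bs (\<lambda>x. f x j) (coord_proj K (snd c z)) =
           ipartial bs (\<lambda>x. f' x j) (coord_proj K (snd c z))))"

type_synonym 'a sjet = "'a \<times> 'a set set"

definition sjet :: "nat \<Rightarrow> ('a, nat) chart set \<Rightarrow> nat \<Rightarrow> nat \<Rightarrow> 'a \<Rightarrow> 'a set \<Rightarrow> 'a sjet" where
  "sjet m A p n z S = (z, {S'. embedded_submanifold {..<m} A p S' \<and> contact m A p n z S S'})"

definition sjets :: "nat \<Rightarrow> ('a, nat) chart set \<Rightarrow> nat \<Rightarrow> nat \<Rightarrow> 'a sjet set" where
  "sjets m A p n = {sjet m A p n z S | z S. embedded_submanifold {..<m} A p S \<and> z \<in> S}"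

abbreviation sjet_base :: "'a sjet \<Rightarrow> 'a" where
  "sjet_base \<equiv> fst"

abbreviation sjet_rep :: "'a sjet \<Rightarrow> 'a set" where
  "sjet_rep w \<equiv> (SOME S. S \<in> snd w)"

definition sjet_proj :: "nat \<Rightarrow> ('a, nat) chart set \<Rightarrow> nat \<Rightarrow> nat \<Rightarrow> 'a sjet \<Rightarrow> 'a sjet" where
  "sjet_proj m A p n w = sjet m A p n (sjet_base w) (sjet_rep w)"

text \<open>Meaningful only if the source of \<open>g\<close> is the base point of \<open>w\<close>; the image of \<open>S\<close> under \<open>\<phi>\<close> is
  that of \<open>S \<inter> dom \<phi>\<close>.\<close>

definition sjet_act ::
    "nat \<Rightarrow> ('a, nat) chart set \<Rightarrow> nat \<Rightarrow> nat \<Rightarrow> 'a djet \<Rightarrow> 'a sjet \<Rightarrow> 'a sjet" where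
  "sjet_act m A p n g w =
     sjet m A p n (djet_target g) {y. \<exists>x\<in>sjet_rep w. djet_rep g x = Some y}"

definition isotropy ::
    "nat \<Rightarrow> ('a, nat) chart set \<Rightarrow> 'a pmap set \<Rightarrow> nat \<Rightarrow> nat \<Rightarrow> 'a sjet \<Rightarrow> 'a djet set" where
  "isotropy m A G p n w =
     {g \<in> djets_of m A n G. djet_source g = sjet_base w \<and> djet_target g = sjet_base w \<and>
        sjet_act m A p n g w = w}"

text \<open>Discreteness is with respect to the topology of \<open>\<D>\<^sup>(\<^sup>n\<^sup>)\<close>.\<close>

definition locally_free_at ::
    "nat \<Rightarrow> ('a, nat) chart set \<Rightarrow> 'a pmap set \<Rightarrow> nat \<Rightarrow> nat \<Rightarrow> 'a sjet \<Rightarrow> bool" where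
  "locally_free_at m A G p n w \<longleftrightarrow>
     subtopology (atlas_topology (djet_idx m n) (djet_atlas m A n)) (isotropy m A G p n w)
       = discrete_topology (isotropy m A G p n w)"

end

theory Submission
  imports Defs
begin

text \<open>
  It suffices to pass from order \<open>n\<close> to order \<open>n + 1\<close>.  Two elements of the isotropy group of order \<open>n + 1\<close>
  that are close have the same \<open>n\<close>-jet by local freeness, so their quotient \<open>h\<close> is the identity to
  order \<open>n\<close> and preserves the submanifold \<open>S\<close> to order \<open>n + 1\<close>.  The section of \<open>n\<close>-jets of \<open>h\<close> stays in
  \<open>\<G>\<^sup>(\<^sup>n\<^sup>)\<close> and agrees with the section of identity jets at \<open>z\<close>; the difference of their velocities in a
  direction \<open>v\<close> is therefore tangent to \<open>\<G>\<^sup>(\<^sup>n\<^sup>)\<close>, and it is the \<open>n\<close>-jet of the derivative of \<open>h - id\<close>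
  along \<open>v\<close>.  By tameness it is the jet of a pseudogroup vector field.  If \<open>v\<close> is tangent to \<open>S\<close>, this field
  is tangent to \<open>S\<close> to order \<open>n\<close>; its flow consists of isotropy elements of order \<open>n\<close>, so its
  \<open>n\<close>-jet vanishes.  Hence all derivatives of order \<open>n + 1\<close> of \<open>h - id\<close> with a tangential index vanish, and since
  \<open>n \<ge> 1\<close> this makes the fields for transverse \<open>v\<close> tangent to \<open>S\<close> to order \<open>n\<close> as well.  Hence \<open>h\<close> has the
  identity \<open>(n + 1)\<close>-jet.

  Contact and jets are handled through orders of vanishing: \<open>Ovan I x0 k F\<close> says that \<open>F\<close> is
  \<open>O(|x - x0|\<^sup>k)\<close>, and two submanifolds have contact of order \<open>n\<close> iff each stays within
  \<open>O(|x - x0|\<^sup>n\<^sup>+\<^sup>1)\<close> of the other.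
\<close>

section \<open>Coordinate spaces with the maximum metric\<close>

text \<open>\<open>contact\<close> asks for one chart in which both submanifolds are graphs, so even
  its transitivity is unclear. Mutual \<open>near\<close>-ness does not mention graphs, is
  transitive, and is preserved by diffeomorphisms. The price is the converse
  \<open>near_ccontact\<close>: n \<ge> 1 forces equal tangent spaces, and the inverse function
  theorem then yields graphs over the same coordinates. Flows are never constructed: tameness
  supplies fields whose flow maps already are local diffeomorphisms, and the constant curve at a
  zero of the field puts the base point into their domains. What remains are bounds for short times,
  elementary once |t| L \<le> 1/2 for a Lipschitz constant L. Since h - id is O(r^(n+1)), each field
  X is O(r^n), and its flow is x + t X(x) up to O(t^2 r^n). Hence the n-jet of the flow at z has
  velocity the n-jet of X, which a discrete isotropy group does not permit unless that n-jet is
  zero. The direction v must be constant for the determining equations, while coordinates that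
  flatten S have variable directions; freezing v at the base point costs a factor O(r) times O(r^n),
  which is harmless at order n + 1.\<close>

definition cdist :: "'i set \<Rightarrow> ('i \<Rightarrow> real) \<Rightarrow> ('i \<Rightarrow> real) \<Rightarrow> real" where
  "cdist I x y = Max (insert 0 ((\<lambda>i. \<bar>x i - y i\<bar>) ` I))"

abbreviation copen :: "'i set \<Rightarrow> ('i \<Rightarrow> real) set \<Rightarrow> bool" where
  "copen I \<equiv> openin (top_of_set (coord_space I))"

lemma cdist_nonneg [simp]: "finite I \<Longrightarrow> 0 \<le> cdist I x y" by (simp add: cdist_def)

lemma abs_le_cdist: "finite I \<Longrightarrow> i \<in> I \<Longrightarrow> \<bar>x i - y i\<bar> \<le> cdist I x y"
  by (simp add: cdist_def)

text \<open>The entry 0 makes the distance 0 when \<open>I\<close> is empty; hence the condition on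
  the sign of \<open>e\<close>.\<close>

lemma cdist_le_iff: "finite I \<Longrightarrow> 0 \<le> e \<Longrightarrow> cdist I x y \<le> e \<longleftrightarrow> (\<forall>i\<in>I. \<bar>x i - y i\<bar> \<le> e)"
  by (simp add: cdist_def)

lemma cdist_less_iff: "finite I \<Longrightarrow> 0 < e \<Longrightarrow> cdist I x y < e \<longleftrightarrow> (\<forall>i\<in>I. \<bar>x i - y i\<bar> < e)"
  by (simp add: cdist_def)

lemma cdist_self [simp]: "finite I \<Longrightarrow> cdist I x x = 0" by (rule antisym) (auto simp: cdist_le_iff)

lemma cdist_commute: "cdist I x y = cdist I y x" by (simp add: cdist_def abs_minus_commute)

lemma cdist_triangle: "finite I \<Longrightarrow> cdist I x z \<le> cdist I x y + cdist I y z"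
proof -
  assume I: "finite I"
  have "\<bar>x i - z i\<bar> \<le> cdist I x y + cdist I y z" if "i \<in> I" for i
    using abs_le_cdist[OF I that, of x y] abs_le_cdist[OF I that, of y z] by linarith
  then show ?thesis using I by (simp add: cdist_le_iff)
qed

lemma cdist_eq_0:
  assumes "finite I" "x \<in> coord_space I" "y \<in> coord_space I" "cdist I x y \<le> 0"
  shows "x = y"
proof
  fix i show "x i = y i"
    using assms abs_le_cdist[of I i x y] by (cases "i \<in> I") (auto simp: coord_space_def)
qed

lemma coord_space_upd [simp]: "x \<in> coord_space I \<Longrightarrow> i \<in> I \<Longrightarrow> x(i := t) \<in> coord_space I"
  by (auto simp: coord_space_def)

lemma cdist_upd_le: "finite I \<Longrightarrow> cdist I x (x(i := t)) \<le> \<bar>x i - t\<bar>" by (simp add: cdist_le_iff)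

lemma cdist_upd_both: "finite I \<Longrightarrow> i \<in> I \<Longrightarrow> cdist I (x(i := s)) (x(i := t)) = \<bar>s - t\<bar>"
  by (rule antisym) (auto simp: cdist_le_iff intro: order_trans[OF _ abs_le_cdist[of I i]])

lemma open_cdist_ball:
  assumes "finite I" shows "open {y. cdist I x y < e}"
proof (cases "e > 0")
  case True
  have "{y. cdist I x y < e} = (\<Inter>i\<in>I. {y. \<bar>x i - y i\<bar> < e}) " using assms True by (auto simp: cdist_less_iff)
  moreover have "open {y. \<bar>x i - y i\<bar> < e}" for i
    by (intro open_Collect_less continuous_intros continuous_on_product_coordinates)
  ultimately show ?thesis using assms by auto
next
  case False
  then have "{y. cdist I x y < e} = {}" using cdist_nonneg[OF assms] by (auto simp: not_less intro: order_trans)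
  then show ?thesis by (metis open_empty)
qed

text \<open>Points of \<open>coord_space I\<close> are pinned to 0 off the finite set
  \<open>I\<close>, so finitely many coordinates control a basic neighbourhood of the product
  topology. Allowing any subset \<open>S\<close> of the space covers relative continuity as
  well.\<close>

lemma openin_cdist_iff:
  assumes I: "finite I" and S: "S \<subseteq> coord_space I"
  shows "openin (top_of_set S) U \<longleftrightarrow>
    U \<subseteq> S \<and> (\<forall>x\<in>U. \<exists>e>0. \<forall>y\<in>S. cdist I x y < e \<longrightarrow> y \<in> U)"
proof
  assume "openin (top_of_set S) U"
  then obtain T where T: "open T" "U = S \<inter> T" unfolding openin_open by blast
  have "\<exists>e>0. \<forall>y\<in>S. cdist I x y < e \<longrightarrow> y \<in> U" if x: "x \<in> U" for x
  proof -
    have oT: "openin (product_topology (\<lambda>_. euclidean) UNIV) T" using T(1) by (simp add: open_fun_def)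
    have xT: "x \<in> T" using x T(2) by blast
    obtain X where X: "x \<in> Pi\<^sub>E UNIV X" "\<And>i. open (X i)" "Pi\<^sub>E UNIV X \<subseteq> T"
      using product_topology_open_contains_basis[OF oT xT] by auto
    have "\<forall>i\<in>I. \<exists>e>0. \<forall>t. \<bar>x i - t\<bar> < e \<longrightarrow> t \<in> X i"
    proof
      fix i assume "i \<in> I"
      have "x i \<in> X i" using X(1) by auto
      then obtain e where "e > 0" "ball (x i) e \<subseteq> X i" using X(2) openE by blast
      then show "\<exists>e>0. \<forall>t. \<bar>x i - t\<bar> < e \<longrightarrow> t \<in> X i" by (auto simp: ball_def dist_real_def subset_iff)
    qed
    then obtain e where e: "\<And>i. i \<in> I \<Longrightarrow> e i > 0 \<and> (\<forall>t. \<bar>x i - t\<bar> < e i \<longrightarrow> t \<in> X i)" by metis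
    \<comment> \<open>The entry 1 keeps the minimum meaningful for empty \<open>I\<close>.\<close>
    define d where "d = Min (insert 1 (e ` I))"
    have d: "d > 0" using I e by (auto simp: d_def)
    have de: "d \<le> e i" if "i \<in> I" for i using I that by (simp add: d_def)
    have "y \<in> U" if y: "y \<in> S" "cdist I x y < d" for y
    proof -
      have "y i \<in> X i" for i
      proof (cases "i \<in> I")
        case True
        then have "\<bar>x i - y i\<bar> < e i" using abs_le_cdist[OF I True, of x y] de[OF True] y by linarith
        then show ?thesis using e[OF True] by blast
      next
        case False
        moreover have "y \<in> coord_space I" "x \<in> coord_space I" using S y x T(2) by auto
          ultimately have "y i = x i" by (simp add: coord_space_def)
        then show ?thesis using X(1) by auto
      qed
      then show ?thesis using X(3) y T(2) by auto
    qed
    then show ?thesis using d by blast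
  qed
  then show "U \<subseteq> S \<and> (\<forall>x\<in>U. \<exists>e>0. \<forall>y\<in>S. cdist I x y < e \<longrightarrow> y \<in> U)" using T(2) by blast
next
  assume R: "U \<subseteq> S \<and> (\<forall>x\<in>U. \<exists>e>0. \<forall>y\<in>S. cdist I x y < e \<longrightarrow> y \<in> U)"
  then obtain e where e: "\<And>x. x \<in> U \<Longrightarrow> e x > 0 \<and> (\<forall>y\<in>S. cdist I x y < e x \<longrightarrow> y \<in> U)" by metis
  have "U = S \<inter> (\<Union>x\<in>U. {y. cdist I x y < e x})" using R e I by auto
  moreover have "open (\<Union>x\<in>U. {y. cdist I x y < e x})" using open_cdist_ball[OF I] by blast
  ultimately show "openin (top_of_set S) U" unfolding openin_open by blast
qed

lemmas copen_iff = openin_cdist_iff[OF _ order_refl]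

lemma copenD: "finite I \<Longrightarrow> copen I U \<Longrightarrow> x \<in> U \<Longrightarrow> \<exists>e>0. \<forall>y\<in>coord_space I. cdist I x y < e \<longrightarrow> y \<in> U"
  by (auto simp: copen_iff)

lemma copen_sub: "copen I U \<Longrightarrow> U \<subseteq> coord_space I" using openin_subset by fastforce

lemma continuous_on_cdist_iff:
  fixes f :: "('i \<Rightarrow> real) \<Rightarrow> real"
  assumes I: "finite I" and U: "U \<subseteq> coord_space I"
  shows "continuous_on U f \<longleftrightarrow>
    (\<forall>x\<in>U. \<forall>e>0. \<exists>d>0. \<forall>y\<in>U. cdist I x y < d \<longrightarrow> \<bar>f y - f x\<bar> < e)"
proof
  assume c: "continuous_on U f"
  show "\<forall>x\<in>U. \<forall>e>0. \<exists>d>0. \<forall>y\<in>U. cdist I x y < d \<longrightarrow> \<bar>f y - f x\<bar> < e"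
  proof (intro ballI allI impI)
    fix x e assume x: "x \<in> U" and e: "(e::real) > 0"
    have "openin (top_of_set U) (U \<inter> f -` ball (f x) e)" using c by (simp add: continuous_openin_preimage_gen)
    moreover have "x \<in> U \<inter> f -` ball (f x) e" using x e by simp
    ultimately obtain d where "d > 0" "\<forall>y\<in>U. cdist I x y < d \<longrightarrow> y \<in> U \<inter> f -` ball (f x) e"
      unfolding openin_cdist_iff[OF I U] by blast
    then show "\<exists>d>0. \<forall>y\<in>U. cdist I x y < d \<longrightarrow> \<bar>f y - f x\<bar> < e"
      by (auto simp: dist_real_def abs_minus_commute)
  qed
next
  assume R: "\<forall>x\<in>U. \<forall>e>0. \<exists>d>0. \<forall>y\<in>U. cdist I x y < d \<longrightarrow> \<bar>f y - f x\<bar> < e"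
  show "continuous_on U f" unfolding continuous_on_open_invariant
  proof (intro allI impI)
    fix B :: "real set" assume B: "open B"
    have "openin (top_of_set U) (U \<inter> f -` B)" unfolding openin_cdist_iff[OF I U]
    proof (intro conjI ballI)
      fix x assume x: "x \<in> U \<inter> f -` B"
      then obtain e where e: "e > 0" "ball (f x) e \<subseteq> B" using B by (auto elim: openE)
      obtain d where "d > 0" "\<forall>y\<in>U. cdist I x y < d \<longrightarrow> \<bar>f y - f x\<bar> < e" using R x e by blast
      then show "\<exists>d>0. \<forall>y\<in>U. cdist I x y < d \<longrightarrow> y \<in> U \<inter> f -` B"
        using e by (intro exI[of _ d]) (auto simp: subset_iff dist_real_def abs_minus_commute)
    qed auto
    then show "\<exists>A. open A \<and> A \<inter> U = f -` B \<inter> U" unfolding openin_open by (metis Int_commute)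
  qed
qed

lemma copen_Int [intro]: "copen I U \<Longrightarrow> copen I V \<Longrightarrow> copen I (U \<inter> V)" by auto

lemma copen_preimage:
  assumes I: "finite I" and J: "finite J" and U: "copen I U" and V: "copen J V"
    and g: "\<And>j. j \<in> J \<Longrightarrow> continuous_on U (\<lambda>x. g x j)" "g ` U \<subseteq> coord_space J"
  shows "copen I {x\<in>U. g x \<in> V}"
  unfolding copen_iff[OF I]
proof (intro conjI ballI)
  show "{x\<in>U. g x \<in> V} \<subseteq> coord_space I" using copen_sub[OF U] by auto
next
  fix x assume x: "x \<in> {x\<in>U. g x \<in> V}"
  then obtain e where e: "e > 0" "\<forall>y\<in>coord_space J. cdist J (g x) y < e \<longrightarrow> y \<in> V"
    using copenD[OF J V] by blast
  obtain r where r: "r > 0" "\<forall>y\<in>coord_space I. cdist I x y < r \<longrightarrow> y \<in> U" using x copenD[OF I U] by blast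
  have "\<forall>j\<in>J. \<exists>d>0. \<forall>y\<in>U. cdist I x y < d \<longrightarrow> \<bar>g y j - g x j\<bar> < e"
    using g(1) x e(1) copen_sub[OF U] I by (simp add: continuous_on_cdist_iff)
  then obtain d where d: "\<And>j. j \<in> J \<Longrightarrow> d j > 0 \<and> (\<forall>y\<in>U. cdist I x y < d j \<longrightarrow> \<bar>g y j - g x j\<bar> < e)"
    by metis
  define s where "s = Min (insert r (d ` J))"
  have s: "s > 0" "s \<le> r" "\<And>j. j \<in> J \<Longrightarrow> s \<le> d j" using J d r by (auto simp: s_def)
  have "y \<in> {x\<in>U. g x \<in> V}" if y: "y \<in> coord_space I" "cdist I x y < s" for y
  proof -
    have yU: "y \<in> U" using r s y by auto
    have "\<bar>g x j - g y j\<bar> < e" if "j \<in> J" for j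
    proof -
      have "cdist I x y < d j" using s(3)[OF that] y by linarith
      then have "\<bar>g y j - g x j\<bar> < e" using d[OF that] yU by blast
      then show ?thesis by (simp add: abs_minus_commute)
    qed
    then have "cdist J (g x) (g y) < e" using J e by (simp add: cdist_less_iff)
    then show ?thesis using yU e g(2) by auto
  qed
  then show "\<exists>e>0. \<forall>y\<in>coord_space I. cdist I x y < e \<longrightarrow> y \<in> {x \<in> U. g x \<in> V}" using s by blast
qed

subsection \<open>The neighbourhood filter\<close>

text \<open>Neighbourhoods within \<open>coord_space I\<close>, whereas \<open>nhds x\<close> would
  also admit points that move off the index set \<open>I\<close>. The centre is not removed, so an
  eventual property holds at a centre that lies in the space.\<close>

definition cnh :: "'i set \<Rightarrow> ('i \<Rightarrow> real) \<Rightarrow> ('i \<Rightarrow> real) filter" where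
  "cnh I x = (INF e\<in>{0<..}. principal {y \<in> coord_space I. cdist I x y < e})"

lemma eventually_cnh:
  "eventually P (cnh I x) \<longleftrightarrow> (\<exists>e>0. \<forall>y\<in>coord_space I. cdist I x y < e \<longrightarrow> P y)"
proof -
  have "eventually P (cnh I x) \<longleftrightarrow>
      (\<exists>e\<in>{0<..}. eventually P (principal {y \<in> coord_space I. cdist I x y < e}))"
    unfolding cnh_def
  proof (rule eventually_INF_base)
    show "{0::real<..} \<noteq> {}" by (simp add: greaterThan_def) (use gt_ex in blast)
    fix a b :: real assume "a \<in> {0<..}" "b \<in> {0<..}"
    then show "\<exists>c\<in>{0<..}. principal {y \<in> coord_space I. cdist I x y < c}
       \<le> inf (principal {y \<in> coord_space I. cdist I x y < a}) (principal {y \<in> coord_space I. cdist I x y < b})"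
      by (intro bexI[of _ "min a b"]) auto
  qed
  then show ?thesis by (auto simp: eventually_principal)
qed

lemma cnh_copen: "finite I \<Longrightarrow> copen I U \<Longrightarrow> x \<in> U \<Longrightarrow> \<forall>\<^sub>F y in cnh I x. y \<in> U"
  unfolding eventually_cnh using copenD by metis

lemma cnh_space: "\<forall>\<^sub>F y in cnh I x. y \<in> coord_space I" unfolding eventually_cnh using zero_less_one by blast

lemma cnh_dist: "e > 0 \<Longrightarrow> \<forall>\<^sub>F y in cnh I x. cdist I x y < e" unfolding eventually_cnh by blast

lemma cnh_center: "finite I \<Longrightarrow> x \<in> coord_space I \<Longrightarrow> eventually P (cnh I x) \<Longrightarrow> P x"
  unfolding eventually_cnh by force

text \<open>Balls grow with the radius, so a property valid near \<open>x\<close> holds on the whole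
  closed ball through \<open>y\<close>. Mean value arguments need it at unknown points of the box
  between \<open>x\<close> and \<open>y\<close>.\<close>

lemma cnh_le:
  assumes I: "finite I" and P: "eventually P (cnh I x)"
  shows "\<forall>\<^sub>F y in cnh I x. \<forall>w\<in>coord_space I. cdist I x w \<le> cdist I x y \<longrightarrow> P w"
  using P unfolding eventually_cnh by (meson le_less_trans)

lemma continuous_on_cnh:
  fixes f :: "('i \<Rightarrow> real) \<Rightarrow> real"
  assumes I: "finite I" and U: "copen I U"
  shows "continuous_on U f \<longleftrightarrow> (\<forall>x\<in>U. (f \<longlongrightarrow> f x) (cnh I x))"
proof -
  have "(\<forall>e>0. \<exists>d>0. \<forall>y\<in>U. cdist I x y < d \<longrightarrow> \<bar>f y - f x\<bar> < e) \<longleftrightarrow> (f \<longlongrightarrow> f x) (cnh I x)"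
    if x: "x \<in> U" for x
  proof -
    obtain r where r: "r > 0" "\<forall>y\<in>coord_space I. cdist I x y < r \<longrightarrow> y \<in> U" using copenD[OF I U x] by blast
    have "(\<exists>d>0. \<forall>y\<in>U. cdist I x y < d \<longrightarrow> \<bar>f y - f x\<bar> < e) \<longleftrightarrow>
      (\<exists>d>0. \<forall>y\<in>coord_space I. cdist I x y < d \<longrightarrow> \<bar>f y - f x\<bar> < e)" (is "?L \<longleftrightarrow> ?R") for e :: real
    proof
      assume ?L
      then obtain d where "d>0" "\<forall>y\<in>U. cdist I x y < d \<longrightarrow> \<bar>f y - f x\<bar> < e" by blast
      then show ?R using r by (intro exI[of _ "min d r"]) auto
    next
      assume ?R then show ?L using copen_sub[OF U] by blast
    qed
    then show ?thesis by (simp add: tendsto_iff eventually_cnh dist_real_def)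
  qed
  then show ?thesis using continuous_on_cdist_iff[OF I copen_sub[OF U], of f] by simp
qed

lemma cnh_map:
  assumes J: "finite J" and g: "\<And>j. j \<in> J \<Longrightarrow> ((\<lambda>x. g x j) \<longlongrightarrow> y j) F"
    and s: "\<forall>\<^sub>F x in F. g x \<in> coord_space J"
  shows "filterlim g (cnh J y) F"
  unfolding filterlim_iff
proof (intro allI impI)
  fix P assume "eventually P (cnh J y)"
  then obtain e where e: "e > 0" "\<forall>w\<in>coord_space J. cdist J y w < e \<longrightarrow> P w" unfolding eventually_cnh by blast
  have "\<forall>\<^sub>F x in F. \<forall>j\<in>J. \<bar>g x j - y j\<bar> < e"
    using J g e(1) by (auto simp: eventually_ball_finite_distrib tendsto_iff dist_real_def)
  with s show "\<forall>\<^sub>F x in F. P (g x)"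
    by eventually_elim (use e J in \<open>auto simp: cdist_less_iff abs_minus_commute\<close>)
qed

lemma cnh_coord: "finite I \<Longrightarrow> i \<in> I \<Longrightarrow> ((\<lambda>x. x i) \<longlongrightarrow> x0 i) (cnh I x0)"
  unfolding tendsto_iff eventually_cnh dist_real_def by (metis abs_le_cdist abs_minus_commute le_less_trans)

section \<open>Calculus in coordinates\<close>

text \<open>An opaque first derivative: \<open>ipartial_Cons\<close> and
  \<open>ipartial_snoc\<close> peel it off at the outer or at the inner end of an index
  list.\<close>

definition pd :: "'i \<Rightarrow> (('i \<Rightarrow> real) \<Rightarrow> real) \<Rightarrow> ('i \<Rightarrow> real) \<Rightarrow> real" where
  "pd i F = ipartial [i] F"

definition pdiff_on :: "'i set \<Rightarrow> ('i \<Rightarrow> real) set \<Rightarrow> (('i \<Rightarrow> real) \<Rightarrow> real) \<Rightarrow> bool" where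
  "pdiff_on I U F \<longleftrightarrow> (\<forall>i\<in>I. \<forall>x\<in>U. (\<lambda>t. F (x(i := t))) differentiable (at (x i)))"

lemma pdiff_onI:
  "(\<And>i x. i \<in> I \<Longrightarrow> x \<in> U \<Longrightarrow> ((\<lambda>t. F (x(i := t))) has_real_derivative D i x) (at (x i))) \<Longrightarrow> pdiff_on I U F"
  unfolding pdiff_on_def real_differentiable_def by blast

lemma pdiff_on_subset: "pdiff_on I U F \<Longrightarrow> W \<subseteq> U \<Longrightarrow> pdiff_on I W F" unfolding pdiff_on_def by blast

lemma smooth_real_on_alt: "smooth_real_on I U F \<longleftrightarrow>
  (\<forall>js. set js \<subseteq> I \<longrightarrow> continuous_on U (ipartial js F) \<and> pdiff_on I U (ipartial js F))"
  unfolding smooth_real_on_def pdiff_on_def ..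

lemma ipartial_append: "ipartial (js @ ks) F = ipartial js (ipartial ks F)" by (induction js) auto

lemma ipartial_snoc: "ipartial (js @ [i]) F = ipartial js (pd i F)" by (simp only: ipartial_append pd_def)

lemma ipartial_Cons: "ipartial (i # js) F = pd i (ipartial js F)" by (simp add: pd_def)

lemma pd_has_derivative:
  assumes "pdiff_on I U F" "i \<in> I" "x(i := s) \<in> U"
  shows "((\<lambda>t. F (x(i := t))) has_real_derivative pd i F (x(i := s))) (at s)"
proof -
  have "(\<lambda>t. F ((x(i := s))(i := t))) differentiable (at ((x(i := s)) i))" using assms unfolding pdiff_on_def by blast
  then show ?thesis by (simp add: pd_def DERIV_deriv_iff_real_differentiable)
qed

lemma pd_has_derivative':
  assumes "pdiff_on I U F" "i \<in> I" "x \<in> U"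
  shows "((\<lambda>t. F (x(i := t))) has_real_derivative pd i F x) (at (x i))"
  using pd_has_derivative[of I U F i x "x i"] assms by (simp add: fun_upd_triv)

lemma pd_eqI:
  assumes "((\<lambda>t. F (x(i := t))) has_real_derivative D) (at (x i))"
  shows "pd i F x = D" and "(\<lambda>t. F (x(i := t))) differentiable (at (x i))"
  using assms by (auto simp: pd_def DERIV_imp_deriv real_differentiable_def)

lemma copen_upd_eventually:
  assumes I: "finite I" "copen I U" "x \<in> U" "i \<in> I"
  shows "\<forall>\<^sub>F t in nhds (x i). x(i := t) \<in> U"
proof -
  obtain e where e: "e > 0" "\<forall>y\<in>coord_space I. cdist I x y < e \<longrightarrow> y \<in> U" using copenD I by metis
  have "x(i := t) \<in> U" if "dist t (x i) < e" for t using e I that copen_sub[OF I(2)] cdist_upd_le[OF I(1), of x i t]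
    by (auto simp: dist_real_def abs_minus_commute)
  then show ?thesis unfolding eventually_nhds_metric using e(1) by blast
qed

text \<open>A partial derivative only sees a short axis-parallel segment, which stays inside the
  open set.\<close>

lemma pd_cong:
  assumes I: "finite I" "copen I U" "i \<in> I" and eq: "\<And>x. x \<in> U \<Longrightarrow> F x = G x" and x: "x \<in> U"
  shows "pd i F x = pd i G x"
    "(\<lambda>t. F (x(i := t))) differentiable (at (x i)) \<longleftrightarrow> (\<lambda>t. G (x(i := t))) differentiable (at (x i))"
proof -
  have ev: "\<forall>\<^sub>F t in nhds (x i). F (x(i := t)) = G (x(i := t))"
    using copen_upd_eventually[OF I(1,2) x I(3)] by eventually_elim (rule eq)
  show "pd i F x = pd i G x" using ev by (simp add: pd_def deriv_cong_ev)
  show "(\<lambda>t. F (x(i := t))) differentiable (at (x i)) \<longleftrightarrow> (\<lambda>t. G (x(i := t))) differentiable (at (x i))"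
    unfolding real_differentiable_def using DERIV_cong_ev[OF refl ev refl] by simp
qed

section \<open>Functions of finite differentiability order and their closure properties\<close>

primrec ck :: "nat \<Rightarrow> 'i set \<Rightarrow> ('i \<Rightarrow> real) set \<Rightarrow> (('i \<Rightarrow> real) \<Rightarrow> real) \<Rightarrow> bool" where
  "ck 0 I U F \<longleftrightarrow> continuous_on U F"
| "ck (Suc k) I U F \<longleftrightarrow> continuous_on U F \<and> pdiff_on I U F \<and> (\<forall>i\<in>I. ck k I U (pd i F))"

text \<open>Smoothness quantifies over all index lists at once and offers no induction. With
  \<open>ck\<close> every closure property is proved by induction on the order.\<close>

lemma smooth_iff_ck: "smooth_real_on I U F \<longleftrightarrow> (\<forall>k. ck k I U F)"
proof
  have pd: "smooth_real_on I U (pd i F)" if "smooth_real_on I U F" "i \<in> I" for F i unfolding smooth_real_on_alt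
  proof (intro allI impI)
    fix js assume "set js \<subseteq> I"
    then have "set (js @ [i]) \<subseteq> I" using that by simp
    then show "continuous_on U (ipartial js (pd i F)) \<and> pdiff_on I U (ipartial js (pd i F))"
      using that(1) unfolding smooth_real_on_alt ipartial_snoc[symmetric] by blast
  qed
  assume S: "smooth_real_on I U F"
  show "\<forall>k. ck k I U F"
  proof
    fix k show "ck k I U F" using S
    proof (induction k arbitrary: F)
      case 0
      then show ?case unfolding smooth_real_on_alt by (auto dest: spec[of _ "[]"])
    next
      case (Suc k)
      then have "continuous_on U (ipartial [] F) \<and> pdiff_on I U (ipartial [] F)"
        unfolding smooth_real_on_alt by (auto dest: spec[of _ "[]"])
      then show ?case using Suc pd by auto
    qed
  qed
next
  assume C: "\<forall>k. ck k I U F"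
  \<comment> \<open>Induction from the end of the list: the last index acts first, and
    \<open>ck\<close> peels off the innermost derivative.\<close>
  have "(\<forall>k. ck k I U F) \<Longrightarrow> set js \<subseteq> I \<Longrightarrow>
      continuous_on U (ipartial js F) \<and> pdiff_on I U (ipartial js F)" for js
  proof (induction js arbitrary: F rule: rev_induct)
    case Nil
    then have "ck (Suc 0) I U F" by blast
    then show ?case by simp
  next
    case (snoc i js)
    have "\<forall>k. ck k I U (pd i F)"
    proof
      fix k have "ck (Suc k) I U F" using snoc(2) by blast
      then show "ck k I U (pd i F)" using snoc(3) by simp
    qed
    from snoc(1)[OF this] show ?case using snoc(3) by (simp add: ipartial_snoc)
  qed
  then show "smooth_real_on I U F" using C unfolding smooth_real_on_alt by blast
qed

lemma ck_continuous: "ck k I U F \<Longrightarrow> continuous_on U F" by (cases k) auto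

lemma ck_Suc_D: "ck (Suc k) I U F \<Longrightarrow> ck k I U F" by (induction k arbitrary: F) auto

lemma ck_subset: "ck k I U F \<Longrightarrow> W \<subseteq> U \<Longrightarrow> ck k I W F"
  by (induction k arbitrary: F) (auto intro: continuous_on_subset pdiff_on_subset)

lemma ck_cong:
  assumes I: "finite I" "copen I U"
  shows "(\<And>x. x \<in> U \<Longrightarrow> F x = G x) \<Longrightarrow> ck k I U F \<Longrightarrow> ck k I U G"
proof (induction k arbitrary: F G)
  case 0
  then show ?case by (metis ck.simps(1) continuous_on_cong)
next
  case (Suc k)
  have "continuous_on U G" using Suc(2,3) by (metis ck.simps(2) continuous_on_cong)
  moreover have "pdiff_on I U G"  unfolding pdiff_on_def
  proof (intro ballI)
    fix i x assume ix: "i \<in> I" "x \<in> U"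
    then have "(\<lambda>t. F (x(i := t))) differentiable (at (x i))" using Suc(3) by (simp add: pdiff_on_def)
    then show "(\<lambda>t. G (x(i := t))) differentiable (at (x i))"
      using pd_cong(2)[where F = F and G = G, OF I ix(1) Suc(2) ix(2)] by simp
  qed
  moreover have "ck k I U (pd i G)" if i: "i \<in> I" for i
  proof (rule Suc(1))
    show "pd i F x = pd i G x" if "x \<in> U" for x by (rule pd_cong(1)[OF I i Suc(2) that])
    show "ck k I U (pd i F)" using Suc(3) i by simp
  qed
  ultimately show ?case by auto
qed

text \<open>Continuity and existence of partial derivatives are local, and the induction hypothesis
  treats the derivatives themselves.\<close>

lemma ck_local:
  assumes I: "finite I" and loc: "\<And>x. x \<in> U \<Longrightarrow> \<exists>W. copen I W \<and> x \<in> W \<and> ck k I W F"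
    and U: "U \<subseteq> coord_space I"
  shows "ck k I U F"
  using loc
proof (induction k arbitrary: F)
  case 0
  show ?case unfolding ck.simps continuous_on_cdist_iff[OF I U]
  proof (intro ballI allI impI)
    fix x e assume x: "x \<in> U" and e: "(e::real) > 0"
    obtain W where W: "copen I W" "x \<in> W" "continuous_on W F" using 0[OF x] by auto
    obtain r where r: "r > 0" "\<forall>y\<in>coord_space I. cdist I x y < r \<longrightarrow> y \<in> W"
      using copenD[OF I W(1,2)] by blast
    obtain d where d: "d > 0" "\<forall>y\<in>W. cdist I x y < d \<longrightarrow> \<bar>F y - F x\<bar> < e"
      using W e unfolding continuous_on_cdist_iff[OF I copen_sub[OF W(1)]] by blast
    show "\<exists>d>0. \<forall>y\<in>U. cdist I x y < d \<longrightarrow> \<bar>F y - F x\<bar> < e"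
      using r d U by (intro exI[of _ "min r d"]) auto
  qed
next
  case (Suc k)
  have "ck k I U F" 
  proof (rule Suc.IH)
    fix x assume "x \<in> U"
    then obtain W where "copen I W" "x \<in> W" "ck (Suc k) I W F" using Suc.prems by blast
    then show "\<exists>W. copen I W \<and> x \<in> W \<and> ck k I W F" using ck_Suc_D by blast
  qed
  then have "continuous_on U F" by (rule ck_continuous)
  moreover have "pdiff_on I U F" unfolding pdiff_on_def
  proof (intro ballI)
    fix i x assume ix: "i \<in> I" "x \<in> U"
    then obtain W where "x \<in> W" "ck (Suc k) I W F" using Suc.prems by blast
    then show "(\<lambda>t. F (x(i := t))) differentiable (at (x i))" using ix by (simp add: pdiff_on_def)
  qed
  moreover have "ck k I U (pd i F)" if "i \<in> I" for i
  proof (rule Suc.IH)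
    fix x assume "x \<in> U"
    then obtain W where "copen I W" "x \<in> W" "ck (Suc k) I W F" using Suc.prems by blast
    then show "\<exists>W. copen I W \<and> x \<in> W \<and> ck k I W (pd i F)" using that by auto
  qed
  ultimately show ?case by simp
qed

lemma pd_const [simp]: "pd i (\<lambda>x. c) = (\<lambda>x. 0)" by (auto simp: pd_def fun_eq_iff)

lemma ck_const [simp]: "ck k I U (\<lambda>x. c)" by (induction k arbitrary: c) (auto simp: pdiff_on_def)

lemma pd_coord: "pd i (\<lambda>x. x j) = (\<lambda>x. if i = j then 1 else 0)" by (auto simp: pd_def fun_eq_iff)

lemma continuous_on_coord: "continuous_on U (\<lambda>x. (x i) :: real)"
  by (rule continuous_on_subset[OF continuous_on_product_coordinates]) simp

lemma ck_coord [simp]: "ck k I U (\<lambda>x. x j)"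
proof (cases k)
  case (Suc l)
  have "(\<lambda>t. (x(i := t)) j) differentiable (at (x i))" for x :: "'a \<Rightarrow> real" and i by (cases "i = j") auto
  then show ?thesis using Suc by (auto simp: pd_coord continuous_on_coord pdiff_on_def)
qed (simp add: continuous_on_coord)

lemma ck_add:
  assumes I: "finite I" "copen I U"
  shows "ck k I U F \<Longrightarrow> ck k I U G \<Longrightarrow> ck k I U (\<lambda>x. F x + G x)"
proof (induction k arbitrary: F G)
  case 0
  then show ?case by (auto intro: continuous_intros)
next
  case (Suc k)
  have d: "((\<lambda>t. F (x(i := t)) + G (x(i := t))) has_real_derivative (pd i F x + pd i G x)) (at (x i))"
    if "i \<in> I" "x \<in> U" for i x
    using Suc.prems that by (auto intro!: DERIV_add pd_has_derivative'[of I U])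
  have pe: "pd i (\<lambda>x. F x + G x) x = pd i F x + pd i G x" if "i \<in> I" "x \<in> U" for i x by (rule pd_eqI(1)[OF d[OF that]])
  have pf: "pdiff_on I U (\<lambda>x. F x + G x)" by (rule pdiff_onI[OF d])
  have "ck k I U (pd i (\<lambda>x. F x + G x))" if "i \<in> I" for i by (rule ck_cong[OF I, of "\<lambda>x. pd i F x + pd i G x"])
       (use that Suc in \<open>auto simp: pe\<close>)
  moreover have "continuous_on U (\<lambda>x. F x + G x)" using Suc.prems by (auto intro: continuous_intros)
  ultimately show ?case using pf by simp
qed

text \<open>The product rule mixes derivatives with the undifferentiated factors, which are brought
  down to order \<open>k\<close> by \<open>ck_Suc_D\<close>.\<close>

lemma ck_mult:
  assumes I: "finite I" "copen I U"
  shows "ck k I U F \<Longrightarrow> ck k I U G \<Longrightarrow> ck k I U (\<lambda>x. F x * G x)"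
proof (induction k arbitrary: F G)
  case 0
  then show ?case by (auto intro: continuous_intros)
next
  case (Suc k)
  have d: "((\<lambda>t. F (x(i := t)) * G (x(i := t))) has_real_derivative (pd i F x * G x + pd i G x * F x)) (at (x i))"
    if "i \<in> I" "x \<in> U" for i x
    using DERIV_mult[OF pd_has_derivative'[of I U F i x] pd_has_derivative'[of I U G i x]] Suc.prems that by auto
  have pe: "pd i (\<lambda>x. F x * G x) x = pd i F x * G x + pd i G x * F x" if "i \<in> I" "x \<in> U" for i x
    by (rule pd_eqI(1)[OF d[OF that]])
  have pf: "pdiff_on I U (\<lambda>x. F x * G x)" by (rule pdiff_onI[OF d])
  have kk: "ck k I U F" "ck k I U G" using Suc.prems by (blast intro: ck_Suc_D)+
  have "ck k I U (pd i (\<lambda>x. F x * G x))" if "i \<in> I" for i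
    by (rule ck_cong[OF I, of "\<lambda>x. pd i F x * G x + pd i G x * F x"])
       (use that Suc kk in \<open>auto simp: pe intro!: ck_add[OF I]\<close>)
  moreover have "continuous_on U (\<lambda>x. F x * G x)" using Suc.prems by (auto intro: continuous_intros)
  ultimately show ?case using pf by simp
qed

text \<open>The derivative is - F' / F^2; that 1 / F has the lower order \<open>k\<close> is exactly
  the induction hypothesis.\<close>

lemma ck_inverse:
  assumes I: "finite I" "copen I U" and nz: "\<And>x. x \<in> U \<Longrightarrow> F x \<noteq> 0"
  shows "ck k I U F \<Longrightarrow> ck k I U (\<lambda>x. inverse (F x))"
proof (induction k)
  case 0
  then show ?case using nz by (auto intro: continuous_intros)
next
  case (Suc k)
  have d: "((\<lambda>t. inverse (F (x(i := t)))) has_real_derivative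
      (-1) * (pd i F x * (inverse (F x) * inverse (F x)))) (at (x i))"
    if "i \<in> I" "x \<in> U" for i x
    using DERIV_inverse'[OF pd_has_derivative'[of I U F i x]] Suc.prems that nz by (auto simp: algebra_simps)
  have pe: "pd i (\<lambda>x. inverse (F x)) x = (-1) * (pd i F x * (inverse (F x) * inverse (F x)))" if "i \<in> I" "x \<in> U" for i x
    by (rule pd_eqI(1)[OF d[OF that]])
  have pf: "pdiff_on I U (\<lambda>x. inverse (F x))" by (rule pdiff_onI[OF d])
  have kk: "ck k I U (\<lambda>x. inverse (F x))" using Suc by (blast intro: ck_Suc_D)
  have "ck k I U (pd i (\<lambda>x. inverse (F x)))" if "i \<in> I" for i
  proof (rule ck_cong[OF I])
    show "ck k I U (\<lambda>x. (-1) * (pd i F x * (inverse (F x) * inverse (F x))))"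
      using kk that Suc.prems by (intro ck_mult[OF I] ck_const) auto
  qed (simp only: pe that)
  moreover have "continuous_on U (\<lambda>x. inverse (F x))" using Suc.prems nz by (auto intro: continuous_intros)
  ultimately show ?case using pf by simp
qed

lemma ck_sum:
  assumes I: "finite I" "copen I U"
  shows "(\<And>a. a \<in> A \<Longrightarrow> ck k I U (F a)) \<Longrightarrow> ck k I U (\<lambda>x. \<Sum>a\<in>A. F a x)"
proof (induction A rule: infinite_finite_induct)
  case (insert a A)
  then show ?case by (auto intro!: ck_add[OF I])
qed auto

subsection \<open>Mean value theorem and chain rule\<close>

text \<open>Closed segments spare a case distinction on the order of the end points and include the
  degenerate case.\<close>

lemma mvt_segment:
  fixes f :: "real \<Rightarrow> real"
  assumes "\<And>t. t \<in> closed_segment a b \<Longrightarrow> (f has_real_derivative f' t) (at t)"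
  shows "\<exists>t\<in>closed_segment a b. f b - f a = f' t * (b - a)"
proof -
  consider "a = b" | "a < b" | "b < a" by linarith
  then show ?thesis
  proof cases
    case 1 then show ?thesis by auto
  next
    case 2
    then obtain t where "a < t" "t < b" "f b - f a = (b - a) * f' t"
      using MVT2[of a b f f'] assms by (auto simp: closed_segment_eq_real_ivl)
    then show ?thesis using 2 by (intro bexI[of _ t]) (auto simp: closed_segment_eq_real_ivl)
  next
    case 3
    then obtain t where "b < t" "t < a" "f a - f b = (a - b) * f' t"
      using MVT2[of b a f f'] assms by (auto simp: closed_segment_eq_real_ivl)
    then show ?thesis using 3 by (intro bexI[of _ t]) (auto simp: closed_segment_eq_real_ivl algebra_simps)
  qed
qed

text \<open>The box spanned by two points contains every path between them that changes the
  coordinates one after the other.\<close>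

definition cbox_of :: "'i set \<Rightarrow> ('i \<Rightarrow> real) \<Rightarrow> ('i \<Rightarrow> real) \<Rightarrow> ('i \<Rightarrow> real) set" where
  "cbox_of I x y = {w \<in> coord_space I. \<forall>i\<in>I. w i \<in> closed_segment (x i) (y i)}"

lemma cbox_of_dist: "finite I \<Longrightarrow> w \<in> cbox_of I x y \<Longrightarrow> cdist I x w \<le> cdist I x y"
proof -
  assume a: "finite I" "w \<in> cbox_of I x y"
  have "\<bar>x i - w i\<bar> \<le> cdist I x y" if "i \<in> I" for i using a that abs_le_cdist[OF a(1) that, of x y]
    by (auto simp: cbox_of_def closed_segment_eq_real_ivl split: if_splits)
  then show ?thesis using a by (simp add: cdist_le_iff)
qed

lemma cbox_of_ball:
  assumes "finite I" "w \<in> cbox_of I x y" "cdist I c x < r" "cdist I c y < r"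
  shows "cdist I c w < r"
proof -
  have r: "r > 0" using assms cdist_nonneg[of I c x] by linarith
  have "\<bar>c i - w i\<bar> < r" if i: "i \<in> I" for i
    using assms(2) i abs_le_cdist[OF assms(1) i, of c x] abs_le_cdist[OF assms(1) i, of c y] assms(3,4)
    by (auto simp: cbox_of_def closed_segment_eq_real_ivl abs_less_iff split: if_splits)
  then show ?thesis using r assms(1) by (simp add: cdist_less_iff)
qed

text \<open>Telescoping along a path from \<open>x\<close> to \<open>y\<close> that changes one
  coordinate at a time. Each coordinate has its own intermediate point, and only partial derivatives
  occur.\<close>

lemma mvt_coords:
  assumes I: "finite I" and x: "x \<in> coord_space I" "y \<in> coord_space I"
    and box: "cbox_of I x y \<subseteq> U" and F: "pdiff_on I U F"
  shows "\<exists>\<xi>. (\<forall>i\<in>I. \<xi> i \<in> cbox_of I x y) \<and> F y - F x = (\<Sum>i\<in>I. pd i F (\<xi> i) * (y i - x i))"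
proof -
  \<comment> \<open>The corner of the box reached after the coordinates in \<open>J\<close> have
    been changed.\<close>
  let ?y = "\<lambda>J i. if i \<in> J then y i else x i"
  have "\<exists>\<xi>. (\<forall>i\<in>J. \<xi> i \<in> cbox_of I x y) \<and> F (?y J) - F x = (\<Sum>i\<in>J. pd i F (\<xi> i) * (y i - x i))"
    if "finite J" "J \<subseteq> I" for J
    using that
  proof (induction J rule: finite_induct)
    case empty
    then show ?case by simp
  next
    case (insert j J)
    then obtain \<xi> where \<xi>: "\<forall>i\<in>J. \<xi> i \<in> cbox_of I x y"
      "F (?y J) - F x = (\<Sum>i\<in>J. pd i F (\<xi> i) * (y i - x i))" by blast
    have b: "(?y J)(j := t) \<in> cbox_of I x y" if "t \<in> closed_segment (x j) (y j)" for t
      using that x insert by (auto simp: cbox_of_def coord_space_def)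
    have "((\<lambda>t. F ((?y J)(j := t))) has_real_derivative pd j F ((?y J)(j := t))) (at t)"
      if "t \<in> closed_segment (x j) (y j)" for t
      using b[OF that] box F insert by (intro pd_has_derivative[of I U]) auto
    from mvt_segment[OF this] obtain t where t: "t \<in> closed_segment (x j) (y j)"
      "F ((?y J)(j := y j)) - F ((?y J)(j := x j)) = pd j F ((?y J)(j := t)) * (y j - x j)" by blast
    have e: "(?y J)(j := y j) = ?y (insert j J)" "(?y J)(j := x j) = ?y J" using insert by auto
    define \<xi>' where "\<xi>' = \<xi>(j := (?y J)(j := t))"
    have "(\<Sum>i\<in>J. pd i F (\<xi>' i) * (y i - x i)) = (\<Sum>i\<in>J. pd i F (\<xi> i) * (y i - x i))"
      by (rule sum.cong) (use insert in \<open>auto simp: \<xi>'_def\<close>)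
    then have "F (?y (insert j J)) - F x = (\<Sum>i\<in>insert j J. pd i F (\<xi>' i) * (y i - x i))"
      using t(2) \<xi>(2) insert unfolding e by (simp add: \<xi>'_def)
    moreover have "\<forall>i\<in>insert j J. \<xi>' i \<in> cbox_of I x y" using b[OF t(1)] \<xi>(1) by (auto simp: \<xi>'_def)
    ultimately show ?case by blast
  qed
  from this[OF I order_refl] show ?thesis
  proof -
    have "?y I = y" using x by (auto simp: coord_space_def fun_eq_iff)
    then show ?thesis using \<open>\<exists>\<xi>. (\<forall>i\<in>I. \<xi> i \<in> cbox_of I x y) \<and> F (?y I) - F x = _\<close> by simp
  qed
qed

text \<open>Divide the coordinatewise mean value formula by \<open>t - t0\<close>. The boxes shrink
  to \<open>\<gamma> t0\<close>, so continuity of the partial derivatives takes the place of a total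
  derivative.\<close>

lemma chain_curve:
  assumes J: "finite J" "copen J V" and F: "pdiff_on J V F" "\<And>j. j \<in> J \<Longrightarrow> continuous_on V (pd j F)"
    and g0: "\<gamma> t0 \<in> V" and gc: "\<forall>\<^sub>F t in nhds t0. \<gamma> t \<in> coord_space J"
    and gd: "\<And>j. j \<in> J \<Longrightarrow> ((\<lambda>t. \<gamma> t j) has_real_derivative g j) (at t0)"
  shows "((\<lambda>t. F (\<gamma> t)) has_real_derivative (\<Sum>j\<in>J. pd j F (\<gamma> t0) * g j)) (at t0)"
proof -
  obtain r where r: "r > 0" "\<forall>y\<in>coord_space J. cdist J (\<gamma> t0) y < r \<longrightarrow> y \<in> V"
    using copenD[OF J g0] by blast
  have lim: "((\<lambda>t. \<gamma> t j) \<longlongrightarrow> \<gamma> t0 j) (at t0)" if "j \<in> J" for j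
    using gd[OF that] DERIV_isCont isCont_def by blast
  have gc': "\<forall>\<^sub>F t in at t0. \<gamma> t \<in> coord_space J" using gc eventually_nhds_x_imp_x
    by (simp add: eventually_at_filter eventually_mono)
  have fl: "filterlim \<gamma> (cnh J (\<gamma> t0)) (at t0)" by (rule cnh_map[OF J(1) lim gc'])
  define P where "P t \<xi> \<longleftrightarrow> (\<forall>j\<in>J. \<xi> j \<in> cbox_of J (\<gamma> t0) (\<gamma> t)) \<and>
      F (\<gamma> t) - F (\<gamma> t0) = (\<Sum>j\<in>J. pd j F (\<xi> j) * (\<gamma> t j - \<gamma> t0 j))" for t \<xi>
  have ex: "\<exists>\<xi>. P t \<xi>" if t: "\<gamma> t \<in> coord_space J" "cdist J (\<gamma> t0) (\<gamma> t) < r" for t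
    unfolding P_def
  proof (rule mvt_coords[OF J(1) _ t(1) _ F(1)])
    show "\<gamma> t0 \<in> coord_space J" using copen_sub[OF J(2)] g0 by blast
    show "cbox_of J (\<gamma> t0) (\<gamma> t) \<subseteq> V" using r(2) cbox_of_dist[OF J(1)] t(2) by (force simp: cbox_of_def)
  qed
  obtain \<xi> where \<xi>: "\<And>t. \<gamma> t \<in> coord_space J \<Longrightarrow> cdist J (\<gamma> t0) (\<gamma> t) < r \<Longrightarrow> P t (\<xi> t)"
    using ex by metis
  have evd: "\<forall>\<^sub>F t in at t0. cdist J (\<gamma> t0) (\<gamma> t) < e" if "e > 0" for e
    using filterlim_iff[THEN iffD1, OF fl] cnh_dist[OF that] by blast
  have evP: "\<forall>\<^sub>F t in at t0. P t (\<xi> t)" using gc' evd[OF r(1)] by eventually_elim (rule \<xi>)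
  have lx: "filterlim (\<lambda>t. \<xi> t j) (cnh J (\<gamma> t0)) (at t0)" if j: "j \<in> J" for j unfolding filterlim_iff
  proof (intro allI impI)
    fix Q assume "eventually Q (cnh J (\<gamma> t0))"
    then obtain e where e: "e > 0" "\<forall>y\<in>coord_space J. cdist J (\<gamma> t0) y < e \<longrightarrow> Q y"
      unfolding eventually_cnh by blast
    show "\<forall>\<^sub>F t in at t0. Q (\<xi> t j)" using evP evd[OF e(1)]
    proof eventually_elim
      case (elim t)
      then have "\<xi> t j \<in> cbox_of J (\<gamma> t0) (\<gamma> t)" using j by (simp add: P_def)
      then show ?case using cbox_of_dist[OF J(1)] elim(2) e(2) by (force simp: cbox_of_def)
    qed
  qed
  have lp: "((\<lambda>t. pd j F (\<xi> t j)) \<longlongrightarrow> pd j F (\<gamma> t0)) (at t0)" if j: "j \<in> J" for j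
    using filterlim_compose[OF _ lx[OF j]] F(2)[OF j] g0 continuous_on_cnh[OF J] by blast
  have "((\<lambda>t. \<Sum>j\<in>J. pd j F (\<xi> t j) * ((\<gamma> t j - \<gamma> t0 j) / (t - t0))) \<longlongrightarrow>
      (\<Sum>j\<in>J. pd j F (\<gamma> t0) * g j)) (at t0)"
    using lp gd by (intro tendsto_sum tendsto_mult) (auto simp: has_field_derivative_iff)
  then have "((\<lambda>t. (F (\<gamma> t) - F (\<gamma> t0)) / (t - t0)) \<longlongrightarrow> (\<Sum>j\<in>J. pd j F (\<gamma> t0) * g j)) (at t0)"
  proof (rule Lim_transform_eventually)
    show "\<forall>\<^sub>F t in at t0. (\<Sum>j\<in>J. pd j F (\<xi> t j) * ((\<gamma> t j - \<gamma> t0 j) / (t - t0))) =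
        (F (\<gamma> t) - F (\<gamma> t0)) / (t - t0)"
      using evP by eventually_elim (simp add: P_def sum_divide_distrib)
  qed
  then show ?thesis by (simp add: has_field_derivative_iff)
qed

lemma pd_comp:
  assumes I: "finite I" "copen I U" and J: "finite J" "copen J V"
    and F: "pdiff_on J V F" "\<And>j. j \<in> J \<Longrightarrow> continuous_on V (pd j F)"
    and g: "\<And>j. j \<in> J \<Longrightarrow> pdiff_on I U (\<lambda>x. g x j)" "g ` U \<subseteq> V" and i: "i \<in> I" and x: "x \<in> U"
  shows "((\<lambda>t. F (g (x(i := t)))) has_real_derivative
      (\<Sum>j\<in>J. pd j F (g x) * pd i (\<lambda>x. g x j) x)) (at (x i))"
proof -
  have "\<forall>\<^sub>F t in nhds (x i). g (x(i := t)) \<in> coord_space J"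
    using copen_upd_eventually[OF I x i] by eventually_elim (use g(2) copen_sub[OF J(2)] in auto)
  then have "((\<lambda>t. F (g (x(i := t)))) has_real_derivative
      (\<Sum>j\<in>J. pd j F (g (x(i := x i))) * pd i (\<lambda>x. g x j) x)) (at (x i))"
    using g x pd_has_derivative'[OF g(1) i x] by (intro chain_curve[OF J F]) auto
  then show ?thesis by simp
qed

text \<open>By the chain rule the derivative consists of products of \<open>pd j F\<close> composed
  with \<open>g\<close>, covered by the induction because \<open>F\<close> is arbitrary there, and
  of derivatives of \<open>g\<close>.\<close>

lemma ck_comp:
  assumes I: "finite I" "copen I U" and J: "finite J" "copen J V"
    and g: "g ` U \<subseteq> V"
  shows "ck k J V F \<Longrightarrow> (\<And>j. j \<in> J \<Longrightarrow> ck k I U (\<lambda>x. g x j)) \<Longrightarrow> ck k I U (\<lambda>x. F (g x))"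
proof (induction k arbitrary: F)
  case 0
  have "\<forall>x\<in>U. ((\<lambda>x. F (g x)) \<longlongrightarrow> F (g x)) (cnh I x)"
  proof
    fix x assume x: "x \<in> U"
    have s: "\<forall>\<^sub>F y in cnh I x. g y \<in> coord_space J"
      using cnh_copen[OF I x] by eventually_elim (use g copen_sub[OF J(2)] in auto)
    have "filterlim g (cnh J (g x)) (cnh I x)" by (rule cnh_map[OF J(1) _ s]) (use 0(2) x continuous_on_cnh[OF I] in auto)
    then show "((\<lambda>x. F (g x)) \<longlongrightarrow> F (g x)) (cnh I x)"
      using 0(1) x g continuous_on_cnh[OF J] filterlim_compose by (metis ck.simps(1) image_subset_iff)
  qed
  then show ?case using continuous_on_cnh[OF I] by simp
next
  case (Suc k)
  have d: "((\<lambda>t. F (g (x(i := t)))) has_real_derivative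
      (\<Sum>j\<in>J. pd j F (g x) * pd i (\<lambda>x. g x j) x)) (at (x i))" if "i \<in> I" "x \<in> U" for i x
    using Suc.prems g that by (intro pd_comp[OF I J]) (auto intro: ck_continuous)
  have pe: "pd i (\<lambda>x. F (g x)) x = (\<Sum>j\<in>J. pd j F (g x) * pd i (\<lambda>x. g x j) x)" if "i \<in> I" "x \<in> U" for i x
    by (rule pd_eqI(1)[OF d[OF that]])
  have pf: "pdiff_on I U (\<lambda>x. F (g x))" by (rule pdiff_onI[OF d])
  have kF: "ck k I U (\<lambda>x. F (g x))" using Suc by (blast intro: ck_Suc_D)
  have kP: "ck k I U (\<lambda>x. pd j F (g x))" if "j \<in> J" for j
  proof (rule Suc.IH)
    show "ck k J V (pd j F)" using Suc.prems(1) that by simp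
    show "ck k I U (\<lambda>x. g x j)" if "j \<in> J" for j using Suc.prems(2)[OF that] by (rule ck_Suc_D)
  qed
  have "ck k I U (pd i (\<lambda>x. F (g x)))" if "i \<in> I" for i
  proof (rule ck_cong[OF I])
    show "ck k I U (\<lambda>x. \<Sum>j\<in>J. pd j F (g x) * pd i (\<lambda>x. g x j) x)"
      using kP Suc.prems(2) that by (intro ck_sum[OF I] ck_mult[OF I]) auto
  qed (simp only: pe that)
  then show ?case using pf ck_continuous[OF kF] by simp
qed

subsection \<open>Smooth functions\<close>

lemma smooth_continuous: "smooth_real_on I U F \<Longrightarrow> continuous_on U F" unfolding smooth_iff_ck using ck_continuous by blast

lemma smooth_pdiff: "smooth_real_on I U F \<Longrightarrow> pdiff_on I U F" unfolding smooth_iff_ck by (auto dest: spec[of _ "Suc 0"])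

lemma smooth_pd: "smooth_real_on I U F \<Longrightarrow> i \<in> I \<Longrightarrow> smooth_real_on I U (pd i F)"
  unfolding smooth_iff_ck by (metis ck.simps(2))

lemma smooth_ipartial: "smooth_real_on I U F \<Longrightarrow> set bs \<subseteq> I \<Longrightarrow> smooth_real_on I U (ipartial bs F)"
  by (induction bs) (auto simp: smooth_pd ipartial_Cons simp del: ipartial.simps(2))

lemma smooth_subset: "smooth_real_on I U F \<Longrightarrow> W \<subseteq> U \<Longrightarrow> smooth_real_on I W F"
  unfolding smooth_iff_ck by (auto intro: ck_subset)

lemma smooth_cong:
  "finite I \<Longrightarrow> copen I U \<Longrightarrow> (\<And>x. x \<in> U \<Longrightarrow> F x = G x) \<Longrightarrow> smooth_real_on I U F \<Longrightarrow> smooth_real_on I U G"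
  unfolding smooth_iff_ck by (auto intro: ck_cong)

lemma smooth_local:
  assumes "finite I" "\<And>x. x \<in> U \<Longrightarrow> \<exists>W. copen I W \<and> x \<in> W \<and> smooth_real_on I W F" "U \<subseteq> coord_space I"
  shows "smooth_real_on I U F"
  unfolding smooth_iff_ck
proof
  fix k show "ck k I U F"
  proof (rule ck_local[OF assms(1) _ assms(3)])
    fix x assume "x \<in> U"
    then obtain W where "copen I W" "x \<in> W" "smooth_real_on I W F" using assms(2) by blast
    then show "\<exists>W. copen I W \<and> x \<in> W \<and> ck k I W F" by (auto simp: smooth_iff_ck)
  qed
qed

lemma smooth_const [simp]: "smooth_real_on I U (\<lambda>x. c)" by (simp add: smooth_iff_ck)

lemma smooth_coord [simp]: "smooth_real_on I U (\<lambda>x. x i)" by (simp add: smooth_iff_ck)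

context
  fixes I :: "'i set" and U
  assumes IU: "finite I" "copen I U"
begin

lemma smooth_add: "smooth_real_on I U F \<Longrightarrow> smooth_real_on I U G \<Longrightarrow> smooth_real_on I U (\<lambda>x. F x + G x)"
  unfolding smooth_iff_ck by (auto intro!: ck_add[OF IU])

lemma smooth_mult: "smooth_real_on I U F \<Longrightarrow> smooth_real_on I U G \<Longrightarrow> smooth_real_on I U (\<lambda>x. F x * G x)"
  unfolding smooth_iff_ck by (auto intro!: ck_mult[OF IU])

lemma smooth_inverse:
  "(\<And>x. x \<in> U \<Longrightarrow> F x \<noteq> 0) \<Longrightarrow> smooth_real_on I U F \<Longrightarrow> smooth_real_on I U (\<lambda>x. inverse (F x))"
  unfolding smooth_iff_ck by (auto intro!: ck_inverse[OF IU])

lemma smooth_sum: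
  "(\<And>a. a \<in> A \<Longrightarrow> smooth_real_on I U (F a)) \<Longrightarrow> smooth_real_on I U (\<lambda>x. \<Sum>a\<in>A. F a x)"
  unfolding smooth_iff_ck by (auto intro!: ck_sum[OF IU])

lemma smooth_diff: "smooth_real_on I U F \<Longrightarrow> smooth_real_on I U G \<Longrightarrow> smooth_real_on I U (\<lambda>x. F x - G x)"
  using smooth_add[of F "\<lambda>x. (-1) * G x"] smooth_mult[of "\<lambda>_. -1" G] by simp

lemma smooth_comp:
  assumes J: "finite J" "copen J V" and g: "g ` U \<subseteq> V"
  shows "smooth_real_on J V F \<Longrightarrow> (\<And>j. j \<in> J \<Longrightarrow> smooth_real_on I U (\<lambda>x. g x j)) \<Longrightarrow>
    smooth_real_on I U (\<lambda>x. F (g x))"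
  unfolding smooth_iff_ck by (rule allI, rule ck_comp[OF IU J g]) auto

lemma ipartial_cong:
  assumes "\<And>x. x \<in> U \<Longrightarrow> F x = G x" "set bs \<subseteq> I" "x \<in> U"
  shows "ipartial bs F x = ipartial bs G x"
  using assms(2,3)
proof (induction bs arbitrary: x)
  case (Cons b bs)
  then show ?case unfolding ipartial_Cons by (intro pd_cong(1)[OF IU]) auto
qed (simp add: assms(1))

lemma pd_diff:
  assumes "pdiff_on I U F" "pdiff_on I U G" "i \<in> I" "x \<in> U"
  shows "pd i (\<lambda>x. F x - G x) x = pd i F x - pd i G x"
  by (rule pd_eqI(1)) (intro DERIV_diff pd_has_derivative'[of I U] assms)

lemma pd_add:
  assumes "pdiff_on I U F" "pdiff_on I U G" "i \<in> I" "x \<in> U"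
  shows "pd i (\<lambda>x. F x + G x) x = pd i F x + pd i G x"
  by (rule pd_eqI(1)) (intro DERIV_add pd_has_derivative'[of I U] assms)

lemma ipartial_diff:
  assumes "smooth_real_on I U F" "smooth_real_on I U G" "set bs \<subseteq> I" "x \<in> U"
  shows "ipartial bs (\<lambda>x. F x - G x) x = ipartial bs F x - ipartial bs G x"
  using assms(3,4)
proof (induction bs arbitrary: x)
  case (Cons b bs)
  have "pd b (ipartial bs (\<lambda>x. F x - G x)) x = pd b (\<lambda>x. ipartial bs F x - ipartial bs G x) x"
    by (rule pd_cong(1)[OF IU]) (use Cons in auto)
  also have "\<dots> = pd b (ipartial bs F) x - pd b (ipartial bs G) x"
    by (rule pd_diff) (use Cons.prems assms in \<open>auto intro!: smooth_pdiff smooth_ipartial\<close>)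
  finally show ?case unfolding ipartial_Cons .
qed simp

lemma pd_cmult:
  assumes "pdiff_on I U F" "i \<in> I" "x \<in> U"
  shows "pd i (\<lambda>x. c * F x) x = c * pd i F x"
  by (rule pd_eqI(1)) (intro DERIV_cmult pd_has_derivative'[of I U] assms)

lemma ipartial_cmult:
  assumes "smooth_real_on I U F" "set bs \<subseteq> I" "x \<in> U"
  shows "ipartial bs (\<lambda>x. c * F x) x = c * ipartial bs F x"
  using assms(2,3)
proof (induction bs arbitrary: x)
  case (Cons b bs)
  have "pd b (ipartial bs (\<lambda>x. c * F x)) x = pd b (\<lambda>x. c * ipartial bs F x) x"
    by (rule pd_cong(1)[OF IU]) (use Cons in auto)
  also have "\<dots> = c * pd b (ipartial bs F) x"
    by (rule pd_cmult) (use Cons.prems assms in \<open>auto intro!: smooth_pdiff smooth_ipartial\<close>)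
  finally show ?case unfolding ipartial_Cons .
qed simp

lemma pd_sum:
  assumes "finite A" "\<And>a. a \<in> A \<Longrightarrow> pdiff_on I U (F a)" "i \<in> I" "x \<in> U"
  shows "pd i (\<lambda>x. \<Sum>a\<in>A. F a x) x = (\<Sum>a\<in>A. pd i (F a) x)"
  by (rule pd_eqI(1)) (intro DERIV_sum pd_has_derivative'[of I U] assms)

lemma ipartial_sum:
  assumes "finite A" "\<And>a. a \<in> A \<Longrightarrow> smooth_real_on I U (F a)" "set bs \<subseteq> I" "x \<in> U"
  shows "ipartial bs (\<lambda>x. \<Sum>a\<in>A. F a x) x = (\<Sum>a\<in>A. ipartial bs (F a) x)"
  using assms(3,4)
proof (induction bs arbitrary: x)
  case (Cons b bs)
  have "pd b (ipartial bs (\<lambda>x. \<Sum>a\<in>A. F a x)) x = pd b (\<lambda>x. \<Sum>a\<in>A. ipartial bs (F a) x) x"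
    by (rule pd_cong(1)[OF IU]) (use Cons in auto)
  also have "\<dots> = (\<Sum>a\<in>A. pd b (ipartial bs (F a)) x)"
    by (rule pd_sum) (use Cons.prems assms in \<open>auto intro!: smooth_pdiff smooth_ipartial\<close>)
  finally show ?case unfolding ipartial_Cons .
qed simp

lemma pd_comp_smooth:
  assumes J: "finite J" "copen J V" and F: "smooth_real_on J V F"
    and g: "\<And>j. j \<in> J \<Longrightarrow> smooth_real_on I U (\<lambda>x. g x j)" "g ` U \<subseteq> V" and i: "i \<in> I" and x: "x \<in> U"
  shows "pd i (\<lambda>x. F (g x)) x = (\<Sum>j\<in>J. pd j F (g x) * pd i (\<lambda>x. g x j) x)"
  by (rule pd_eqI(1), rule pd_comp[OF IU J smooth_pdiff[OF F] smooth_continuous[OF smooth_pd[OF F]]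
        smooth_pdiff[OF g(1)] g(2) i x])

end

subsection \<open>Iterated differences\<close>

text \<open>Forward differences recover higher derivatives from values of the function alone. They
  serve both the symmetry of derivatives and the estimate of derivatives by the size of the
  function.\<close>

primrec dlts :: "'i list \<Rightarrow> real \<Rightarrow> (('i \<Rightarrow> real) \<Rightarrow> real) \<Rightarrow> ('i \<Rightarrow> real) \<Rightarrow> real" where
  "dlts [] h F = F"
| "dlts (i # is) h F = (\<lambda>x. dlts is h F (x(i := x i + h)) - dlts is h F x)"

lemma cdist_shift:
  assumes "finite I" "i \<in> I" "cdist I (x(i := t)) y \<le> r" "\<bar>x i - t\<bar> \<le> h"
  shows "cdist I x y \<le> h + r"
  using cdist_triangle[OF assms(1), of x y "x(i := t)"] cdist_upd_le[OF assms(1), of x i t] assms(3,4) by linarith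

text \<open>A difference is a finite combination of translates, so it commutes with
  \<open>pd i\<close>. The sample points drift by at most \<open>h\<close> per index, whence the
  size of the region.\<close>

lemma dlts_derivative:
  assumes I: "finite I" and h: "(h::real) > 0" and F: "pdiff_on I U F" and i: "i \<in> I"
  shows "x \<in> coord_space I \<Longrightarrow> set is \<subseteq> I \<Longrightarrow>
    (\<And>y. y \<in> coord_space I \<Longrightarrow> cdist I x y \<le> real (length is) * h \<Longrightarrow> y \<in> U) \<Longrightarrow>
    ((\<lambda>t. dlts is h F (x(i := t))) has_real_derivative dlts is h (pd i F) x) (at (x i))"
proof (induction "is" arbitrary: x)
  case Nil
  then have "x \<in> U" using I by simp
  then show ?case unfolding dlts.simps by (rule pd_has_derivative'[OF F i])
next
  case (Cons j js)
  let ?x = "x(j := x j + h)"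
  have j: "j \<in> I" using Cons.prems by simp
  have xs: "?x \<in> coord_space I" using Cons.prems(1) j by simp
  have 1: "((\<lambda>t. dlts js h F (x(i := t))) has_real_derivative dlts js h (pd i F) x) (at (x i))"
  proof (rule Cons.IH)
    fix y assume "y \<in> coord_space I" "cdist I x y \<le> real (length js) * h"
    then show "y \<in> U" using Cons.prems(3)[of y] h by (auto simp: algebra_simps)
  qed (use Cons.prems(1,2) in auto)
  have 2: "((\<lambda>t. dlts js h F (?x(i := t))) has_real_derivative dlts js h (pd i F) ?x) (at (?x i))"
  proof (rule Cons.IH[OF xs])
    fix y assume y: "y \<in> coord_space I" "cdist I ?x y \<le> real (length js) * h"
    have "cdist I x y \<le> h + real (length js) * h" by (rule cdist_shift[OF I j y(2)]) (use h in simp)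
    then show "y \<in> U" using Cons.prems(3)[of y] y(1) by (auto simp: algebra_simps)
  qed (use Cons.prems(2) in auto)
  \<comment> \<open>For \<open>i = j\<close> the shifted slot is the variable itself and the
    derivative is translated by \<open>h\<close>; otherwise the two updates commute.\<close>
  have 3: "((\<lambda>t. dlts js h F ((x(i := t))(j := (x(i := t)) j + h))) has_real_derivative
      dlts js h (pd i F) ?x) (at (x i))"
  proof (cases "i = j")
    case True
    then have "((\<lambda>t. dlts js h F (?x(i := t + h))) has_real_derivative dlts js h (pd i F) ?x) (at (x i))"
      using 2 DERIV_shift[of "\<lambda>t. dlts js h F (?x(i := t))" _ "x i" h] by simp
    then show ?thesis using True by simp
  next
    case False
    then have "(x(i := t))(j := (x(i := t)) j + h) = ?x(i := t)" for t by (simp add: fun_upd_twist)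
    then show ?thesis using 2 False by simp
  qed
  show ?case unfolding dlts.simps by (rule DERIV_diff[OF 3 1])
qed

text \<open>The mean value theorem turns the outermost difference into a derivative, which then
  passes inside the remaining differences. The indices therefore come out reversed.\<close>

lemma dlts_mvt:
  assumes I: "finite I" and h: "(h::real) > 0"
  shows "x \<in> coord_space I \<Longrightarrow> set is \<subseteq> I \<Longrightarrow> ck (length is) I U F \<Longrightarrow>
    (\<And>y. y \<in> coord_space I \<Longrightarrow> cdist I x y \<le> real (length is) * h \<Longrightarrow> y \<in> U) \<Longrightarrow>
    \<exists>\<xi>\<in>coord_space I. cdist I x \<xi> \<le> real (length is) * h \<and>
      dlts is h F x = h ^ length is * ipartial (rev is) F \<xi>"
proof (induction "is" arbitrary: x F)
  case Nil
  then show ?case using I by (intro bexI[of _ x]) auto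
next
  case (Cons i js)
  have i: "i \<in> I" using Cons.prems by simp
  have reg: "y \<in> U" if y: "y \<in> coord_space I" "cdist I (x(i := t)) y \<le> real (length js) * h"
    and t: "t \<in> closed_segment (x i) (x i + h)" for y t
  proof -
    have "\<bar>x i - t\<bar> \<le> h" using t h by (auto simp: closed_segment_eq_real_ivl)
    from cdist_shift[OF I i y(2) this] show ?thesis using Cons.prems(4)[OF y(1)] by (simp add: algebra_simps)
  qed
  have "((\<lambda>t. dlts js h F (x(i := t))) has_real_derivative dlts js h (pd i F) (x(i := t))) (at t)"
    if t: "t \<in> closed_segment (x i) (x i + h)" for t
    using dlts_derivative[OF I h _ i, of U F "x(i := t)" js] reg[OF _ _ t] Cons.prems i by simp
  from mvt_segment[OF this] obtain t where t: "t \<in> closed_segment (x i) (x i + h)"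
    "dlts js h F (x(i := x i + h)) - dlts js h F (x(i := x i)) = dlts js h (pd i F) (x(i := t)) * (x i + h - x i)"
    by blast
  have "\<exists>\<xi>\<in>coord_space I. cdist I (x(i := t)) \<xi> \<le> real (length js) * h \<and>
      dlts js h (pd i F) (x(i := t)) = h ^ length js * ipartial (rev js) (pd i F) \<xi>"
  proof (rule Cons.IH)
    show "x(i := t) \<in> coord_space I" using Cons.prems(1) i by simp
    show "set js \<subseteq> I" "ck (length js) I U (pd i F)" using Cons.prems(2,3) by auto
  qed (rule reg[OF _ _ t(1)])
  then obtain \<xi> where \<xi>: "\<xi> \<in> coord_space I" "cdist I (x(i := t)) \<xi> \<le> real (length js) * h"
      "dlts js h (pd i F) (x(i := t)) = h ^ length js * ipartial (rev js) (pd i F) \<xi>" by blast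
  have "\<bar>x i - t\<bar> \<le> h" using t h by (auto simp: closed_segment_eq_real_ivl)
  from cdist_shift[OF I i \<xi>(2) this] show ?case using \<xi> t(2) by (intro bexI[of _ \<xi>]) (auto simp: ipartial_snoc algebra_simps)
qed

lemma dlts_swap: "dlts (i # j # is) h F = dlts (j # i # is) h F" by (cases "i = j") (auto simp: fun_eq_iff fun_upd_twist)

text \<open>Each difference at most doubles the bound.\<close>

lemma dlts_bound:
  assumes I: "finite I" and h: "(h::real) > 0"
  shows "x \<in> coord_space I \<Longrightarrow> set is \<subseteq> I \<Longrightarrow>
    (\<And>y. y \<in> coord_space I \<Longrightarrow> cdist I x y \<le> real (length is) * h \<Longrightarrow> \<bar>F y\<bar> \<le> B) \<Longrightarrow>
    \<bar>dlts is h F x\<bar> \<le> 2 ^ length is * B"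
proof (induction "is" arbitrary: x)
  case Nil
  then show ?case using I by simp
next
  case (Cons j js)
  let ?x = "x(j := x j + h)"
  have j: "j \<in> I" using Cons.prems by simp
  have xs: "?x \<in> coord_space I" using Cons.prems(1) j by simp
  have 1: "\<bar>dlts js h F x\<bar> \<le> 2 ^ length js * B"
  proof (rule Cons.IH)
    fix y assume "y \<in> coord_space I" "cdist I x y \<le> real (length js) * h"
    then show "\<bar>F y\<bar> \<le> B" using Cons.prems(3)[of y] h by (auto simp: algebra_simps)
  qed (use Cons.prems(1,2) in auto)
  have 2: "\<bar>dlts js h F ?x\<bar> \<le> 2 ^ length js * B"
  proof (rule Cons.IH[OF xs])
    fix y assume y: "y \<in> coord_space I" "cdist I ?x y \<le> real (length js) * h"
    have "cdist I x y \<le> h + real (length js) * h" by (rule cdist_shift[OF I j y(2)]) (use h in simp)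
    then show "\<bar>F y\<bar> \<le> B" using Cons.prems(3)[of y] y(1) by (auto simp: algebra_simps)
  qed (use Cons.prems(2) in auto)
  show ?case using 1 2 by simp
qed

lemma tendsto_pd:
  assumes "finite I" "copen I U" "smooth_real_on I U F" "set bs \<subseteq> I" "x \<in> U"
  shows "(ipartial bs F \<longlongrightarrow> ipartial bs F x) (cnh I x)"
  using smooth_continuous[OF smooth_ipartial[OF assms(3,4)]] continuous_on_cnh[OF assms(1,2)] assms(5) by blast

text \<open>Both orders are limits of the same second difference quotient.\<close>

lemma pd_commute:
  assumes I: "finite I" "copen I U" and F: "smooth_real_on I U F" and x: "x \<in> U" and ij: "i \<in> I" "j \<in> I"
  shows "pd i (pd j F) x = pd j (pd i F) x"
proof (rule ccontr)
  assume ne: "pd i (pd j F) x \<noteq> pd j (pd i F) x"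
  \<comment> \<open>Half the gap: two numbers within \<open>e\<close> of the respective limits
    cannot coincide, yet both mixed derivatives take a common value near \<open>x\<close>.\<close>
  define e where "e = \<bar>ipartial [i,j] F x - ipartial [j,i] F x\<bar> / 2"
  have e: "e > 0" using ne by (simp add: e_def ipartial_Cons del: ipartial.simps(2))
  have "\<forall>\<^sub>F y in cnh I x. y \<in> U \<and> dist (ipartial [i,j] F y) (ipartial [i,j] F x) < e \<and>
      dist (ipartial [j,i] F y) (ipartial [j,i] F x) < e"
    using tendsto_pd[OF I F _ x] ij e by (intro eventually_conj cnh_copen[OF I x]) (auto simp: tendsto_iff simp del: ipartial.simps)
  then obtain d where d: "d > 0" "\<And>y. y \<in> coord_space I \<Longrightarrow> cdist I x y < d \<Longrightarrow> y \<in> U \<and>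
      dist (ipartial [i,j] F y) (ipartial [i,j] F x) < e \<and> dist (ipartial [j,i] F y) (ipartial [j,i] F x) < e"
    unfolding eventually_cnh by blast
  have xs: "x \<in> coord_space I" using copen_sub[OF I(2)] x by blast
  \<comment> \<open>Two steps of this length stay inside the ball of radius
    \<open>d\<close>.\<close>
  define h where "h = d / 3"
  have h: "h > 0" "2 * h < d" using d by (auto simp: h_def)
  have c: "ck k I U F" for k using F by (simp add: smooth_iff_ck)
  have ex: "\<exists>\<xi>\<in>coord_space I. cdist I x \<xi> \<le> real (length bs) * h \<and> dlts bs h F x = h ^ length bs * ipartial (rev bs) F \<xi>"
    if "length bs = 2" "set bs \<subseteq> I" for bs
    by (rule dlts_mvt[OF I(1) h(1) xs that(2) c]) (use d h that in force)
  obtain \<xi> where \<xi>: "\<xi> \<in> coord_space I" "cdist I x \<xi> \<le> 2 * h" "dlts [j,i] h F x = h ^ 2 * ipartial [i,j] F \<xi>"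
    using ex[of "[j,i]"] ij by (auto simp: power2_eq_square simp del: ipartial.simps dlts.simps)
  obtain \<xi>' where \<xi>': "\<xi>' \<in> coord_space I" "cdist I x \<xi>' \<le> 2 * h" "dlts [i,j] h F x = h ^ 2 * ipartial [j,i] F \<xi>'"
    using ex[of "[i,j]"] ij by (auto simp: power2_eq_square simp del: ipartial.simps dlts.simps)
  have eq: "ipartial [i,j] F \<xi> = ipartial [j,i] F \<xi>'"
    using \<xi>(3) \<xi>'(3) dlts_swap[of i j "[]" h F] h(1) by (simp del: ipartial.simps dlts.simps)
  have "dist (ipartial [i,j] F \<xi>) (ipartial [i,j] F x) < e" "dist (ipartial [j,i] F \<xi>') (ipartial [j,i] F x) < e"
    using d(2)[OF \<xi>(1)] d(2)[OF \<xi>'(1)] \<xi>(2) \<xi>'(2) h(2) by auto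
  then show False unfolding eq e_def dist_real_def by (smt (verit) field_sum_of_halves)
qed

text \<open>Insertion is a sequence of adjacent transpositions, each an instance of
  \<open>pd_commute\<close>. It links the sorted lists that index jets to the arbitrary lists of
  Taylor's formula.\<close>

lemma ipartial_sort:
  fixes I :: "'i::linorder set"
  assumes I: "finite I" "copen I U" and F: "smooth_real_on I U F"
  shows "set bs \<subseteq> I \<Longrightarrow> x \<in> U \<Longrightarrow> ipartial (sort bs) F x = ipartial bs F x"
proof (induction bs arbitrary: x)
  case (Cons b bs)
  have ins: "ipartial (insort b cs) F y = ipartial (b # cs) F y" if "set cs \<subseteq> I" "b \<in> I" "y \<in> U" for cs y
    using that(1,3)
  proof (induction cs arbitrary: y)
    case (Cons c cs)
    show ?case
    proof (cases "b \<le> c")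
      case False
      have "ipartial (insort b (c # cs)) F y = pd c (ipartial (insort b cs) F) y"
        using False by (simp add: ipartial_Cons del: ipartial.simps)
      also have "\<dots> = pd c (ipartial (b # cs) F) y" by (rule pd_cong(1)[OF I]) (use Cons in auto)
      also have "\<dots> = pd b (pd c (ipartial cs F)) y" unfolding ipartial_Cons using Cons.prems that(2)
        by (intro pd_commute[OF I smooth_ipartial[OF F]]) auto
      finally show ?thesis unfolding ipartial_Cons .
    qed simp
  qed simp
  have "ipartial (sort (b # bs)) F x = ipartial (b # sort bs) F x" using ins[of "sort bs" x] Cons.prems by (simp del: ipartial.simps)
  also have "\<dots> = ipartial (b # bs) F x" unfolding ipartial_Cons by (rule pd_cong(1)[OF I]) (use Cons in auto)
  finally show ?case .
qed simp

subsection \<open>Order of vanishing\<close>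

text \<open>For \<open>k > 0\<close> the estimate at the centre gives \<open>F x0 = 0\<close> when
  \<open>x0\<close> lies in the space; for \<open>k = 0\<close> the convention
  \<open>0 ^ 0 = 1\<close> makes it local boundedness.\<close>

definition Ovan :: "'i set \<Rightarrow> ('i \<Rightarrow> real) \<Rightarrow> nat \<Rightarrow> (('i \<Rightarrow> real) \<Rightarrow> real) \<Rightarrow> bool" where
  "Ovan I x0 k F \<longleftrightarrow> (\<exists>C. \<forall>\<^sub>F x in cnh I x0. \<bar>F x\<bar> \<le> C * cdist I x0 x ^ k)"

lemma OvanE:
  assumes "Ovan I x0 k F" "finite I"
  obtains C where "C > 0" "\<forall>\<^sub>F x in cnh I x0. \<bar>F x\<bar> \<le> C * cdist I x0 x ^ k"
proof -
  obtain C where C: "\<forall>\<^sub>F x in cnh I x0. \<bar>F x\<bar> \<le> C * cdist I x0 x ^ k" using assms by (auto simp: Ovan_def)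
  have "\<forall>\<^sub>F x in cnh I x0. \<bar>F x\<bar> \<le> (max C 1) * cdist I x0 x ^ k"
    using C by eventually_elim (rule order_trans, assumption, use assms in \<open>auto intro!: mult_right_mono\<close>)
  then show ?thesis using that[of "max C 1"] by simp
qed

lemma Ovan_cong: "\<forall>\<^sub>F x in cnh I x0. F x = G x \<Longrightarrow> Ovan I x0 k F \<Longrightarrow> Ovan I x0 k G"
proof -
  assume eq: "\<forall>\<^sub>F x in cnh I x0. F x = G x" and "Ovan I x0 k F"
  then obtain C where "\<forall>\<^sub>F x in cnh I x0. \<bar>F x\<bar> \<le> C * cdist I x0 x ^ k" by (auto simp: Ovan_def)
  with eq have "\<forall>\<^sub>F x in cnh I x0. \<bar>G x\<bar> \<le> C * cdist I x0 x ^ k" by eventually_elim simp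
  then show ?thesis unfolding Ovan_def by blast
qed

context
  fixes I :: "'i set" and x0 :: "'i \<Rightarrow> real"
  assumes I: "finite I"
begin

lemma Ovan_zero [simp]: "Ovan I x0 k (\<lambda>x. 0)" unfolding Ovan_def by (intro exI[of _ 0]) simp

lemma Ovan_add: "Ovan I x0 k F \<Longrightarrow> Ovan I x0 k G \<Longrightarrow> Ovan I x0 k (\<lambda>x. F x + G x)"
proof -
  assume "Ovan I x0 k F" "Ovan I x0 k G"
  then obtain C D where C: "\<forall>\<^sub>F x in cnh I x0. \<bar>F x\<bar> \<le> C * cdist I x0 x ^ k"
    and D: "\<forall>\<^sub>F x in cnh I x0. \<bar>G x\<bar> \<le> D * cdist I x0 x ^ k" by (auto simp: Ovan_def)
  have "\<forall>\<^sub>F x in cnh I x0. \<bar>F x + G x\<bar> \<le> (C + D) * cdist I x0 x ^ k"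
    using C D by eventually_elim (auto simp: algebra_simps intro: order_trans[OF abs_triangle_ineq])
  then show ?thesis unfolding Ovan_def by blast
qed

lemma Ovan_mult: "Ovan I x0 k F \<Longrightarrow> Ovan I x0 l G \<Longrightarrow> Ovan I x0 (k + l) (\<lambda>x. F x * G x)"
proof -
  assume a: "Ovan I x0 k F" "Ovan I x0 l G"
  obtain C where C: "C > 0" "\<forall>\<^sub>F x in cnh I x0. \<bar>F x\<bar> \<le> C * cdist I x0 x ^ k" using OvanE[OF a(1) I] .
  obtain D where D: "D > 0" "\<forall>\<^sub>F x in cnh I x0. \<bar>G x\<bar> \<le> D * cdist I x0 x ^ l" using OvanE[OF a(2) I] .
  have "\<forall>\<^sub>F x in cnh I x0. \<bar>F x * G x\<bar> \<le> (C * D) * cdist I x0 x ^ (k + l)" using C(2) D(2)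
  proof eventually_elim
    case (elim x)
    have "\<bar>F x\<bar> * \<bar>G x\<bar> \<le> (C * cdist I x0 x ^ k) * (D * cdist I x0 x ^ l)"
      using elim C(1) D(1) I by (intro mult_mono) auto
    then show ?case by (simp add: abs_mult power_add ac_simps)
  qed
  then show ?thesis unfolding Ovan_def by blast
qed

lemma Ovan_mono: "Ovan I x0 k F \<Longrightarrow> l \<le> k \<Longrightarrow> Ovan I x0 l F"
proof -
  assume a: "Ovan I x0 k F" "l \<le> k"
  obtain C where C: "C > 0" "\<forall>\<^sub>F x in cnh I x0. \<bar>F x\<bar> \<le> C * cdist I x0 x ^ k" using OvanE[OF a(1) I] .
  have "\<forall>\<^sub>F x in cnh I x0. \<bar>F x\<bar> \<le> C * cdist I x0 x ^ l" using C(2) cnh_dist[OF zero_less_one]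
  proof eventually_elim
    case (elim x)
    have "cdist I x0 x ^ k \<le> cdist I x0 x ^ l" using elim I a(2) by (intro power_decreasing) auto
    then show ?case using elim C(1) by (meson mult_left_mono less_imp_le order_trans)
  qed
  then show ?thesis unfolding Ovan_def by blast
qed

lemma Ovan_const: "Ovan I x0 0 (\<lambda>x. c)" unfolding Ovan_def by (intro exI[of _ "\<bar>c\<bar>"]) simp

lemma Ovan_cmult: "Ovan I x0 k F \<Longrightarrow> Ovan I x0 k (\<lambda>x. c * F x)" using Ovan_mult[OF Ovan_const] by simp

lemma Ovan_uminus: "Ovan I x0 k F \<Longrightarrow> Ovan I x0 k (\<lambda>x. - F x)" by (simp add: Ovan_def)

lemma Ovan_diff: "Ovan I x0 k F \<Longrightarrow> Ovan I x0 k G \<Longrightarrow> Ovan I x0 k (\<lambda>x. F x - G x)"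
  using Ovan_add[OF _ Ovan_uminus, of k F G] by simp

lemma Ovan_sum: "(\<And>a. a \<in> A \<Longrightarrow> Ovan I x0 k (F a)) \<Longrightarrow> Ovan I x0 k (\<lambda>x. \<Sum>a\<in>A. F a x)"
  by (induction A rule: infinite_finite_induct) (auto intro: Ovan_add)

lemma Ovan_all:
  assumes "finite A" "\<And>a. a \<in> A \<Longrightarrow> Ovan I x0 k (F a)"
  obtains C where "C > 0" "\<forall>\<^sub>F x in cnh I x0. \<forall>a\<in>A. \<bar>F a x\<bar> \<le> C * cdist I x0 x ^ k"
proof -
  have "\<exists>C>0. \<forall>\<^sub>F x in cnh I x0. \<bar>F a x\<bar> \<le> C * cdist I x0 x ^ k" if "a \<in> A" for a
    by (rule OvanE[OF assms(2)[OF that] I]) blast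
  then obtain C where C: "\<And>a. a \<in> A \<Longrightarrow> C a > 0 \<and> (\<forall>\<^sub>F x in cnh I x0. \<bar>F a x\<bar> \<le> C a * cdist I x0 x ^ k)"
    by metis
  have D: "C a \<le> 1 + sum C A" if "a \<in> A" for a using member_le_sum[of a A C] assms(1) that C by fastforce
  have "\<forall>\<^sub>F x in cnh I x0. \<forall>a\<in>A. \<bar>F a x\<bar> \<le> (1 + sum C A) * cdist I x0 x ^ k"
    unfolding eventually_ball_finite_distrib[OF assms(1)]
  proof
    fix a assume a: "a \<in> A"
    then have "\<forall>\<^sub>F x in cnh I x0. \<bar>F a x\<bar> \<le> C a * cdist I x0 x ^ k" using C by blast
    then show "\<forall>\<^sub>F x in cnh I x0. \<bar>F a x\<bar> \<le> (1 + sum C A) * cdist I x0 x ^ k"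
      by eventually_elim (erule order_trans, use D[OF a] I in \<open>auto intro!: mult_right_mono\<close>)
  qed
  moreover have "1 + sum C A > 0" using C by (intro add_pos_nonneg sum_nonneg) (auto intro: less_imp_le)
  ultimately show ?thesis using that by blast
qed

lemma Ovan_continuous:
  assumes "copen I U" "continuous_on U F" "x0 \<in> U"
  shows "Ovan I x0 0 F"
proof -
  have "(F \<longlongrightarrow> F x0) (cnh I x0)" using assms continuous_on_cnh[OF I] by blast
  then have "\<forall>\<^sub>F x in cnh I x0. dist (F x) (F x0) < 1" by (simp add: tendsto_iff)
  then have "\<forall>\<^sub>F x in cnh I x0. \<bar>F x\<bar> \<le> (\<bar>F x0\<bar> + 1) * cdist I x0 x ^ 0"
    by eventually_elim (auto simp: dist_real_def)
  then show ?thesis unfolding Ovan_def by blast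
qed

lemma Ovan_smooth0: "copen I U \<Longrightarrow> smooth_real_on I U F \<Longrightarrow> x0 \<in> U \<Longrightarrow> Ovan I x0 0 F"
  using Ovan_continuous smooth_continuous by blast

text \<open>The first derivatives have one vanishing order less, and the mean value formula on the
  box from \<open>x0\<close> to \<open>x\<close> restores it by the factor
  \<open>x i - x0 i\<close>.\<close>

lemma taylor_vanishing:
  assumes U: "copen I U" "x0 \<in> U"
  shows "smooth_real_on I U F \<Longrightarrow> (\<And>bs. set bs \<subseteq> I \<Longrightarrow> length bs < k \<Longrightarrow> ipartial bs F x0 = 0) \<Longrightarrow>
    Ovan I x0 k F"
proof (induction k arbitrary: F)
  case 0
  then show ?case using Ovan_smooth0 U by blast
next
  case (Suc k)
  have x0: "x0 \<in> coord_space I" using copen_sub U by blast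
  have pv: "Ovan I x0 k (pd i F)" if i: "i \<in> I" for i
  proof (rule Suc.IH)
    fix bs assume "set bs \<subseteq> I" "length bs < k"
    then show "ipartial bs (pd i F) x0 = 0" using Suc.prems(2)[of "bs @ [i]"] i by (simp add: ipartial_snoc)
  qed (rule smooth_pd[OF Suc.prems(1) i])
  obtain C where C: "C > 0" "\<forall>\<^sub>F x in cnh I x0. \<forall>i\<in>I. \<bar>pd i F x\<bar> \<le> C * cdist I x0 x ^ k"
    using Ovan_all[where F = "\<lambda>i. pd i F", OF I pv] by blast
  have F0: "F x0 = 0" using Suc.prems(2)[of "[]"] by simp
  have "\<forall>\<^sub>F x in cnh I x0. \<bar>F x\<bar> \<le> (card I * C) * cdist I x0 x ^ Suc k"
    using cnh_le[OF I C(2)] cnh_le[OF I cnh_copen[OF I U]] cnh_space[of I x0]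
  proof eventually_elim
    case (elim x)
    have "cbox_of I x0 x \<subseteq> U" using elim(2) cbox_of_dist[OF I] by (force simp: cbox_of_def)
    from mvt_coords[OF I x0 elim(3) this smooth_pdiff[OF Suc.prems(1)]]
    obtain \<xi> where \<xi>: "\<And>i. i \<in> I \<Longrightarrow> \<xi> i \<in> cbox_of I x0 x"
      "F x - F x0 = (\<Sum>i\<in>I. pd i F (\<xi> i) * (x i - x0 i))" by blast
    have "\<bar>F x\<bar> \<le> (\<Sum>i\<in>I. \<bar>pd i F (\<xi> i) * (x i - x0 i)\<bar>)" using \<xi>(2) F0 by (simp add: sum_abs)
    also have "\<dots> \<le> (\<Sum>i\<in>I. C * cdist I x0 x ^ Suc k)"
    proof (rule sum_mono)
      fix i assume i: "i \<in> I"
      have d: "cdist I x0 (\<xi> i) \<le> cdist I x0 x" using cbox_of_dist[OF I \<xi>(1)[OF i]] .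
      have "\<bar>pd i F (\<xi> i)\<bar> \<le> C * cdist I x0 (\<xi> i) ^ k" using elim(1) d \<xi>(1)[OF i] i by (auto simp: cbox_of_def)
      also have "\<dots> \<le> C * cdist I x0 x ^ k" using C(1) d I by (intro mult_left_mono power_mono) auto
      finally have "\<bar>pd i F (\<xi> i)\<bar> * \<bar>x i - x0 i\<bar> \<le> (C * cdist I x0 x ^ k) * cdist I x0 x"
        using abs_le_cdist[OF I i, of x x0] C(1) I by (intro mult_mono) (auto simp: cdist_commute)
      then show "\<bar>pd i F (\<xi> i) * (x i - x0 i)\<bar> \<le> C * cdist I x0 x ^ Suc k" by (simp add: abs_mult ac_simps)
    qed
    also have "\<dots> = (card I * C) * cdist I x0 x ^ Suc k" by simp
    finally show ?case .
  qed
  then show ?case unfolding Ovan_def by blast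
qed

text \<open>The difference with step \<open>h\<close> equals \<open>h ^ l\<close> times a derivative
  near \<open>x0\<close>, where l is \<open>length bs\<close>, and is at most
  \<open>2 ^ l * (\<epsilon> * (l * h) ^ n)\<close>. For l < n a power of \<open>h\<close> is left
  over and \<open>h\<close> tends to 0; for l = n the constant is \<open>(2 * n) ^ n\<close>.
  Linearity in \<open>\<epsilon>\<close> later turns a quadratic error of a flow into a quadratic
  error of its jet.\<close>

lemma ipartial_bound:
  assumes U: "copen I U" "x0 \<in> U" and F: "smooth_real_on I U F" and bs: "set bs \<subseteq> I" "length bs \<le> n"
    and e: "0 \<le> \<epsilon>" and B: "\<forall>\<^sub>F x in cnh I x0. \<bar>F x\<bar> \<le> \<epsilon> * cdist I x0 x ^ n"
  shows "length bs < n \<Longrightarrow> ipartial bs F x0 = 0"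
    and "length bs = n \<Longrightarrow> \<bar>ipartial bs F x0\<bar> \<le> (2 * real n) ^ n * \<epsilon>"
proof -
  let ?l = "length bs"
  define M where "M = 2 ^ ?l * (\<epsilon> * real ?l ^ n)"
  have M: "M \<ge> 0" using e by (simp add: M_def)
  have x0: "x0 \<in> coord_space I" using copen_sub U by blast
  have main: "\<bar>ipartial bs F x0\<bar> \<le> M * (if ?l < n then r else 1) + r" if r: "0 < r" "r < 1" for r
  proof -
    have "\<forall>\<^sub>F x in cnh I x0. x \<in> U \<and> dist (ipartial bs F x) (ipartial bs F x0) < r \<and>
        \<bar>F x\<bar> \<le> \<epsilon> * cdist I x0 x ^ n"
      using tendsto_pd[OF I U(1) F bs(1) U(2)] r B by (intro eventually_conj cnh_copen[OF I U]) (auto simp: tendsto_iff)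
    then obtain d where d: "d > 0" "\<And>y. y \<in> coord_space I \<Longrightarrow> cdist I x0 y < d \<Longrightarrow> y \<in> U \<and>
      dist (ipartial bs F y) (ipartial bs F x0) < r \<and> \<bar>F y\<bar> \<le> \<epsilon> * cdist I x0 y ^ n"
      unfolding eventually_cnh by blast
    \<comment> \<open>The first bound turns a surplus power of \<open>h\<close> into
      \<open>r\<close>; the second keeps all sample points inside the ball of radius
      \<open>d\<close>.\<close>
    define h where "h = min r (d / (2 * real ?l + 1))"
    have h: "h > 0" "h \<le> r" using d r by (auto simp: h_def)
    have "?l * h \<le> ?l * (d / (2 * real ?l + 1))" by (intro mult_left_mono) (auto simp: h_def)
    also have "\<dots> < d" using d(1) by (simp add: field_simps add_pos_nonneg)
    finally have hd: "?l * h < d" .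
    have c: "ck k I U F" for k using F by (simp add: smooth_iff_ck)
    have "\<exists>\<xi>\<in>coord_space I. cdist I x0 \<xi> \<le> real (length (rev bs)) * h \<and>
        dlts (rev bs) h F x0 = h ^ length (rev bs) * ipartial (rev (rev bs)) F \<xi>"
      by (rule dlts_mvt[OF I h(1) x0 _ c]) (use bs d(2) hd in auto)
    then obtain \<xi> where \<xi>: "\<xi> \<in> coord_space I" "cdist I x0 \<xi> \<le> ?l * h"
      "dlts (rev bs) h F x0 = h ^ ?l * ipartial bs F \<xi>" by auto
    have "\<bar>dlts (rev bs) h F x0\<bar> \<le> 2 ^ length (rev bs) * (\<epsilon> * (real ?l * h) ^ n)"
    proof (rule dlts_bound[OF I h(1) x0])
      fix y assume y: "y \<in> coord_space I" "cdist I x0 y \<le> real (length (rev bs)) * h"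
      have "\<bar>F y\<bar> \<le> \<epsilon> * cdist I x0 y ^ n" using d(2)[OF y(1)] y(2) hd by auto
      also have "\<dots> \<le> \<epsilon> * (real ?l * h) ^ n" using y e I by (intro mult_left_mono power_mono) auto
      finally show "\<bar>F y\<bar> \<le> \<epsilon> * (real ?l * h) ^ n" .
    qed (use bs in auto)
    then have "h ^ ?l * \<bar>ipartial bs F \<xi>\<bar> \<le> M * h ^ n"
      using \<xi>(3) h(1) by (simp add: M_def abs_mult power_mult_distrib ac_simps)
    also have "h ^ n = h ^ ?l * h ^ (n - ?l)" using bs(2) by (simp flip: power_add)
    finally have "\<bar>ipartial bs F \<xi>\<bar> \<le> M * h ^ (n - ?l)" using h(1) by (simp add: mult.left_commute)
    also have "\<dots> \<le> M * (if ?l < n then r else 1)"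
    proof (intro mult_left_mono M)
      show "h ^ (n - ?l) \<le> (if ?l < n then r else 1)"
      proof (cases "?l < n")
        case True
        then have "h ^ (n - ?l) \<le> h ^ 1" using h r by (intro power_decreasing) auto
        then show ?thesis using True h by simp
      qed (use bs in simp)
    qed
    finally show ?thesis using d(2)[OF \<xi>(1)] \<xi>(2) hd by (auto simp: dist_real_def)
  qed
  show "ipartial bs F x0 = 0" if l: "?l < n"
  proof (rule ccontr)
    assume ne: "ipartial bs F x0 \<noteq> 0"
    \<comment> \<open>With this \<open>r\<close> the bound \<open>(M + 1) * r\<close> is at most
      half of the quantity it bounds.\<close>
    define r where "r = min (1/2) (\<bar>ipartial bs F x0\<bar> / (2 * (M + 1)))"
    have "0 < r" "r < 1" using ne M by (auto simp: r_def)
    from main[OF this] l have "\<bar>ipartial bs F x0\<bar> \<le> (M + 1) * r" by (simp add: algebra_simps)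
    also have "\<dots> \<le> (M + 1) * (\<bar>ipartial bs F x0\<bar> / (2 * (M + 1)))"
      using M by (intro mult_left_mono) (auto simp: r_def)
    also have "\<dots> = \<bar>ipartial bs F x0\<bar> / 2" using M by (simp add: field_simps)
    finally show False using ne by simp
  qed
  show "\<bar>ipartial bs F x0\<bar> \<le> (2 * real n) ^ n * \<epsilon>" if l: "?l = n"
  proof (rule field_le_epsilon)
    fix r :: real assume "0 < r"
    then have "\<bar>ipartial bs F x0\<bar> \<le> M + min r (1/2)" using main[of "min r (1/2)"] l by auto
    then show "\<bar>ipartial bs F x0\<bar> \<le> (2 * real n) ^ n * \<epsilon> + r" using l by (simp add: M_def power_mult_distrib ac_simps)
  qed
qed

lemma Ovan_iff:
  assumes U: "copen I U" "x0 \<in> U" and F: "smooth_real_on I U F"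
  shows "Ovan I x0 k F \<longleftrightarrow> (\<forall>bs. set bs \<subseteq> I \<and> length bs < k \<longrightarrow> ipartial bs F x0 = 0)"
proof
  assume "Ovan I x0 k F"
  then obtain C where C: "C > 0" "\<forall>\<^sub>F x in cnh I x0. \<bar>F x\<bar> \<le> C * cdist I x0 x ^ k" using OvanE[OF _ I] by blast
  show "\<forall>bs. set bs \<subseteq> I \<and> length bs < k \<longrightarrow> ipartial bs F x0 = 0"
    using ipartial_bound(1)[OF U F _ _ _ C(2)] C(1) by simp
qed (rule taylor_vanishing[OF U F], simp)

text \<open>An estimate alone says nothing about derivatives; smoothness permits the detour through
  the Taylor coefficients at \<open>x0\<close>.\<close>

lemma Ovan_pd:
  assumes U: "copen I U" "x0 \<in> U" and F: "smooth_real_on I U F" and O: "Ovan I x0 (Suc k) F" and i: "i \<in> I"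
  shows "Ovan I x0 k (pd i F)"
proof -
  have "ipartial bs (pd i F) x0 = 0" if "set bs \<subseteq> I" "length bs < k" for bs
    using O[unfolded Ovan_iff[OF U F], rule_format, of "bs @ [i]"] that i by (simp add: ipartial_snoc)
  then show ?thesis using Ovan_iff[OF U smooth_pd[OF F i]] by blast
qed

lemma Ovan_Suc_pd:
  assumes U: "copen I U" "x0 \<in> U" and F: "smooth_real_on I U F" and F0: "F x0 = 0"
    and p: "\<And>i. i \<in> I \<Longrightarrow> Ovan I x0 k (pd i F)"
  shows "Ovan I x0 (Suc k) F"
  unfolding Ovan_iff[OF U F]
proof (intro allI impI)
  fix bs assume bs: "set bs \<subseteq> I \<and> length bs < Suc k"
  show "ipartial bs F x0 = 0"
  proof (cases bs rule: rev_cases)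
    case (snoc cs i)
    then have "i \<in> I" "set cs \<subseteq> I" "length cs < k" using bs by auto
    then have "ipartial cs (pd i F) x0 = 0" using p Ovan_iff[OF U smooth_pd[OF F]] by blast
    then show ?thesis using snoc by (simp add: ipartial_snoc)
  qed (simp add: F0)
qed

lemma Ovan_smooth1:
  assumes U: "copen I U" "x0 \<in> U" and F: "smooth_real_on I U F"
  shows "Ovan I x0 1 (\<lambda>x. F x - F x0)"
proof -
  have "smooth_real_on I U (\<lambda>x. F x - F x0)" by (intro smooth_diff[OF I U(1)] F smooth_const)
  then show ?thesis by (simp add: Ovan_iff[OF U])
qed

end

text \<open>\<open>g\<close> stays within O(r) of \<open>y0\<close>, so powers of the distance to
  \<open>y0\<close> become powers of the distance to \<open>x0\<close>.\<close>

lemma Ovan_compose: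
  assumes I: "finite I" "finite J" and F: "Ovan J y0 k F"
    and g: "\<And>j. j \<in> J \<Longrightarrow> Ovan I x0 1 (\<lambda>x. g x j - y0 j)"
    and gs: "\<forall>\<^sub>F x in cnh I x0. g x \<in> coord_space J" and lim: "filterlim g (cnh J y0) (cnh I x0)"
  shows "Ovan I x0 k (\<lambda>x. F (g x))"
proof -
  obtain C where C: "C > 0" "\<forall>\<^sub>F x in cnh J y0. \<bar>F x\<bar> \<le> C * cdist J y0 x ^ k" using OvanE[OF F I(2)] .
  obtain L where L: "L > 0" "\<forall>\<^sub>F x in cnh I x0. \<forall>j\<in>J. \<bar>g x j - y0 j\<bar> \<le> L * cdist I x0 x ^ 1"
    using Ovan_all[where F = "\<lambda>j x. g x j - y0 j", OF I g] by blast
  have "\<forall>\<^sub>F x in cnh I x0. \<bar>F (g x)\<bar> \<le> (C * L ^ k) * cdist I x0 x ^ k"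
    using L(2) lim[unfolded filterlim_iff, rule_format, OF C(2)]
  proof eventually_elim
    case (elim x)
    have "cdist J y0 (g x) \<le> L * cdist I x0 x" using elim(1) L(1) I by (simp add: cdist_le_iff abs_minus_commute)
    then have "cdist J y0 (g x) ^ k \<le> (L * cdist I x0 x) ^ k" using I by (intro power_mono) auto
    then have "C * cdist J y0 (g x) ^ k \<le> C * (L * cdist I x0 x) ^ k" using C by (intro mult_left_mono) auto
    then show ?case using elim(2) by (simp add: power_mult_distrib)
  qed
  then show ?thesis unfolding Ovan_def by blast
qed

text \<open>Near \<open>y0\<close> the partial derivatives of \<open>F\<close> are bounded, so the
  mean value formula on the box from \<open>h x\<close> to \<open>g x\<close> passes the estimate
  from the arguments to the values.\<close>

lemma Ovan_comp_diff:
  assumes I: "finite I" and J: "finite J" "copen J V" and F: "smooth_real_on J V F" and y0: "y0 \<in> V"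
    and g: "filterlim g (cnh J y0) (cnh I x0)" and h: "filterlim h (cnh J y0) (cnh I x0)"
    and O: "\<And>j. j \<in> J \<Longrightarrow> Ovan I x0 k (\<lambda>x. g x j - h x j)"
  shows "Ovan I x0 k (\<lambda>x. F (g x) - F (h x))"
proof -
  have "Ovan J y0 0 (pd j F)" if "j \<in> J" for j by (rule Ovan_smooth0[OF J smooth_pd[OF F that] y0])
  from Ovan_all[where F = "\<lambda>j. pd j F", OF J(1) J(1) this] obtain M where M: "M > 0" "\<forall>\<^sub>F y in cnh J y0. \<forall>j\<in>J. \<bar>pd j F y\<bar> \<le> M * cdist J y0 y ^ 0"
    by blast
  have "\<forall>\<^sub>F y in cnh J y0. y \<in> V \<and> (\<forall>j\<in>J. \<bar>pd j F y\<bar> \<le> M)"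
    using M(2) by (intro eventually_conj cnh_copen[OF J y0]) auto
  then obtain r where r: "r > 0" "\<And>y. y \<in> coord_space J \<Longrightarrow> cdist J y0 y < r \<Longrightarrow> y \<in> V \<and> (\<forall>j\<in>J. \<bar>pd j F y\<bar> \<le> M)"
    unfolding eventually_cnh by blast
  obtain C where C: "C > 0" "\<forall>\<^sub>F x in cnh I x0. \<forall>j\<in>J. \<bar>g x j - h x j\<bar> \<le> C * cdist I x0 x ^ k"
    using Ovan_all[where F = "\<lambda>j x. g x j - h x j", OF I J(1) O] by blast
  have ev: "\<forall>\<^sub>F x in cnh I x0. q x \<in> coord_space J \<and> cdist J y0 (q x) < r"
    if "filterlim q (cnh J y0) (cnh I x0)" for q
    using that[unfolded filterlim_iff, rule_format, OF eventually_conj[OF cnh_space cnh_dist[OF r(1)]]] .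
  have "\<forall>\<^sub>F x in cnh I x0. \<bar>F (g x) - F (h x)\<bar> \<le> (card J * (M * C)) * cdist I x0 x ^ k"
    using C(2) ev[OF g] ev[OF h]
  proof eventually_elim
    case (elim x)
    have in_ball: "w \<in> coord_space J \<and> cdist J y0 w < r" if "w \<in> cbox_of J (h x) (g x)" for w
      using cbox_of_ball[OF J(1) that, of y0 r] elim that by (auto simp: cbox_of_def)
    have "cbox_of J (h x) (g x) \<subseteq> V" using in_ball r(2) by blast
    from mvt_coords[OF J(1) _ _ this smooth_pdiff[OF F]] elim
    obtain \<xi> where \<xi>: "\<And>i. i \<in> J \<Longrightarrow> \<xi> i \<in> cbox_of J (h x) (g x)"
      "F (g x) - F (h x) = (\<Sum>i\<in>J. pd i F (\<xi> i) * (g x i - h x i))" by blast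
    have "\<bar>F (g x) - F (h x)\<bar> \<le> (\<Sum>i\<in>J. \<bar>pd i F (\<xi> i) * (g x i - h x i)\<bar>)" unfolding \<xi>(2) by (rule sum_abs)
    also have "\<dots> \<le> (\<Sum>i\<in>J. M * (C * cdist I x0 x ^ k))"
    proof (rule sum_mono)
      fix i assume i: "i \<in> J"
      have "\<bar>pd i F (\<xi> i)\<bar> \<le> M" using r(2) in_ball[OF \<xi>(1)[OF i]] i by blast
      then show "\<bar>pd i F (\<xi> i) * (g x i - h x i)\<bar> \<le> M * (C * cdist I x0 x ^ k)"
        unfolding abs_mult using elim(1) i M(1) by (intro mult_mono) auto
    qed
    also have "\<dots> = (card J * (M * C)) * cdist I x0 x ^ k" by simp
    finally show ?case .
  qed
  then show ?thesis unfolding Ovan_def by blast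
qed

section \<open>Local diffeomorphisms of coordinate spaces\<close>

lemma copenI_ev:
  assumes "U \<subseteq> coord_space I" "\<And>x. x \<in> U \<Longrightarrow> \<forall>\<^sub>F y in cnh I x. y \<in> U" "finite I"
  shows "copen I U"
  using assms by (simp add: copen_iff eventually_cnh)

lemma copen_ball:
  assumes I: "finite I" shows "copen I {y\<in>coord_space I. cdist I c y < r}"
  unfolding copen_iff[OF I]
proof (intro conjI ballI)
  fix x assume x: "x \<in> {y\<in>coord_space I. cdist I c y < r}"
  have "cdist I c y < r" if "cdist I x y < r - cdist I c x" for y using cdist_triangle[OF I, of c y x] that by linarith
  then show "\<exists>e>0. \<forall>y\<in>coord_space I. cdist I x y < e \<longrightarrow> y \<in> {y\<in>coord_space I. cdist I c y < r}"
    using x by (intro exI[of _ "r - cdist I c x"]) auto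
qed auto

lemma eventually_abs_less:
  fixes f :: "'a \<Rightarrow> real"
  assumes "(f \<longlongrightarrow> l) F" "\<bar>l - c\<bar> < e"
  shows "\<forall>\<^sub>F x in F. \<bar>f x - c\<bar> < e"
  by (rule order_tendstoD(2)[OF _ assms(2)]) (intro tendsto_intros assms(1))

text \<open>The inverse is part of the data, so no inverse has to be chosen when such maps are
  restricted or composed.\<close>

definition cdiffeo :: "'i set \<Rightarrow> ('i \<Rightarrow> real) set \<Rightarrow> ('i \<Rightarrow> real) set \<Rightarrow>
    (('i \<Rightarrow> real) \<Rightarrow> 'i \<Rightarrow> real) \<Rightarrow> (('i \<Rightarrow> real) \<Rightarrow> 'i \<Rightarrow> real) \<Rightarrow> bool" where
  "cdiffeo I V V' \<tau> \<sigma> \<longleftrightarrow> copen I V \<and> copen I V' \<and>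
     (\<forall>x\<in>V. \<tau> x \<in> V' \<and> \<sigma> (\<tau> x) = x) \<and> (\<forall>y\<in>V'. \<sigma> y \<in> V \<and> \<tau> (\<sigma> y) = y) \<and>
     (\<forall>i\<in>I. smooth_real_on I V (\<lambda>x. \<tau> x i)) \<and> (\<forall>i\<in>I. smooth_real_on I V' (\<lambda>y. \<sigma> y i))"

lemma cdiffeoD:
  assumes "cdiffeo I V V' \<tau> \<sigma>"
  shows "copen I V" "copen I V'" "\<And>x. x \<in> V \<Longrightarrow> \<tau> x \<in> V'" "\<And>x. x \<in> V \<Longrightarrow> \<sigma> (\<tau> x) = x"
    "\<And>y. y \<in> V' \<Longrightarrow> \<sigma> y \<in> V" "\<And>y. y \<in> V' \<Longrightarrow> \<tau> (\<sigma> y) = y"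
    "\<And>i. i \<in> I \<Longrightarrow> smooth_real_on I V (\<lambda>x. \<tau> x i)" "\<And>i. i \<in> I \<Longrightarrow> smooth_real_on I V' (\<lambda>y. \<sigma> y i)"
    "V \<subseteq> coord_space I" "V' \<subseteq> coord_space I"
  using assms unfolding cdiffeo_def by (auto dest: copen_sub)

lemma cdiffeo_sym: "cdiffeo I V V' \<tau> \<sigma> \<Longrightarrow> cdiffeo I V' V \<sigma> \<tau>" unfolding cdiffeo_def by simp

lemma cdiffeo_restrict:
  assumes I: "finite I" and d: "cdiffeo I V V' \<tau> \<sigma>" and W: "copen I W" "W \<subseteq> V"
  shows "cdiffeo I W {y\<in>V'. \<sigma> y \<in> W} \<tau> \<sigma>"
proof -
  note D = cdiffeoD[OF d]
  have sV: "\<sigma> ` V' \<subseteq> coord_space I" using D(5,9) by blast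
  have "copen I {y\<in>V'. \<sigma> y \<in> W}" by (rule copen_preimage[OF I I D(2) W(1) smooth_continuous[OF D(8)] sV])
  then show ?thesis unfolding cdiffeo_def using D W by (auto intro: smooth_subset[OF D(7)] smooth_subset[OF D(8)])
qed

lemma cdiffeo_restrict_target:
  assumes I: "finite I" and d: "cdiffeo I V V' \<tau> \<sigma>" and W: "copen I W" "W \<subseteq> V'"
  shows "cdiffeo I {x\<in>V. \<tau> x \<in> W} W \<tau> \<sigma>"
  using cdiffeo_sym[OF cdiffeo_restrict[OF I cdiffeo_sym[OF d] W]] .

lemma cdiffeo_comp:
  assumes I: "finite I" and d: "cdiffeo I V V' \<tau> \<sigma>" and e: "cdiffeo I V' V'' \<tau>' \<sigma>'"
  shows "cdiffeo I V V'' (\<lambda>x. \<tau>' (\<tau> x)) (\<lambda>y. \<sigma> (\<sigma>' y))"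
proof -
  note D = cdiffeoD[OF d] and E = cdiffeoD[OF e]
  have t: "smooth_real_on I V (\<lambda>x. \<tau>' (\<tau> x) i)" if "i \<in> I" for i
    by (rule smooth_comp[OF I D(1) I D(2) _ E(7)[OF that] D(7)]) (use D(3) in auto)
  have s: "smooth_real_on I V'' (\<lambda>x. \<sigma> (\<sigma>' x) i)" if "i \<in> I" for i
    by (rule smooth_comp[OF I E(2) I E(1) _ D(8)[OF that] E(8)]) (use E(5) in auto)
  show ?thesis unfolding cdiffeo_def using D E t s by auto
qed

lemma cdiffeo_cong:
  assumes I: "finite I" and d: "cdiffeo I V V' \<tau> \<sigma>" and t: "\<And>x. x \<in> V \<Longrightarrow> \<tau> x = \<tau>' x"
    and s: "\<And>y. y \<in> V' \<Longrightarrow> \<sigma> y = \<sigma>' y"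
  shows "cdiffeo I V V' \<tau>' \<sigma>'"
proof -
  note D = cdiffeoD[OF d]
  have "smooth_real_on I V (\<lambda>x. \<tau>' x i)" if "i \<in> I" for i by (rule smooth_cong[OF I D(1) _ D(7)[OF that]]) (simp add: t)
  moreover have "smooth_real_on I V' (\<lambda>x. \<sigma>' x i)" if "i \<in> I" for i
    by (rule smooth_cong[OF I D(2) _ D(8)[OF that]]) (simp add: s)
  moreover have "\<forall>x\<in>V. \<tau>' x \<in> V' \<and> \<sigma>' (\<tau>' x) = x" using D(3,4) t s by metis
  moreover have "\<forall>y\<in>V'. \<sigma>' y \<in> V \<and> \<tau>' (\<sigma>' y) = y" using D(5,6) t s by metis
  ultimately show ?thesis unfolding cdiffeo_def using D(1,2) by blast
qed

lemma cdiffeo_id: "copen I V \<Longrightarrow> cdiffeo I V V (\<lambda>x. x) (\<lambda>x. x)" unfolding cdiffeo_def by simp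

section \<open>Jacobians and the inverse function theorem\<close>

lemma cdiffeo_pd_inverse:
  assumes I: "finite I" and d: "cdiffeo I V V' \<tau> \<sigma>" and x: "x \<in> V" and ib: "i \<in> I" "b \<in> I"
  shows "(\<Sum>a\<in>I. pd a (\<lambda>y. \<sigma> y i) (\<tau> x) * pd b (\<lambda>x. \<tau> x a) x) = (if b = i then 1 else 0)"
proof -
  note D = cdiffeoD[OF d]
  have sub: "\<tau> ` V \<subseteq> V'" using D(3) by blast
  have "(\<Sum>a\<in>I. pd a (\<lambda>y. \<sigma> y i) (\<tau> x) * pd b (\<lambda>x. \<tau> x a) x) = pd b (\<lambda>x. \<sigma> (\<tau> x) i) x"
    by (rule pd_comp_smooth[OF I D(1) I D(2) D(8)[OF ib(1)] D(7) sub ib(2) x, symmetric])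
  also have "\<dots> = pd b (\<lambda>x. x i) x" by (rule pd_cong(1)[OF I D(1) ib(2) _ x]) (simp add: D(4))
  finally show ?thesis by (simp add: pd_coord)
qed

text \<open>Changing a single coordinate is a one-variable problem with parameters. On a small box
  \<open>pd j g > 1/2\<close>, so \<open>g\<close> increases strictly in coordinate
  \<open>j\<close>. The intermediate value theorem gives the inverse, and the mean value formula
  gives its Lipschitz bound and its derivatives.\<close>

lemma coordinate_diffeo:
  assumes I: "finite I" and j: "j \<in> I" and U: "copen I U" and x0: "x0 \<in> U"
    and g: "smooth_real_on I U g" and g1: "pd j g x0 = 1"
  obtains W W' \<sigma> where "x0 \<in> W" "W \<subseteq> U" "cdiffeo I W W' (\<lambda>x. x(j := g x)) \<sigma>"
proof -
  have xs: "x0 \<in> coord_space I" using copen_sub[OF U] x0 by blast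
  have "Ovan I x0 0 (pd a g)" if "a \<in> I" for a by (rule Ovan_smooth0[OF I U smooth_pd[OF g that] x0])
  from Ovan_all[where F = "\<lambda>a. pd a g", OF I I this]
  obtain M where M: "M > 0" "\<forall>\<^sub>F x in cnh I x0. \<forall>a\<in>I. \<bar>pd a g x\<bar> \<le> M * cdist I x0 x ^ 0" by blast
  have "(pd j g \<longlongrightarrow> pd j g x0) (cnh I x0)"
    using smooth_continuous[OF smooth_pd[OF g j]] continuous_on_cnh[OF I U] x0 by blast
  then have "\<forall>\<^sub>F x in cnh I x0. 1/2 < pd j g x" by (rule order_tendstoD) (simp add: g1)
  then have "\<forall>\<^sub>F x in cnh I x0. x \<in> U \<and> 1/2 < pd j g x \<and> (\<forall>a\<in>I. \<bar>pd a g x\<bar> \<le> M)"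
    using M(2) by (intro eventually_conj cnh_copen[OF I U x0]) auto
  then obtain r0 where r0: "r0 > 0" and B: "\<And>y. y \<in> coord_space I \<Longrightarrow> cdist I x0 y < r0 \<Longrightarrow>
      y \<in> U \<and> 1/2 < pd j g y \<and> (\<forall>a\<in>I. \<bar>pd a g y\<bar> \<le> M)"
    unfolding eventually_cnh by blast
  define r where "r = r0 / 2"
  have r: "r > 0" "r < r0" using r0 by (auto simp: r_def)
  have gt: "(g \<longlongrightarrow> g x) (cnh I x)" if "x \<in> U" for x
    using smooth_continuous[OF g] continuous_on_cnh[OF I U] that by blast
  have "\<forall>\<^sub>F x in cnh I x0. \<bar>g x - g x0\<bar> < r / 8" by (rule eventually_abs_less[OF gt[OF x0]]) (use r in simp)
  then obtain d0 where d0: "d0 > 0" "\<And>y. y \<in> coord_space I \<Longrightarrow> cdist I x0 y < d0 \<Longrightarrow> \<bar>g y - g x0\<bar> < r / 8"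
    unfolding eventually_cnh by blast
  define d where "d = min d0 r"
  have d: "d > 0" "d \<le> d0" "d \<le> r" using d0 r by (auto simp: d_def)
  \<comment> \<open>Moving coordinate \<open>j\<close> by \<open>r\<close> changes \<open>g\<close>
    by more than \<open>r/2\<close>, while the value in the middle of the line and the target both
    lie within \<open>r/8\<close> of \<open>g x0\<close>. Hence the target is attained strictly
    between the ends.\<close>
  define W where "W = {x\<in>coord_space I. (\<forall>a\<in>I-{j}. \<bar>x a - x0 a\<bar> < d) \<and> \<bar>x j - x0 j\<bar> < r \<and> \<bar>g x - g x0\<bar> < r/8}"
  define W' where "W' = {y\<in>coord_space I. (\<forall>a\<in>I-{j}. \<bar>y a - x0 a\<bar> < d) \<and> \<bar>y j - g x0\<bar> < r/8}"
  have ball: "cdist I x0 (y(j := t)) < r0"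
    if "\<forall>a\<in>I-{j}. \<bar>y a - x0 a\<bar> < d" "\<bar>t - x0 j\<bar> < r0" for y t
    unfolding cdist_less_iff[OF I r0]
  proof
    fix a assume "a \<in> I"
    then show "\<bar>x0 a - (y(j := t)) a\<bar> < r0" using that d r by (cases "a = j") (force simp: abs_minus_commute)+
  qed
  have incr: "\<exists>D>1/2. g (y(j := t)) - g (y(j := s)) = D * (t - s)"
    if y: "y \<in> coord_space I" "\<forall>a\<in>I-{j}. \<bar>y a - x0 a\<bar> < d"
      and st: "\<bar>s - x0 j\<bar> < r0" "\<bar>t - x0 j\<bar> < r0" for y s t
  proof -
    have seg: "y(j := u) \<in> U \<and> pd j g (y(j := u)) > 1/2" if u: "u \<in> closed_segment s t" for u
    proof -
      have "\<bar>u - x0 j\<bar> < r0" using u st by (auto simp: closed_segment_eq_real_ivl split: if_splits)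
      from B[OF coord_space_upd[OF y(1) j] ball[OF y(2) this]] show ?thesis by blast
    qed
    have "((\<lambda>t. g (y(j := t))) has_real_derivative pd j g (y(j := u))) (at u)" if "u \<in> closed_segment s t" for u
      by (rule pd_has_derivative[OF smooth_pdiff[OF g] j]) (use seg[OF that] in blast)
    from mvt_segment[OF this] seg show ?thesis by blast
  qed
  define h where "h y = (SOME t. \<bar>t - x0 j\<bar> < r \<and> g (y(j := t)) = y j)" for y
  define \<sigma> where "\<sigma> y = y(j := h y)" for y
  have hex: "\<exists>t. \<bar>t - x0 j\<bar> < r \<and> g (y(j := t)) = y j" if y: "y \<in> W'" for y
  proof -
    have yy: "y \<in> coord_space I" "\<forall>a\<in>I-{j}. \<bar>y a - x0 a\<bar> < d" "\<bar>y j - g x0\<bar> < r/8"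
      using y by (auto simp: W'_def)
    define \<phi> where "\<phi> t = g (y(j := t))" for t
    have "cdist I x0 (y(j := x0 j)) < d0" unfolding cdist_less_iff[OF I d0(1)]
    proof
      fix a assume "a \<in> I"
      then show "\<bar>x0 a - (y(j := x0 j)) a\<bar> < d0" using yy(2) d d0(1) by (cases "a = j") (force simp: abs_minus_commute)+
    qed
    from d0(2)[OF coord_space_upd[OF yy(1) j] this] have p0: "\<bar>\<phi> (x0 j) - g x0\<bar> < r / 8" by (simp add: \<phi>_def)
    obtain D1 where D1: "D1 > 1/2" "\<phi> (x0 j + r) - \<phi> (x0 j) = D1 * r"
      using incr[OF yy(1,2), of "x0 j" "x0 j + r"] r r0 by (auto simp: \<phi>_def)
    have p1: "\<phi> (x0 j + r) > \<phi> (x0 j) + r / 2" using mult_strict_right_mono[OF D1(1) r(1)] D1(2) by linarith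
    obtain D2 where D2: "D2 > 1/2" "\<phi> (x0 j) - \<phi> (x0 j - r) = D2 * r"
      using incr[OF yy(1,2), of "x0 j - r" "x0 j"] r r0 by (auto simp: \<phi>_def)
    have p2: "\<phi> (x0 j - r) < \<phi> (x0 j) - r / 2" using mult_strict_right_mono[OF D2(1) r(1)] D2(2) by linarith
    have cont: "isCont \<phi> t" if "x0 j - r \<le> t \<and> t \<le> x0 j + r" for t
    proof -
      have "\<bar>t - x0 j\<bar> < r0" using that r by auto
      from B[OF coord_space_upd[OF yy(1) j] ball[OF yy(2) this]]
      have "y(j := t) \<in> U" by blast
      from pd_has_derivative[OF smooth_pdiff[OF g] j this] show ?thesis unfolding \<phi>_def by (rule DERIV_isCont)
    qed
    have q: "\<phi> (x0 j - r) < y j" "y j < \<phi> (x0 j + r)" using p0 p1 p2 yy(3) unfolding abs_less_iff by linarith+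
    have "\<exists>t. x0 j - r \<le> t \<and> t \<le> x0 j + r \<and> \<phi> t = y j" by (rule IVT) (use q r cont in auto)
    then obtain t where t: "x0 j - r \<le> t" "t \<le> x0 j + r" "\<phi> t = y j" by blast
    have "t \<noteq> x0 j - r" "t \<noteq> x0 j + r" using t(3) q by auto
    then have "\<bar>t - x0 j\<bar> < r" using t(1,2) by auto
    then show ?thesis using t(3) by (auto simp: \<phi>_def)
  qed
  have hy: "\<bar>h y - x0 j\<bar> < r" "g (\<sigma> y) = y j" if "y \<in> W'" for y
    using someI_ex[OF hex[OF that]] by (auto simp: h_def \<sigma>_def)
  have huniq: "h y = t" if y: "y \<in> W'" and t: "\<bar>t - x0 j\<bar> < r" "g (y(j := t)) = y j" for y t
  proof -
    have yy: "y \<in> coord_space I" "\<forall>a\<in>I-{j}. \<bar>y a - x0 a\<bar> < d" using y by (auto simp: W'_def)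
    obtain D where "D > 1/2" "g (y(j := t)) - g (y(j := h y)) = D * (t - h y)" using incr[OF yy, of "h y" t] hy(1)[OF y] t(1) r by auto
    then show ?thesis using hy(2)[OF y] t(2) by (simp add: \<sigma>_def)
  qed
  have EW: "x(j := g x) \<in> W'" "\<sigma> (x(j := g x)) = x" if x: "x \<in> W" for x
  proof -
    show 1: "x(j := g x) \<in> W'" using x j by (auto simp: W_def W'_def)
    have "h (x(j := g x)) = x j" by (rule huniq[OF 1]) (use x in \<open>auto simp: W_def\<close>)
    then show "\<sigma> (x(j := g x)) = x" by (simp add: \<sigma>_def)
  qed
  have SW: "\<sigma> y \<in> W" "(\<sigma> y)(j := g (\<sigma> y)) = y" if y: "y \<in> W'" for y
  proof -
    show "\<sigma> y \<in> W" using hy[OF y] y j by (auto simp: W_def W'_def \<sigma>_def)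
    show "(\<sigma> y)(j := g (\<sigma> y)) = y" using hy(2)[OF y] by (simp add: \<sigma>_def)
  qed
  have Wb: "cdist I x0 x < r0" if x: "x \<in> W" for x using ball[of x "x j"] x r by (auto simp: W_def)
  have WU: "W \<subseteq> U" using Wb B by (auto simp: W_def)
  have oW': "copen I W'"
  proof (rule copenI_ev[OF _ _ I])
    fix x assume x: "x \<in> W'"
    have 1: "\<forall>\<^sub>F y in cnh I x. \<forall>a\<in>I-{j}. \<bar>y a - x0 a\<bar> < d"
      using I x by (auto simp: eventually_ball_finite_distrib W'_def intro!: eventually_abs_less[OF cnh_coord[OF I]])
    have 2: "\<forall>\<^sub>F y in cnh I x. \<bar>y j - g x0\<bar> < r/8"
      using x by (intro eventually_abs_less[OF cnh_coord[OF I j]]) (auto simp: W'_def)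
    show "\<forall>\<^sub>F y in cnh I x. y \<in> W'" using 1 2 cnh_space[of I x] by eventually_elim (auto simp: W'_def)
  qed (auto simp: W'_def)
  have oW: "copen I W"
  proof (rule copenI_ev[OF _ _ I])
    fix x assume x: "x \<in> W"
    have 1: "\<forall>\<^sub>F y in cnh I x. \<forall>a\<in>I-{j}. \<bar>y a - x0 a\<bar> < d"
      using I x by (auto simp: eventually_ball_finite_distrib W_def intro!: eventually_abs_less[OF cnh_coord[OF I]])
    have 2: "\<forall>\<^sub>F y in cnh I x. \<bar>y j - x0 j\<bar> < r"
      using x by (intro eventually_abs_less[OF cnh_coord[OF I j]]) (auto simp: W_def)
    have 3: "\<forall>\<^sub>F y in cnh I x. \<bar>g y - g x0\<bar> < r/8"
      using x WU by (intro eventually_abs_less[OF gt]) (auto simp: W_def)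
    show "\<forall>\<^sub>F y in cnh I x. y \<in> W" using 1 2 3 cnh_space[of I x] by eventually_elim (auto simp: W_def)
  qed (auto simp: W_def)
  \<comment> \<open>The mean value formula for \<open>g\<close> between \<open>\<sigma> y\<close>
    and \<open>\<sigma> y'\<close>, using \<open>g (\<sigma> y) = y j\<close>. Solved for
    \<open>h y' - h y\<close>, it yields first the Lipschitz bound and then the derivatives of
    \<open>h\<close>.\<close>
  have diff: "\<exists>\<xi>. (\<forall>a\<in>I. \<xi> a \<in> coord_space I \<and> cdist I x0 (\<xi> a) < r0 \<and> cdist I (\<sigma> y) (\<xi> a) \<le> cdist I (\<sigma> y) (\<sigma> y')) \<and>
      y' j - y j = (\<Sum>a\<in>I-{j}. pd a g (\<xi> a) * (y' a - y a)) + pd j g (\<xi> j) * (h y' - h y)"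
    if y: "y \<in> W'" "y' \<in> W'" for y y'
  proof -
    have ss: "\<sigma> y \<in> coord_space I" "\<sigma> y' \<in> coord_space I" "cdist I x0 (\<sigma> y) < r0" "cdist I x0 (\<sigma> y') < r0"
      using SW(1) y Wb by (auto simp: W_def)
    have bx: "w \<in> coord_space I \<and> cdist I x0 w < r0" if "w \<in> cbox_of I (\<sigma> y) (\<sigma> y')" for w
      using cbox_of_ball[OF I that ss(3,4)] that by (auto simp: cbox_of_def)
    then have "cbox_of I (\<sigma> y) (\<sigma> y') \<subseteq> U" using B by blast
    from mvt_coords[OF I ss(1,2) this smooth_pdiff[OF g]]
    obtain \<xi> where \<xi>: "\<And>a. a \<in> I \<Longrightarrow> \<xi> a \<in> cbox_of I (\<sigma> y) (\<sigma> y')"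
      "g (\<sigma> y') - g (\<sigma> y) = (\<Sum>a\<in>I. pd a g (\<xi> a) * (\<sigma> y' a - \<sigma> y a))" by blast
    have "(\<Sum>a\<in>I. pd a g (\<xi> a) * (\<sigma> y' a - \<sigma> y a)) =
        (\<Sum>a\<in>I-{j}. pd a g (\<xi> a) * (\<sigma> y' a - \<sigma> y a)) + pd j g (\<xi> j) * (h y' - h y)"
      using sum.remove[OF I j, of "\<lambda>a. pd a g (\<xi> a) * (\<sigma> y' a - \<sigma> y a)"] by (simp add: \<sigma>_def)
    also have "(\<Sum>a\<in>I-{j}. pd a g (\<xi> a) * (\<sigma> y' a - \<sigma> y a)) = (\<Sum>a\<in>I-{j}. pd a g (\<xi> a) * (y' a - y a))"
      by (rule sum.cong) (auto simp: \<sigma>_def)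
    finally have "y' j - y j = (\<Sum>a\<in>I-{j}. pd a g (\<xi> a) * (y' a - y a)) + pd j g (\<xi> j) * (h y' - h y)"
      using \<xi>(2) hy(2) y by simp
    then show ?thesis using bx[OF \<xi>(1)] cbox_of_dist[OF I \<xi>(1)] by (intro exI[of _ \<xi>]) auto
  qed
  \<comment> \<open>The factor 2 is the reciprocal of the lower bound for \<open>pd j g\<close>; 1
    stems from coordinate \<open>j\<close>, and each other coordinate contributes at most
    \<open>M\<close>.\<close>
  define L where "L = 2 * (1 + card I * M)"
  have L: "L > 0" using M by (simp add: L_def add_pos_nonneg)
  have lip: "\<bar>h y' - h y\<bar> \<le> L * cdist I y y'" if y: "y \<in> W'" "y' \<in> W'" for y y'
  proof -
    obtain \<xi> where \<xi>: "\<And>a. a \<in> I \<Longrightarrow> \<xi> a \<in> coord_space I \<and> cdist I x0 (\<xi> a) < r0"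
      and e: "y' j - y j = (\<Sum>a\<in>I-{j}. pd a g (\<xi> a) * (y' a - y a)) + pd j g (\<xi> j) * (h y' - h y)"
      using diff[OF y] by blast
    have "\<bar>\<Sum>a\<in>I-{j}. pd a g (\<xi> a) * (y' a - y a)\<bar> \<le> (\<Sum>a\<in>I-{j}. \<bar>pd a g (\<xi> a) * (y' a - y a)\<bar>)" by (rule sum_abs)
    also have "\<dots> \<le> (\<Sum>a\<in>I-{j}. M * cdist I y y')"
    proof (rule sum_mono)
      fix a assume a: "a \<in> I - {j}"
      have "\<bar>pd a g (\<xi> a)\<bar> \<le> M" using B \<xi>[of a] a by blast
      moreover have "\<bar>y' a - y a\<bar> \<le> cdist I y y'" using abs_le_cdist[OF I, of a y' y] a by (simp add: cdist_commute)
      ultimately show "\<bar>pd a g (\<xi> a) * (y' a - y a)\<bar> \<le> M * cdist I y y'"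
        unfolding abs_mult using M by (intro mult_mono) auto
    qed
    also have "\<dots> = card (I-{j}) * (M * cdist I y y')" by simp
    also have "\<dots> \<le> card I * (M * cdist I y y')" using M I by (intro mult_right_mono) (auto intro: card_mono)
    finally have s: "\<bar>\<Sum>a\<in>I-{j}. pd a g (\<xi> a) * (y' a - y a)\<bar> \<le> card I * (M * cdist I y y')" .
    have "\<bar>y' j - y j\<bar> \<le> cdist I y y'" using abs_le_cdist[OF I j, of y' y] by (simp add: cdist_commute)
    then have p: "\<bar>pd j g (\<xi> j) * (h y' - h y)\<bar> \<le> cdist I y y' + card I * (M * cdist I y y')" using e s by linarith
    have "1/2 \<le> \<bar>pd j g (\<xi> j)\<bar>" using B \<xi>[OF j] by fastforce
    then have "1/2 * \<bar>h y' - h y\<bar> \<le> \<bar>pd j g (\<xi> j) * (h y' - h y)\<bar>" unfolding abs_mult by (intro mult_right_mono) auto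
    then show ?thesis using p by (simp add: L_def algebra_simps)
  qed
  have W'c: "W' \<subseteq> coord_space I" by (auto simp: W'_def)
  have ch: "continuous_on W' h" unfolding continuous_on_cdist_iff[OF I W'c]
  proof (intro ballI allI impI)
    fix y e assume y: "y \<in> W'" and e: "(e::real) > 0"
    have "\<bar>h y' - h y\<bar> < e" if "y' \<in> W'" "cdist I y y' < e / L" for y'
      using lip[OF y that(1)] that(2) L by (simp add: pos_less_divide_eq mult.commute)
    then show "\<exists>d>0. \<forall>y'\<in>W'. cdist I y y' < d \<longrightarrow> \<bar>h y' - h y\<bar> < e"
      using e L by (intro exI[of _ "e / L"]) auto
  qed
  \<comment> \<open>Implicit differentiation of \<open>g (\<sigma> y) = y j\<close> with respect to
    \<open>y i\<close>.\<close>
  define q where "q i z = (if i = j then 1 else (-1) * pd i g z) * inverse (pd j g z)" for i z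
  have hder: "((\<lambda>t. h (y(i := t))) has_real_derivative q i (\<sigma> y)) (at (y i))" if y: "y \<in> W'" and i: "i \<in> I" for y i
  proof -
    have evW: "\<forall>\<^sub>F t in at (y i). y(i := t) \<in> W'"
      using copen_upd_eventually[OF I oW' y i] by (simp add: eventually_at_filter eventually_mono)
    define P where "P t \<xi> \<longleftrightarrow> (\<forall>a\<in>I. \<xi> a \<in> coord_space I \<and> cdist I x0 (\<xi> a) < r0 \<and> cdist I (\<sigma> y) (\<xi> a) \<le> cdist I (\<sigma> y) (\<sigma> (y(i := t)))) \<and>
      (y(i := t)) j - y j = (\<Sum>a\<in>I-{j}. pd a g (\<xi> a) * ((y(i := t)) a - y a)) + pd j g (\<xi> j) * (h (y(i := t)) - h y)" for t \<xi>
    have "\<exists>\<xi>. P t \<xi>" if "y(i := t) \<in> W'" for t unfolding P_def by (rule diff[OF y that])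
    then obtain \<xi> where "\<And>t. y(i := t) \<in> W' \<Longrightarrow> P t (\<xi> t)" by metis
    then have evP: "\<forall>\<^sub>F t in at (y i). P t (\<xi> t)" using evW by (auto elim: eventually_mono)
    have "\<forall>\<^sub>F t in at (y i). cdist I (\<sigma> y) (\<sigma> (y(i := t))) \<le> (1 + L) * \<bar>y i - t\<bar>" using evW
    proof eventually_elim
      case (elim t)
      have c: "cdist I y (y(i := t)) \<le> \<bar>y i - t\<bar>" by (rule cdist_upd_le[OF I])
      have "\<bar>h (y(i := t)) - h y\<bar> \<le> L * \<bar>y i - t\<bar>" using lip[OF y elim] mult_left_mono[OF c, of L] L by linarith
      moreover have "0 \<le> L * \<bar>y i - t\<bar>" using L by simp
      moreover have "\<bar>y a - (y(i := t)) a\<bar> \<le> \<bar>y i - t\<bar>" for a by simp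
      ultimately show ?case using L by (subst cdist_le_iff[OF I]) (auto simp: \<sigma>_def algebra_simps abs_minus_commute)
    qed
    moreover have "((\<lambda>t. (1 + L) * \<bar>y i - t\<bar>) \<longlongrightarrow> (1 + L) * \<bar>y i - y i\<bar>) (at (y i))"
      by (intro tendsto_intros)
    ultimately have lim: "\<forall>\<^sub>F t in at (y i). cdist I (\<sigma> y) (\<sigma> (y(i := t))) < e" if "e > 0" for e
    proof -
      assume a1: "\<forall>\<^sub>F t in at (y i). cdist I (\<sigma> y) (\<sigma> (y(i := t))) \<le> (1 + L) * \<bar>y i - t\<bar>"
        and a2: "((\<lambda>t. (1 + L) * \<bar>y i - t\<bar>) \<longlongrightarrow> (1 + L) * \<bar>y i - y i\<bar>) (at (y i))"
      have "\<forall>\<^sub>F t in at (y i). (1 + L) * \<bar>y i - t\<bar> < e" by (rule order_tendstoD(2)[OF a2]) (use that in simp)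
      with a1 show ?thesis by eventually_elim simp
    qed
    have fl: "filterlim (\<lambda>t. \<xi> t a) (cnh I (\<sigma> y)) (at (y i))" if a: "a \<in> I" for a unfolding filterlim_iff
    proof (intro allI impI)
      fix Q assume "eventually Q (cnh I (\<sigma> y))"
      then obtain e where e: "e > 0" "\<forall>z\<in>coord_space I. cdist I (\<sigma> y) z < e \<longrightarrow> Q z"
        unfolding eventually_cnh by blast
      show "\<forall>\<^sub>F t in at (y i). Q (\<xi> t a)" using evP lim[OF e(1)]
      proof eventually_elim
        case (elim t)
        have "\<xi> t a \<in> coord_space I \<and> cdist I (\<sigma> y) (\<xi> t a) \<le> cdist I (\<sigma> y) (\<sigma> (y(i := t)))"
          using elim(1) a unfolding P_def by blast
        then show ?case using e(2) elim(2) by (meson le_less_trans)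
      qed
    qed
    have sU: "\<sigma> y \<in> U" using SW(1)[OF y] WU by blast
    have lp: "((\<lambda>t. pd a g (\<xi> t b)) \<longlongrightarrow> pd a g (\<sigma> y)) (at (y i))" if "a \<in> I" "b \<in> I" for a b
    proof (rule filterlim_compose[OF _ fl[OF that(2)]])
      show "(pd a g \<longlongrightarrow> pd a g (\<sigma> y)) (cnh I (\<sigma> y))"
        using smooth_continuous[OF smooth_pd[OF g that(1)]] continuous_on_cnh[OF I U] sU by blast
    qed
    have pj: "pd j g (\<sigma> y) \<noteq> 0"
    proof -
      have "1/2 < pd j g (\<sigma> y)" using B[OF _ Wb[OF SW(1)[OF y]]] SW(1)[OF y] by (auto simp: W_def)
      then show ?thesis by linarith
    qed
    have l2: "((\<lambda>t. (if i = j then 1 else (-1) * pd i g (\<xi> t i)) * inverse (pd j g (\<xi> t j))) \<longlongrightarrow> q i (\<sigma> y)) (at (y i))"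
      unfolding q_def using pj lp i j by (cases "i = j") (auto intro!: tendsto_intros)
    have "((\<lambda>t. (h (y(i := t)) - h y) / (t - y i)) \<longlongrightarrow> q i (\<sigma> y)) (at (y i))"
    proof (rule Lim_transform_eventually[OF l2])
      have "\<forall>\<^sub>F t in at (y i). t \<noteq> y i" by (simp add: eventually_at_filter)
      with evP show "\<forall>\<^sub>F t in at (y i). (if i = j then 1 else (-1) * pd i g (\<xi> t i)) * inverse (pd j g (\<xi> t j)) =
          (h (y(i := t)) - h y) / (t - y i)"
      proof eventually_elim
        case (elim t)
        have p: "1/2 < pd j g (\<xi> t j)" using elim(1) j B unfolding P_def by blast
        have eq: "(y(i := t)) j - y j = (\<Sum>a\<in>I-{j}. pd a g (\<xi> t a) * ((y(i := t)) a - y a)) + pd j g (\<xi> t j) * (h (y(i := t)) - h y)"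
          using elim(1) unfolding P_def by blast
        show ?case
        proof (cases "i = j")
          case True
          have "(\<Sum>a\<in>I-{j}. pd a g (\<xi> t a) * ((y(i := t)) a - y a)) = 0" by (rule sum.neutral) (use True in auto)
          then have "t - y i = pd j g (\<xi> t j) * (h (y(i := t)) - h y)" using eq True by simp
          then show ?thesis using p elim(2) True by (simp add: field_simps)
        next
          case False
          have "(\<Sum>a\<in>I-{j}. pd a g (\<xi> t a) * ((y(i := t)) a - y a)) = (\<Sum>a\<in>I-{j}. if a = i then pd i g (\<xi> t i) * (t - y i) else 0)"
            by (rule sum.cong) auto
          also have "\<dots> = pd i g (\<xi> t i) * (t - y i)" using i I False by simp
          finally have "pd j g (\<xi> t j) * (h (y(i := t)) - h y) = - (pd i g (\<xi> t i) * (t - y i))" using eq False by simp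
          then have "h (y(i := t)) - h y = - (pd i g (\<xi> t i) * (t - y i)) / pd j g (\<xi> t j)" using p by (simp add: field_simps)
          then show ?thesis using p elim(2) False by (simp add: field_simps)
        qed
      qed
    qed
    then show ?thesis by (simp add: has_field_derivative_iff)
  qed
  define V0 where "V0 = {y\<in>coord_space I. cdist I x0 y < r0}"
  have oV0: "copen I V0" unfolding V0_def by (rule copen_ball[OF I])
  have V0U: "V0 \<subseteq> U" using B by (auto simp: V0_def)
  have sV0: "\<sigma> ` W' \<subseteq> V0" using SW(1) Wb by (auto simp: V0_def W_def)
  have sq: "smooth_real_on I V0 (q i)" if i: "i \<in> I" for i
  proof -
    have a: "smooth_real_on I V0 (pd a g)" if "a \<in> I" for a by (rule smooth_subset[OF smooth_pd[OF g that] V0U])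
    have "pd j g x \<noteq> 0" if "x \<in> V0" for x using B that unfolding V0_def by fastforce
    then have inv: "smooth_real_on I V0 (\<lambda>z. inverse (pd j g z))" by (rule smooth_inverse[OF I oV0 _ a[OF j]])
    show ?thesis
    proof (cases "i = j")
      case True
      then show ?thesis using inv unfolding q_def by simp
    next
      case False
      have "smooth_real_on I V0 (\<lambda>z. ((-1) * pd i g z) * inverse (pd j g z))"
        by (intro smooth_mult[OF I oV0] smooth_const a i inv)
      then show ?thesis using False unfolding q_def by simp
    qed
  qed
  \<comment> \<open>Bootstrapping: the derivatives of \<open>h\<close> are \<open>q i\<close>
    composed with \<open>\<sigma>\<close>, and \<open>\<sigma>\<close> is as regular as
    \<open>h\<close>, so each order yields the next.\<close>
  have hk: "ck k I W' h" for k
  proof (induction k)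
    case (Suc k)
    have c: "ck k I W' (\<lambda>y. \<sigma> y a)" for a by (cases "a = j") (simp_all add: \<sigma>_def Suc)
    have "ck k I W' (pd i h)" if i: "i \<in> I" for i
    proof (rule ck_cong[OF I oW'])
      show "ck k I W' (\<lambda>y. q i (\<sigma> y))"
      proof (rule ck_comp[OF I oW' I oV0 sV0])
        show "ck k I V0 (q i)" using sq[OF i] by (simp add: smooth_iff_ck)
      qed (rule c)
      show "q i (\<sigma> y) = pd i h y" if "y \<in> W'" for y using pd_eqI(1)[OF hder[OF that i]] by simp
    qed
    moreover have "pdiff_on I W' h" by (rule pdiff_onI[OF hder])
    ultimately show ?case using ch by simp
  qed (simp add: ch)
  have "cdiffeo I W W' (\<lambda>x. x(j := g x)) \<sigma>" unfolding cdiffeo_def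
  proof (intro conjI ballI oW oW')
    fix i assume "i \<in> I"
    show "smooth_real_on I W (\<lambda>x. (x(j := g x)) i)" by (cases "i = j") (auto intro: smooth_subset[OF g WU])
    show "smooth_real_on I W' (\<lambda>y. \<sigma> y i)" by (cases "i = j") (auto simp: \<sigma>_def smooth_iff_ck hk)
  qed (use EW SW in auto)
  from that[OF _ WU this] show ?thesis using xs d(1) r(1) by (simp add: W_def)
qed

text \<open>Induction on the set \<open>T\<close> of coordinates that \<open>F\<close> may change.
  The map \<open>x(j := F x j)\<close> is inverted first; composed with that inverse,
  \<open>F\<close> fixes coordinate \<open>j\<close> as well and keeps the identity derivative at
  the base point.\<close>

lemma local_inverse_aux:
  assumes I: "finite I" and T: "finite T" "T \<subseteq> I"
  shows "copen I U \<Longrightarrow> x0 \<in> U \<Longrightarrow> (\<And>x. x \<in> U \<Longrightarrow> F x \<in> coord_space I) \<Longrightarrow>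
    (\<And>i. i \<in> I \<Longrightarrow> smooth_real_on I U (\<lambda>x. F x i)) \<Longrightarrow>
    (\<And>i b. i \<in> I \<Longrightarrow> b \<in> I \<Longrightarrow> pd b (\<lambda>x. F x i) x0 = (if b = i then 1 else 0)) \<Longrightarrow>
    (\<And>x i. x \<in> U \<Longrightarrow> i \<in> I - T \<Longrightarrow> F x i = x i) \<Longrightarrow>
    \<exists>W W' G. x0 \<in> W \<and> W \<subseteq> U \<and> cdiffeo I W W' F G"
  using T
proof (induction T arbitrary: U x0 F rule: finite_induct)
  case empty
  have "F x = x" if "x \<in> U" for x
  proof
    fix i show "F x i = x i"
      using empty.prems(6)[OF that, of i] empty.prems(3)[OF that] copen_sub[OF empty.prems(1)] that
      by (cases "i \<in> I") (auto simp: coord_space_def)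
  qed
  then have "cdiffeo I U U F (\<lambda>x. x)" using cdiffeo_cong[OF I cdiffeo_id[OF empty.prems(1)]] by simp
  then show ?case using empty.prems(2) by blast
next
  case (insert j T)
  note pr = insert.prems
  have j: "j \<in> I" using pr(7) by blast
  obtain W1 W1' \<sigma> where W1: "x0 \<in> W1" "W1 \<subseteq> U" "cdiffeo I W1 W1' (\<lambda>x. x(j := F x j)) \<sigma>"
    by (rule coordinate_diffeo[OF I j pr(1,2) pr(4)[OF j]]) (use pr(5)[OF j j] in auto)
  note D = cdiffeoD[OF W1(3)]
  define E where "E x = x(j := F x j)" for x
  let ?y0 = "E x0"
  have E0: "?y0 \<in> W1'" "\<sigma> ?y0 = x0" using D(3,4)[OF W1(1)] by (auto simp: E_def)
  have d': "cdiffeo I W1' W1 \<sigma> E" using cdiffeo_sym[OF W1(3)] by (simp add: E_def[abs_def])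
  have ps: "pd b (\<lambda>y. \<sigma> y i) ?y0 = (if b = i then 1 else 0)" if ib: "i \<in> I" "b \<in> I" for i b
  proof -
    have "pd a (\<lambda>x. E x i) x0 = (if a = i then 1 else 0)" if "a \<in> I" for a
      using pr(5)[OF j that] by (cases "i = j") (auto simp: E_def pd_coord)
    then have "(\<Sum>a\<in>I. pd a (\<lambda>x. E x i) (\<sigma> ?y0) * pd b (\<lambda>y. \<sigma> y a) ?y0) =
        (\<Sum>a\<in>I. if a = i then pd b (\<lambda>y. \<sigma> y i) ?y0 else 0)"
      unfolding E0(2) by (intro sum.cong) auto
    then show ?thesis using cdiffeo_pd_inverse[OF I d' E0(1) ib] I ib by simp
  qed
  have sub: "\<sigma> ` W1' \<subseteq> U" using D(5) W1(2) by blast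
  have "\<exists>W W' G. ?y0 \<in> W \<and> W \<subseteq> W1' \<and> cdiffeo I W W' (\<lambda>y. F (\<sigma> y)) G"
  proof (rule insert.IH[OF D(2) E0(1)])
    show "F (\<sigma> y) \<in> coord_space I" if "y \<in> W1'" for y using pr(3) sub that by blast
    show "smooth_real_on I W1' (\<lambda>y. F (\<sigma> y) i)" if i: "i \<in> I" for i
      by (rule smooth_comp[OF I D(2) I pr(1) sub pr(4)[OF i] D(8)])
    show "pd b (\<lambda>y. F (\<sigma> y) i) ?y0 = (if b = i then 1 else 0)" if ib: "i \<in> I" "b \<in> I" for i b
    proof -
      have "pd b (\<lambda>y. F (\<sigma> y) i) ?y0 = (\<Sum>a\<in>I. pd a (\<lambda>x. F x i) (\<sigma> ?y0) * pd b (\<lambda>y. \<sigma> y a) ?y0)"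
        by (rule pd_comp_smooth[OF I D(2) I pr(1) pr(4)[OF ib(1)] D(8) sub ib(2) E0(1)])
      also have "\<dots> = (\<Sum>a\<in>I. if a = i then pd b (\<lambda>y. \<sigma> y i) ?y0 else 0)"
        unfolding E0(2) using pr(5)[OF ib(1)] by (intro sum.cong) auto
      finally show ?thesis using I ib ps[OF ib] by simp
    qed
    show "F (\<sigma> y) i = y i" if y: "y \<in> W1'" and i: "i \<in> I - T" for y i
    proof -
      have e: "((\<sigma> y)(j := F (\<sigma> y) j)) i = y i" using D(6)[OF y] by simp
      show ?thesis
      proof (cases "i = j")
        case False
        then have "F (\<sigma> y) i = \<sigma> y i" using pr(6)[of "\<sigma> y" i] sub y i by blast
        then show ?thesis using e False by simp
      qed (use e in simp)
    qed
  qed (use pr(7) in auto)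
  then obtain W2 W2' G where W2: "?y0 \<in> W2" "W2 \<subseteq> W1'" "cdiffeo I W2 W2' (\<lambda>y. F (\<sigma> y)) G" by blast
  let ?W = "{x\<in>W1. E x \<in> W2}"
  have "cdiffeo I ?W W2 E \<sigma>" using cdiffeo_restrict_target[OF I W1(3) cdiffeoD(1)[OF W2(3)] W2(2)] by (simp add: E_def[abs_def])
  from cdiffeo_comp[OF I this W2(3)] have "cdiffeo I ?W W2' (\<lambda>x. F (\<sigma> (E x))) (\<lambda>y. \<sigma> (G y))" .
  then have "cdiffeo I ?W W2' F (\<lambda>y. \<sigma> (G y))" by (rule cdiffeo_cong[OF I]) (use D(4) in \<open>auto simp: E_def\<close>)
  moreover have "x0 \<in> ?W" "?W \<subseteq> U" using W1 W2(1) by auto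
  ultimately show ?case by (intro exI conjI)
qed

text \<open>A map with identity derivative is, near the point, a composition of maps that change one
  coordinate each.\<close>

lemma local_inverse:
  assumes "finite I" "copen I U" "x0 \<in> U" "\<And>x. x \<in> U \<Longrightarrow> F x \<in> coord_space I"
    "\<And>i. i \<in> I \<Longrightarrow> smooth_real_on I U (\<lambda>x. F x i)"
    "\<And>i b. i \<in> I \<Longrightarrow> b \<in> I \<Longrightarrow> pd b (\<lambda>x. F x i) x0 = (if b = i then 1 else 0)"
  obtains W W' G where "x0 \<in> W" "W \<subseteq> U" "cdiffeo I W W' F G"
  using local_inverse_aux[OF assms(1) assms(1) order_refl assms(2-6)] by auto

section \<open>Limits and local Lipschitz bounds of smooth maps\<close>

lemma smooth_map_filterlim:
  assumes I: "finite I" "copen I V" and J: "finite J" and x0: "x0 \<in> V"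
    and t: "\<And>j. j \<in> J \<Longrightarrow> smooth_real_on I V (\<lambda>x. \<tau> x j)" "\<And>x. x \<in> V \<Longrightarrow> \<tau> x \<in> coord_space J"
  shows "filterlim \<tau> (cnh J (\<tau> x0)) (cnh I x0)"
proof (rule cnh_map[OF J])
  show "((\<lambda>x. \<tau> x j) \<longlongrightarrow> \<tau> x0 j) (cnh I x0)" if "j \<in> J" for j
    using smooth_continuous[OF t(1)[OF that]] continuous_on_cnh[OF I] x0 by blast
  show "\<forall>\<^sub>F x in cnh I x0. \<tau> x \<in> coord_space J" using cnh_copen[OF I x0] by eventually_elim (rule t(2))
qed

lemma smooth_lipschitz_real:
  assumes I: "finite I" "copen I V" and x0: "x0 \<in> V" and F: "smooth_real_on I V F"
  shows "\<exists>L>0. \<exists>e>0. \<forall>x\<in>coord_space I. \<forall>y\<in>coord_space I.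
    cdist I x0 x < e \<longrightarrow> cdist I x0 y < e \<longrightarrow> x \<in> V \<and> \<bar>F x - F y\<bar> \<le> L * cdist I x y"
proof -
  have "Ovan I x0 0 (pd a F)" if "a \<in> I" for a by (rule Ovan_smooth0[OF I smooth_pd[OF F that] x0])
  from Ovan_all[where F = "\<lambda>a. pd a F", OF I(1) I(1) this]
  obtain M where M: "M > 0" "\<forall>\<^sub>F x in cnh I x0. \<forall>a\<in>I. \<bar>pd a F x\<bar> \<le> M * cdist I x0 x ^ 0" by blast
  have "\<forall>\<^sub>F x in cnh I x0. x \<in> V \<and> (\<forall>a\<in>I. \<bar>pd a F x\<bar> \<le> M)"
    using M(2) by (intro eventually_conj cnh_copen[OF I x0]) auto
  then obtain e where e: "e > 0" and B: "\<And>y. y \<in> coord_space I \<Longrightarrow> cdist I x0 y < e \<Longrightarrow>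
      y \<in> V \<and> (\<forall>a\<in>I. \<bar>pd a F y\<bar> \<le> M)"
    unfolding eventually_cnh by blast
  have "x \<in> V \<and> \<bar>F x - F y\<bar> \<le> (card I * M + 1) * cdist I x y"
    if xy: "x \<in> coord_space I" "y \<in> coord_space I" "cdist I x0 x < e" "cdist I x0 y < e" for x y
  proof -
    have bx: "w \<in> coord_space I \<and> cdist I x0 w < e" if "w \<in> cbox_of I x y" for w
      using cbox_of_ball[OF I(1) that xy(3,4)] that by (auto simp: cbox_of_def)
    then have "cbox_of I x y \<subseteq> V" using B by blast
    from mvt_coords[OF I(1) xy(1,2) this smooth_pdiff[OF F]]
    obtain \<xi> where \<xi>: "\<And>a. a \<in> I \<Longrightarrow> \<xi> a \<in> cbox_of I x y"
      "F y - F x = (\<Sum>a\<in>I. pd a F (\<xi> a) * (y a - x a))" by blast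
    have "\<bar>F y - F x\<bar> \<le> (\<Sum>a\<in>I. \<bar>pd a F (\<xi> a) * (y a - x a)\<bar>)" unfolding \<xi>(2) by (rule sum_abs)
    also have "\<dots> \<le> (\<Sum>a\<in>I. M * cdist I x y)"
    proof (rule sum_mono)
      fix a assume a: "a \<in> I"
      have "\<bar>pd a F (\<xi> a)\<bar> \<le> M" using B bx[OF \<xi>(1)[OF a]] a by blast
      moreover have "\<bar>y a - x a\<bar> \<le> cdist I x y" using abs_le_cdist[OF I(1) a, of y x] by (simp add: cdist_commute)
      ultimately show "\<bar>pd a F (\<xi> a) * (y a - x a)\<bar> \<le> M * cdist I x y"
        unfolding abs_mult using M by (intro mult_mono) auto
    qed
    also have "\<dots> = card I * M * cdist I x y" by simp
    also have "\<dots> \<le> (card I * M + 1) * cdist I x y" using I by (intro mult_right_mono) auto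
    finally show ?thesis using B[OF xy(1,3)] by (simp add: abs_minus_commute)
  qed
  moreover have "card I * M + 1 > 0" using M by (simp add: add_nonneg_pos)
  ultimately show ?thesis using e by blast
qed

lemma smooth_lipschitz:
  assumes I: "finite I" "copen I V" and J: "finite J" and x0: "x0 \<in> V"
    and t: "\<And>j. j \<in> J \<Longrightarrow> smooth_real_on I V (\<lambda>x. \<tau> x j)"
  shows "\<exists>L>0. \<exists>e>0. \<forall>x\<in>coord_space I. \<forall>y\<in>coord_space I.
    cdist I x0 x < e \<longrightarrow> cdist I x0 y < e \<longrightarrow> cdist J (\<tau> x) (\<tau> y) \<le> L * cdist I x y"
proof -
  \<comment> \<open>Constant and radius are packed into a pair, so that a single choice function
    serves both.\<close>
  have "\<forall>j\<in>J. \<exists>Le. fst Le > 0 \<and> snd Le > 0 \<and> (\<forall>x y. x \<in> coord_space I \<longrightarrow> y \<in> coord_space I \<longrightarrow>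
      cdist I x0 x < snd Le \<longrightarrow> cdist I x0 y < snd Le \<longrightarrow> \<bar>\<tau> x j - \<tau> y j\<bar> \<le> fst Le * cdist I x y)"
  proof
    fix j assume "j \<in> J"
    from smooth_lipschitz_real[OF I x0 t[OF this]] obtain L e where "L > 0" "e > 0"
      "\<forall>x\<in>coord_space I. \<forall>y\<in>coord_space I.
        cdist I x0 x < e \<longrightarrow> cdist I x0 y < e \<longrightarrow> x \<in> V \<and> \<bar>\<tau> x j - \<tau> y j\<bar> \<le> L * cdist I x y" by blast
    then show "\<exists>Le. fst Le > 0 \<and> snd Le > 0 \<and> (\<forall>x y. x \<in> coord_space I \<longrightarrow> y \<in> coord_space I \<longrightarrow>
      cdist I x0 x < snd Le \<longrightarrow> cdist I x0 y < snd Le \<longrightarrow> \<bar>\<tau> x j - \<tau> y j\<bar> \<le> fst Le * cdist I x y)"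
      by (intro exI[of _ "(L, e)"]) auto
  qed
  then obtain q where q: "\<And>j. j \<in> J \<Longrightarrow> fst (q j) > 0 \<and> snd (q j) > 0 \<and> (\<forall>x y. x \<in> coord_space I \<longrightarrow> y \<in> coord_space I \<longrightarrow>
      cdist I x0 x < snd (q j) \<longrightarrow> cdist I x0 y < snd (q j) \<longrightarrow> \<bar>\<tau> x j - \<tau> y j\<bar> \<le> fst (q j) * cdist I x y)"
    by metis
  define L where "L = 1 + (\<Sum>j\<in>J. fst (q j))"
  define e where "e = Min (insert 1 ((\<lambda>j. snd (q j)) ` J))"
  have "0 \<le> (\<Sum>j\<in>J. fst (q j))" by (rule sum_nonneg) (use q in \<open>auto intro: less_imp_le\<close>)
  then have L: "L > 0" by (simp add: L_def)
  have e: "e > 0" using J q by (auto simp: e_def)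
  have "cdist J (\<tau> x) (\<tau> y) \<le> L * cdist I x y"
    if xy: "x \<in> coord_space I" "y \<in> coord_space I" "cdist I x0 x < e" "cdist I x0 y < e" for x y
  proof -
    have p: "0 \<le> L * cdist I x y" using L I by simp
    have "\<bar>\<tau> x j - \<tau> y j\<bar> \<le> L * cdist I x y" if j: "j \<in> J" for j
    proof -
      have "e \<le> snd (q j)" using J j by (simp add: e_def)
      then have "\<bar>\<tau> x j - \<tau> y j\<bar> \<le> fst (q j) * cdist I x y" using q[OF j] xy by force
      also have "fst (q j) \<le> (\<Sum>j\<in>J. fst (q j))" by (rule member_le_sum) (use J j q in \<open>auto intro: less_imp_le\<close>)
      then have "fst (q j) * cdist I x y \<le> L * cdist I x y" using I by (intro mult_right_mono) (auto simp: L_def)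
      finally show ?thesis .
    qed
    then show ?thesis using cdist_le_iff[OF J p] by blast
  qed
  then show ?thesis using L e by blast
qed

section \<open>Sets that agree to a given order at a point\<close>

text \<open>A comparison of sets by distances instead of derivatives of defining functions. It is
  one-sided, so that the two halves of a contact can be established by separate arguments.\<close>

definition near :: "'i set \<Rightarrow> ('i \<Rightarrow> real) \<Rightarrow> nat \<Rightarrow> ('i \<Rightarrow> real) set \<Rightarrow> ('i \<Rightarrow> real) set \<Rightarrow> bool" where
  "near I x0 k S T \<longleftrightarrow>
    (\<exists>C. \<forall>\<^sub>F x in cnh I x0. x \<in> S \<longrightarrow> (\<exists>y\<in>T. cdist I x y \<le> C * cdist I x0 x ^ k))"

lemma nearE:
  assumes "near I x0 k S T" "finite I"
  obtains C where "C > 0" "\<forall>\<^sub>F x in cnh I x0. x \<in> S \<longrightarrow> (\<exists>y\<in>T. cdist I x y \<le> C * cdist I x0 x ^ k)"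
proof -
  obtain C where C: "\<forall>\<^sub>F x in cnh I x0. x \<in> S \<longrightarrow> (\<exists>y\<in>T. cdist I x y \<le> C * cdist I x0 x ^ k)"
    using assms by (auto simp: near_def)
  have "\<forall>\<^sub>F x in cnh I x0. x \<in> S \<longrightarrow> (\<exists>y\<in>T. cdist I x y \<le> max C 1 * cdist I x0 x ^ k)"
    using C
  proof eventually_elim
    case (elim x)
    have "C * cdist I x0 x ^ k \<le> max C 1 * cdist I x0 x ^ k" using assms(2) by (intro mult_right_mono) auto
    then show ?case using elim by (meson order_trans)
  qed
  then show ?thesis using that[of "max C 1"] by simp
qed

lemma near_refl: "finite I \<Longrightarrow> near I x0 k S S" unfolding near_def by (intro exI[of _ 0] always_eventually) force

lemma near_superset: "near I x0 k S T \<Longrightarrow> T \<subseteq> T' \<Longrightarrow> near I x0 k S T'"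
proof -
  assume n: "near I x0 k S T" and T: "T \<subseteq> T'"
  obtain C where "\<forall>\<^sub>F x in cnh I x0. x \<in> S \<longrightarrow> (\<exists>y\<in>T. cdist I x y \<le> C * cdist I x0 x ^ k)"
    using n unfolding near_def by blast
  then have "\<forall>\<^sub>F x in cnh I x0. x \<in> S \<longrightarrow> (\<exists>y\<in>T'. cdist I x y \<le> C * cdist I x0 x ^ k)"
    by eventually_elim (use T in blast)
  then show ?thesis unfolding near_def by blast
qed

lemma near_mono:
  assumes I: "finite I" and n: "near I x0 k S T" and l: "l \<le> k"
  shows "near I x0 l S T"
proof -
  obtain C where C: "C > 0" "\<forall>\<^sub>F x in cnh I x0. x \<in> S \<longrightarrow> (\<exists>y\<in>T. cdist I x y \<le> C * cdist I x0 x ^ k)"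
    using nearE[OF n I] .
  have "\<forall>\<^sub>F x in cnh I x0. x \<in> S \<longrightarrow> (\<exists>y\<in>T. cdist I x y \<le> C * cdist I x0 x ^ l)"
    using C(2) cnh_dist[OF zero_less_one]
  proof eventually_elim
    case (elim x)
    have "cdist I x0 x ^ k \<le> cdist I x0 x ^ l" using elim I l by (intro power_decreasing) auto
    then have "C * cdist I x0 x ^ k \<le> C * cdist I x0 x ^ l" using C(1) by simp
    then show ?case using elim(1) by (meson order_trans)
  qed
  then show ?thesis unfolding near_def by blast
qed

text \<open>For \<open>k \<ge> 1\<close> the partner of a point is itself close to
  \<open>x0\<close>, so it may be required to have any property valid near \<open>x0\<close>. For
  \<open>k = 0\<close> partners could stay far away.\<close>

lemma near_refine:
  assumes I: "finite I" and n: "near I x0 k S T" and k: "1 \<le> k" and P: "eventually P (cnh I x0)"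
    and T: "T \<subseteq> coord_space I"
  obtains C where "C > 0" "\<forall>\<^sub>F x in cnh I x0. x \<in> S \<longrightarrow>
    (\<exists>y\<in>T. P y \<and> cdist I x y \<le> C * cdist I x0 x ^ k \<and> cdist I x0 y \<le> (1 + C) * cdist I x0 x)"
proof -
  obtain C where C: "C > 0" "\<forall>\<^sub>F x in cnh I x0. x \<in> S \<longrightarrow> (\<exists>y\<in>T. cdist I x y \<le> C * cdist I x0 x ^ k)"
    using nearE[OF n I] .
  obtain e where e: "e > 0" "\<forall>y\<in>coord_space I. cdist I x0 y < e \<longrightarrow> P y"
    using P unfolding eventually_cnh by blast
  have "\<forall>\<^sub>F x in cnh I x0. cdist I x0 x < e / (1 + C)" by (rule cnh_dist) (use e C in simp)
  with C(2) cnh_dist[OF zero_less_one] have "\<forall>\<^sub>F x in cnh I x0. x \<in> S \<longrightarrow>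
    (\<exists>y\<in>T. P y \<and> cdist I x y \<le> C * cdist I x0 x ^ k \<and> cdist I x0 y \<le> (1 + C) * cdist I x0 x)"
  proof eventually_elim
    case (elim x)
    show ?case
    proof
      assume "x \<in> S"
      then obtain y where y: "y \<in> T" "cdist I x y \<le> C * cdist I x0 x ^ k" using elim by blast
      have "cdist I x0 x ^ k \<le> cdist I x0 x ^ 1" using elim I k by (intro power_decreasing) auto
      then have "C * cdist I x0 x ^ k \<le> C * cdist I x0 x" using C(1) by simp
      then have d: "cdist I x0 y \<le> (1 + C) * cdist I x0 x" using cdist_triangle[OF I, of x0 y x] y(2) by (simp add: algebra_simps)
      moreover have "(1 + C) * cdist I x0 x < e" using elim C by (simp add: pos_less_divide_eq mult.commute)
      ultimately have "P y" using e(2) y(1) T by auto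
      then show "\<exists>y\<in>T. P y \<and> cdist I x y \<le> C * cdist I x0 x ^ k \<and> cdist I x0 y \<le> (1 + C) * cdist I x0 x"
        using y d by blast
    qed
  qed
  then show ?thesis by (rule that[OF C(1)])
qed

lemma near_trans:
  assumes I: "finite I" and n: "near I x0 k S T" "near I x0 k T R" and k: "1 \<le> k"
    and T: "T \<subseteq> coord_space I"
  shows "near I x0 k S R"
proof -
  obtain D where D: "D > 0" "\<forall>\<^sub>F x in cnh I x0. x \<in> T \<longrightarrow> (\<exists>y\<in>R. cdist I x y \<le> D * cdist I x0 x ^ k)"
    using nearE[OF n(2) I] .
  obtain C where C: "C > 0" "\<forall>\<^sub>F x in cnh I x0. x \<in> S \<longrightarrow>
    (\<exists>y\<in>T. (y \<in> T \<longrightarrow> (\<exists>z\<in>R. cdist I y z \<le> D * cdist I x0 y ^ k)) \<and> cdist I x y \<le> C * cdist I x0 x ^ k \<and>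
      cdist I x0 y \<le> (1 + C) * cdist I x0 x)"
    using near_refine[OF I n(1) k D(2) T] .
  have "\<forall>\<^sub>F x in cnh I x0. x \<in> S \<longrightarrow> (\<exists>z\<in>R. cdist I x z \<le> (C + D * (1 + C) ^ k) * cdist I x0 x ^ k)"
    using C(2)
  proof eventually_elim
    case (elim x)
    show ?case
    proof
      assume "x \<in> S"
      then obtain y z where y: "cdist I x y \<le> C * cdist I x0 x ^ k" "cdist I x0 y \<le> (1 + C) * cdist I x0 x"
        "z \<in> R" "cdist I y z \<le> D * cdist I x0 y ^ k" using elim by blast
      have "cdist I x0 y ^ k \<le> ((1 + C) * cdist I x0 x) ^ k" using y(2) I by (intro power_mono) auto
      then have "D * cdist I x0 y ^ k \<le> D * ((1 + C) * cdist I x0 x) ^ k" using D(1) by simp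
      then have "cdist I x z \<le> C * cdist I x0 x ^ k + D * ((1 + C) * cdist I x0 x) ^ k"
        using cdist_triangle[OF I, of x z y] y by linarith
      then show "\<exists>z\<in>R. cdist I x z \<le> (C + D * (1 + C) ^ k) * cdist I x0 x ^ k"
        using y(3) by (intro bexI[of _ z]) (simp_all only: power_mult_distrib distrib_right[of C] mult.assoc)
    qed
  qed
  then show ?thesis unfolding near_def by blast
qed

lemma near_local:
  assumes I: "finite I" and n: "near I x0 k S T" and k: "1 \<le> k" and U: "copen I U" "x0 \<in> U"
    and T: "T \<subseteq> coord_space I"
  shows "near I x0 k (S \<inter> U) (T \<inter> U)"
proof -
  obtain C where C: "C > 0" "\<forall>\<^sub>F x in cnh I x0. x \<in> S \<longrightarrow>
    (\<exists>y\<in>T. y \<in> U \<and> cdist I x y \<le> C * cdist I x0 x ^ k \<and> cdist I x0 y \<le> (1 + C) * cdist I x0 x)"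
    using near_refine[OF I n k cnh_copen[OF I U] T] .
  have "\<forall>\<^sub>F x in cnh I x0. x \<in> S \<inter> U \<longrightarrow> (\<exists>y\<in>T \<inter> U. cdist I x y \<le> C * cdist I x0 x ^ k)"
    using C(2) by eventually_elim blast
  then show ?thesis unfolding near_def by blast
qed

lemma near_weaken:
  assumes I: "finite I" and n: "near I x0 k (S \<inter> U) T" and U: "copen I U" "x0 \<in> U" and T: "T \<subseteq> T'"
  shows "near I x0 k S T'"
proof -
  obtain C where C: "C > 0" "\<forall>\<^sub>F x in cnh I x0. x \<in> S \<inter> U \<longrightarrow> (\<exists>y\<in>T. cdist I x y \<le> C * cdist I x0 x ^ k)"
    using nearE[OF n I] .
  have "\<forall>\<^sub>F x in cnh I x0. x \<in> S \<longrightarrow> (\<exists>y\<in>T'. cdist I x y \<le> C * cdist I x0 x ^ k)"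
    using C(2) cnh_copen[OF I U] by eventually_elim (use T in blast)
  then show ?thesis unfolding near_def by blast
qed

lemma cdiffeo_filterlim:
  assumes I: "finite I" and d: "cdiffeo I V V' \<tau> \<sigma>" and x0: "x0 \<in> V"
  shows "filterlim \<tau> (cnh I (\<tau> x0)) (cnh I x0)"
  by (rule smooth_map_filterlim[OF I cdiffeoD(1)[OF d] I x0 cdiffeoD(7)[OF d]]) (use cdiffeoD(3,10)[OF d] in auto)

lemma cdiffeo_dist:
  assumes I: "finite I" and d: "cdiffeo I V V' \<tau> \<sigma>" and x0: "x0 \<in> V"
  obtains L where "L > 0" "\<forall>\<^sub>F x in cnh I x0. cdist I (\<tau> x0) (\<tau> x) \<le> L * cdist I x0 x"
proof -
  obtain L e where L: "L > 0" "e > 0" "\<And>x y. x \<in> coord_space I \<Longrightarrow> y \<in> coord_space I \<Longrightarrow>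
    cdist I x0 x < e \<Longrightarrow> cdist I x0 y < e \<Longrightarrow> cdist I (\<tau> x) (\<tau> y) \<le> L * cdist I x y"
    using smooth_lipschitz[where \<tau> = \<tau>, OF I cdiffeoD(1)[OF d] I x0 cdiffeoD(7)[OF d]] by blast
  have "x0 \<in> coord_space I" using cdiffeoD(9)[OF d] x0 by blast
  then have "\<forall>\<^sub>F x in cnh I x0. cdist I (\<tau> x0) (\<tau> x) \<le> L * cdist I x0 x"
    unfolding eventually_cnh using L I by (intro exI[of _ e]) auto
  then show ?thesis by (rule that[OF L(1)])
qed

text \<open>A Lipschitz bound for \<open>\<tau>\<close> controls the distance of the images, and one
  for \<open>\<sigma>\<close> compares the distances to the two base points.\<close>

lemma near_image:
  assumes I: "finite I" and d: "cdiffeo I V V' \<tau> \<sigma>" and x0: "x0 \<in> V" and k: "1 \<le> k"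
    and n: "near I x0 k S T" and S: "S \<subseteq> V" and T: "T \<subseteq> V"
  shows "near I (\<tau> x0) k (\<tau> ` S) (\<tau> ` T)"
proof -
  note D = cdiffeoD[OF d]
  let ?y0 = "\<tau> x0"
  have y0: "?y0 \<in> V'" "\<sigma> ?y0 = x0" using D(3,4) x0 by auto
  have Tc: "T \<subseteq> coord_space I" using T D(9) by blast
  obtain L e where L: "L > 0" "e > 0" "\<And>x y. x \<in> coord_space I \<Longrightarrow> y \<in> coord_space I \<Longrightarrow>
    cdist I x0 x < e \<Longrightarrow> cdist I x0 y < e \<Longrightarrow> cdist I (\<tau> x) (\<tau> y) \<le> L * cdist I x y"
    using smooth_lipschitz[where \<tau> = \<tau>, OF I D(1) I x0 D(7)] by blast
  obtain L' where L': "L' > 0" "\<forall>\<^sub>F y in cnh I ?y0. cdist I (\<sigma> ?y0) (\<sigma> y) \<le> L' * cdist I ?y0 y"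
    using cdiffeo_dist[OF I cdiffeo_sym[OF d] y0(1)] .
  obtain C where C: "C > 0" "\<forall>\<^sub>F x in cnh I x0. x \<in> S \<longrightarrow>
    (\<exists>y\<in>T. cdist I x0 y < e \<and> cdist I x y \<le> C * cdist I x0 x ^ k \<and> cdist I x0 y \<le> (1 + C) * cdist I x0 x)"
    using near_refine[OF I n k cnh_dist[OF L(2)] Tc] .
  have fl: "filterlim \<sigma> (cnh I x0) (cnh I ?y0)" using cdiffeo_filterlim[OF I cdiffeo_sym[OF d] y0(1)] y0(2) by simp
  have "\<forall>\<^sub>F y in cnh I ?y0. y \<in> \<tau> ` S \<longrightarrow> (\<exists>w\<in>\<tau> ` T. cdist I y w \<le> (L * (C * L' ^ k)) * cdist I ?y0 y ^ k)"
    using fl[unfolded filterlim_iff, rule_format, OF C(2)]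
      fl[unfolded filterlim_iff, rule_format, OF cnh_dist[OF L(2)]] L'(2)
  proof eventually_elim
    case (elim y)
    show ?case
    proof
      assume "y \<in> \<tau> ` S"
      then obtain x where x: "x \<in> S" "y = \<tau> x" by blast
      have sx: "\<sigma> y = x" using x D(4) S by blast
      obtain w where w: "w \<in> T" "cdist I x0 w < e" "cdist I x w \<le> C * cdist I x0 x ^ k" using elim(1) x(1) sx by blast
      have "cdist I x0 x ^ k \<le> (L' * cdist I ?y0 y) ^ k" using elim(3) sx y0(2) I by (intro power_mono) auto
      then have "C * cdist I x0 x ^ k \<le> C * (L' * cdist I ?y0 y) ^ k" using C(1) by simp
      then have "L * cdist I x w \<le> L * (C * (L' * cdist I ?y0 y) ^ k)" using w(3) L(1) by simp
      moreover have "cdist I (\<tau> x) (\<tau> w) \<le> L * cdist I x w" using L(3)[of x w] elim(2) sx w S T x(1) D(9) by blast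
      ultimately show "\<exists>w\<in>\<tau> ` T. cdist I y w \<le> (L * (C * L' ^ k)) * cdist I ?y0 y ^ k"
        using x(2) w(1) by (intro bexI[of _ "\<tau> w"]) (auto simp: power_mult_distrib ac_simps)
    qed
  qed
  then show ?thesis unfolding near_def by blast
qed

text \<open>The partner of \<open>\<tau> x\<close> is \<open>\<tau>' x\<close>, the image of the
  same point under the other map.\<close>

lemma near_maps:
  assumes I: "finite I" and d: "cdiffeo I V V' \<tau> \<sigma>" and x0: "x0 \<in> V"
    and O: "\<And>i. i \<in> I \<Longrightarrow> Ovan I x0 k (\<lambda>x. \<tau> x i - \<tau>' x i)" and S: "S \<subseteq> V"
  shows "near I (\<tau> x0) k (\<tau> ` S) (\<tau>' ` S)"
proof -
  note D = cdiffeoD[OF d]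
  let ?y0 = "\<tau> x0"
  have y0: "?y0 \<in> V'" "\<sigma> ?y0 = x0" using D(3,4) x0 by auto
  obtain L' where L': "L' > 0" "\<forall>\<^sub>F y in cnh I ?y0. cdist I (\<sigma> ?y0) (\<sigma> y) \<le> L' * cdist I ?y0 y"
    using cdiffeo_dist[OF I cdiffeo_sym[OF d] y0(1)] .
  obtain C where C: "C > 0" "\<forall>\<^sub>F x in cnh I x0. \<forall>i\<in>I. \<bar>\<tau> x i - \<tau>' x i\<bar> \<le> C * cdist I x0 x ^ k"
    using Ovan_all[where F = "\<lambda>i x. \<tau> x i - \<tau>' x i", OF I I O] by blast
  have fl: "filterlim \<sigma> (cnh I x0) (cnh I ?y0)" using cdiffeo_filterlim[OF I cdiffeo_sym[OF d] y0(1)] y0(2) by simp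
  have "\<forall>\<^sub>F y in cnh I ?y0. y \<in> \<tau> ` S \<longrightarrow> (\<exists>w\<in>\<tau>' ` S. cdist I y w \<le> (C * L' ^ k) * cdist I ?y0 y ^ k)"
    using fl[unfolded filterlim_iff, rule_format, OF C(2)] L'(2)
  proof eventually_elim
    case (elim y)
    show ?case
    proof
      assume "y \<in> \<tau> ` S"
      then obtain x where x: "x \<in> S" "y = \<tau> x" by blast
      have sx: "\<sigma> y = x" using x D(4) S by blast
      have "cdist I x0 x ^ k \<le> (L' * cdist I ?y0 y) ^ k" using elim(2) sx y0(2) I by (intro power_mono) auto
      then have "C * cdist I x0 x ^ k \<le> C * (L' * cdist I ?y0 y) ^ k" using C(1) by simp
      moreover have "cdist I (\<tau> x) (\<tau>' x) \<le> C * cdist I x0 x ^ k" using elim(1) sx C(1) I by (subst cdist_le_iff) auto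
      ultimately show "\<exists>w\<in>\<tau>' ` S. cdist I y w \<le> (C * L' ^ k) * cdist I ?y0 y ^ k"
        using x by (intro bexI[of _ "\<tau>' x"]) (auto simp: power_mult_distrib ac_simps)
    qed
  qed
  then show ?thesis unfolding near_def by blast
qed

text \<open>The transverse coordinates vanish at the partner in \<open>T\<close>, and
  \<open>\<tau>\<close> is Lipschitz.\<close>

lemma near_flat:
  assumes I: "finite I" and d: "cdiffeo I V V' \<tau> \<sigma>" and x0: "x0 \<in> V" and k: "1 \<le> k"
    and n: "near I x0 k S T" and T: "T \<subseteq> coord_space I"
    and flat: "T \<inter> V = {x\<in>V. \<forall>j\<in>I-K. \<tau> x j = 0}"
  obtains C where "C > 0" "\<forall>\<^sub>F x in cnh I x0. x \<in> S \<longrightarrow> (\<forall>j\<in>I-K. \<bar>\<tau> x j\<bar> \<le> C * cdist I x0 x ^ k)"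
proof -
  note D = cdiffeoD[OF d]
  obtain L e where L: "L > 0" "e > 0" "\<And>x y. x \<in> coord_space I \<Longrightarrow> y \<in> coord_space I \<Longrightarrow>
    cdist I x0 x < e \<Longrightarrow> cdist I x0 y < e \<Longrightarrow> cdist I (\<tau> x) (\<tau> y) \<le> L * cdist I x y"
    using smooth_lipschitz[where \<tau> = \<tau>, OF I D(1) I x0 D(7)] by blast
  obtain C where C: "C > 0" "\<forall>\<^sub>F x in cnh I x0. x \<in> S \<longrightarrow>
    (\<exists>y\<in>T. (y \<in> V \<and> cdist I x0 y < e) \<and> cdist I x y \<le> C * cdist I x0 x ^ k \<and> cdist I x0 y \<le> (1 + C) * cdist I x0 x)"
    using near_refine[OF I n k eventually_conj[OF cnh_copen[OF I D(1) x0] cnh_dist[OF L(2)]] T] .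
  have "\<forall>\<^sub>F x in cnh I x0. x \<in> S \<longrightarrow> (\<forall>j\<in>I-K. \<bar>\<tau> x j\<bar> \<le> (L * C) * cdist I x0 x ^ k)"
    using C(2) cnh_dist[OF L(2)] cnh_space
  proof eventually_elim
    case (elim x)
    show ?case
    proof (intro impI ballI)
      fix j assume "x \<in> S" and j: "j \<in> I - K"
      then obtain y where y: "y \<in> T" "y \<in> V" "cdist I x0 y < e" "cdist I x y \<le> C * cdist I x0 x ^ k" using elim by blast
      have "\<tau> y j = 0" using flat y(1,2) j by blast
      then have "\<bar>\<tau> x j\<bar> \<le> cdist I (\<tau> x) (\<tau> y)" using abs_le_cdist[OF I, of j "\<tau> x" "\<tau> y"] j by simp
      also have "\<dots> \<le> L * cdist I x y" using L(3) elim y T by blast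
      also have "\<dots> \<le> L * (C * cdist I x0 x ^ k)" using y(4) L(1) by simp
      finally show "\<bar>\<tau> x j\<bar> \<le> (L * C) * cdist I x0 x ^ k" by simp
    qed
  qed
  then show ?thesis by (rule that[rotated]) (use L(1) C(1) in simp)
qed

section \<open>Contact in coordinates\<close>

text \<open>An embedded submanifold near one point, read in a fixed chart: \<open>\<tau>\<close> is
  the transition to a chart that flattens it.\<close>

definition slice :: "'i set \<Rightarrow> ('i \<Rightarrow> real) \<Rightarrow> nat \<Rightarrow> ('i \<Rightarrow> real) set \<Rightarrow> bool" where
  "slice I x0 p S \<longleftrightarrow> (\<exists>V V' \<tau> \<sigma> K. x0 \<in> V \<and> cdiffeo I V V' \<tau> \<sigma> \<and> K \<subseteq> I \<and> card K = p \<and>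
     S \<inter> V = {x\<in>V. \<forall>l\<in>I-K. \<tau> x l = 0})"

definition cgraph :: "'i set \<Rightarrow> ('i \<Rightarrow> real) set \<Rightarrow> (('i \<Rightarrow> real) \<Rightarrow> 'i \<Rightarrow> real) \<Rightarrow> 'i set \<Rightarrow>
    (('i \<Rightarrow> real) \<Rightarrow> 'i \<Rightarrow> real) \<Rightarrow> ('i \<Rightarrow> real) set \<Rightarrow> bool" where
  "cgraph I V \<tau> K f S \<longleftrightarrow> smooth_map_on K (coord_proj K ` \<tau> ` V) (I - K) f \<and>
     S \<inter> V = {x\<in>V. \<forall>j\<in>I-K. \<tau> x j = f (coord_proj K (\<tau> x)) j}"

text \<open>\<open>contact\<close> read in a fixed chart. The set \<open>Q\<close> confines the
  domain; when it is the image of that chart, the coordinates found can be pulled back to the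
  manifold.\<close>

definition ccontact :: "'i set \<Rightarrow> ('i \<Rightarrow> real) set \<Rightarrow> ('i \<Rightarrow> real) \<Rightarrow> nat \<Rightarrow> nat \<Rightarrow>
    ('i \<Rightarrow> real) set \<Rightarrow> ('i \<Rightarrow> real) set \<Rightarrow> bool" where
  "ccontact I Q x0 p n S T \<longleftrightarrow> (\<exists>V V' \<tau> \<sigma> K f f'. V \<subseteq> Q \<and> x0 \<in> V \<and> cdiffeo I V V' \<tau> \<sigma> \<and>
     K \<subseteq> I \<and> card K = p \<and> cgraph I V \<tau> K f S \<and> cgraph I V \<tau> K f' T \<and>
     (\<forall>j\<in>I-K. \<forall>bs. set bs \<subseteq> K \<and> length bs \<le> n \<longrightarrow>
        ipartial bs (\<lambda>x. f x j) (coord_proj K (\<tau> x0)) = ipartial bs (\<lambda>x. f' x j) (coord_proj K (\<tau> x0))))"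

lemma coord_proj_in [simp]: "coord_proj K x \<in> coord_space K" by (simp add: coord_proj_def coord_space_def)

lemma coord_space_mono: "K \<subseteq> I \<Longrightarrow> coord_space K \<subseteq> coord_space I" by (auto simp: coord_space_def)

lemma cdist_sub:
  assumes "finite I" "K \<subseteq> I" "x \<in> coord_space K" "y \<in> coord_space K"
  shows "cdist I x y = cdist K x y"
proof (rule antisym)
  have K: "finite K" using assms finite_subset by blast
  have "\<bar>x i - y i\<bar> \<le> cdist K x y" for i
    using abs_le_cdist[OF K, of i x y] assms(3,4) K by (cases "i \<in> K") (auto simp: coord_space_def)
  then show "cdist I x y \<le> cdist K x y" using assms(1) K by (simp add: cdist_le_iff)
  show "cdist K x y \<le> cdist I x y" using assms K by (subst cdist_le_iff) (auto intro: abs_le_cdist)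
qed

lemma cnh_sub:
  assumes "finite I" "K \<subseteq> I" "x \<in> coord_space K" and P: "eventually P (cnh I x)"
  shows "eventually P (cnh K x)"
proof -
  obtain e where e: "e > 0" "\<forall>y\<in>coord_space I. cdist I x y < e \<longrightarrow> P y" using P unfolding eventually_cnh by blast
  have "P y" if "y \<in> coord_space K" "cdist K x y < e" for y
    using e(2) that cdist_sub[OF assms(1-3) that(1)] coord_space_mono[OF assms(2)] by auto
  then show ?thesis unfolding eventually_cnh using e(1) by blast
qed

text \<open>A point near a projected point is lifted by keeping the coordinates outside
  \<open>K\<close>.\<close>

lemma copen_coord_proj:
  assumes I: "finite I" and K: "K \<subseteq> I" and V: "copen I V"
  shows "copen K (coord_proj K ` V)"
proof -
  have fK: "finite K" using I K finite_subset by blast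
  show ?thesis unfolding copen_iff[OF fK]
  proof (intro conjI ballI)
    fix w assume "w \<in> coord_proj K ` V"
    then obtain v where v: "v \<in> V" "w = coord_proj K v" by blast
    obtain e where e: "e > 0" "\<forall>y\<in>coord_space I. cdist I v y < e \<longrightarrow> y \<in> V" using copenD[OF I V v(1)] by blast
    have vI: "v \<in> coord_space I" using copen_sub[OF V] v(1) by blast
    have "y \<in> coord_proj K ` V" if y: "y \<in> coord_space K" "cdist K w y < e" for y
    proof -
      let ?u = "\<lambda>i. if i \<in> K then y i else v i"
      have "cdist I v ?u < e" unfolding cdist_less_iff[OF I e(1)]
      proof
        fix i assume "i \<in> I"
        then show "\<bar>v i - ?u i\<bar> < e" using abs_le_cdist[OF fK, of i w y] y(2) v(2) e(1) by (auto simp: coord_proj_def)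
      qed
      moreover have "?u \<in> coord_space I" using vI K by (auto simp: coord_space_def)
      ultimately have "?u \<in> V" using e(2) by blast
      moreover have "coord_proj K ?u = y" using y(1) by (auto simp: coord_proj_def coord_space_def)
      ultimately show ?thesis by force
    qed
    then show "\<exists>e>0. \<forall>y\<in>coord_space K. cdist K w y < e \<longrightarrow> y \<in> coord_proj K ` V" using e(1) by blast
  qed auto
qed

lemma smooth_fewer_coords: "smooth_real_on I U F \<Longrightarrow> K \<subseteq> I \<Longrightarrow> smooth_real_on K U F"
  unfolding smooth_real_on_def by blast

lemma ipartial_zero: "ipartial bs (\<lambda>x. 0) = (\<lambda>x. 0)" by (induction bs) (auto simp: fun_eq_iff)

text \<open>A point of \<open>S\<close> is moved vertically to the graph of \<open>f'\<close>. The
  displacement f - f' is O(r^(n+1)) by Taylor's formula, and the inverse chart is Lipschitz.\<close>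

lemma ccontact_near:
  assumes I: "finite I" and x0: "x0 \<in> S" "x0 \<in> T" and c: "ccontact I Q x0 p n S T"
  shows "near I x0 (Suc n) S T"
proof -
  obtain V V' \<tau> \<sigma> K f f' where V: "x0 \<in> V" and d: "cdiffeo I V V' \<tau> \<sigma>"
    and K: "K \<subseteq> I" "card K = p" and g: "cgraph I V \<tau> K f S" "cgraph I V \<tau> K f' T"
    and der: "\<And>j bs. j \<in> I-K \<Longrightarrow> set bs \<subseteq> K \<Longrightarrow> length bs \<le> n \<Longrightarrow>
      ipartial bs (\<lambda>x. f x j) (coord_proj K (\<tau> x0)) = ipartial bs (\<lambda>x. f' x j) (coord_proj K (\<tau> x0))"
    using c unfolding ccontact_def by blast
  note D = cdiffeoD[OF d]
  have fK: "finite K" using I K finite_subset by blast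
  let ?P = "\<lambda>x. coord_proj K (\<tau> x)"
  let ?V = "coord_proj K ` \<tau> ` V"
  have VV: "\<tau> ` V = V'" using D(3,5,6) by (auto simp: image_iff) metis
  have oV: "copen K ?V" unfolding VV by (rule copen_coord_proj[OF I K(1) D(2)])
  have w0: "?P x0 \<in> ?V" using V by blast
  have sm: "smooth_real_on K ?V (\<lambda>x. f x j)" "smooth_real_on K ?V (\<lambda>x. f' x j)" if "j \<in> I - K" for j
    using g that unfolding cgraph_def smooth_map_on_def by auto
  have OF: "Ovan K (?P x0) (Suc n) (\<lambda>x. f x j - f' x j)" if j: "j \<in> I - K" for j
    unfolding Ovan_iff[OF fK oV w0 smooth_diff[OF fK oV sm[OF j]]]
    using ipartial_diff[OF fK oV sm[OF j]] der[OF j] w0 by (auto simp: less_Suc_eq_le)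
  have smP: "smooth_real_on I V (\<lambda>x. ?P x i)" if "i \<in> K" for i
    using D(7)[of i] that K by (simp add: coord_proj_def subset_iff)
  have flP: "filterlim ?P (cnh K (?P x0)) (cnh I x0)" by (rule smooth_map_filterlim[OF I D(1) fK V smP]) simp_all
  have OP: "Ovan I x0 (Suc n) (\<lambda>x. f (?P x) j - f' (?P x) j)" if j: "j \<in> I - K" for j
  proof (rule Ovan_compose[OF I fK OF[OF j] _ _ flP])
    show "Ovan I x0 1 (\<lambda>x. ?P x i - ?P x0 i)" if "i \<in> K" for i by (rule Ovan_smooth1[OF I D(1) V smP[OF that]])
  qed simp
  obtain C where C: "C > 0" "\<forall>\<^sub>F x in cnh I x0. \<forall>j\<in>I-K. \<bar>f (?P x) j - f' (?P x) j\<bar> \<le> C * cdist I x0 x ^ Suc n"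
    using Ovan_all[where F = "\<lambda>j x. f (?P x) j - f' (?P x) j", OF I finite_Diff[OF I] OP] by blast
  \<comment> \<open>The vertical projection of \<open>\<tau> x\<close> to the graph of
    \<open>f'\<close>.\<close>
  define u where "u x = (\<lambda>i. if i \<in> K then \<tau> x i else if i \<in> I then f' (?P x) i else 0)" for x
  have us: "u x \<in> coord_space I" for x using K by (auto simp: u_def coord_space_def)
  have Pu: "coord_proj K (u x) = ?P x" for x by (auto simp: u_def coord_proj_def)
  have u0: "u x0 = \<tau> x0"
  proof
    fix i
    have "x0 \<in> {x\<in>V. \<forall>j\<in>I-K. \<tau> x j = f' (?P x) j}" using g(2) x0(2) V unfolding cgraph_def by blast
    moreover have "\<tau> x0 \<in> coord_space I" using D(3,10) V by blast
    ultimately show "u x0 i = \<tau> x0 i" by (auto simp: u_def coord_space_def)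
  qed
  have smu: "smooth_real_on I V (\<lambda>x. u x i)" if i: "i \<in> I" for i
  proof (cases "i \<in> K")
    case True
    then show ?thesis using D(7)[OF i] by (simp add: u_def)
  next
    case False
    have "smooth_real_on I V (\<lambda>x. f' (?P x) i)" by (rule smooth_comp[OF I D(1) fK oV _ sm(2) smP]) (use i False in auto)
    then show ?thesis using False i by (simp add: u_def)
  qed
  have flu: "filterlim u (cnh I (\<tau> x0)) (cnh I x0)" using smooth_map_filterlim[OF I D(1) I V smu us] by (simp add: u0)
  have flt: "filterlim \<tau> (cnh I (\<tau> x0)) (cnh I x0)" by (rule cdiffeo_filterlim[OF I d V])
  obtain L e where L: "L > 0" "e > 0" "\<And>x y. x \<in> coord_space I \<Longrightarrow> y \<in> coord_space I \<Longrightarrow>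
    cdist I (\<tau> x0) x < e \<Longrightarrow> cdist I (\<tau> x0) y < e \<Longrightarrow> cdist I (\<sigma> x) (\<sigma> y) \<le> L * cdist I x y"
    using smooth_lipschitz[where \<tau> = \<sigma>, OF I D(2) I D(3)[OF V] D(8)] by blast
  have "\<forall>\<^sub>F x in cnh I x0. x \<in> S \<longrightarrow> (\<exists>y\<in>T. cdist I x y \<le> (L * C) * cdist I x0 x ^ Suc n)"
    using C(2) cnh_copen[OF I D(1) V]
      flu[unfolded filterlim_iff, rule_format, OF cnh_copen[OF I D(2) D(3)[OF V]]]
      flu[unfolded filterlim_iff, rule_format, OF cnh_dist[OF L(2)]]
      flt[unfolded filterlim_iff, rule_format, OF cnh_dist[OF L(2)]]
  proof eventually_elim
    case (elim x)
    show ?case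
    proof
      assume xS: "x \<in> S"
      have sy: "\<sigma> (u x) \<in> V" "\<tau> (\<sigma> (u x)) = u x" using D(5,6) elim(3) by auto
      have "\<sigma> (u x) \<in> {x\<in>V. \<forall>j\<in>I-K. \<tau> x j = f' (?P x) j}" using sy by (auto simp: Pu) (simp add: u_def)
      then have yT: "\<sigma> (u x) \<in> T" using g(2) unfolding cgraph_def by blast
      have "x \<in> {x\<in>V. \<forall>j\<in>I-K. \<tau> x j = f (?P x) j}" using g(1) xS elim(2) unfolding cgraph_def by blast
      then have "\<bar>\<tau> x i - u x i\<bar> \<le> C * cdist I x0 x ^ Suc n" if "i \<in> I" for i
        using elim(1) that C(1) I by (cases "i \<in> K") (auto simp: u_def)
      then have "cdist I (\<tau> x) (u x) \<le> C * cdist I x0 x ^ Suc n" using C(1) I by (subst cdist_le_iff) auto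
      then have "L * cdist I (\<tau> x) (u x) \<le> L * (C * cdist I x0 x ^ Suc n)" using L(1) by simp
      moreover have "cdist I (\<sigma> (\<tau> x)) (\<sigma> (u x)) \<le> L * cdist I (\<tau> x) (u x)"
        by (rule L(3)) (use elim us D(3,10) in blast)+
      ultimately have "cdist I x (\<sigma> (u x)) \<le> L * (C * cdist I x0 x ^ Suc n)" using D(4)[OF elim(2)] by simp
      then show "\<exists>y\<in>T. cdist I x y \<le> (L * C) * cdist I x0 x ^ Suc n" using yT by (auto simp: mult.assoc)
    qed
  qed
  then show ?thesis unfolding near_def by blast
qed

lemma derivative_zero_of_quadratic:
  assumes d: "(\<phi> has_real_derivative D) (at (t0::real))" and z: "\<phi> t0 = 0"
    and q: "\<forall>\<^sub>F t in at t0. \<bar>\<phi> t\<bar> \<le> C * \<bar>t - t0\<bar> ^ 2"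
  shows "D = 0"
proof -
  have lim: "((\<lambda>t. (\<phi> t - \<phi> t0) / (t - t0)) \<longlongrightarrow> D) (at t0)" using d by (simp add: has_field_derivative_iff)
  have "((\<lambda>t. (\<phi> t - \<phi> t0) / (t - t0)) \<longlongrightarrow> 0) (at t0)"
  proof (rule Lim_null_comparison)
    have "\<forall>\<^sub>F t in at t0. t \<noteq> t0" by (simp add: eventually_at_filter)
    with q show "\<forall>\<^sub>F t in at t0. norm ((\<phi> t - \<phi> t0) / (t - t0)) \<le> C * \<bar>t - t0\<bar>"
      by eventually_elim (simp add: z power2_eq_square abs_divide pos_divide_le_eq mult.assoc)
    have "((\<lambda>t. C * \<bar>t - t0\<bar>) \<longlongrightarrow> C * \<bar>t0 - t0\<bar>) (at t0)" by (intro tendsto_intros)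
    then show "((\<lambda>t. C * \<bar>t - t0\<bar>) \<longlongrightarrow> 0) (at t0)" by simp
  qed
  then show ?thesis using lim tendsto_unique trivial_limit_at by blast
qed

text \<open>Nearness of order 2 transfers tangent directions: along a coordinate line of
  \<open>S\<close> the equations of \<open>T\<close> are quadratically small, so their first
  derivatives vanish.\<close>

lemma flat_tangent:
  assumes I: "finite I" and t: "cdiffeo I V V' \<tau> \<sigma>" and r: "cdiffeo I V U' \<rho> \<pi>" and x0: "x0 \<in> V"
    and S: "S \<inter> V = {x\<in>V. \<forall>l\<in>I-L. \<rho> x l = 0}" and T: "T \<inter> V = {x\<in>V. \<forall>j\<in>I-K. \<tau> x j = 0}"
    and x0S: "x0 \<in> S" and x0T: "x0 \<in> T" and Tc: "T \<subseteq> coord_space I" and n: "near I x0 2 S T" and L: "L \<subseteq> I"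
    and l: "l \<in> L" and j: "j \<in> I - K"
  shows "pd l (\<lambda>w. \<tau> (\<pi> w) j) (\<rho> x0) = 0"
proof -
  note D = cdiffeoD[OF t] and R = cdiffeoD[OF r]
  let ?w0 = "\<rho> x0"
  have w0: "?w0 \<in> U'" "\<pi> ?w0 = x0" using R(3,4) x0 by auto
  have lI: "l \<in> I" using l L by blast
  obtain C where C: "C > 0" "\<forall>\<^sub>F x in cnh I x0. x \<in> S \<longrightarrow> (\<forall>j\<in>I-K. \<bar>\<tau> x j\<bar> \<le> C * cdist I x0 x ^ 2)"
    using near_flat[OF I t x0 _ n Tc T] by auto
  obtain M where M: "M > 0" "\<forall>\<^sub>F w in cnh I ?w0. cdist I (\<pi> ?w0) (\<pi> w) \<le> M * cdist I ?w0 w"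
    using cdiffeo_dist[OF I cdiffeo_sym[OF r] w0(1)] .
  have fl: "filterlim \<pi> (cnh I x0) (cnh I ?w0)" using cdiffeo_filterlim[OF I cdiffeo_sym[OF r] w0(1)] w0(2) by simp
  let ?\<gamma> = "\<lambda>s. ?w0(l := s)"
  have w0c: "?w0 \<in> coord_space I" using R(10) w0 by blast
  have flg: "filterlim ?\<gamma> (cnh I ?w0) (at (?w0 l))"
  proof (rule cnh_map[OF I])
    show "((\<lambda>s. (?w0(l := s)) i) \<longlongrightarrow> ?w0 i) (at (?w0 l))" for i by (cases "i = l") auto
    show "\<forall>\<^sub>F x in at (\<rho> x0 l). (\<rho> x0)(l := x) \<in> coord_space I" using w0c lI by simp
  qed
  have "\<forall>\<^sub>F w in cnh I ?w0. (\<forall>i\<in>I-L. w i = 0) \<longrightarrow> \<bar>\<tau> (\<pi> w) j\<bar> \<le> (C * M ^ 2) * cdist I ?w0 w ^ 2"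
    using fl[unfolded filterlim_iff, rule_format, OF C(2)] M(2) cnh_copen[OF I R(2) w0(1)]
  proof eventually_elim
    case (elim w)
    show ?case
    proof
      assume "\<forall>i\<in>I-L. w i = 0"
      then have "\<pi> w \<in> {x\<in>V. \<forall>l\<in>I-L. \<rho> x l = 0}" using R(5,6)[OF elim(3)] by simp
      then have "\<pi> w \<in> S" using S by blast
      then have "\<bar>\<tau> (\<pi> w) j\<bar> \<le> C * cdist I x0 (\<pi> w) ^ 2" using elim(1) j by blast
      also have "\<dots> \<le> C * (M * cdist I ?w0 w) ^ 2" using elim(2) w0(2) C(1) I by (intro mult_left_mono power_mono) auto
      finally show "\<bar>\<tau> (\<pi> w) j\<bar> \<le> (C * M ^ 2) * cdist I ?w0 w ^ 2" by (simp add: power_mult_distrib)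
    qed
  qed
  from flg[unfolded filterlim_iff, rule_format, OF this]
  have ev: "\<forall>\<^sub>F s in at (?w0 l). \<bar>\<tau> (\<pi> (?\<gamma> s)) j\<bar> \<le> (C * M ^ 2) * \<bar>s - ?w0 l\<bar> ^ 2"
  proof eventually_elim
    case (elim s)
    have "x0 \<in> {x\<in>V. \<forall>l\<in>I-L. \<rho> x l = 0}" using S x0S x0 by blast
    then have "\<forall>i\<in>I-L. (?\<gamma> s) i = 0" using l by auto
    moreover have "cdist I ?w0 (?\<gamma> s) = \<bar>s - ?w0 l\<bar>"
      using cdist_upd_both[OF I lI, of ?w0 "?w0 l" s] by (simp add: abs_minus_commute)
    ultimately show ?case using elim by metis
  qed
  have sm: "smooth_real_on I U' (\<lambda>w. \<tau> (\<pi> w) j)" by (rule smooth_comp[OF I R(2) I D(1) _ D(7) R(8)]) (use R(5) j in auto)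
  have "x0 \<in> {x\<in>V. \<forall>j\<in>I-K. \<tau> x j = 0}" using T x0T x0 by blast
  then have z: "\<tau> (\<pi> (?\<gamma> (?w0 l))) j = 0" using j w0(2) by simp
  show ?thesis by (rule derivative_zero_of_quadratic[OF pd_has_derivative'[OF smooth_pdiff[OF sm] lI w0(1)] z ev])
qed

text \<open>As \<open>n \<ge> 1\<close>, nearness of order 2 holds both ways and the tangent spaces
  at \<open>x0\<close> coincide. So in coordinates flattening \<open>T\<close> the equations of
  \<open>S\<close> can be solved for the transverse coordinates. This presents \<open>S\<close> as a
  graph over the same coordinates \<open>K\<close> over which \<open>T\<close> is the graph of 0,
  and nearness bounds the graph function.\<close>

lemma near_ccontact:
  assumes I: "finite I" and n: "1 \<le> n" and Q: "copen I Q" and x0: "x0 \<in> Q"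
    and sS: "slice I x0 p S" and sT: "slice I x0 p T" and x0S: "x0 \<in> S" and x0T: "x0 \<in> T"
    and Sc: "S \<subseteq> coord_space I" and Tc: "T \<subseteq> coord_space I"
    and nST: "near I x0 (Suc n) S T" and nTS: "near I x0 (Suc n) T S"
  shows "ccontact I Q x0 p n S T"
proof -
  obtain Va Va' \<tau> \<sigma> K where a: "x0 \<in> Va" "cdiffeo I Va Va' \<tau> \<sigma>" "K \<subseteq> I" "card K = p"
    "T \<inter> Va = {x\<in>Va. \<forall>l\<in>I-K. \<tau> x l = 0}" using sT unfolding slice_def by blast
  obtain Vb Vb' \<rho> \<pi> L where b: "x0 \<in> Vb" "cdiffeo I Vb Vb' \<rho> \<pi>" "L \<subseteq> I" "card L = p"
    "S \<inter> Vb = {x\<in>Vb. \<forall>l\<in>I-L. \<rho> x l = 0}" using sS unfolding slice_def by blast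
  define V where "V = Q \<inter> (Va \<inter> Vb)"
  have oV: "copen I V" unfolding V_def by (intro copen_Int Q cdiffeoD(1)[OF a(2)] cdiffeoD(1)[OF b(2)])
  have xV: "x0 \<in> V" using a(1) b(1) x0 by (simp add: V_def)
  define V' where "V' = {y\<in>Va'. \<sigma> y \<in> V}"
  define U' where "U' = {y\<in>Vb'. \<pi> y \<in> V}"
  have t: "cdiffeo I V V' \<tau> \<sigma>" unfolding V'_def by (rule cdiffeo_restrict[OF I a(2) oV]) (auto simp: V_def)
  have r: "cdiffeo I V U' \<rho> \<pi>" unfolding U'_def by (rule cdiffeo_restrict[OF I b(2) oV]) (auto simp: V_def)
  have T: "T \<inter> V = {x\<in>V. \<forall>l\<in>I-K. \<tau> x l = 0}" using a(5) unfolding V_def by blast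
  have S: "S \<inter> V = {x\<in>V. \<forall>l\<in>I-L. \<rho> x l = 0}" using b(5) unfolding V_def by blast
  note D = cdiffeoD[OF t] and R = cdiffeoD[OF r]
  note K = a(3) and L = b(3)
  have fK: "finite K" using I K finite_subset by blast
  let ?u0 = "\<tau> x0" and ?w0 = "\<rho> x0"
  have u0: "?u0 \<in> V'" "\<sigma> ?u0 = x0" and w0: "?w0 \<in> U'" "\<pi> ?w0 = x0" using D(3,4) R(3,4) xV by auto
  define \<Theta> where "\<Theta> u = \<rho> (\<sigma> u)" for u
  define \<Psi> where "\<Psi> w = \<tau> (\<pi> w)" for w
  have dT: "cdiffeo I V' U' \<Theta> \<Psi>"
    unfolding \<Theta>_def[abs_def] \<Psi>_def[abs_def] by (rule cdiffeo_comp[OF I cdiffeo_sym[OF t] r])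
  have Tu0: "\<Theta> ?u0 = ?w0" "\<Psi> ?w0 = ?u0" using u0 w0 by (auto simp: \<Theta>_def \<Psi>_def)
  have n2: "near I x0 2 S T" "near I x0 2 T S" using near_mono[OF I nST, of 2] near_mono[OF I nTS, of 2] n by auto
  have tan1: "pd l (\<lambda>w. \<Psi> w j) ?w0 = 0" if "l \<in> L" "j \<in> I - K" for l j
    unfolding \<Psi>_def by (rule flat_tangent[OF I t r xV S T x0S x0T Tc n2(1) L that])
  have tan2: "pd j (\<lambda>u. \<Theta> u l) ?u0 = 0" if "j \<in> K" "l \<in> I - L" for l j
    unfolding \<Theta>_def by (rule flat_tangent[OF I r t xV T S x0T x0S Sc n2(2) K that])
  \<comment> \<open>Transverse blocks of the Jacobians of the two coordinate changes. By
    \<open>tan1\<close> and \<open>tan2\<close> the mixed blocks vanish, so \<open>B\<close> and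
    \<open>C\<close> are inverse to each other.\<close>
  define B where "B j l = pd l (\<lambda>w. \<Psi> w j) ?w0" for j l
  define C where "C l j = pd j (\<lambda>u. \<Theta> u l) ?u0" for j l
  have BC: "(\<Sum>l\<in>I-L. B j l * C l b) = (if b = j then 1 else 0)" if "j \<in> I - K" "b \<in> I" for j b
  proof -
    have "(\<Sum>l\<in>I. B j l * C l b) = (if b = j then 1 else 0)"
      using cdiffeo_pd_inverse[OF I dT u0(1), of j b] that by (simp add: B_def C_def Tu0)
    moreover have "(\<Sum>l\<in>I-L. B j l * C l b) = (\<Sum>l\<in>I. B j l * C l b)"
      by (rule sum.mono_neutral_left) (use I tan1 that in \<open>auto simp: B_def\<close>)
    ultimately show ?thesis by simp
  qed
  have CB: "(\<Sum>j\<in>I-K. C l' j * B j l) = (if l = l' then 1 else 0)" if "l' \<in> I - L" "l \<in> I" for l l'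
  proof -
    have "(\<Sum>j\<in>I. C l' j * B j l) = (if l = l' then 1 else 0)"
      using cdiffeo_pd_inverse[OF I cdiffeo_sym[OF dT] w0(1), of l' l] that by (simp add: B_def C_def Tu0)
    moreover have "(\<Sum>j\<in>I-K. C l' j * B j l) = (\<Sum>j\<in>I. C l' j * B j l)"
      by (rule sum.mono_neutral_left) (use I tan2 that in \<open>auto simp: C_def\<close>)
    ultimately show ?thesis by simp
  qed
  \<comment> \<open>The equations of \<open>S\<close>, multiplied by \<open>B\<close> so that
    \<open>F\<close> has identity derivative at \<open>?u0\<close>, as \<open>local_inverse\<close>
    requires. Since \<open>B\<close> is invertible, the zero set of the transverse components is
    still \<open>S\<close>.\<close>
  define F where "F u = (\<lambda>i. if i \<in> K then u i else if i \<in> I then \<Sum>l\<in>I-L. B i l * \<Theta> u l else 0)" for u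
  have Fc: "F u \<in> coord_space I" for u using K by (auto simp: F_def coord_space_def)
  have smF: "smooth_real_on I V' (\<lambda>u. F u i)" if "i \<in> I" for i
  proof (cases "i \<in> K")
    case False
    have "smooth_real_on I V' (\<lambda>u. \<Sum>l\<in>I-L. B i l * \<Theta> u l)"
      by (intro smooth_sum[OF I D(2)] smooth_mult[OF I D(2)] smooth_const cdiffeoD(7)[OF dT]) auto
    then show ?thesis using False that by (simp add: F_def)
  qed (simp add: F_def)
  have pdF: "pd b (\<lambda>u. F u i) ?u0 = (if b = i then 1 else 0)" if ib: "i \<in> I" "b \<in> I" for i b
  proof (cases "i \<in> K")
    case False
    have "pd b (\<lambda>u. \<Sum>l\<in>I-L. B i l * \<Theta> u l) ?u0 = (\<Sum>l\<in>I-L. pd b (\<lambda>u. B i l * \<Theta> u l) ?u0)"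
      by (rule pd_sum[OF I D(2) finite_Diff[OF I] _ ib(2) u0(1)])
         (intro smooth_pdiff smooth_mult[OF I D(2)] smooth_const cdiffeoD(7)[OF dT], auto)
    also have "\<dots> = (\<Sum>l\<in>I-L. B i l * C l b)" unfolding C_def
      by (rule sum.cong[OF refl], rule pd_cmult[OF I D(2) smooth_pdiff[OF cdiffeoD(7)[OF dT]] ib(2) u0(1)]) auto
    also have "\<dots> = (if b = i then 1 else 0)" using BC[of i b] ib False by simp
    finally show ?thesis using False ib by (simp add: F_def)
  qed (simp add: F_def pd_coord)
  obtain W W1 G where W: "?u0 \<in> W" "W \<subseteq> V'" and dF: "cdiffeo I W W1 F G" by (rule local_inverse[OF I D(2) u0(1) Fc smF pdF])
  note E = cdiffeoD[OF dF]
  have Fflat: "(\<forall>l\<in>I-L. \<Theta> u l = 0) \<longleftrightarrow> (\<forall>j\<in>I-K. F u j = 0)" for u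
  proof
    assume z: "\<forall>j\<in>I-K. F u j = 0"
    show "\<forall>l\<in>I-L. \<Theta> u l = 0"
    proof
      fix l' assume l': "l' \<in> I - L"
      have "\<Theta> u l' = (\<Sum>l\<in>I-L. (if l = l' then 1 else 0) * \<Theta> u l)"
        using I l' by (simp add: if_distrib[of "\<lambda>x. x * _"] cong: if_cong)
      also have "\<dots> = (\<Sum>l\<in>I-L. (\<Sum>j\<in>I-K. C l' j * B j l) * \<Theta> u l)" by (rule sum.cong) (use CB[OF l'] in auto)
      also have "\<dots> = (\<Sum>l\<in>I-L. \<Sum>j\<in>I-K. C l' j * (B j l * \<Theta> u l))"
        by (simp add: sum_distrib_right mult.assoc)
      also have "\<dots> = (\<Sum>j\<in>I-K. \<Sum>l\<in>I-L. C l' j * (B j l * \<Theta> u l))" by (rule sum.swap)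
      also have "\<dots> = (\<Sum>j\<in>I-K. C l' j * F u j)" by (rule sum.cong) (auto simp: F_def sum_distrib_left)
      also have "\<dots> = 0" using z by simp
      finally show "\<Theta> u l' = 0" .
    qed
  qed (auto simp: F_def)
  have flat_proj: "(\<forall>j\<in>I-K. F u j = 0) \<longleftrightarrow> F u = coord_proj K u" for u
    using K by (auto simp: F_def coord_proj_def fun_eq_iff)
  have Fu0: "F ?u0 = coord_proj K ?u0"
  proof -
    have "x0 \<in> {x\<in>V. \<forall>l\<in>I-L. \<rho> x l = 0}" using S x0S xV by blast
    then have "\<forall>l\<in>I-L. \<Theta> ?u0 l = 0" using Tu0 by simp
    then show ?thesis using Fflat flat_proj by blast
  qed
  define W2 where "W2 = {u\<in>W. coord_proj K u \<in> W1}"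
  have oW2: "copen I W2" unfolding W2_def
  proof (rule copen_preimage[OF I I E(1,2)])
    show "continuous_on W (\<lambda>x. coord_proj K x j)" for j by (cases "j \<in> K") (auto simp: coord_proj_def continuous_on_coord)
    show "coord_proj K ` W \<subseteq> coord_space I" using coord_space_mono[OF K] coord_proj_in by blast
  qed
  have u0W2: "?u0 \<in> W2" using W(1) E(3)[OF W(1)] Fu0 by (simp add: W2_def)
  define V2 where "V2 = {x\<in>V. \<tau> x \<in> W2}"
  have W2V: "W2 \<subseteq> V'" using W(2) by (auto simp: W2_def)
  have d2: "cdiffeo I V2 W2 \<tau> \<sigma>" unfolding V2_def by (rule cdiffeo_restrict_target[OF I t oW2 W2V])
  \<comment> \<open>\<open>S\<close> is given by \<open>F u = coord_proj K u\<close>, that is by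
    \<open>u = G (coord_proj K u)\<close>; its graph function is the transverse part of
    \<open>G\<close>.\<close>
  define f where "f v = coord_proj (I - K) (G v)" for v
  have imV2: "\<tau> ` V2 = W2" using cdiffeoD(3,5,6)[OF d2] by (auto simp: image_iff) metis
  let ?A = "coord_proj K ` W2"
  have oA: "copen K ?A" by (rule copen_coord_proj[OF I K oW2])
  have AW: "?A \<subseteq> W1" by (auto simp: W2_def)
  have smG: "smooth_real_on K ?A (\<lambda>v. G v j)" if "j \<in> I" for j
    by (rule smooth_subset[OF smooth_fewer_coords[OF E(8)[OF that] K] AW])
  have fj: "f v j = G v j" if "j \<in> I - K" for v j using that by (simp add: f_def coord_proj_def)
  have smf: "smooth_real_on K ?A (\<lambda>v. f v j)" if "j \<in> I - K" for j using smG[of j] that by (simp add: f_def coord_proj_def)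
  have Gpr: "G v i = v i" if "v \<in> W1" "i \<in> K" for v i
  proof -
    have "F (G v) i = G v i" using that(2) by (simp add: F_def)
    then show ?thesis using E(6)[OF that(1)] by simp
  qed
  have gS: "cgraph I V2 \<tau> K f S" unfolding cgraph_def imV2
  proof (intro conjI)
    show "smooth_map_on K ?A (I - K) f" unfolding smooth_map_on_def using smf by (auto simp: f_def)
    have "x \<in> S \<longleftrightarrow> (\<forall>j\<in>I-K. \<tau> x j = f (coord_proj K (\<tau> x)) j)" if x: "x \<in> V2" for x
    proof -
      have xV: "x \<in> V" "\<tau> x \<in> W" "coord_proj K (\<tau> x) \<in> W1" using x by (auto simp: V2_def W2_def)
      have "x \<in> S \<longleftrightarrow> (\<forall>l\<in>I-L. \<Theta> (\<tau> x) l = 0)" using S xV(1) D(4) by (auto simp: \<Theta>_def)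
      also have "\<dots> \<longleftrightarrow> F (\<tau> x) = coord_proj K (\<tau> x)" using Fflat flat_proj by blast
      also have "\<dots> \<longleftrightarrow> \<tau> x = G (coord_proj K (\<tau> x))" using E(4)[OF xV(2)] E(6)[OF xV(3)] by metis
      also have "\<dots> \<longleftrightarrow> (\<forall>j\<in>I-K. \<tau> x j = f (coord_proj K (\<tau> x)) j)"
      proof
        assume e: "\<tau> x = G (coord_proj K (\<tau> x))"
        show "\<forall>j\<in>I-K. \<tau> x j = f (coord_proj K (\<tau> x)) j" by (intro ballI trans[OF fun_cong[OF e] fj[symmetric]])
      next
        assume e: "\<forall>j\<in>I-K. \<tau> x j = f (coord_proj K (\<tau> x)) j"
        show "\<tau> x = G (coord_proj K (\<tau> x))"
        proof
          fix i
          consider "i \<in> K" | "i \<in> I - K" | "i \<notin> I" by blast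
          then show "\<tau> x i = G (coord_proj K (\<tau> x)) i"
          proof cases
            case 1 then show ?thesis using Gpr[OF xV(3) 1] by (simp add: coord_proj_def)
          next
            case 2 then show ?thesis using e fj by simp
          next
            case 3
            have "\<tau> x \<in> coord_space I" "G (coord_proj K (\<tau> x)) \<in> coord_space I"
              using D(3,10) xV(1) E(5,9) xV(3) by blast+
            then show ?thesis using 3 by (simp add: coord_space_def)
          qed
        qed
      qed
      finally show ?thesis .
    qed
    then show "S \<inter> V2 = {x \<in> V2. \<forall>j\<in>I - K. \<tau> x j = f (coord_proj K (\<tau> x)) j}" by blast
  qed
  have gT: "cgraph I V2 \<tau> K (\<lambda>_ _. 0) T" unfolding cgraph_def
  proof (intro conjI)
    show "smooth_map_on K (coord_proj K ` \<tau> ` V2) (I - K) (\<lambda>_ _. 0)" by (auto simp: smooth_map_on_def coord_space_def)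
    show "T \<inter> V2 = {x \<in> V2. \<forall>j\<in>I - K. \<tau> x j = 0}" using T unfolding V2_def by blast
  qed
  obtain c where c: "c > 0" "\<forall>\<^sub>F x in cnh I x0. x \<in> S \<longrightarrow> (\<forall>j\<in>I-K. \<bar>\<tau> x j\<bar> \<le> c * cdist I x0 x ^ Suc n)"
    using near_flat[OF I t xV _ nST Tc T] n by auto
  let ?v0 = "coord_proj K ?u0"
  have v0: "?v0 \<in> W1" "G ?v0 = ?u0" "?v0 \<in> ?A" using E(3)[OF W(1)] Fu0 E(4)[OF W(1)] u0W2 by auto
  have dG: "cdiffeo I W1 {x\<in>V. \<tau> x \<in> W} (\<lambda>v. \<sigma> (G v)) (\<lambda>x. F (\<tau> x))"
    by (rule cdiffeo_comp[OF I cdiffeo_sym[OF dF] cdiffeo_sym[OF cdiffeo_restrict_target[OF I t E(1) W(2)]]])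
  have flG: "filterlim (\<lambda>v. \<sigma> (G v)) (cnh I x0) (cnh I ?v0)" using cdiffeo_filterlim[OF I dG v0(1)] v0(2) u0(2) by simp
  obtain M where M: "M > 0" "\<forall>\<^sub>F v in cnh I ?v0. cdist I (\<sigma> (G ?v0)) (\<sigma> (G v)) \<le> M * cdist I ?v0 v"
    using cdiffeo_dist[OF I dG v0(1)] .
  \<comment> \<open>The values of \<open>f\<close> are the transverse coordinates of points of
    \<open>S\<close>, and these are small because \<open>S\<close> is near the flat set
    \<open>T\<close>.\<close>
  have ev: "\<forall>\<^sub>F v in cnh I ?v0. v \<in> ?A \<longrightarrow> (\<forall>j\<in>I-K. \<bar>f v j\<bar> \<le> (c * M ^ Suc n) * cdist I ?v0 v ^ Suc n)"
    using flG[unfolded filterlim_iff, rule_format, OF c(2)] M(2)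
  proof eventually_elim
    case (elim v)
    show ?case
    proof (intro impI ballI)
      fix j assume vA: "v \<in> ?A" and j: "j \<in> I - K"
      have vW: "v \<in> W1" using vA AW by blast
      have vK: "v \<in> coord_space K" using vA by auto
      have GW: "G v \<in> W" "F (G v) = v" "G v \<in> V'" using E(5,6)[OF vW] W(2) by auto
      have "\<forall>j\<in>I-K. F (G v) j = 0" using GW(2) vK by (simp add: coord_space_def)
      then have "\<forall>l\<in>I-L. \<Theta> (G v) l = 0" using Fflat by blast
      then have "\<sigma> (G v) \<in> S" using S D(5)[OF GW(3)] by (auto simp: \<Theta>_def)
      then have "\<bar>\<tau> (\<sigma> (G v)) j\<bar> \<le> c * cdist I x0 (\<sigma> (G v)) ^ Suc n" using elim(1) j by blast
      also have "\<dots> \<le> c * (M * cdist I ?v0 v) ^ Suc n" using elim(2) v0(2) u0(2) c(1) I by (intro mult_left_mono power_mono) auto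
      finally show "\<bar>f v j\<bar> \<le> (c * M ^ Suc n) * cdist I ?v0 v ^ Suc n"
        using D(6)[OF GW(3)] fj[OF j] by (simp add: power_mult_distrib ac_simps)
    qed
  qed
  have der: "ipartial bs (\<lambda>x. f x j) ?v0 = ipartial bs (\<lambda>x. 0) ?v0"
    if j: "j \<in> I - K" and bs: "set bs \<subseteq> K" "length bs \<le> n" for j bs
  proof -
    have "\<forall>\<^sub>F v in cnh K ?v0. \<bar>f v j\<bar> \<le> (c * M ^ Suc n) * cdist K ?v0 v ^ Suc n"
      using cnh_sub[OF I K coord_proj_in ev] cnh_copen[OF fK oA v0(3)] cnh_space[of K ?v0]
    proof eventually_elim
      case (elim v)
      then show ?case using j cdist_sub[OF I K _ elim(3), of ?v0] by simp
    qed
    then have "Ovan K ?v0 (Suc n) (\<lambda>v. f v j)" unfolding Ovan_def by blast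
    then show ?thesis using Ovan_iff[OF fK oA v0(3) smf[OF j]] bs by (simp add: ipartial_zero)
  qed
  show ?thesis unfolding ccontact_def
    by (rule exI[of _ V2], rule exI[of _ W2], rule exI[of _ \<tau>], rule exI[of _ \<sigma>], rule exI[of _ K], rule exI[of _ f],
        rule exI[of _ "\<lambda>_ _. 0"])
       (use d2 K a(4) gS gT der u0W2 xV in \<open>auto simp: V2_def V_def\<close>)
qed

lemma sliceI:
  assumes "x0 \<in> V" "cdiffeo I V V' \<tau> \<sigma>" "K \<subseteq> I" "card K = p" "S \<inter> V = {x\<in>V. \<forall>l\<in>I-K. \<tau> x l = 0}"
  shows "slice I x0 p S"
  unfolding slice_def
  by (rule exI[of _ V], rule exI[of _ V'], rule exI[of _ \<tau>], rule exI[of _ \<sigma>], rule exI[of _ K]) (use assms in simp)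

section \<open>Charts\<close>

lemma cdiffeo_restrict_image:
  assumes I: "finite I" and d: "cdiffeo I V V' \<tau> \<sigma>" and W: "copen I W" "W \<subseteq> V"
  shows "cdiffeo I W (\<tau> ` W) \<tau> \<sigma>"
proof -
  note D = cdiffeoD[OF d]
  have "{y\<in>V'. \<sigma> y \<in> W} = \<tau> ` W"
  proof
    show "{y\<in>V'. \<sigma> y \<in> W} \<subseteq> \<tau> ` W" using D(6) by force
    show "\<tau> ` W \<subseteq> {y\<in>V'. \<sigma> y \<in> W}" using D(3,4) W(2) by auto
  qed
  then show ?thesis using cdiffeo_restrict[OF I d W] by simp
qed

context
  fixes I :: "'i set" and A :: "('x, 'i) chart set"
  assumes at: "smooth_atlas I A"
begin

lemma atlas_finite: "finite I" using at by (simp add: smooth_atlas_def)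

lemma chart_inj: "c \<in> A \<Longrightarrow> inj_on (snd c) (fst c)"
  and chart_copen: "c \<in> A \<Longrightarrow> copen I (snd c ` fst c)"
  using at unfolding smooth_atlas_def by blast+

lemma cinv_left: "c \<in> A \<Longrightarrow> q \<in> fst c \<Longrightarrow> cinv c (snd c q) = q" by (rule inv_into_f_f[OF chart_inj])

lemma cinv_right: "x \<in> snd c ` fst c \<Longrightarrow> snd c (cinv c x) = x" by (rule f_inv_into_f)

lemma cinv_in: "x \<in> snd c ` fst c \<Longrightarrow> cinv c x \<in> fst c" by (rule inv_into_into)

lemma chart_coord: "c \<in> A \<Longrightarrow> q \<in> fst c \<Longrightarrow> snd c q \<in> coord_space I"
  using copen_sub[OF chart_copen] by blast

lemma chart_mem: "c \<in> A \<Longrightarrow> q \<in> fst c \<Longrightarrow> W \<subseteq> fst c \<Longrightarrow> snd c q \<in> snd c ` W \<longleftrightarrow> q \<in> W"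
  by (rule inj_on_image_mem_iff[OF chart_inj])

lemma transition:
  assumes c: "c \<in> A" and d: "d \<in> A"
  shows "cdiffeo I (snd c ` (fst c \<inter> fst d)) (snd d ` (fst c \<inter> fst d))
    (\<lambda>x. snd d (cinv c x)) (\<lambda>y. snd c (cinv d y))"
proof -
  have o: "copen I (snd c ` (fst c \<inter> fst d))" "copen I (snd d ` (fst c \<inter> fst d))"
    using at c d unfolding smooth_atlas_def by (auto simp: Int_commute)
  have s: "smooth_map_on I (snd c ` (fst c \<inter> fst d)) I (snd d \<circ> cinv c)"
    "smooth_map_on I (snd d ` (fst d \<inter> fst c)) I (snd c \<circ> cinv d)"
    using at c d unfolding smooth_atlas_def by auto
  show ?thesis unfolding cdiffeo_def using o s c d by (auto simp: smooth_map_on_def cinv_left Int_commute)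
qed

text \<open>Induction over the generation of the topology; a basic set lives in another chart and is
  carried over by the transition map.\<close>

lemma atlas_open_image:
  assumes "openin (atlas_topology I A) W" and c: "c \<in> A"
  shows "copen I (snd c ` (W \<inter> fst c))"
proof -
  have "generate_topology_on {W. \<exists>c\<in>A. W \<subseteq> fst c \<and> copen I (snd c ` W)} W"
    using assms(1) unfolding atlas_topology_def by (rule openin_topology_generated_by)
  then show ?thesis
  proof (induction rule: generate_topology_on.induct)
    case (Int a b)
    have "snd c ` (a \<inter> b \<inter> fst c) = snd c ` (a \<inter> fst c) \<inter> snd c ` (b \<inter> fst c)"
      using chart_inj[OF c] by (auto dest: inj_onD)
    then show ?case using Int.IH by auto
  next
    case (UN K)
    have "snd c ` (\<Union>K \<inter> fst c) = \<Union>((\<lambda>k. snd c ` (k \<inter> fst c)) ` K)" by blast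
    moreover have "copen I \<dots>" by (rule openin_Union) (use UN.IH in auto)
    ultimately show ?case by simp
  next
    case (Basis s)
    then obtain d where d: "d \<in> A" "s \<subseteq> fst d" "copen I (snd d ` s)" by blast
    note D = cdiffeoD[OF transition[OF c d(1)]]
    have "copen I {x \<in> snd c ` (fst c \<inter> fst d). snd d (cinv c x) \<in> snd d ` s}"
      by (rule copen_preimage[OF atlas_finite atlas_finite D(1) d(3) smooth_continuous[OF D(7)]
          order_trans[OF image_subsetI[OF D(3)] D(10)]])
    moreover have "{x \<in> snd c ` (fst c \<inter> fst d). snd d (cinv c x) \<in> snd d ` s} = snd c ` (s \<inter> fst c)"
    proof (intro set_eqI iffI)
      fix x assume "x \<in> {x \<in> snd c ` (fst c \<inter> fst d). snd d (cinv c x) \<in> snd d ` s}"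
      then obtain q where q: "q \<in> fst c" "q \<in> fst d" "x = snd c q" "snd d q \<in> snd d ` s" using cinv_left[OF c] by auto
      then show "x \<in> snd c ` (s \<inter> fst c)" using chart_mem[OF d(1) q(2) d(2)] by blast
    next
      fix x assume "x \<in> snd c ` (s \<inter> fst c)"
      then obtain q where "q \<in> s" "q \<in> fst c" "x = snd c q" by blast
      then show "x \<in> {x \<in> snd c ` (fst c \<inter> fst d). snd d (cinv c x) \<in> snd d ` s}" using d(2) cinv_left[OF c] by auto
    qed
    ultimately show ?case by simp
  qed simp
qed

lemma atlas_openI: "c \<in> A \<Longrightarrow> W \<subseteq> fst c \<Longrightarrow> copen I (snd c ` W) \<Longrightarrow> openin (atlas_topology I A) W"
  unfolding atlas_topology_def by (rule topology_generated_by_Basis) auto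

lemma chart_open: "c \<in> A \<Longrightarrow> openin (atlas_topology I A) (fst c)" by (rule atlas_openI[OF _ order_refl chart_copen])

lemma atlas_topspace: "topspace (atlas_topology I A) = points A"
proof
  show "topspace (atlas_topology I A) \<subseteq> points A" unfolding atlas_topology_def points_def by auto
  show "points A \<subseteq> topspace (atlas_topology I A)" using openin_subset[OF chart_open] by (auto simp: points_def)
qed

lemma smooth_atlas_insertI:
  assumes inj: "inj_on (snd e) (fst e)" and op: "copen I (snd e ` fst e)"
    and tr: "\<And>d. d \<in> A \<Longrightarrow> cdiffeo I (snd e ` (fst e \<inter> fst d)) (snd d ` (fst e \<inter> fst d))
      (\<lambda>x. snd d (cinv e x)) (\<lambda>y. snd e (cinv d y))"
  shows "smooth_atlas I (insert e A)"
proof -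
  have P: "copen I (snd c ` (fst c \<inter> fst d)) \<and> smooth_map_on I (snd c ` (fst c \<inter> fst d)) I (snd d \<circ> cinv c)"
    if "cdiffeo I (snd c ` (fst c \<inter> fst d)) V' (\<lambda>x. snd d (cinv c x)) \<sigma>" for c d :: "('x, 'i) chart" and V' \<sigma>
    using cdiffeoD(1,3,7,10)[OF that] by (auto simp: smooth_map_on_def image_subset_iff subset_iff)
  have ee: "cdiffeo I (snd e ` (fst e \<inter> fst e)) (snd e ` (fst e \<inter> fst e)) (\<lambda>x. snd e (cinv e x)) (\<lambda>x. snd e (cinv e x))"
    by (rule cdiffeo_cong[OF atlas_finite cdiffeo_id]) (use op in \<open>auto simp: cinv_right[symmetric] f_inv_into_f\<close>)
  have ed: "cdiffeo I (snd d ` (fst d \<inter> fst e)) (snd e ` (fst e \<inter> fst d)) (\<lambda>x. snd e (cinv d x)) (\<lambda>y. snd d (cinv e y))"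
    if "d \<in> A" for d using cdiffeo_sym[OF tr[OF that]] by (simp add: Int_commute)
  show ?thesis unfolding smooth_atlas_def
  proof (intro conjI ballI)
    fix c d assume "c \<in> insert e A" "d \<in> insert e A"
    then have "copen I (snd c ` (fst c \<inter> fst d)) \<and> smooth_map_on I (snd c ` (fst c \<inter> fst d)) I (snd d \<circ> cinv c)"
      using P[OF ee] P[OF tr] P[OF ed] P[OF transition] by blast
    then show "copen I (snd c ` (fst c \<inter> fst d))" "smooth_map_on I (snd c ` (fst c \<inter> fst d)) I (snd d \<circ> cinv c)" by auto
  qed (use inj op chart_inj chart_copen atlas_finite in auto)
qed

text \<open>Turns coordinates constructed inside one chart into charts of the maximal atlas, over
  which \<open>contact\<close> and embedded submanifolds quantify.\<close>

lemma admissible_from_cdiffeo: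
  assumes c: "c \<in> A" and d: "cdiffeo I V V' \<tau> \<sigma>" and V: "V \<subseteq> snd c ` fst c"
  shows "admissible_chart I A (cinv c ` V, \<lambda>q. \<tau> (snd c q))"
proof -
  note D = cdiffeoD[OF d]
  let ?e = "(cinv c ` V, \<lambda>q. \<tau> (snd c q))"
  have sc: "snd c (cinv c x) = x" "cinv c x \<in> fst c" if "x \<in> V" for x
    using cinv_right[OF subsetD[OF V that]] cinv_in[OF subsetD[OF V that]] .
  have inj: "inj_on (snd ?e) (fst ?e)"
  proof (rule inj_onI)
    fix q r assume "q \<in> fst ?e" "r \<in> fst ?e" and e: "snd ?e q = snd ?e r"
    then obtain x y where xy: "x \<in> V" "q = cinv c x" "y \<in> V" "r = cinv c y" by auto
    then have "\<tau> x = \<tau> y" using e sc by simp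
    then have "x = y" using D(4) xy by metis
    then show "q = r" using xy by simp
  qed
  have im: "snd ?e ` fst ?e = V'"
  proof -
    have "snd ?e ` fst ?e = \<tau> ` V" using sc by (auto simp: image_image)
    also have "\<dots> = V'" using D(3,5,6) by (auto simp: image_iff) metis
    finally show ?thesis .
  qed
  have ie: "cinv ?e (\<tau> x) = cinv c x" if x: "x \<in> V" for x
  proof -
    have "inv_into (fst ?e) (snd ?e) (snd ?e (cinv c x)) = cinv c x" by (rule inv_into_f_f[OF inj]) (use x in auto)
    then show ?thesis using sc[OF x] by simp
  qed
  have "smooth_atlas I (insert ?e A)"
  proof (rule smooth_atlas_insertI[OF inj])
    show "copen I (snd ?e ` fst ?e)" unfolding im by (rule D(2))
    fix f assume f: "f \<in> A"
    note T = transition[OF c f]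
    note TD = cdiffeoD[OF T]
    define W where "W = V \<inter> snd c ` (fst c \<inter> fst f)"
    have oW: "copen I W" unfolding W_def using D(1) TD(1) by blast
    have d1: "cdiffeo I W (\<tau> ` W) \<tau> \<sigma>" by (rule cdiffeo_restrict_image[OF atlas_finite d oW]) (simp add: W_def)
    have d2: "cdiffeo I W ((\<lambda>x. snd f (cinv c x)) ` W) (\<lambda>x. snd f (cinv c x)) (\<lambda>y. snd c (cinv f y))"
      by (rule cdiffeo_restrict_image[OF atlas_finite T oW]) (simp add: W_def)
    have EW: "cinv c ` W = cinv c ` V \<inter> fst f"
    proof
      show "cinv c ` W \<subseteq> cinv c ` V \<inter> fst f" using cinv_left[OF c] by (auto simp: W_def)
      show "cinv c ` V \<inter> fst f \<subseteq> cinv c ` W"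
      proof
        fix q assume q: "q \<in> cinv c ` V \<inter> fst f"
        then obtain x where x: "x \<in> V" "q = cinv c x" by blast
        then have "x \<in> W" using sc[OF x(1)] q unfolding W_def by (metis IntD2 IntI image_eqI)
        then show "q \<in> cinv c ` W" using x by blast
      qed
    qed
    have s1: "\<tau> ` W = snd ?e ` (fst ?e \<inter> fst f)" using sc by (simp add: EW[symmetric] image_image W_def)
    have s2: "(\<lambda>x. snd f (cinv c x)) ` W = snd f ` (fst ?e \<inter> fst f)" by (simp add: EW[symmetric] image_image)
    have "cdiffeo I (\<tau> ` W) ((\<lambda>x. snd f (cinv c x)) ` W) (\<lambda>x. snd f (cinv c (\<sigma> x))) (\<lambda>y. \<tau> (snd c (cinv f y)))"
      by (rule cdiffeo_comp[OF atlas_finite cdiffeo_sym[OF d1] d2])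
    then have "cdiffeo I (\<tau> ` W) ((\<lambda>x. snd f (cinv c x)) ` W) (\<lambda>x. snd f (cinv ?e x)) (\<lambda>y. snd ?e (cinv f y))"
    proof (rule cdiffeo_cong[OF atlas_finite])
      fix x assume "x \<in> \<tau> ` W"
      then obtain w where w: "w \<in> V" "x = \<tau> w" by (auto simp: W_def)
      show "snd f (cinv c (\<sigma> x)) = snd f (cinv ?e x)" unfolding w(2) ie[OF w(1)] D(4)[OF w(1)] ..
    qed simp
    then show "cdiffeo I (snd ?e ` (fst ?e \<inter> fst f)) (snd f ` (fst ?e \<inter> fst f)) (\<lambda>x. snd f (cinv ?e x)) (\<lambda>y. snd ?e (cinv f y))"
      unfolding s1 s2 .
  qed
  moreover have "fst ?e \<subseteq> points A" using sc(2) c by (auto simp: points_def)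
  ultimately show ?thesis unfolding admissible_chart_def by blast
qed

end

text \<open>The definition offers, at each point, some pair of charts and a smooth local extension.
  As \<open>S\<close> is open, the extension agrees with \<open>f\<close> on an open set, and
  transition maps on both sides convert it to the prescribed charts.\<close>

lemma smooth_between_coord:
  assumes A: "smooth_atlas I A" and B: "smooth_atlas J B" and S: "openin (atlas_topology I A) S"
    and f: "smooth_between I A J B S f" and c: "c \<in> A" and d: "d \<in> B"
  shows "copen I (snd c ` {x \<in> fst c \<inter> S. f x \<in> fst d})"
    and "j \<in> J \<Longrightarrow> smooth_real_on I (snd c ` {x \<in> fst c \<inter> S. f x \<in> fst d}) (\<lambda>x. snd d (f (cinv c x)) j)"
proof -
  note fI = atlas_finite[OF A] and fJ = atlas_finite[OF B]
  let ?U = "snd c ` {x \<in> fst c \<inter> S. f x \<in> fst d}"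
  let ?G = "\<lambda>x. snd d (f (cinv c x))"
  have Uc: "?U \<subseteq> coord_space I" using chart_coord[OF A c] by blast
  have loc: "\<exists>N. copen I N \<and> x \<in> N \<and> N \<subseteq> ?U \<and> (\<forall>j\<in>J. smooth_real_on I N (\<lambda>x. ?G x j))" if xU: "x \<in> ?U" for x
  proof -
    obtain q where q: "q \<in> fst c" "q \<in> S" "f q \<in> fst d" "x = snd c q" using xU by blast
    obtain c' d' W F where W: "c' \<in> A" "d' \<in> B" "q \<in> fst c'" "f q \<in> fst d'" "copen I W" "snd c' q \<in> W"
      "smooth_map_on I W J F" "\<forall>y\<in>S \<inter> fst c'. snd c' y \<in> W \<longrightarrow> f y \<in> fst d' \<and> snd d' (f y) = F (snd c' y)"
      using f q(2) unfolding smooth_between_def by blast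
    note T = cdiffeoD[OF transition[OF A c W(1)]]
    note R = cdiffeoD[OF transition[OF B W(2) d]]
    have smF: "smooth_real_on I W (\<lambda>x. F x j)" if "j \<in> J" for j using W(7) that by (simp add: smooth_map_on_def)
    have FW: "F ` W \<subseteq> coord_space J" using W(7) by (simp add: smooth_map_on_def)
    define V1 where "V1 = snd c ` (S \<inter> fst c') \<inter> snd c ` (fst c \<inter> fst c')"
    define V where "V = snd c ` (S \<inter> fst c' \<inter> fst c)"
    have oV: "copen I V" unfolding V_def by (rule atlas_open_image[OF A openin_Int[OF S chart_open[OF A W(1)]] c])
    have VT: "V \<subseteq> snd c ` (fst c \<inter> fst c')" by (auto simp: V_def)
    define \<theta> where "\<theta> x = snd c' (cinv c x)" for x
    have sth: "smooth_real_on I V (\<lambda>x. \<theta> x i)" if "i \<in> I" for i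
      using smooth_subset[OF T(7)[OF that] VT] by (simp add: \<theta>_def)
    have thV: "\<theta> ` V \<subseteq> coord_space I" using T(3,10) VT unfolding \<theta>_def by blast
    define N1 where "N1 = {y\<in>V. \<theta> y \<in> W}"
    have oN1: "copen I N1" unfolding N1_def by (rule copen_preimage[OF fI fI oV W(5) smooth_continuous[OF sth] thV])
    have N1V: "N1 \<subseteq> V" and thN1: "\<theta> ` N1 \<subseteq> W" by (auto simp: N1_def)
    have sF: "smooth_real_on I N1 (\<lambda>x. F (\<theta> x) j)" if "j \<in> J" for j
      by (rule smooth_comp[OF fI oN1 fI W(5) thN1 smF[OF that] smooth_subset[OF sth N1V]])
    have FN1: "(\<lambda>x. F (\<theta> x)) ` N1 \<subseteq> coord_space J" using FW thN1 by blast
    let ?D = "snd d' ` (fst d' \<inter> fst d)"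
    define N where "N = {y\<in>N1. F (\<theta> y) \<in> ?D}"
    have oN: "copen I N" unfolding N_def by (rule copen_preimage[OF fI fJ oN1 R(1) smooth_continuous[OF sF] FN1])
    have NN: "N \<subseteq> N1" and FN: "(\<lambda>x. F (\<theta> x)) ` N \<subseteq> ?D" by (auto simp: N_def)
    have rep: "cinv c y \<in> fst c \<inter> S \<and> f (cinv c y) \<in> fst d \<and> y = snd c (cinv c y) \<and> ?G y = snd d (cinv d' (F (\<theta> y)))"
      if y: "y \<in> N" for y
    proof -
      obtain r where r: "r \<in> S" "r \<in> fst c'" "r \<in> fst c" "y = snd c r" using y by (auto simp: N_def N1_def V_def)
      have cr: "cinv c y = r" using cinv_left[OF A c r(3)] r(4) by simp
      have w: "snd c' r \<in> W" using y cr by (simp add: N_def N1_def \<theta>_def)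
      then have fr: "f r \<in> fst d'" "snd d' (f r) = F (\<theta> y)" using W(8) r cr by (auto simp: \<theta>_def)
      have "snd d' (f r) \<in> ?D" using y fr by (simp add: N_def)
      then have "f r \<in> fst d' \<inter> fst d" using chart_mem[OF B W(2) fr(1), of "fst d' \<inter> fst d"] by auto
      moreover have "cinv d' (F (\<theta> y)) = f r" using cinv_left[OF B W(2) fr(1)] fr(2) by simp
      ultimately show ?thesis using cr r by simp
    qed
    have sm: "smooth_real_on I N (\<lambda>x. ?G x j)" if j: "j \<in> J" for j
    proof (rule smooth_cong[OF fI oN])
      show "smooth_real_on I N (\<lambda>x. snd d (cinv d' (F (\<theta> x))) j)"
        by (rule smooth_comp[OF fI oN fJ R(1) FN R(7)[OF j] smooth_subset[OF sF NN]])
      show "snd d (cinv d' (F (\<theta> x))) j = ?G x j" if "x \<in> N" for x using rep[OF that] by simp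
    qed
    have "N \<subseteq> ?U"
    proof
      fix y assume "y \<in> N"
      from rep[OF this] show "y \<in> ?U" by blast
    qed
    moreover have "x \<in> N"
    proof -
      have cq: "cinv c x = q" using cinv_left[OF A c q(1)] q(4) by simp
      have "snd d' (f q) = F (\<theta> x)" using W(8) q W(3,6) cq by (auto simp: \<theta>_def)
      moreover have "snd d' (f q) \<in> ?D" using W(4) q(3) by blast
      moreover have "x \<in> V" using q W(3) by (auto simp: V_def)
      ultimately show ?thesis using W(6) cq by (simp add: N_def N1_def \<theta>_def)
    qed
    ultimately show ?thesis using oN sm by blast
  qed
  show o: "copen I ?U"
  proof (rule copenI_ev[OF Uc _ fI])
    fix x assume "x \<in> ?U"
    then obtain N where N: "copen I N" "x \<in> N" "N \<subseteq> ?U" using loc by blast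
    show "\<forall>\<^sub>F y in cnh I x. y \<in> ?U" using cnh_copen[OF fI N(1,2)] by eventually_elim (use N(3) in blast)
  qed
  show "smooth_real_on I ?U (\<lambda>x. ?G x j)" if j: "j \<in> J"
  proof (rule smooth_local[OF fI _ Uc])
    fix x assume "x \<in> ?U"
    then show "\<exists>W. copen I W \<and> x \<in> W \<and> smooth_real_on I W (\<lambda>x. ?G x j)" using loc j by blast
  qed
qed

section \<open>Local diffeomorphisms in charts\<close>

definition rep_dom :: "('a, nat) chart \<Rightarrow> ('a, nat) chart \<Rightarrow> 'a pmap \<Rightarrow> (nat \<Rightarrow> real) set" where
  "rep_dom c d \<phi> = snd c ` {x \<in> fst c \<inter> dom \<phi>. the (\<phi> x) \<in> fst d}"

lemma local_diffeo_inj: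
  assumes "\<phi> \<in> local_diffeos m A" "\<phi> x = Some y" "\<phi> x' = Some y"
  shows "x = x'"
proof -
  have "inj_on (\<lambda>x. the (\<phi> x)) (dom \<phi>)" using assms(1) by (auto simp: local_diffeos_def diffeo_on_def bij_betw_def)
  from inj_onD[OF this, of x x'] show ?thesis using assms(2,3) by (simp add: domI)
qed

lemma pmap_inv_eq:
  assumes "\<phi> \<in> local_diffeos m A"
  shows "pmap_inv \<phi> y = Some x \<longleftrightarrow> \<phi> x = Some y"
proof
  assume e: "\<phi> x = Some y"
  then have "(THE x. \<phi> x = Some y) = x" using local_diffeo_inj[OF assms] by blast
  then show "pmap_inv \<phi> y = Some x" using e by (auto simp: pmap_inv_def ran_def)
next
  assume e: "pmap_inv \<phi> y = Some x"
  then have "y \<in> ran \<phi>" "x = (THE x. \<phi> x = Some y)" by (auto simp: pmap_inv_def split: if_splits)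
  then obtain x' where x': "\<phi> x' = Some y" by (auto simp: ran_def)
  then have "(THE x. \<phi> x = Some y) = x'" using local_diffeo_inj[OF assms] by blast
  then show "\<phi> x = Some y" using x' \<open>x = _\<close> by simp
qed

text \<open>The definition of a local diffeomorphism speaks of \<open>inv_into\<close>. Identifying
  it with \<open>pmap_inv\<close> makes the inverse again a coordinate representative in the sense
  of \<open>coord_rep\<close>.\<close>

lemma rep_cdiffeo:
  assumes A: "smooth_atlas {..<m} A" and \<phi>: "\<phi> \<in> local_diffeos m A" and c: "c \<in> A" and d: "d \<in> A"
  shows "cdiffeo {..<m} (rep_dom c d \<phi>) (rep_dom d c (pmap_inv \<phi>)) (coord_rep c d \<phi>) (coord_rep d c (pmap_inv \<phi>))"
proof -
  let ?f = "\<lambda>x. the (\<phi> x)"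
  let ?g = "inv_into (dom \<phi>) ?f"
  have L: "openin (atlas_topology {..<m} A) (dom \<phi>)" "openin (atlas_topology {..<m} A) (ran \<phi>)"
    "bij_betw ?f (dom \<phi>) (ran \<phi>)" "smooth_between {..<m} A {..<m} A (dom \<phi>) ?f"
    "smooth_between {..<m} A {..<m} A (ran \<phi>) ?g"
    using \<phi> by (auto simp: local_diffeos_def diffeo_on_def)
  have pi: "pmap_inv \<phi> y = (if y \<in> ran \<phi> then Some (?g y) else None)" for y
  proof (cases "y \<in> ran \<phi>")
    case True
    then have "?g y \<in> dom \<phi>" "?f (?g y) = y" using L(3) bij_betw_inv_into_right[OF L(3)] inv_into_into[of y ?f "dom \<phi>"]
      by (auto simp: bij_betw_def)
    then have "\<phi> (?g y) = Some y" by auto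
    then show ?thesis using pmap_inv_eq[OF \<phi>] True by simp
  qed (simp add: pmap_inv_def)
  have di: "dom (pmap_inv \<phi>) = ran \<phi>" using pi by (auto simp: dom_def split: if_splits)
  have e1: "rep_dom d c (pmap_inv \<phi>) = snd d ` {x \<in> fst d \<inter> ran \<phi>. ?g x \<in> fst c}"
    unfolding rep_dom_def di using pi by (intro arg_cong[of _ _ "\<lambda>X. snd d ` X"]) auto
  have V: "copen {..<m} (rep_dom c d \<phi>)" "\<And>i. i < m \<Longrightarrow> smooth_real_on {..<m} (rep_dom c d \<phi>) (\<lambda>x. coord_rep c d \<phi> x i)"
    using smooth_between_coord[OF A A L(1,4) c d] by (auto simp: rep_dom_def coord_rep_def)
  have V': "copen {..<m} (rep_dom d c (pmap_inv \<phi>))" unfolding e1 by (rule smooth_between_coord(1)[OF A A L(2,5) d c])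
  have g1: "coord_rep c d \<phi> x \<in> rep_dom d c (pmap_inv \<phi>) \<and> coord_rep d c (pmap_inv \<phi>) (coord_rep c d \<phi> x) = x"
    if x: "x \<in> rep_dom c d \<phi>" for x
  proof -
    obtain q r where q: "q \<in> fst c" "\<phi> q = Some r" "r \<in> fst d" "x = snd c q" using x by (auto simp: rep_dom_def)
    have e: "coord_rep c d \<phi> x = snd d r" using q cinv_left[OF A c] by (simp add: coord_rep_def)
    have p: "pmap_inv \<phi> r = Some q" using q pmap_inv_eq[OF \<phi>] by simp
    then show ?thesis unfolding e using q cinv_left[OF A d] by (auto simp: rep_dom_def coord_rep_def)
  qed
  have g2: "coord_rep d c (pmap_inv \<phi>) y \<in> rep_dom c d \<phi> \<and> coord_rep c d \<phi> (coord_rep d c (pmap_inv \<phi>) y) = y"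
    if y: "y \<in> rep_dom d c (pmap_inv \<phi>)" for y
  proof -
    obtain q r where q: "r \<in> fst d" "pmap_inv \<phi> r = Some q" "q \<in> fst c" "y = snd d r" using y by (auto simp: rep_dom_def)
    have e: "coord_rep d c (pmap_inv \<phi>) y = snd c q" using q cinv_left[OF A d] by (simp add: coord_rep_def)
    have p: "\<phi> q = Some r" using q pmap_inv_eq[OF \<phi>] by simp
    then show ?thesis unfolding e using q cinv_left[OF A c] by (auto simp: rep_dom_def coord_rep_def)
  qed
  have s': "smooth_real_on {..<m} (rep_dom d c (pmap_inv \<phi>)) (\<lambda>x. coord_rep d c (pmap_inv \<phi>) x i)" if i: "i < m" for i
  proof (rule smooth_cong[OF finite_lessThan V'])
    show "smooth_real_on {..<m} (rep_dom d c (pmap_inv \<phi>)) (\<lambda>x. snd c (?g (cinv d x)) i)"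
      unfolding e1 by (rule smooth_between_coord(2)[OF A A L(2,5) d c]) (use i in simp)
    fix x assume "x \<in> rep_dom d c (pmap_inv \<phi>)"
    then obtain r where "r \<in> fst d" "r \<in> ran \<phi>" "x = snd d r" unfolding e1 by blast
    then show "snd c (?g (cinv d x)) i = coord_rep d c (pmap_inv \<phi>) x i" using cinv_left[OF A d] pi by (simp add: coord_rep_def)
  qed
  show ?thesis unfolding cdiffeo_def using V V' g1 g2 s' by auto
qed

section \<open>Contact of submanifolds\<close>

definition cimg :: "('a, nat) chart \<Rightarrow> 'a set \<Rightarrow> (nat \<Rightarrow> real) set" where
  "cimg c S = snd c ` (S \<inter> fst c)"

definition pimage :: "'a pmap \<Rightarrow> 'a set \<Rightarrow> 'a set" where
  "pimage \<phi> S = {y. \<exists>x\<in>S. \<phi> x = Some y}"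

context
  fixes m :: nat and A :: "('a, nat) chart set" and c :: "('a, nat) chart" and z :: 'a
  assumes A: "smooth_atlas {..<m} A" and c: "c \<in> A" and z: "z \<in> fst c"
begin

lemma cimg_coord: "cimg c S \<subseteq> coord_space {..<m}" using chart_coord[OF A c] by (auto simp: cimg_def)

lemma cimg_mem: "q \<in> fst c \<Longrightarrow> snd c q \<in> cimg c S \<longleftrightarrow> q \<in> S"
  using chart_mem[OF A c, of q "S \<inter> fst c"] by (simp add: cimg_def)

text \<open>In the atlas enlarged by \<open>e\<close> the two charts are on the same
  footing.\<close>

lemma admissible_transition:
  assumes "admissible_chart {..<m} A e"
  shows "cdiffeo {..<m} (snd c ` (fst c \<inter> fst e)) (snd e ` (fst c \<inter> fst e))
    (\<lambda>x. snd e (cinv c x)) (\<lambda>y. snd c (cinv e y))"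
  by (rule transition[of _ "insert e A"]) (use assms c in \<open>simp_all add: admissible_chart_def\<close>)

lemma embedded_slice:
  assumes S: "embedded_submanifold {..<m} A p S" and zS: "z \<in> S"
  obtains e K where "admissible_chart {..<m} A e" "z \<in> fst e" "K \<subseteq> {..<m}" "card K = p"
    "cimg c S \<inter> snd c ` (fst c \<inter> fst e) =
      {x \<in> snd c ` (fst c \<inter> fst e). \<forall>i\<in>{..<m}-K. snd e (cinv c x) i = 0}"
proof -
  obtain e K where e: "admissible_chart {..<m} A e" "z \<in> fst e" "K \<subseteq> {..<m}" "card K = p"
    "snd e ` (S \<inter> fst e) = {y \<in> snd e ` fst e. \<forall>i\<in>{..<m} - K. y i = 0}"
    using S zS unfolding embedded_submanifold_def by blast
  have A': "smooth_atlas {..<m} (insert e A)" using e(1) by (simp add: admissible_chart_def)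
  have "q \<in> S \<longleftrightarrow> (\<forall>i\<in>{..<m}-K. snd e q i = 0)" if q: "q \<in> fst c" "q \<in> fst e" for q
    using chart_mem[OF A', of e q "S \<inter> fst e"] e(5) q by auto
  then have "cimg c S \<inter> snd c ` (fst c \<inter> fst e) =
      {x \<in> snd c ` (fst c \<inter> fst e). \<forall>i\<in>{..<m}-K. snd e (cinv c x) i = 0}"
    by (auto simp: cinv_left[OF A c] cimg_mem)
  then show ?thesis using that e by blast
qed

lemma slice_embedded:
  assumes S: "embedded_submanifold {..<m} A p S" and zS: "z \<in> S"
  shows "slice {..<m} (snd c z) p (cimg c S)"
proof -
  obtain e K where e: "admissible_chart {..<m} A e" "z \<in> fst e" "K \<subseteq> {..<m}" "card K = p"
    "cimg c S \<inter> snd c ` (fst c \<inter> fst e) =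
      {x \<in> snd c ` (fst c \<inter> fst e). \<forall>i\<in>{..<m}-K. snd e (cinv c x) i = 0}"
    using embedded_slice[OF assms] .
  show ?thesis by (rule sliceI[OF _ admissible_transition[OF e(1)] e(3,4,5)]) (use e(2) z in simp)
qed

lemma graph_cgraph:
  assumes e: "admissible_chart {..<m} A e" and g: "is_graph_in m e K f S"
  shows "cgraph {..<m} (snd c ` (fst c \<inter> fst e)) (\<lambda>x. snd e (cinv c x)) K f (cimg c S)"
  unfolding cgraph_def
proof (intro conjI)
  have "(\<lambda>x. snd e (cinv c x)) ` snd c ` (fst c \<inter> fst e) \<subseteq> snd e ` fst e" using cinv_left[OF A c] by auto
  then have sub: "coord_proj K ` (\<lambda>x. snd e (cinv c x)) ` snd c ` (fst c \<inter> fst e) \<subseteq> coord_proj K ` snd e ` fst e" by blast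
  show "smooth_map_on K (coord_proj K ` (\<lambda>x. snd e (cinv c x)) ` snd c ` (fst c \<inter> fst e)) ({..<m} - K) f"
    unfolding smooth_map_on_def
  proof (intro conjI ballI)
    have G: "smooth_map_on K (coord_proj K ` snd e ` fst e) ({..<m} - K) f" using g by (simp add: is_graph_in_def)
    show "f ` coord_proj K ` (\<lambda>x. snd e (cinv c x)) ` snd c ` (fst c \<inter> fst e) \<subseteq> coord_space ({..<m} - K)"
      by (rule order_trans[OF image_mono[OF sub]]) (use G in \<open>simp add: smooth_map_on_def\<close>)
    show "smooth_real_on K (coord_proj K ` (\<lambda>x. snd e (cinv c x)) ` snd c ` (fst c \<inter> fst e)) (\<lambda>x. f x j)"
      if "j \<in> {..<m} - K" for j
      by (rule smooth_subset[OF _ sub]) (use G that in \<open>simp add: smooth_map_on_def\<close>)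
  qed
  have "q \<in> S \<longleftrightarrow> (\<forall>j\<in>{..<m}-K. snd e q j = f (coord_proj K (snd e q)) j)" if "q \<in> fst e" for q
  proof -
    have "S \<inter> fst e = {x \<in> fst e. \<forall>j\<in>{..<m} - K. snd e x j = f (coord_proj K (snd e x)) j}"
      using g by (simp add: is_graph_in_def)
    then show ?thesis using that by blast
  qed
  then show "cimg c S \<inter> snd c ` (fst c \<inter> fst e) = {x \<in> snd c ` (fst c \<inter> fst e).
      \<forall>j\<in>{..<m} - K. snd e (cinv c x) j = f (coord_proj K (snd e (cinv c x))) j}"
    by (auto simp: cinv_left[OF A c] cimg_mem)
qed

lemma contact_ccontact:
  assumes "contact m A p n z S T"
  shows "ccontact {..<m} UNIV (snd c z) p n (cimg c S) (cimg c T)"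
proof -
  obtain e K f f' where e: "admissible_chart {..<m} A e" "z \<in> fst e" "K \<subseteq> {..<m}" "card K = p"
    "is_graph_in m e K f S" "is_graph_in m e K f' T"
    "\<forall>j\<in>{..<m} - K. \<forall>bs. set bs \<subseteq> K \<and> length bs \<le> n \<longrightarrow>
           ipartial bs (\<lambda>x. f x j) (coord_proj K (snd e z)) = ipartial bs (\<lambda>x. f' x j) (coord_proj K (snd e z))"
    using assms unfolding contact_def by blast
  have cz: "cinv c (snd c z) = z" by (rule cinv_left[OF A c z])
  show ?thesis unfolding ccontact_def
    by (rule exI[of _ "snd c ` (fst c \<inter> fst e)"], rule exI[of _ "snd e ` (fst c \<inter> fst e)"],
        rule exI[of _ "\<lambda>x. snd e (cinv c x)"], rule exI[of _ "\<lambda>y. snd c (cinv e y)"], rule exI[of _ K],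
        rule exI[of _ f], rule exI[of _ f'])
       (use e z admissible_transition[OF e(1)] graph_cgraph[OF e(1)] cz in auto)
qed

lemma contact_sym: "contact m A p n z S T \<Longrightarrow> contact m A p n z T S"
proof -
  assume C: "contact m A p n z S T"
  then obtain e K f f' where e: "admissible_chart {..<m} A e" "z \<in> fst e" "K \<subseteq> {..<m}" "card K = p"
    "is_graph_in m e K f S" "is_graph_in m e K f' T"
    "\<forall>j\<in>{..<m} - K. \<forall>bs. set bs \<subseteq> K \<and> length bs \<le> n \<longrightarrow>
           ipartial bs (\<lambda>x. f x j) (coord_proj K (snd e z)) = ipartial bs (\<lambda>x. f' x j) (coord_proj K (snd e z))"
    unfolding contact_def by blast
  have "\<exists>c K f f'. admissible_chart {..<m} A c \<and> z \<in> fst c \<and> K \<subseteq> {..<m} \<and> card K = p \<and>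
        is_graph_in m c K f T \<and> is_graph_in m c K f' S \<and>
        (\<forall>j\<in>{..<m} - K. \<forall>bs. set bs \<subseteq> K \<and> length bs \<le> n \<longrightarrow>
           ipartial bs (\<lambda>x. f x j) (coord_proj K (snd c z)) = ipartial bs (\<lambda>x. f' x j) (coord_proj K (snd c z)))"
    by (rule exI[of _ e], rule exI[of _ K], rule exI[of _ f'], rule exI[of _ f]) (use e in simp)
  moreover have "z \<in> T \<inter> S" using C unfolding contact_def by blast
  ultimately show ?thesis unfolding contact_def by (intro conjI)
qed

lemma contact_near:
  assumes C: "contact m A p n z S T"
  shows "near {..<m} (snd c z) (Suc n) (cimg c S) (cimg c T)"
proof -
  have "z \<in> S \<inter> T" using C unfolding contact_def by (rule conjunct1)
  then have "snd c z \<in> cimg c S" "snd c z \<in> cimg c T" using z by (simp_all add: cimg_mem)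
  from ccontact_near[OF finite_lessThan this contact_ccontact[OF C]] show ?thesis .
qed

text \<open>The straightening map after the chart \<open>c\<close> is itself an admissible chart,
  because its domain lies in the image of \<open>c\<close>.\<close>

lemma ccontact_contact:
  assumes C: "ccontact {..<m} (snd c ` fst c) (snd c z) p n (cimg c S) (cimg c T)" and zS: "z \<in> S" "z \<in> T"
  shows "contact m A p n z S T"
proof -
  obtain V V' \<tau> \<sigma> K f f' where V: "V \<subseteq> snd c ` fst c" "snd c z \<in> V" "cdiffeo {..<m} V V' \<tau> \<sigma>"
    "K \<subseteq> {..<m}" "card K = p" "cgraph {..<m} V \<tau> K f (cimg c S)" "cgraph {..<m} V \<tau> K f' (cimg c T)"
    "\<forall>j\<in>{..<m}-K. \<forall>bs. set bs \<subseteq> K \<and> length bs \<le> n \<longrightarrow>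
        ipartial bs (\<lambda>x. f x j) (coord_proj K (\<tau> (snd c z))) = ipartial bs (\<lambda>x. f' x j) (coord_proj K (\<tau> (snd c z)))"
    using C unfolding ccontact_def by blast
  let ?e = "(cinv c ` V, \<lambda>q. \<tau> (snd c q))"
  have sc: "snd c (cinv c x) = x" "cinv c x \<in> fst c" if "x \<in> V" for x
    using cinv_right[OF A subsetD[OF V(1) that]] cinv_in[OF A subsetD[OF V(1) that]] .
  have adm: "admissible_chart {..<m} A ?e" by (rule admissible_from_cdiffeo[OF A c V(3,1)])
  have im: "snd ?e ` fst ?e = \<tau> ` V" using sc by (auto simp: image_image)
  have gr: "is_graph_in m ?e K g X" if g: "cgraph {..<m} V \<tau> K g (cimg c X)" for g X unfolding is_graph_in_def im
  proof (intro conjI)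
    show "smooth_map_on K (coord_proj K ` \<tau> ` V) ({..<m} - K) g" using g by (simp add: cgraph_def)
    have "cinv c x \<in> X \<longleftrightarrow> (\<forall>j\<in>{..<m}-K. \<tau> x j = g (coord_proj K (\<tau> x)) j)" if x: "x \<in> V" for x
    proof -
      have "cinv c x \<in> X \<longleftrightarrow> x \<in> cimg c X" using cimg_mem[of "cinv c x"] sc[OF x] by simp
      then show ?thesis using g x unfolding cgraph_def by blast
    qed
    then show "X \<inter> fst ?e = {x \<in> fst ?e. \<forall>j\<in>{..<m} - K. snd ?e x j = g (coord_proj K (snd ?e x)) j}"
      using sc by auto
  qed
  have ze: "z \<in> fst ?e" using V(2) cinv_left[OF A c z] by force
  show ?thesis unfolding contact_def
  proof (intro conjI)
    show "\<exists>c K f f'. admissible_chart {..<m} A c \<and> z \<in> fst c \<and> K \<subseteq> {..<m} \<and> card K = p \<and>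
        is_graph_in m c K f S \<and> is_graph_in m c K f' T \<and>
        (\<forall>j\<in>{..<m} - K. \<forall>bs. set bs \<subseteq> K \<and> length bs \<le> n \<longrightarrow>
           ipartial bs (\<lambda>x. f x j) (coord_proj K (snd c z)) = ipartial bs (\<lambda>x. f' x j) (coord_proj K (snd c z)))"
      by (rule exI[of _ ?e], rule exI[of _ K], rule exI[of _ f], rule exI[of _ f'])
         (use adm ze V gr in auto)
  qed (use zS in auto)
qed

text \<open>From here on contact is a two-sided estimate in the single chart \<open>c\<close>, so
  that transitivity and invariance under diffeomorphisms come from the lemmas on
  \<open>near\<close>.\<close>

lemma contact_iff:
  assumes n: "1 \<le> n" and sl: "slice {..<m} (snd c z) p (cimg c S)" "slice {..<m} (snd c z) p (cimg c T)"
    and zS: "z \<in> S" "z \<in> T"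
  shows "contact m A p n z S T \<longleftrightarrow> near {..<m} (snd c z) (Suc n) (cimg c S) (cimg c T) \<and>
    near {..<m} (snd c z) (Suc n) (cimg c T) (cimg c S)"
proof
  assume "contact m A p n z S T"
  then show "near {..<m} (snd c z) (Suc n) (cimg c S) (cimg c T) \<and>
    near {..<m} (snd c z) (Suc n) (cimg c T) (cimg c S)" using contact_near contact_sym by blast
next
  assume N: "near {..<m} (snd c z) (Suc n) (cimg c S) (cimg c T) \<and>
    near {..<m} (snd c z) (Suc n) (cimg c T) (cimg c S)"
  show "contact m A p n z S T"
    by (rule ccontact_contact[OF near_ccontact[OF finite_lessThan n chart_copen[OF A c] _ sl _ _ cimg_coord cimg_coord]])
       (use N zS z in \<open>auto simp: cimg_mem\<close>)
qed

text \<open>The intersection on the left discards points that \<open>\<phi>\<close> brings into the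
  chart from outside it.\<close>

lemma cimg_pimage:
  assumes \<phi>: "\<phi> \<in> local_diffeos m A"
  shows "cimg c (pimage \<phi> S) \<inter> rep_dom c c (pmap_inv \<phi>) = coord_rep c c \<phi> ` (cimg c S \<inter> rep_dom c c \<phi>)"
proof
  note D = cdiffeoD[OF rep_cdiffeo[OF A \<phi> c c]]
  show "cimg c (pimage \<phi> S) \<inter> rep_dom c c (pmap_inv \<phi>) \<subseteq> coord_rep c c \<phi> ` (cimg c S \<inter> rep_dom c c \<phi>)"
  proof
    fix y assume y: "y \<in> cimg c (pimage \<phi> S) \<inter> rep_dom c c (pmap_inv \<phi>)"
    then obtain r x where r: "r \<in> fst c" "y = snd c r" "x \<in> S" "\<phi> x = Some r" by (auto simp: cimg_def pimage_def)
    obtain r' q where q: "r' \<in> fst c" "pmap_inv \<phi> r' = Some q" "q \<in> fst c" "y = snd c r'" using y by (auto simp: rep_dom_def)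
    have "r = r'" using inj_onD[OF chart_inj[OF A c]] r q by metis
    then have "q = x" using q r pmap_inv_eq[OF \<phi>] local_diffeo_inj[OF \<phi>] by blast
    then have "snd c x \<in> cimg c S \<inter> rep_dom c c \<phi>" using r q by (auto simp: cimg_def rep_dom_def)
    moreover have "coord_rep c c \<phi> (snd c x) = y" using r q \<open>q = x\<close> cinv_left[OF A c] by (simp add: coord_rep_def)
    ultimately show "y \<in> coord_rep c c \<phi> ` (cimg c S \<inter> rep_dom c c \<phi>)" by blast
  qed
  show "coord_rep c c \<phi> ` (cimg c S \<inter> rep_dom c c \<phi>) \<subseteq> cimg c (pimage \<phi> S) \<inter> rep_dom c c (pmap_inv \<phi>)"
  proof
    fix y assume "y \<in> coord_rep c c \<phi> ` (cimg c S \<inter> rep_dom c c \<phi>)"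
    then obtain x where x: "x \<in> cimg c S" "x \<in> rep_dom c c \<phi>" "y = coord_rep c c \<phi> x" by blast
    then obtain q r where q: "q \<in> fst c" "\<phi> q = Some r" "r \<in> fst c" "x = snd c q" by (auto simp: rep_dom_def)
    have "q \<in> S" using x q cimg_mem by simp
    moreover have "y = snd c r" using x q cinv_left[OF A c] by (simp add: coord_rep_def)
    ultimately show "y \<in> cimg c (pimage \<phi> S) \<inter> rep_dom c c (pmap_inv \<phi>)"
      using q D(3)[OF x(2)] x(3) by (auto simp: cimg_def pimage_def)
  qed
qed

lemma rep_fix:
  assumes "\<phi> z = Some z"
  shows "snd c z \<in> rep_dom c c \<phi>" "coord_rep c c \<phi> (snd c z) = snd c z"
proof -
  show "snd c z \<in> rep_dom c c \<phi>" unfolding rep_dom_def by (rule imageI) (use assms z in auto)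
  show "coord_rep c c \<phi> (snd c z) = snd c z" using assms cinv_left[OF A c z] by (simp add: coord_rep_def)
qed

lemma pmap_inv_fix: "\<phi> \<in> local_diffeos m A \<Longrightarrow> \<phi> z = Some z \<Longrightarrow> pmap_inv \<phi> z = Some z"
  by (simp add: pmap_inv_eq)

text \<open>The image is flattened by applying the inverse of \<open>\<phi>\<close> before the map
  that flattens \<open>S\<close>.\<close>

lemma slice_pimage:
  assumes \<phi>: "\<phi> \<in> local_diffeos m A" "\<phi> z = Some z" and S: "slice {..<m} (snd c z) p (cimg c S)"
  shows "slice {..<m} (snd c z) p (cimg c (pimage \<phi> S))"
proof -
  obtain V V' \<tau> \<sigma> K where V: "snd c z \<in> V" "cdiffeo {..<m} V V' \<tau> \<sigma>" "K \<subseteq> {..<m}" "card K = p"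
    "cimg c S \<inter> V = {x\<in>V. \<forall>l\<in>{..<m}-K. \<tau> x l = 0}" using S unfolding slice_def by blast
  let ?\<psi> = "coord_rep c c (pmap_inv \<phi>)" and ?U = "rep_dom c c (pmap_inv \<phi>)"
  note R = rep_cdiffeo[OF A \<phi>(1) c c]
  note D = cdiffeoD[OF R]
  have x0: "snd c z \<in> ?U" "?\<psi> (snd c z) = snd c z" using rep_fix[of "pmap_inv \<phi>", OF pmap_inv_fix[OF \<phi>]] .
  define W where "W = rep_dom c c \<phi> \<inter> V"
  have oW: "copen {..<m} W" unfolding W_def using D(1) cdiffeoD(1)[OF V(2)] by blast
  have d1: "cdiffeo {..<m} {y\<in>?U. ?\<psi> y \<in> W} W ?\<psi> (coord_rep c c \<phi>)"
    by (rule cdiffeo_restrict_target[OF finite_lessThan cdiffeo_sym[OF R] oW]) (auto simp: W_def)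
  have d2: "cdiffeo {..<m} W (\<tau> ` W) \<tau> \<sigma>" by (rule cdiffeo_restrict_image[OF finite_lessThan V(2) oW]) (auto simp: W_def)
  have d: "cdiffeo {..<m} {y\<in>?U. ?\<psi> y \<in> W} (\<tau> ` W) (\<lambda>y. \<tau> (?\<psi> y)) (\<lambda>u. coord_rep c c \<phi> (\<sigma> u))"
    by (rule cdiffeo_comp[OF finite_lessThan d1 d2])
  have "y \<in> cimg c (pimage \<phi> S) \<longleftrightarrow> (\<forall>l\<in>{..<m}-K. \<tau> (?\<psi> y) l = 0)" if y: "y \<in> ?U" "?\<psi> y \<in> W" for y
  proof -
    have "y \<in> cimg c (pimage \<phi> S) \<longleftrightarrow> y \<in> coord_rep c c \<phi> ` (cimg c S \<inter> rep_dom c c \<phi>)"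
      using cimg_pimage[OF \<phi>(1), of S] y(1) by blast
    also have "\<dots> \<longleftrightarrow> ?\<psi> y \<in> cimg c S"
    proof
      assume "y \<in> coord_rep c c \<phi> ` (cimg c S \<inter> rep_dom c c \<phi>)"
      then show "?\<psi> y \<in> cimg c S" using D(4) by auto
    next
      assume "?\<psi> y \<in> cimg c S"
      then show "y \<in> coord_rep c c \<phi> ` (cimg c S \<inter> rep_dom c c \<phi>)" using D(5,6)[OF y(1)] by force
    qed
    also have "\<dots> \<longleftrightarrow> (\<forall>l\<in>{..<m}-K. \<tau> (?\<psi> y) l = 0)" using V(5) y(2) unfolding W_def by blast
    finally show ?thesis .
  qed
  then have "cimg c (pimage \<phi> S) \<inter> {y\<in>?U. ?\<psi> y \<in> W} = {y\<in>{y\<in>?U. ?\<psi> y \<in> W}. \<forall>l\<in>{..<m}-K. \<tau> (?\<psi> y) l = 0}" by blast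
  moreover have "snd c z \<in> {y\<in>?U. ?\<psi> y \<in> W}" using x0 V(1) rep_fix[of \<phi>, OF \<phi>(2)] by (simp add: W_def)
  ultimately show ?thesis using sliceI[OF _ d V(3,4)] by simp
qed

lemma near_pimage:
  assumes \<phi>: "\<phi> \<in> local_diffeos m A" "\<phi> z = Some z" and k: "1 \<le> k"
    and n: "near {..<m} (snd c z) k (cimg c S) (cimg c T)"
  shows "near {..<m} (snd c z) k (cimg c (pimage \<phi> S)) (cimg c (pimage \<phi> T))"
proof -
  note R = rep_cdiffeo[OF A \<phi>(1) c c]
  note D = cdiffeoD[OF R]
  have "near {..<m} (snd c z) k (cimg c S \<inter> rep_dom c c \<phi>) (cimg c T \<inter> rep_dom c c \<phi>)"
    by (rule near_local[OF finite_lessThan n k D(1) rep_fix(1)[of \<phi>, OF \<phi>(2)] cimg_coord])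
  from near_image[OF finite_lessThan R rep_fix(1)[of \<phi>, OF \<phi>(2)] k this]
  have "near {..<m} (snd c z) k (cimg c (pimage \<phi> S) \<inter> rep_dom c c (pmap_inv \<phi>)) (cimg c (pimage \<phi> T) \<inter> rep_dom c c (pmap_inv \<phi>))"
    unfolding cimg_pimage[OF \<phi>(1)] rep_fix(2)[of \<phi>, OF \<phi>(2)] by simp
  then show ?thesis by (rule near_weaken[OF finite_lessThan _ D(2) rep_fix(1)[of "pmap_inv \<phi>", OF pmap_inv_fix[OF \<phi>]]]) simp
qed

text \<open>Maps with equal jets carry a submanifold to positions that agree to the same order, so
  the action on jets does not depend on the representing map.\<close>

lemma near_pimage_jets:
  assumes \<phi>: "\<phi> \<in> local_diffeos m A" "\<phi> z = Some z" and \<psi>: "\<psi> \<in> local_diffeos m A" "\<psi> z = Some z"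
    and O: "\<And>i. i < m \<Longrightarrow> Ovan {..<m} (snd c z) k (\<lambda>x. coord_rep c c \<phi> x i - coord_rep c c \<psi> x i)"
  shows "near {..<m} (snd c z) k (cimg c (pimage \<phi> S)) (cimg c (pimage \<psi> S))"
proof -
  note R = rep_cdiffeo[OF A \<phi>(1) c c] and R' = rep_cdiffeo[OF A \<psi>(1) c c]
  let ?X = "cimg c S \<inter> (rep_dom c c \<phi> \<inter> rep_dom c c \<psi>)"
  have oW: "copen {..<m} (rep_dom c c \<phi> \<inter> rep_dom c c \<psi>)" using cdiffeoD(1)[OF R] cdiffeoD(1)[OF R'] by blast
  have n: "near {..<m} (snd c z) k (coord_rep c c \<phi> ` ?X) (coord_rep c c \<psi> ` ?X)"
    using near_maps[OF finite_lessThan R rep_fix(1)[of \<phi>, OF \<phi>(2)], of k "coord_rep c c \<psi>" ?X] O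
    unfolding rep_fix(2)[of \<phi>, OF \<phi>(2)] by auto
  let ?W = "{y \<in> rep_dom c c (pmap_inv \<phi>). coord_rep c c (pmap_inv \<phi>) y \<in> rep_dom c c \<phi> \<inter> rep_dom c c \<psi>}"
  have dW: "cdiffeo {..<m} (rep_dom c c \<phi> \<inter> rep_dom c c \<psi>) ?W (coord_rep c c \<phi>) (coord_rep c c (pmap_inv \<phi>))"
    by (rule cdiffeo_restrict[OF finite_lessThan R oW]) simp
  have s1: "cimg c (pimage \<phi> S) \<inter> ?W \<subseteq> coord_rep c c \<phi> ` ?X"
  proof
    fix y assume y: "y \<in> cimg c (pimage \<phi> S) \<inter> ?W"
    then have "y \<in> coord_rep c c \<phi> ` (cimg c S \<inter> rep_dom c c \<phi>)" using cimg_pimage[OF \<phi>(1), of S] by blast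
    then obtain x where x: "x \<in> cimg c S" "x \<in> rep_dom c c \<phi>" "y = coord_rep c c \<phi> x" by blast
    then have "x \<in> rep_dom c c \<psi>" using y cdiffeoD(4)[OF R x(2)] by auto
    then show "y \<in> coord_rep c c \<phi> ` ?X" using x by blast
  qed
  have s2: "coord_rep c c \<psi> ` ?X \<subseteq> cimg c (pimage \<psi> S)" using cimg_pimage[OF \<psi>(1), of S] by blast
  obtain C where C: "C > 0" "\<forall>\<^sub>F x in cnh {..<m} (snd c z). x \<in> coord_rep c c \<phi> ` ?X \<longrightarrow>
      (\<exists>y\<in>coord_rep c c \<psi> ` ?X. cdist {..<m} x y \<le> C * cdist {..<m} (snd c z) x ^ k)"
    using nearE[OF n finite_lessThan] .
  have zW: "snd c z \<in> ?W" using rep_fix[of "pmap_inv \<phi>", OF pmap_inv_fix[OF \<phi>]] rep_fix(1)[of \<phi>, OF \<phi>(2)] rep_fix(1)[of \<psi>, OF \<psi>(2)] by simp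
  have "\<forall>\<^sub>F x in cnh {..<m} (snd c z). x \<in> cimg c (pimage \<phi> S) \<longrightarrow>
      (\<exists>y\<in>cimg c (pimage \<psi> S). cdist {..<m} x y \<le> C * cdist {..<m} (snd c z) x ^ k)"
    using C(2) cnh_copen[OF finite_lessThan cdiffeoD(2)[OF dW] zW] by eventually_elim (use s1 s2 in blast)
  then show ?thesis unfolding near_def by blast
qed

end

section \<open>Jets of local diffeomorphisms\<close>

lemma same_jet_refl: "z \<in> dom \<phi> \<Longrightarrow> same_jet m A n z \<phi> \<phi>" by (simp add: same_jet_def)

lemma same_jet_sym: "same_jet m A n z \<phi> \<psi> \<Longrightarrow> same_jet m A n z \<psi> \<phi>" unfolding same_jet_def by simp

lemma same_jet_trans: "same_jet m A n z \<phi> \<psi> \<Longrightarrow> same_jet m A n z \<psi> \<eta> \<Longrightarrow> same_jet m A n z \<phi> \<eta>"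
  unfolding same_jet_def by simp

lemma djet_eq_iff:
  assumes "\<phi> \<in> local_diffeos m A" "\<psi> \<in> local_diffeos m A" "z \<in> dom \<phi>" "z \<in> dom \<psi>"
  shows "djet m A n z \<phi> = djet m A n z \<psi> \<longleftrightarrow> same_jet m A n z \<phi> \<psi>"
proof
  assume "djet m A n z \<phi> = djet m A n z \<psi>"
  then have "{\<eta> \<in> local_diffeos m A. same_jet m A n z \<phi> \<eta>} = {\<eta> \<in> local_diffeos m A. same_jet m A n z \<psi> \<eta>}"
    by (simp add: djet_def)
  moreover have "\<psi> \<in> {\<eta> \<in> local_diffeos m A. same_jet m A n z \<psi> \<eta>}" using assms(2) same_jet_refl[OF assms(4)] by simp
  ultimately show "same_jet m A n z \<phi> \<psi>" by blast
next
  assume s: "same_jet m A n z \<phi> \<psi>"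
  have "same_jet m A n z \<phi> \<eta> \<longleftrightarrow> same_jet m A n z \<psi> \<eta>" for \<eta>
  proof
    show "same_jet m A n z \<psi> \<eta>" if "same_jet m A n z \<phi> \<eta>" by (rule same_jet_trans[OF same_jet_sym[OF s] that])
    show "same_jet m A n z \<phi> \<eta>" if "same_jet m A n z \<psi> \<eta>" by (rule same_jet_trans[OF s that])
  qed
  then show "djet m A n z \<phi> = djet m A n z \<psi>" by (simp add: djet_def)
qed

lemma djet_rep_same:
  assumes "\<phi> \<in> local_diffeos m A" "z \<in> dom \<phi>"
  shows "djet_rep (djet m A n z \<phi>) \<in> local_diffeos m A" "same_jet m A n z \<phi> (djet_rep (djet m A n z \<phi>))"
proof -
  have "\<phi> \<in> snd (djet m A n z \<phi>)" using assms same_jet_refl by (simp add: djet_def)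
  then have "djet_rep (djet m A n z \<phi>) \<in> snd (djet m A n z \<phi>)" by (rule someI[of "\<lambda>\<phi>'. \<phi>' \<in> snd (djet m A n z \<phi>)"])
  then show "djet_rep (djet m A n z \<phi>) \<in> local_diffeos m A" "same_jet m A n z \<phi> (djet_rep (djet m A n z \<phi>))"
    by (auto simp: djet_def)
qed

lemma djet_target_eq:
  assumes "\<phi> \<in> local_diffeos m A" "\<phi> z = Some w"
  shows "djet_target (djet m A n z \<phi>) = w"
  unfolding djet_target_def
proof (rule the_equality)
  show "\<exists>\<psi>\<in>snd (djet m A n z \<phi>). \<psi> (djet_source (djet m A n z \<phi>)) = Some w"
    using assms same_jet_refl[of z \<phi> m A n] by (intro bexI[of _ \<phi>]) (auto simp: djet_def)
  fix w' assume "\<exists>\<psi>\<in>snd (djet m A n z \<phi>). \<psi> (djet_source (djet m A n z \<phi>)) = Some w'"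
  then show "w' = w" using assms by (auto simp: djet_def same_jet_def)
qed

lemma multi_idx_sort: "set bs \<subseteq> {..<m} \<Longrightarrow> length bs \<le> n \<Longrightarrow> sort bs \<in> multi_idx m n"
  by (simp add: multi_idx_def)

context
  fixes m :: nat and A :: "('a, nat) chart set" and c :: "('a, nat) chart" and z :: 'a
  assumes A: "smooth_atlas {..<m} A" and c: "c \<in> A" and z: "z \<in> fst c"
begin

text \<open>\<open>Suc n\<close>, since a jet of order \<open>n\<close> includes the derivatives of
  order \<open>n\<close>. The passage from sorted to arbitrary index lists is
  \<open>ipartial_sort\<close>.\<close>

lemma Ovan_jets:
  assumes \<phi>: "\<phi> \<in> local_diffeos m A" "\<phi> z = Some z" and \<psi>: "\<psi> \<in> local_diffeos m A" "\<psi> z = Some z"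
    and i: "i < m"
  shows "Ovan {..<m} (snd c z) (Suc n) (\<lambda>x. coord_rep c c \<phi> x i - coord_rep c c \<psi> x i) \<longleftrightarrow>
    (\<forall>bs\<in>multi_idx m n. ipartial bs (\<lambda>x. coord_rep c c \<phi> x i) (snd c z) = ipartial bs (\<lambda>x. coord_rep c c \<psi> x i) (snd c z))"
proof -
  let ?U = "rep_dom c c \<phi> \<inter> rep_dom c c \<psi>"
  note D = cdiffeoD[OF rep_cdiffeo[OF A \<phi>(1) c c]] and E = cdiffeoD[OF rep_cdiffeo[OF A \<psi>(1) c c]]
  have oU: "copen {..<m} ?U" using D(1) E(1) by blast
  have x0: "snd c z \<in> ?U" using rep_fix(1)[where \<phi> = \<phi>, OF A c z \<phi>(2)] rep_fix(1)[where \<phi> = \<psi>, OF A c z \<psi>(2)] by blast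
  have s: "smooth_real_on {..<m} ?U (\<lambda>x. coord_rep c c \<phi> x i)" "smooth_real_on {..<m} ?U (\<lambda>x. coord_rep c c \<psi> x i)"
    using smooth_subset[OF D(7)] smooth_subset[OF E(7)] i by auto
  note df = ipartial_diff[OF finite_lessThan oU s _ x0]
  have "(\<forall>bs. set bs \<subseteq> {..<m} \<and> length bs < Suc n \<longrightarrow>
      ipartial bs (\<lambda>x. coord_rep c c \<phi> x i - coord_rep c c \<psi> x i) (snd c z) = 0) \<longleftrightarrow>
    (\<forall>bs\<in>multi_idx m n. ipartial bs (\<lambda>x. coord_rep c c \<phi> x i) (snd c z) = ipartial bs (\<lambda>x. coord_rep c c \<psi> x i) (snd c z))"
    (is "?L \<longleftrightarrow> ?R")
  proof
    assume ?L then show ?R using df by (auto simp: multi_idx_def)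
  next
    assume R: ?R
    show ?L
    proof (intro allI impI)
      fix bs :: "nat list" assume bs: "set bs \<subseteq> {..<m} \<and> length bs < Suc n"
      then have "sort bs \<in> multi_idx m n" by (intro multi_idx_sort) auto
      then have "ipartial (sort bs) (\<lambda>x. coord_rep c c \<phi> x i) (snd c z) = ipartial (sort bs) (\<lambda>x. coord_rep c c \<psi> x i) (snd c z)"
        using R by blast
      then show "ipartial bs (\<lambda>x. coord_rep c c \<phi> x i - coord_rep c c \<psi> x i) (snd c z) = 0"
        using df bs ipartial_sort[OF finite_lessThan oU s(1) _ x0] ipartial_sort[OF finite_lessThan oU s(2) _ x0] by simp
    qed
  qed
  then show ?thesis using Ovan_iff[OF finite_lessThan oU x0 smooth_diff[OF finite_lessThan oU s]] by simp
qed

text \<open>Jets compare derivatives in all pairs of charts, but orders of vanishing survive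
  composition with transition maps on both sides, so one chart suffices.\<close>

lemma same_jet_iff:
  assumes \<phi>: "\<phi> \<in> local_diffeos m A" "\<phi> z = Some z" and \<psi>: "\<psi> \<in> local_diffeos m A" "\<psi> z = Some z"
  shows "same_jet m A n z \<phi> \<psi> \<longleftrightarrow>
    (\<forall>i<m. Ovan {..<m} (snd c z) (Suc n) (\<lambda>x. coord_rep c c \<phi> x i - coord_rep c c \<psi> x i))"
proof
  assume "same_jet m A n z \<phi> \<psi>"
  then have "\<forall>i<m. \<forall>bs\<in>multi_idx m n. ipartial bs (\<lambda>x. coord_rep c c \<phi> x i) (snd c z) =
      ipartial bs (\<lambda>x. coord_rep c c \<psi> x i) (snd c z)"
    unfolding same_jet_def using c z \<phi>(2) by simp
  then show "\<forall>i<m. Ovan {..<m} (snd c z) (Suc n) (\<lambda>x. coord_rep c c \<phi> x i - coord_rep c c \<psi> x i)"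
    using Ovan_jets[OF \<phi> \<psi>] by blast
next
  assume O: "\<forall>i<m. Ovan {..<m} (snd c z) (Suc n) (\<lambda>x. coord_rep c c \<phi> x i - coord_rep c c \<psi> x i)"
  let ?I = "{..<m}" and ?x0 = "snd c z"
  note F = finite_lessThan[of m]
  show "same_jet m A n z \<phi> \<psi>" unfolding same_jet_def
  proof (intro conjI ballI impI allI)
    show "z \<in> dom \<phi> \<inter> dom \<psi>" "\<phi> z = \<psi> z" using \<phi>(2) \<psi>(2) by auto
    fix c' d' a bs assume cd: "c' \<in> A" "d' \<in> A" "z \<in> fst c'" "the (\<phi> z) \<in> fst d'" and a: "a < m" and bs: "bs \<in> multi_idx m n"
    have zd: "z \<in> fst d'" using cd(4) \<phi>(2) by simp
    let ?x1 = "snd c' z"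
    let ?\<kappa> = "\<lambda>x. snd c (cinv c' x)" and ?\<theta> = "\<lambda>x. snd d' (cinv c x)"
    note K = transition[OF A cd(1) c] and T = transition[OF A c cd(2)]
    note KD = cdiffeoD[OF K] and TD = cdiffeoD[OF T]
    have x1: "?x1 \<in> snd c' ` (fst c' \<inter> fst c)" using cd(3) z by blast
    have x0T: "?x0 \<in> snd c ` (fst c \<inter> fst d')" using zd z by blast
    have k0: "?\<kappa> ?x1 = ?x0" using cinv_left[OF A cd(1,3)] by simp
    have flk: "filterlim ?\<kappa> (cnh ?I ?x0) (cnh ?I ?x1)" using cdiffeo_filterlim[OF F K x1] k0 by simp
    have O1: "Ovan ?I ?x1 (Suc n) (\<lambda>x. coord_rep c c \<phi> (?\<kappa> x) i - coord_rep c c \<psi> (?\<kappa> x) i)" if i: "i \<in> ?I" for i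
    proof (rule Ovan_compose[OF F F _ _ _ flk])
      show "Ovan ?I ?x0 (Suc n) (\<lambda>x. coord_rep c c \<phi> x i - coord_rep c c \<psi> x i)" using O i by simp
      show "Ovan ?I ?x1 1 (\<lambda>x. ?\<kappa> x j - ?x0 j)" if "j \<in> ?I" for j
        using Ovan_smooth1[OF F KD(1) x1 KD(7)[OF that]] k0 by simp
      show "\<forall>\<^sub>F x in cnh ?I ?x1. ?\<kappa> x \<in> coord_space ?I"
        using cnh_copen[OF F KD(1) x1] by eventually_elim (use KD(3,10) in blast)
    qed
    have rd: "eventually (\<lambda>x. x \<in> rep_dom c c \<eta>) (cnh ?I ?x0)" "filterlim (coord_rep c c \<eta>) (cnh ?I ?x0) (cnh ?I ?x0)"
      "eventually (\<lambda>x. x \<in> rep_dom c' d' \<eta>) (cnh ?I ?x1)" "?x1 \<in> rep_dom c' d' \<eta>"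
      if \<eta>: "\<eta> \<in> local_diffeos m A" "\<eta> z = Some z" for \<eta>
    proof -
      note R = rep_cdiffeo[OF A \<eta>(1) c c]
      show "eventually (\<lambda>x. x \<in> rep_dom c c \<eta>) (cnh ?I ?x0)"
        by (rule cnh_copen[OF F cdiffeoD(1)[OF R] rep_fix(1)[where \<phi> = \<eta>, OF A c z \<eta>(2)]])
      show "filterlim (coord_rep c c \<eta>) (cnh ?I ?x0) (cnh ?I ?x0)"
        using cdiffeo_filterlim[OF F R rep_fix(1)[where \<phi> = \<eta>, OF A c z \<eta>(2)]] rep_fix(2)[where \<phi> = \<eta>, OF A c z \<eta>(2)] by simp
      show x1d: "?x1 \<in> rep_dom c' d' \<eta>" unfolding rep_dom_def by (rule imageI) (use \<eta>(2) cd(3) zd in auto)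
      show "eventually (\<lambda>x. x \<in> rep_dom c' d' \<eta>) (cnh ?I ?x1)"
        by (rule cnh_copen[OF F cdiffeoD(1)[OF rep_cdiffeo[OF A \<eta>(1) cd(1,2)]] x1d])
    qed
    have eq: "\<forall>\<^sub>F x in cnh ?I ?x1. ?\<theta> (coord_rep c c \<eta> (?\<kappa> x)) = coord_rep c' d' \<eta> x"
      if \<eta>: "\<eta> \<in> local_diffeos m A" "\<eta> z = Some z" for \<eta>
      using flk[unfolded filterlim_iff, rule_format, OF rd(1)[OF \<eta>]] cnh_copen[OF F KD(1) x1]
    proof eventually_elim
      case (elim x)
      then obtain q where q: "q \<in> fst c'" "q \<in> fst c" "x = snd c' q" by blast
      have cq: "cinv c' x = q" "cinv c (snd c q) = q" using q cinv_left[OF A cd(1)] cinv_left[OF A c] by auto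
      obtain r s where r: "r \<in> fst c" "\<eta> r = Some s" "s \<in> fst c" "snd c q = snd c r" using elim(1) cq by (auto simp: rep_dom_def)
      have "r = q" using inj_onD[OF chart_inj[OF A c] r(4)] q(2) r(1) by simp
      then have e: "\<eta> q = Some s" using r(2) by simp
      show ?case unfolding coord_rep_def cq e using cinv_left[OF A c r(3)] by simp
    qed
    have lim: "filterlim (\<lambda>x. coord_rep c c \<eta> (?\<kappa> x)) (cnh ?I ?x0) (cnh ?I ?x1)"
      if "\<eta> \<in> local_diffeos m A" "\<eta> z = Some z" for \<eta> using filterlim_compose[OF rd(2)[OF that] flk] .
    have "Ovan ?I ?x1 (Suc n) (\<lambda>x. ?\<theta> (coord_rep c c \<phi> (?\<kappa> x)) a - ?\<theta> (coord_rep c c \<psi> (?\<kappa> x)) a)"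
      by (rule Ovan_comp_diff[OF F F TD(1) TD(7) x0T lim[OF \<phi>] lim[OF \<psi>] O1]) (use a in simp)
    then have O2: "Ovan ?I ?x1 (Suc n) (\<lambda>x. coord_rep c' d' \<phi> x a - coord_rep c' d' \<psi> x a)"
      by (rule Ovan_cong[rotated]) (use eq[OF \<phi>] eq[OF \<psi>] in eventually_elim, simp)
    let ?U = "rep_dom c' d' \<phi> \<inter> rep_dom c' d' \<psi>"
    note P = cdiffeoD[OF rep_cdiffeo[OF A \<phi>(1) cd(1,2)]] and Q = cdiffeoD[OF rep_cdiffeo[OF A \<psi>(1) cd(1,2)]]
    have oU: "copen ?I ?U" using P(1) Q(1) by blast
    have x1U: "?x1 \<in> ?U" using rd(4)[OF \<phi>] rd(4)[OF \<psi>] by blast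
    have s: "smooth_real_on ?I ?U (\<lambda>x. coord_rep c' d' \<phi> x a)" "smooth_real_on ?I ?U (\<lambda>x. coord_rep c' d' \<psi> x a)"
      using smooth_subset[OF P(7)] smooth_subset[OF Q(7)] a by auto
    have b: "set bs \<subseteq> ?I" "length bs < Suc n" using bs by (auto simp: multi_idx_def)
    have "ipartial bs (\<lambda>x. coord_rep c' d' \<phi> x a - coord_rep c' d' \<psi> x a) ?x1 = 0"
      using O2 b Ovan_iff[OF F oU x1U smooth_diff[OF F oU s]] by blast
    then show "ipartial bs (\<lambda>x. coord_rep c' d' \<phi> x a) ?x1 = ipartial bs (\<lambda>x. coord_rep c' d' \<psi> x a) ?x1"
      using ipartial_diff[OF F oU s b(1) x1U] by simp
  qed
qed

section \<open>Isotropy\<close>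

text \<open>The symmetric relation; contact of order \<open>n\<close> corresponds to
  \<open>k = Suc n\<close>.\<close>

definition capprox :: "nat \<Rightarrow> 'a set \<Rightarrow> 'a set \<Rightarrow> bool" where
  "capprox k S T \<longleftrightarrow> near {..<m} (snd c z) k (cimg c S) (cimg c T) \<and> near {..<m} (snd c z) k (cimg c T) (cimg c S)"

lemma capprox_refl: "capprox k S S" by (simp add: capprox_def near_refl)

lemma capprox_sym: "capprox k S T \<Longrightarrow> capprox k T S" by (simp add: capprox_def)

lemma capprox_trans: "1 \<le> k \<Longrightarrow> capprox k S T \<Longrightarrow> capprox k T R \<Longrightarrow> capprox k S R"
  unfolding capprox_def by (auto intro: near_trans[OF finite_lessThan _ _ _ cimg_coord[OF A c z]])

lemma capprox_mono: "capprox k S T \<Longrightarrow> l \<le> k \<Longrightarrow> capprox l S T"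
  unfolding capprox_def by (auto intro: near_mono[OF finite_lessThan])

lemma capprox_pimage:
  "\<phi> \<in> local_diffeos m A \<Longrightarrow> \<phi> z = Some z \<Longrightarrow> 1 \<le> k \<Longrightarrow> capprox k S T \<Longrightarrow> capprox k (pimage \<phi> S) (pimage \<phi> T)"
  unfolding capprox_def by (auto intro: near_pimage[OF A c z])

lemma capprox_same_jet:
  assumes \<phi>: "\<phi> \<in> local_diffeos m A" "\<phi> z = Some z" and \<psi>: "\<psi> \<in> local_diffeos m A" "\<psi> z = Some z"
    and s: "same_jet m A n z \<phi> \<psi>"
  shows "capprox (Suc n) (pimage \<phi> S) (pimage \<psi> S)"
  unfolding capprox_def using near_pimage_jets[OF A c z \<phi> \<psi>] near_pimage_jets[OF A c z \<psi> \<phi>] s same_jet_sym[OF s]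
  unfolding same_jet_iff[OF \<phi> \<psi>] same_jet_iff[OF \<psi> \<phi>] by simp

lemma contact_capprox:
  assumes "1 \<le> n" "slice {..<m} (snd c z) p (cimg c S)" "slice {..<m} (snd c z) p (cimg c T)" "z \<in> S" "z \<in> T"
  shows "contact m A p n z S T \<longleftrightarrow> capprox (Suc n) S T"
  unfolding capprox_def by (rule contact_iff[OF A c z assms])

text \<open>The hypotheses are asymmetric because \<open>X\<close> will be the image of a
  submanifold under a partial map, which is only known to be a slice near \<open>z\<close>.\<close>

lemma sjet_eq_iff:
  assumes n: "1 \<le> n" and X: "slice {..<m} (snd c z) p (cimg c X)" "z \<in> X"
    and S: "embedded_submanifold {..<m} A p S" "z \<in> S"
  shows "sjet m A p n z X = sjet m A p n z S \<longleftrightarrow> capprox (Suc n) X S"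
proof
  note sl = slice_embedded[OF A c z]
  note cc = contact_capprox[OF n]
  {
    assume "sjet m A p n z X = sjet m A p n z S"
    then have e: "{S'. embedded_submanifold {..<m} A p S' \<and> contact m A p n z X S'} =
      {S'. embedded_submanifold {..<m} A p S' \<and> contact m A p n z S S'}" by (simp add: sjet_def)
    have "contact m A p n z S S" using cc[OF sl[OF S] sl[OF S] S(2) S(2)] capprox_refl by blast
    then have "S \<in> {S'. embedded_submanifold {..<m} A p S' \<and> contact m A p n z S S'}" using S(1) by blast
    then have "contact m A p n z X S" unfolding e[symmetric] by blast
    then show "capprox (Suc n) X S" using cc[OF X(1) sl[OF S] X(2) S(2)] by blast
  next
    assume a: "capprox (Suc n) X S"
    have "contact m A p n z X S' \<longleftrightarrow> contact m A p n z S S'" if S': "embedded_submanifold {..<m} A p S'" for S'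
    proof (cases "z \<in> S'")
      case True
      have "capprox (Suc n) X S' \<longleftrightarrow> capprox (Suc n) S S'"
      proof
        have k: "1 \<le> Suc n" by simp
        show "capprox (Suc n) S S'" if "capprox (Suc n) X S'" by (rule capprox_trans[OF k capprox_sym[OF a] that])
        show "capprox (Suc n) X S'" if "capprox (Suc n) S S'" by (rule capprox_trans[OF k a that])
      qed
      then show ?thesis using cc[OF X(1) sl[OF S' True] X(2) True] cc[OF sl[OF S] sl[OF S' True] S(2) True] by simp
    next
      case False
      then show ?thesis by (simp add: contact_def)
    qed
    then show "sjet m A p n z X = sjet m A p n z S" unfolding sjet_def by blast
  }
qed

lemma sjet_rep_props:
  assumes n: "1 \<le> n" and S: "embedded_submanifold {..<m} A p S" "z \<in> S"
  defines "R \<equiv> sjet_rep (sjet m A p n z S)"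
  shows "embedded_submanifold {..<m} A p R" "z \<in> R" "capprox (Suc n) S R"
proof -
  note sl = slice_embedded[OF A c z]
  note cc = contact_capprox[OF n]
  have "contact m A p n z S S" using cc[OF sl[OF S] sl[OF S] S(2) S(2)] capprox_refl by blast
  then have "S \<in> snd (sjet m A p n z S)" using S(1) by (simp add: sjet_def)
  then have "R \<in> snd (sjet m A p n z S)" unfolding R_def by (rule someI[of "\<lambda>R. R \<in> snd (sjet m A p n z S)"])
  then have R: "embedded_submanifold {..<m} A p R" "contact m A p n z S R" by (auto simp: sjet_def)
  then show "embedded_submanifold {..<m} A p R" by blast
  have "z \<in> S \<inter> R" using R(2) unfolding contact_def by (rule conjunct1)
  then show zR: "z \<in> R" by blast
  show "capprox (Suc n) S R" using cc[OF sl[OF S] sl[OF R(1) zR] S(2) zR] R(2) by blast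
qed

lemma pimage_fix: "\<phi> z = Some z \<Longrightarrow> z \<in> S \<Longrightarrow> z \<in> pimage \<phi> S" by (auto simp: pimage_def)

text \<open>The action is defined through chosen representatives of both jets; replacing them by
  \<open>\<phi>\<close> and \<open>S\<close> changes the image only beyond the order that
  matters.\<close>

lemma sjet_act_fix_iff:
  assumes n: "1 \<le> n" and S: "embedded_submanifold {..<m} A p S" "z \<in> S"
    and \<phi>: "\<phi> \<in> local_diffeos m A" "\<phi> z = Some z"
  shows "sjet_act m A p n (djet m A n z \<phi>) (sjet m A p n z S) = sjet m A p n z S \<longleftrightarrow> capprox (Suc n) (pimage \<phi> S) S"
proof -
  let ?R = "sjet_rep (sjet m A p n z S)" and ?\<psi> = "djet_rep (djet m A n z \<phi>)"
  have zd: "z \<in> dom \<phi>" using \<phi>(2) by blast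
  note R = sjet_rep_props[OF n S]
  note P = djet_rep_same[OF \<phi>(1) zd, of n]
  have pz: "?\<psi> z = Some z" using P(2) \<phi>(2) by (simp add: same_jet_def)
  have act: "sjet_act m A p n (djet m A n z \<phi>) (sjet m A p n z S) = sjet m A p n z (pimage ?\<psi> ?R)"
    using djet_target_eq[OF \<phi>] by (simp add: sjet_act_def pimage_def)
  have sl: "slice {..<m} (snd c z) p (cimg c (pimage ?\<psi> ?R))"
    by (rule slice_pimage[OF A c z P(1) pz slice_embedded[OF A c z R(1,2)]])
  have k: "1 \<le> Suc n" by simp
  have "capprox (Suc n) (pimage ?\<psi> ?R) (pimage \<phi> S)"
    by (rule capprox_trans[OF k capprox_pimage[OF P(1) pz k capprox_sym[OF R(3)]] capprox_sym[OF capprox_same_jet[OF \<phi> P(1) pz P(2)]]])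
  then have "capprox (Suc n) (pimage ?\<psi> ?R) S \<longleftrightarrow> capprox (Suc n) (pimage \<phi> S) S"
    using capprox_trans[OF k capprox_sym] capprox_trans[OF k] by (intro iffI)
  then show ?thesis unfolding act using sjet_eq_iff[OF n sl pimage_fix[where \<phi> = "djet_rep (djet m A n z \<phi>)", OF pz R(2)] S] by simp
qed

lemma isotropy_iff:
  assumes n: "1 \<le> n" and S: "embedded_submanifold {..<m} A p S" "z \<in> S" and G: "G \<subseteq> local_diffeos m A"
  shows "g \<in> isotropy m A G p n (sjet m A p n z S) \<longleftrightarrow>
    (\<exists>\<phi>\<in>G. \<phi> z = Some z \<and> g = djet m A n z \<phi> \<and> capprox (Suc n) (pimage \<phi> S) S)"
proof
  assume g: "g \<in> isotropy m A G p n (sjet m A p n z S)"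
  then obtain z' \<phi> where p: "g = djet m A n z' \<phi>" "\<phi> \<in> G" "z' \<in> dom \<phi>" by (auto simp: isotropy_def djets_of_def)
  have z': "z' = z" using g p(1) by (simp add: isotropy_def djet_def sjet_def)
  obtain w where w: "\<phi> z = Some w" using p(3) z' by blast
  have L: "\<phi> \<in> local_diffeos m A" using G p(2) by blast
  have "w = z" using g djet_target_eq[OF L w] p(1) z' by (simp add: isotropy_def sjet_def)
  then have fz: "\<phi> z = Some z" using w by simp
  have "sjet_act m A p n (djet m A n z \<phi>) (sjet m A p n z S) = sjet m A p n z S" using g p(1) z' by (simp add: isotropy_def)
  then have "capprox (Suc n) (pimage \<phi> S) S" using sjet_act_fix_iff[OF n S L fz] by simp
  then show "\<exists>\<phi>\<in>G. \<phi> z = Some z \<and> g = djet m A n z \<phi> \<and> capprox (Suc n) (pimage \<phi> S) S" using p z' fz by blast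
next
  assume "\<exists>\<phi>\<in>G. \<phi> z = Some z \<and> g = djet m A n z \<phi> \<and> capprox (Suc n) (pimage \<phi> S) S"
  then obtain \<phi> where p: "\<phi> \<in> G" "\<phi> z = Some z" "g = djet m A n z \<phi>" "capprox (Suc n) (pimage \<phi> S) S" by blast
  have L: "\<phi> \<in> local_diffeos m A" using G p(1) by blast
  have "g \<in> djets_of m A n G" unfolding djets_of_def using p by blast
  moreover have "djet_target g = z" using djet_target_eq[OF L p(2)] p(3) by simp
  moreover have "sjet_act m A p n g (sjet m A p n z S) = sjet m A p n z S" using sjet_act_fix_iff[OF n S L p(2)] p by simp
  ultimately show "g \<in> isotropy m A G p n (sjet m A p n z S)" using p(3) by (simp add: isotropy_def djet_def sjet_def)
qed

section \<open>Coordinates on jet bundles\<close>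

text \<open>The section of \<open>n\<close>-jets of \<open>\<phi>\<close> in the coordinates of
  \<open>djet_chart m A n c c\<close>, as a function on coordinate space that can be
  differentiated.\<close>

definition jcoord :: "nat \<Rightarrow> 'a pmap \<Rightarrow> (nat \<Rightarrow> real) \<Rightarrow> jidx \<Rightarrow> real" where
  "jcoord n \<phi> x = (\<lambda>i. if i \<in> djet_idx m n then
     (case i of Inl b \<Rightarrow> x b | Inr (a, bs) \<Rightarrow> ipartial bs (\<lambda>x. coord_rep c c \<phi> x a) x) else 0)"

lemma rep_dom_cinv:
  assumes "x \<in> rep_dom c c \<phi>"
  shows "cinv c x \<in> fst c" "snd c (cinv c x) = x" "cinv c x \<in> dom \<phi>" "the (\<phi> (cinv c x)) \<in> fst c"
  using assms cinv_left[OF A c] by (auto simp: rep_dom_def)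

lemma djet_coords:
  assumes \<phi>: "\<phi> \<in> local_diffeos m A" and x: "x \<in> rep_dom c c \<phi>"
  shows "djet m A n (cinv c x) \<phi> \<in> fst (djet_chart m A n c c)"
    "snd (djet_chart m A n c c) (djet m A n (cinv c x) \<phi>) = jcoord n \<phi> x"
proof -
  let ?q = "cinv c x"
  note q = rep_dom_cinv[OF x]
  obtain r where r: "\<phi> ?q = Some r" using q(3) by blast
  have "djet m A n ?q \<phi> \<in> djets m A n" unfolding djets_def djets_of_def using \<phi> q(3) by blast
  then show "djet m A n ?q \<phi> \<in> fst (djet_chart m A n c c)"
    using q r djet_target_eq[OF \<phi> r] by (simp add: djet_chart_def djet_def)
  have sj: "same_jet m A n ?q \<phi> (djet_rep (djet m A n ?q \<phi>))" by (rule djet_rep_same[OF \<phi> q(3)])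
  have "ipartial bs (\<lambda>x. coord_rep c c (djet_rep (djet m A n ?q \<phi>)) x a) x = ipartial bs (\<lambda>x. coord_rep c c \<phi> x a) x"
    if "a < m" "bs \<in> multi_idx m n" for a bs
    using sj[unfolded same_jet_def, THEN conjunct2, THEN conjunct2, rule_format, OF c c q(1,4) that] unfolding q(2) by (rule sym)
  moreover have src: "djet_source (djet m A n ?q \<phi>) = ?q" by (simp add: djet_def)
  ultimately show "snd (djet_chart m A n c c) (djet m A n ?q \<phi>) = jcoord n \<phi> x"
    unfolding djet_chart_def jcoord_def snd_conv src q(2) by (intro ext) (auto simp: djet_idx_def)
qed

lemma djet_coords_fix:
  assumes \<phi>: "\<phi> \<in> local_diffeos m A" "\<phi> z = Some z"
  shows "djet m A n z \<phi> \<in> fst (djet_chart m A n c c)"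
    "snd (djet_chart m A n c c) (djet m A n z \<phi>) = jcoord n \<phi> (snd c z)"
  using djet_coords[OF \<phi>(1) rep_fix(1)[where \<phi> = \<phi>, OF A c z \<phi>(2)], of n] cinv_left[OF A c z] by simp_all

lemma finite_djet_idx: "finite (djet_idx m n)"
proof -
  have "finite {bs. set bs \<subseteq> {..<m} \<and> length bs \<le> n}" by (rule finite_lists_length_le) simp
  then have "finite (multi_idx m n)" by (rule rev_finite_subset) (auto simp: multi_idx_def)
  then show ?thesis by (simp add: djet_idx_def)
qed

lemma djet_chart_in: "djet_chart m A n c c \<in> djet_atlas m A n" unfolding djet_atlas_def using c by blast

text \<open>All isotropy elements have source and target \<open>z\<close>, so they lie in the one
  chart \<open>djet_chart m A n c c\<close>, and discreteness becomes a metric separation of their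
  coordinates. Passing to elements of \<open>G\<close> removes jets as sets from the rest of the
  argument.\<close>

lemma locally_free_iff:
  assumes DA: "smooth_atlas (djet_idx m n) (djet_atlas m A n)"
    and n: "1 \<le> n" and S: "embedded_submanifold {..<m} A p S" "z \<in> S" and G: "G \<subseteq> local_diffeos m A"
  shows "locally_free_at m A G p n (sjet m A p n z S) \<longleftrightarrow>
    (\<forall>\<phi>\<in>G. \<phi> z = Some z \<longrightarrow> capprox (Suc n) (pimage \<phi> S) S \<longrightarrow>
      (\<exists>e>0. \<forall>\<psi>\<in>G. \<psi> z = Some z \<longrightarrow> capprox (Suc n) (pimage \<psi> S) S \<longrightarrow>
        cdist (djet_idx m n) (jcoord n \<phi> (snd c z)) (jcoord n \<psi> (snd c z)) < e \<longrightarrow> same_jet m A n z \<phi> \<psi>))"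
proof -
  let ?J = "djet_idx m n" and ?T = "atlas_topology (djet_idx m n) (djet_atlas m A n)"
    and ?H = "isotropy m A G p n (sjet m A p n z S)" and ?C = "djet_chart m A n c c"
  note fJ = finite_djet_idx[of n] and iff = isotropy_iff[OF n S G]
  note C = djet_chart_in[of n]
  have HC: "?H \<subseteq> fst ?C"
  proof
    fix g assume "g \<in> ?H"
    then obtain \<phi> where "\<phi> \<in> G" "\<phi> z = Some z" "g = djet m A n z \<phi>" unfolding iff by blast
    then show "g \<in> fst ?C" using djet_coords_fix(1)[of \<phi> n] G by blast
  qed
  have Htop: "?H \<subseteq> topspace ?T" using HC C unfolding atlas_topspace[OF DA] points_def by blast
  have disc: "locally_free_at m A G p n (sjet m A p n z S) \<longleftrightarrow> (\<forall>g\<in>?H. \<exists>W. openin ?T W \<and> ?H \<inter> W = {g})"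
  proof -
    have "subtopology ?T ?H = discrete_topology ?H \<longleftrightarrow> (\<forall>g\<in>?H. openin (subtopology ?T ?H) {g})"
      using discrete_topology_unique[of ?H "subtopology ?T ?H"] Htop by (auto simp: topspace_subtopology)
    also have "\<dots> \<longleftrightarrow> (\<forall>g\<in>?H. \<exists>W. openin ?T W \<and> ?H \<inter> W = {g})"
      by (simp add: openin_subtopology) (metis Int_commute)
    finally show ?thesis by (simp add: locally_free_at_def)
  qed
  have met: "(\<exists>W. openin ?T W \<and> ?H \<inter> W = {g}) \<longleftrightarrow> (\<exists>e>0. \<forall>h\<in>?H. cdist ?J (snd ?C g) (snd ?C h) < e \<longrightarrow> h = g)"
    if g: "g \<in> ?H" for g
  proof
    assume "\<exists>W. openin ?T W \<and> ?H \<inter> W = {g}"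
    then obtain W where W: "openin ?T W" "?H \<inter> W = {g}" by blast
    have gC: "g \<in> fst ?C" using HC g by blast
    have o: "copen ?J (snd ?C ` (W \<inter> fst ?C))" by (rule atlas_open_image[OF DA W(1) C])
    have "snd ?C g \<in> snd ?C ` (W \<inter> fst ?C)" using W(2) gC by blast
    then obtain e where e: "e > 0" "\<forall>y\<in>coord_space ?J. cdist ?J (snd ?C g) y < e \<longrightarrow> y \<in> snd ?C ` (W \<inter> fst ?C)"
      using copenD[OF fJ o] by blast
    have "h = g" if h: "h \<in> ?H" "cdist ?J (snd ?C g) (snd ?C h) < e" for h
    proof -
      have hC: "h \<in> fst ?C" using HC h(1) by blast
      have "snd ?C h \<in> snd ?C ` (W \<inter> fst ?C)" using e(2) h(2) chart_coord[OF DA C hC] by blast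
      then have "h \<in> W \<inter> fst ?C" using chart_mem[OF DA C hC, of "W \<inter> fst ?C"] by simp
      then show ?thesis using W(2) h(1) by blast
    qed
    then show "\<exists>e>0. \<forall>h\<in>?H. cdist ?J (snd ?C g) (snd ?C h) < e \<longrightarrow> h = g" using e(1) by blast
  next
    assume "\<exists>e>0. \<forall>h\<in>?H. cdist ?J (snd ?C g) (snd ?C h) < e \<longrightarrow> h = g"
    then obtain e where e: "e > 0" "\<forall>h\<in>?H. cdist ?J (snd ?C g) (snd ?C h) < e \<longrightarrow> h = g" by blast
    let ?W = "{h \<in> fst ?C. cdist ?J (snd ?C g) (snd ?C h) < e}"
    have "snd ?C ` ?W = snd ?C ` fst ?C \<inter> {y\<in>coord_space ?J. cdist ?J (snd ?C g) y < e}" using chart_coord[OF DA C] by auto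
    then have im: "copen ?J (snd ?C ` ?W)" using chart_copen[OF DA C] copen_ball[OF fJ] by auto
    have "openin ?T ?W" by (rule atlas_openI[OF DA C _ im]) blast
    moreover have "?H \<inter> ?W = {g}" using e HC g cdist_self[OF fJ] by auto
    ultimately show "\<exists>W. openin ?T W \<and> ?H \<inter> W = {g}" by blast
  qed
  have pt: "(\<exists>e>0. \<forall>h\<in>?H. cdist ?J (snd ?C (djet m A n z \<phi>)) (snd ?C h) < e \<longrightarrow> h = djet m A n z \<phi>) \<longleftrightarrow>
    (\<exists>e>0. \<forall>\<psi>\<in>G. \<psi> z = Some z \<longrightarrow> capprox (Suc n) (pimage \<psi> S) S \<longrightarrow>
        cdist ?J (jcoord n \<phi> (snd c z)) (jcoord n \<psi> (snd c z)) < e \<longrightarrow> same_jet m A n z \<phi> \<psi>)"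
    if p: "\<phi> \<in> G" "\<phi> z = Some z" for \<phi>
  proof -
    have L: "\<phi> \<in> local_diffeos m A" "z \<in> dom \<phi>" using G p by auto
    have "(\<forall>h\<in>?H. cdist ?J (snd ?C (djet m A n z \<phi>)) (snd ?C h) < e \<longrightarrow> h = djet m A n z \<phi>) \<longleftrightarrow>
      (\<forall>\<psi>\<in>G. \<psi> z = Some z \<longrightarrow> capprox (Suc n) (pimage \<psi> S) S \<longrightarrow>
        cdist ?J (jcoord n \<phi> (snd c z)) (jcoord n \<psi> (snd c z)) < e \<longrightarrow> same_jet m A n z \<phi> \<psi>)" (is "?L \<longleftrightarrow> ?R") for e
    proof
      assume a: ?L
      show ?R
      proof (intro ballI impI)
        fix \<psi> assume s: "\<psi> \<in> G" "\<psi> z = Some z" "capprox (Suc n) (pimage \<psi> S) S"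
          "cdist ?J (jcoord n \<phi> (snd c z)) (jcoord n \<psi> (snd c z)) < e"
        have L': "\<psi> \<in> local_diffeos m A" "z \<in> dom \<psi>" using G s by auto
        have "djet m A n z \<psi> \<in> ?H" using iff s by blast
        then have "djet m A n z \<psi> = djet m A n z \<phi>"
          using a s(4) djet_coords_fix(2)[OF L(1) p(2)] djet_coords_fix(2)[OF L'(1) s(2)] by simp
        then show "same_jet m A n z \<phi> \<psi>" using djet_eq_iff[OF L(1) L'(1) L(2) L'(2)] by metis
      qed
    next
      assume a: ?R
      show ?L
      proof (intro ballI impI)
        fix h assume h: "h \<in> ?H" "cdist ?J (snd ?C (djet m A n z \<phi>)) (snd ?C h) < e"
        then obtain \<psi> where s: "\<psi> \<in> G" "\<psi> z = Some z" "h = djet m A n z \<psi>" "capprox (Suc n) (pimage \<psi> S) S"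
          using iff by blast
        have L': "\<psi> \<in> local_diffeos m A" "z \<in> dom \<psi>" using G s by auto
        have "same_jet m A n z \<phi> \<psi>" using a s h(2) djet_coords_fix(2)[OF L(1) p(2)] djet_coords_fix(2)[OF L'(1) s(2)] by simp
        then show "h = djet m A n z \<phi>" using djet_eq_iff[OF L(1) L'(1) L(2) L'(2)] s(3) by metis
      qed
    qed
    then show ?thesis by simp
  qed
  show ?thesis unfolding disc
  proof (intro iffI ballI impI)
    fix \<phi> assume a: "\<forall>g\<in>?H. \<exists>W. openin ?T W \<and> ?H \<inter> W = {g}" and p: "\<phi> \<in> G" "\<phi> z = Some z" "capprox (Suc n) (pimage \<phi> S) S"
    have H: "djet m A n z \<phi> \<in> ?H" using iff p by blast
    show "\<exists>e>0. \<forall>\<psi>\<in>G. \<psi> z = Some z \<longrightarrow> capprox (Suc n) (pimage \<psi> S) S \<longrightarrow>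
        cdist ?J (jcoord n \<phi> (snd c z)) (jcoord n \<psi> (snd c z)) < e \<longrightarrow> same_jet m A n z \<phi> \<psi>"
      using pt[OF p(1,2)] met[OF H] a H by blast
  next
    fix g assume a: "\<forall>\<phi>\<in>G. \<phi> z = Some z \<longrightarrow> capprox (Suc n) (pimage \<phi> S) S \<longrightarrow>
      (\<exists>e>0. \<forall>\<psi>\<in>G. \<psi> z = Some z \<longrightarrow> capprox (Suc n) (pimage \<psi> S) S \<longrightarrow>
        cdist ?J (jcoord n \<phi> (snd c z)) (jcoord n \<psi> (snd c z)) < e \<longrightarrow> same_jet m A n z \<phi> \<psi>)" and H: "g \<in> ?H"
    obtain \<phi> where p: "\<phi> \<in> G" "\<phi> z = Some z" "g = djet m A n z \<phi>" "capprox (Suc n) (pimage \<phi> S) S" using iff H by blast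
    have "\<exists>e>0. \<forall>h\<in>?H. cdist ?J (snd ?C g) (snd ?C h) < e \<longrightarrow> h = g"
      unfolding p(3) pt[OF p(1,2)] using a p(1,2,4) by blast
    then show "\<exists>W. openin ?T W \<and> ?H \<inter> W = {g}" using met[OF H] by blast
  qed
qed

end

section \<open>Flows near a zero of a vector field\<close>

lemma gronwall_small:
  fixes w w' :: "real \<Rightarrow> 'i \<Rightarrow> real"
  assumes J: "finite J" and th: "0 \<le> \<theta>" "\<theta> \<le> 1" and a: "0 \<le> a" "a \<le> 1/2" and b: "0 \<le> b"
    and d: "\<And>s i. s \<in> {0..\<theta>} \<Longrightarrow> i \<in> J \<Longrightarrow> ((\<lambda>s. w s i) has_real_derivative w' s i) (at s)"
    and bd: "\<And>s i. s \<in> {0..\<theta>} \<Longrightarrow> i \<in> J \<Longrightarrow> \<bar>w' s i\<bar> \<le> a * cdist J (\<lambda>_. 0) (w s) + b"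
    and s: "s \<in> {0..\<theta>}"
  shows "cdist J (\<lambda>_. 0) (w s) \<le> 2 * (cdist J (\<lambda>_. 0) (w 0) + b)"
proof -
  let ?N = "\<lambda>s. cdist J (\<lambda>_. 0) (w s)"
  have "\<exists>s\<in>{0..\<theta>}. \<forall>t\<in>{0..\<theta>}. \<bar>w t i\<bar> \<le> \<bar>w s i\<bar>" if i: "i \<in> J" for i
  proof (rule continuous_attains_sup)
    show "continuous_on {0..\<theta>} (\<lambda>s. \<bar>w s i\<bar>)"
      by (intro continuous_intros continuous_at_imp_continuous_on ballI DERIV_isCont[OF d[OF _ i]])
  qed (use th in auto)
  then obtain q where q: "\<And>i. i \<in> J \<Longrightarrow> q i \<in> {0..\<theta>} \<and> (\<forall>t\<in>{0..\<theta>}. \<bar>w t i\<bar> \<le> \<bar>w (q i) i\<bar>)" by metis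
  define M where "M = Max (insert 0 ((\<lambda>i. \<bar>w (q i) i\<bar>) ` J))"
  have M0: "0 \<le> M" using J by (simp add: M_def)
  have Mi: "\<bar>w t i\<bar> \<le> M" if t: "t \<in> {0..\<theta>}" "i \<in> J" for t i
  proof -
    have "\<bar>w (q i) i\<bar> \<le> M" using J t(2) by (simp add: M_def)
    then show ?thesis using q[OF t(2)] t(1) by force
  qed
  have NM: "?N t \<le> M" if "t \<in> {0..\<theta>}" for t using Mi[OF that] M0 J by (simp add: cdist_le_iff)
  have "M \<le> ?N 0 + (a * M + b)"
  proof -
    have "M \<in> insert 0 ((\<lambda>i. \<bar>w (q i) i\<bar>) ` J)" unfolding M_def by (rule Max_in) (use J in auto)
    then consider "M = 0" | i where "i \<in> J" "M = \<bar>w (q i) i\<bar>" by blast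
    then show ?thesis
    proof cases
      case 1
      then show ?thesis using b J by simp
    next
      case 2
      have qi: "0 \<le> q i" "q i \<le> \<theta>" using q[OF 2(1)] by auto
      have "((\<lambda>s. w s i) has_real_derivative w' s i) (at s)" if "s \<in> closed_segment 0 (q i)" for s
        using d[of s i] that qi 2(1) by (auto simp: closed_segment_eq_real_ivl)
      from mvt_segment[OF this] obtain t where t: "t \<in> closed_segment 0 (q i)" "w (q i) i - w 0 i = w' t i * (q i - 0)" by blast
      have tt: "t \<in> {0..\<theta>}" using t(1) qi by (auto simp: closed_segment_eq_real_ivl)
      have "\<bar>w' t i\<bar> \<le> a * M + b" using bd[OF tt 2(1)] mult_left_mono[OF NM[OF tt] a(1)] by linarith
      then have "\<bar>w' t i\<bar> * q i \<le> (a * M + b) * 1" using qi th a M0 b by (intro mult_mono) auto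
      then have "\<bar>w (q i) i - w 0 i\<bar> \<le> a * M + b" using t(2) qi by (simp add: abs_mult)
      moreover have "\<bar>w 0 i\<bar> \<le> ?N 0" using abs_le_cdist[OF J 2(1), of "\<lambda>_. 0" "w 0"] by simp
      ultimately show ?thesis using 2(2) by linarith
    qed
  qed
  moreover have "a * M \<le> 1/2 * M" using a M0 by (intro mult_right_mono) auto
  moreover have "M \<le> n0 + (p + b) \<Longrightarrow> p \<le> 1/2 * M \<Longrightarrow> M \<le> 2 * (n0 + b)" for n0 p :: real by simp
  ultimately have "M \<le> 2 * (?N 0 + b)" by blast
  then show ?thesis using NM[OF s] by linarith
qed

lemma compact_cball:
  assumes I: "finite I" and x0: "x0 \<in> coord_space I"
  shows "compact {x\<in>coord_space I. cdist I x0 x \<le> r}"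
proof (cases "0 \<le> r")
  case True
  have "(x i \<in> (if i \<in> I then {x0 i - r..x0 i + r} else {0})) \<longleftrightarrow> (i \<notin> I \<longrightarrow> x i = 0) \<and> (i \<in> I \<longrightarrow> \<bar>x0 i - x i\<bar> \<le> r)" for x i
    by auto
  then have "{x\<in>coord_space I. cdist I x0 x \<le> r} = Pi\<^sub>E UNIV (\<lambda>i. if i \<in> I then {x0 i - r..x0 i + r} else {0})"
    unfolding PiE_UNIV_domain Pi_def cdist_le_iff[OF I True] coord_space_def by blast
  moreover have "compactin (product_topology (\<lambda>_. euclidean) UNIV) (Pi\<^sub>E UNIV (\<lambda>i. if i \<in> I then {x0 i - r..x0 i + r} else {0}))"
    unfolding compactin_PiE by auto
  ultimately show ?thesis by (simp add: euclidean_product_topology)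
next
  case False
  then have "{x\<in>coord_space I. cdist I x0 x \<le> r} = {}" using order_trans[OF cdist_nonneg[OF I]] by blast
  then show ?thesis by (metis compact_empty)
qed

text \<open>An integral curve up to time \<open>t\<close>, reparametrised to the unit interval: the
  time becomes a factor of the field, and negative times need no separate treatment.\<close>

definition scaled_curve ::
    "nat \<Rightarrow> ('a, nat) chart set \<Rightarrow> 'a set \<Rightarrow> 'a vfield \<Rightarrow> real \<Rightarrow> (real \<Rightarrow> 'a) \<Rightarrow> bool" where
  "scaled_curve m A N X t \<Gamma> \<longleftrightarrow> (\<forall>\<theta>\<in>{0..1}. \<Gamma> \<theta> \<in> N \<and>
     (\<forall>c\<in>A. \<Gamma> \<theta> \<in> fst c \<longrightarrow> (\<forall>\<^sub>F r in nhds \<theta>. \<Gamma> r \<in> fst c) \<and>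
        (\<forall>a<m. ((\<lambda>r. snd c (\<Gamma> r) a) has_real_derivative t * X c (\<Gamma> \<theta>) a) (at \<theta>))))"

lemma flows_to_scaled_curve:
  assumes "flows_to m A N X t x y"
  shows "\<exists>\<Gamma>. scaled_curve m A N X t \<Gamma> \<and> \<Gamma> 0 = x \<and> \<Gamma> 1 = y"
proof -
  obtain a b \<gamma> where ab: "0 \<in> {a<..<b}" "t \<in> {a<..<b}" and g: "integral_curve m A N X {a<..<b} \<gamma>"
    and e: "\<gamma> 0 = x" "\<gamma> t = y" using assms unfolding flows_to_def by blast
  have "scaled_curve m A N X t (\<lambda>\<theta>. \<gamma> (\<theta> * t))" unfolding scaled_curve_def
  proof (intro ballI conjI impI allI)
    fix \<theta> :: real assume th: "\<theta> \<in> {0..1}"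
    have "closed_segment 0 t \<subseteq> {a<..<b}" using ab by (auto simp: closed_segment_eq_real_ivl split: if_splits)
    moreover have "\<theta> * t \<in> closed_segment 0 t" using th by (auto simp: in_segment)
    ultimately have s: "\<theta> * t \<in> {a<..<b}" by blast
    then show "\<gamma> (\<theta> * t) \<in> N" using g unfolding integral_curve_def by blast
    fix c assume c: "c \<in> A" "\<gamma> (\<theta> * t) \<in> fst c"
    have ev: "\<forall>\<^sub>F r in at (\<theta> * t). \<gamma> r \<in> fst c" using g s c unfolding integral_curve_def by blast
    then have "\<forall>\<^sub>F r in nhds (\<theta> * t). \<gamma> r \<in> fst c" using c(2) by (auto simp: eventually_at_filter elim: eventually_mono)
    moreover have "filterlim (\<lambda>r. r * t) (nhds (\<theta> * t)) (nhds \<theta>)" by (intro tendsto_intros filterlim_ident)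
    ultimately show "\<forall>\<^sub>F r in nhds \<theta>. \<gamma> (r * t) \<in> fst c" unfolding filterlim_iff by blast
    fix i assume i: "i < m"
    have d: "((\<lambda>r. snd c (\<gamma> r) i) has_real_derivative X c (\<gamma> (\<theta> * t)) i) (at (\<theta> * t))"
      using g s c i unfolding integral_curve_def by blast
    have "((\<lambda>r. r * t) has_real_derivative t) (at \<theta>)" by (auto intro!: derivative_eq_intros)
    from DERIV_chain2[OF d this]
    show "((\<lambda>r. snd c (\<gamma> (r * t)) i) has_real_derivative t * X c (\<gamma> (\<theta> * t)) i) (at \<theta>)" by (simp add: mult.commute)
  qed
  then show ?thesis using e by (intro exI[of _ "\<lambda>\<theta>. \<gamma> (\<theta> * t)"]) simp
qed

lemma flows_to_sym:
  assumes "flows_to m A N X t x y" shows "flows_to m A N X (- t) y x"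
proof -
  obtain a b \<gamma> where ab: "0 \<in> {a<..<b}" "t \<in> {a<..<b}" and g: "integral_curve m A N X {a<..<b} \<gamma>"
    and e: "\<gamma> 0 = x" "\<gamma> t = y" using assms unfolding flows_to_def by blast
  have "integral_curve m A N X {a - t<..<b - t} (\<lambda>s. \<gamma> (s + t))" unfolding integral_curve_def
  proof (intro ballI conjI impI allI)
    fix s assume "s \<in> {a - t<..<b - t}"
    then have s: "s + t \<in> {a<..<b}" by auto
    then show "\<gamma> (s + t) \<in> N" using g unfolding integral_curve_def by blast
    fix c assume c: "c \<in> A" "\<gamma> (s + t) \<in> fst c"
    have ev: "\<forall>\<^sub>F r in at (s + t). \<gamma> r \<in> fst c" using g s c unfolding integral_curve_def by blast
    then show "\<forall>\<^sub>F r in at s. \<gamma> (r + t) \<in> fst c"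
    proof -
      obtain d where "d > 0" "\<forall>r. r \<noteq> s + t \<and> dist r (s + t) < d \<longrightarrow> \<gamma> r \<in> fst c" using ev unfolding eventually_at by auto
      then show ?thesis unfolding eventually_at by (intro exI[of _ d]) (auto simp: dist_real_def)
    qed
    fix i assume i: "i < m"
    have d: "((\<lambda>r. snd c (\<gamma> r) i) has_real_derivative X c (\<gamma> (s + t)) i) (at (s + t))"
      using g s c i unfolding integral_curve_def by blast
    then show "((\<lambda>r. snd c (\<gamma> (r + t)) i) has_real_derivative X c (\<gamma> (s + t)) i) (at s)"
      by (rule DERIV_shift[THEN iffD1])
  qed
  then show ?thesis unfolding flows_to_def using ab e
    by (intro exI[of _ "a - t"] exI[of _ "b - t"] exI[of _ "\<lambda>s. \<gamma> (s + t)"]) auto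
qed

section \<open>A priori estimates for curves near a zero of the field\<close>

definition lip_box :: "nat \<Rightarrow> ('a, nat) chart \<Rightarrow> 'a set \<Rightarrow> 'a vfield \<Rightarrow> 'a \<Rightarrow> real \<Rightarrow> real \<Rightarrow> bool" where
  "lip_box m c N X z r L \<longleftrightarrow> 0 < r \<and> 0 < L \<and>
     (\<forall>x\<in>coord_space {..<m}. \<forall>y\<in>coord_space {..<m}. cdist {..<m} (snd c z) x \<le> r \<longrightarrow> cdist {..<m} (snd c z) y \<le> r \<longrightarrow>
        x \<in> snd c ` (fst c \<inter> N) \<and> cdist {..<m} (X c (cinv c x)) (X c (cinv c y)) \<le> L * cdist {..<m} x y)"

lemma lip_boxD:
  assumes "lip_box m c N X z r L"
  shows "0 < r" "0 < L" "\<And>x. x \<in> coord_space {..<m} \<Longrightarrow> cdist {..<m} (snd c z) x \<le> r \<Longrightarrow> x \<in> snd c ` (fst c \<inter> N)"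
    "\<And>x y. x \<in> coord_space {..<m} \<Longrightarrow> y \<in> coord_space {..<m} \<Longrightarrow> cdist {..<m} (snd c z) x \<le> r \<Longrightarrow>
      cdist {..<m} (snd c z) y \<le> r \<Longrightarrow> cdist {..<m} (X c (cinv c x)) (X c (cinv c y)) \<le> L * cdist {..<m} x y"
  using assms unfolding lip_box_def by blast+

context
  fixes m :: nat and A :: "('a, nat) chart set" and c :: "('a, nat) chart" and z :: 'a and N :: "'a set" and X :: "'a vfield"
  assumes M: "smooth_manifold {..<m} A" and c: "c \<in> A" and z: "z \<in> fst c"
    and vf: "vector_field_on m A N X" and zN: "z \<in> N" and X0: "\<forall>i<m. X c z i = 0"
begin

lemma vf_atlas: "smooth_atlas {..<m} A" using M by (simp add: smooth_manifold_def)

lemma vf_N: "openin (atlas_topology {..<m} A) N" using vf by (simp add: vector_field_on_def)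

lemma vf_dom: "copen {..<m} (snd c ` (fst c \<inter> N))" "snd c z \<in> snd c ` (fst c \<inter> N)"
proof -
  show "copen {..<m} (snd c ` (fst c \<inter> N))" using atlas_open_image[OF vf_atlas vf_N c] by (simp add: Int_commute)
qed (use z zN in blast)

lemma vf_smooth: "i < m \<Longrightarrow> smooth_real_on {..<m} (snd c ` (fst c \<inter> N)) (\<lambda>x. X c (cinv c x) i)"
  using vf c unfolding vector_field_on_def smooth_map_on_def by blast

lemma vf_zero: "i < m \<Longrightarrow> X c (cinv c (snd c z)) i = 0" using X0 cinv_left[OF vf_atlas c z] by simp

lemma z_coord: "snd c z \<in> coord_space {..<m}" by (rule chart_coord[OF vf_atlas c z])

lemma lip_box_exists:
  assumes P: "eventually P (cnh {..<m} (snd c z))"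
  obtains r L where "lip_box m c N X z r L" "\<And>x. x \<in> coord_space {..<m} \<Longrightarrow> cdist {..<m} (snd c z) x \<le> r \<Longrightarrow> P x"
proof -
  have sm: "smooth_real_on {..<m} (snd c ` (fst c \<inter> N)) (\<lambda>x. X c (cinv c x) i)" if "i \<in> {..<m}" for i
    using vf_smooth that by simp
  obtain L e where L: "L > 0" "e > 0" "\<And>x y. x \<in> coord_space {..<m} \<Longrightarrow> y \<in> coord_space {..<m} \<Longrightarrow>
    cdist {..<m} (snd c z) x < e \<Longrightarrow> cdist {..<m} (snd c z) y < e \<Longrightarrow>
    cdist {..<m} (X c (cinv c x)) (X c (cinv c y)) \<le> L * cdist {..<m} x y"
    using smooth_lipschitz[where \<tau> = "\<lambda>x. X c (cinv c x)", OF finite_lessThan vf_dom(1) finite_lessThan vf_dom(2) sm] by blast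
  obtain d where d: "d > 0" "\<forall>y\<in>coord_space {..<m}. cdist {..<m} (snd c z) y < d \<longrightarrow> P y \<and> y \<in> snd c ` (fst c \<inter> N)"
    using eventually_conj[OF P cnh_copen[OF finite_lessThan vf_dom]] unfolding eventually_cnh by blast
  define r where "r = min e d / 2"
  have r: "0 < r" "r < e" "r < d" using L(2) d(1) by (auto simp: r_def)
  have "lip_box m c N X z r L" unfolding lip_box_def
  proof (intro conjI ballI impI)
    fix x y assume xy: "x \<in> coord_space {..<m}" "y \<in> coord_space {..<m}" "cdist {..<m} (snd c z) x \<le> r" "cdist {..<m} (snd c z) y \<le> r"
    show "x \<in> snd c ` (fst c \<inter> N)" using d(2) xy(1,3) r(3) by force
    show "cdist {..<m} (X c (cinv c x)) (X c (cinv c y)) \<le> L * cdist {..<m} x y" by (rule L(3)) (use xy r in auto)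
  qed (use r L in auto)
  moreover have "P x" if "x \<in> coord_space {..<m}" "cdist {..<m} (snd c z) x \<le> r" for x using d(2) that r(3) by force
  ultimately show ?thesis by (rule that)
qed

text \<open>Integral curves are only required to be differentiable in charts; continuity for the
  manifold topology follows from a chart around the current point.\<close>

lemma curve_continuous:
  assumes G: "scaled_curve m A N X t \<Gamma>" and th: "\<theta> \<in> {0..1}" and W: "openin (atlas_topology {..<m} A) W" "\<Gamma> \<theta> \<in> W"
  shows "\<forall>\<^sub>F r in nhds \<theta>. \<Gamma> r \<in> W"
proof -
  have "\<Gamma> \<theta> \<in> points A" using openin_subset[OF W(1)] W(2) atlas_topspace[OF vf_atlas] by blast
  then obtain d where d: "d \<in> A" "\<Gamma> \<theta> \<in> fst d" by (auto simp: points_def)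
  have ev: "\<forall>\<^sub>F r in nhds \<theta>. \<Gamma> r \<in> fst d"
    and der: "\<And>i. i < m \<Longrightarrow> ((\<lambda>r. snd d (\<Gamma> r) i) has_real_derivative t * X d (\<Gamma> \<theta>) i) (at \<theta>)"
    using G th d unfolding scaled_curve_def by blast+
  have o: "copen {..<m} (snd d ` (W \<inter> fst d))" by (rule atlas_open_image[OF vf_atlas W(1) d(1)])
  have fl: "filterlim (\<lambda>r. snd d (\<Gamma> r)) (cnh {..<m} (snd d (\<Gamma> \<theta>))) (nhds \<theta>)"
  proof (rule cnh_map[OF finite_lessThan])
    show "((\<lambda>r. snd d (\<Gamma> r) i) \<longlongrightarrow> snd d (\<Gamma> \<theta>) i) (nhds \<theta>)" if "i \<in> {..<m}" for i
    proof -
      have "isCont (\<lambda>r. snd d (\<Gamma> r) i) \<theta>" using DERIV_isCont[OF der] that by simp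
      then show ?thesis unfolding isCont_def by (rule tendsto_at_iff_tendsto_nhds[THEN iffD1])
    qed
    show "\<forall>\<^sub>F r in nhds \<theta>. snd d (\<Gamma> r) \<in> coord_space {..<m}"
      using ev by eventually_elim (rule chart_coord[OF vf_atlas d(1)])
  qed
  have "snd d (\<Gamma> \<theta>) \<in> snd d ` (W \<inter> fst d)" using W(2) d(2) by blast
  from fl[unfolded filterlim_iff, rule_format, OF cnh_copen[OF finite_lessThan o this]] ev
  show ?thesis by eventually_elim (use chart_mem[OF vf_atlas d(1), of _ "W \<inter> fst d"] in blast)
qed

text \<open>Here the Hausdorff property enters: the ball is compact, hence closed in the manifold.
  Otherwise a curve could leave the chart at a limit point invisible in coordinates, as on a line
  with two origins.\<close>

lemma closed_chart_ball:
  assumes B: "\<And>x. x \<in> coord_space {..<m} \<Longrightarrow> cdist {..<m} (snd c z) x \<le> r \<Longrightarrow> x \<in> snd c ` fst c"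
  shows "closedin (atlas_topology {..<m} A) {q\<in>fst c. cdist {..<m} (snd c z) (snd c q) \<le> r}"
proof -
  let ?T = "atlas_topology {..<m} A"
  let ?B = "{x\<in>coord_space {..<m}. cdist {..<m} (snd c z) x \<le> r}"
  let ?D = "snd c ` fst c"
  have cm: "continuous_map (top_of_set ?D) ?T (cinv c)" unfolding continuous_map
  proof (intro conjI allI impI)
    show "cinv c ` topspace (top_of_set ?D) \<subseteq> topspace ?T"
      using c unfolding atlas_topspace[OF vf_atlas] points_def by (auto simp: cinv_left[OF vf_atlas c])
    fix U assume U: "openin ?T U"
    have "copen {..<m} (snd c ` (U \<inter> fst c))" by (rule atlas_open_image[OF vf_atlas U c])
    moreover have "{x \<in> topspace (top_of_set ?D). cinv c x \<in> U} = snd c ` (U \<inter> fst c)"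
      using cinv_left[OF vf_atlas c] by auto
    ultimately show "openin (top_of_set ?D) {x \<in> topspace (top_of_set ?D). cinv c x \<in> U}"
      using copen_sub[OF chart_copen[OF vf_atlas c]] by (auto intro: openin_subset_trans)
  qed
  have BD: "?B \<subseteq> ?D" using B by blast
  have "compact ?B" by (rule compact_cball[OF finite_lessThan z_coord])
  then have "compactin (top_of_set ?D) ?B" using BD by (simp add: compactin_subtopology)
  from image_compactin[OF this cm] have "compactin ?T (cinv c ` ?B)" .
  moreover have "cinv c ` ?B = {q\<in>fst c. cdist {..<m} (snd c z) (snd c q) \<le> r}"
  proof
    show "cinv c ` ?B \<subseteq> {q\<in>fst c. cdist {..<m} (snd c z) (snd c q) \<le> r}"
    proof
      fix q assume "q \<in> cinv c ` ?B"
      then obtain x where x: "x \<in> ?B" "q = cinv c x" by blast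
      then have xD: "x \<in> ?D" using BD by blast
      have "q \<in> fst c" "snd c q = x" unfolding x(2) by (rule cinv_in[OF vf_atlas xD], rule cinv_right[OF vf_atlas xD])
      then show "q \<in> {q\<in>fst c. cdist {..<m} (snd c z) (snd c q) \<le> r}" using x(1) by simp
    qed
    show "{q\<in>fst c. cdist {..<m} (snd c z) (snd c q) \<le> r} \<subseteq> cinv c ` ?B"
      using cinv_left[OF vf_atlas c] chart_coord[OF vf_atlas c] by force
  qed
  ultimately have "compactin ?T {q\<in>fst c. cdist {..<m} (snd c z) (snd c q) \<le> r}" by simp
  then show ?thesis using M by (intro compactin_imp_closedin) (auto simp: smooth_manifold_def)
qed

lemma curve_derivative:
  assumes "scaled_curve m A N X t \<Gamma>" "\<theta> \<in> {0..1}" "\<Gamma> \<theta> \<in> fst c" "i < m"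
  shows "((\<lambda>r. snd c (\<Gamma> r) i) has_real_derivative t * X c (\<Gamma> \<theta>) i) (at \<theta>)"
  using assms c unfolding scaled_curve_def by blast

text \<open>As the field vanishes at \<open>z\<close>, the Lipschitz bound reads |X| \<le> L r, and
  \<open>gronwall_small\<close> applies to the displacement from \<open>z\<close>.\<close>

lemma curve_estimate:
  assumes B: "lip_box m c N X z r L" and t: "\<bar>t\<bar> * L \<le> 1/2" and G: "scaled_curve m A N X t \<Gamma>"
    and th: "\<theta> \<in> {0..1}" and K: "\<And>s. s \<in> {0..\<theta>} \<Longrightarrow> \<Gamma> s \<in> fst c \<and> cdist {..<m} (snd c z) (snd c (\<Gamma> s)) \<le> r"
    and s: "s \<in> {0..\<theta>}"
  shows "cdist {..<m} (snd c z) (snd c (\<Gamma> s)) \<le> 2 * cdist {..<m} (snd c z) (snd c (\<Gamma> 0))"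
proof -
  note BD = lip_boxD[OF B]
  let ?x0 = "snd c z"
  define w where "w s = (\<lambda>i. snd c (\<Gamma> s) i - ?x0 i)" for s
  have nw: "cdist {..<m} (\<lambda>_. 0) (w s) = cdist {..<m} ?x0 (snd c (\<Gamma> s))" for s by (simp add: cdist_def w_def)
  have "cdist {..<m} (\<lambda>_. 0) (w s) \<le> 2 * (cdist {..<m} (\<lambda>_. 0) (w 0) + 0)"
  proof (rule gronwall_small[OF finite_lessThan _ _ _ t order_refl _ _ s])
    show "0 \<le> \<theta>" "\<theta> \<le> 1" using th by auto
    show "0 \<le> \<bar>t\<bar> * L" using BD(2) by simp
    fix u i assume u: "u \<in> {0..\<theta>}" and i: "i \<in> {..<m}"
    have u1: "u \<in> {0..1}" using u th by auto
    show "((\<lambda>s. w s i) has_real_derivative t * X c (\<Gamma> u) i) (at u)"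
      unfolding w_def using curve_derivative[OF G u1] K[OF u] i by (auto intro!: derivative_eq_intros)
    let ?q = "snd c (\<Gamma> u)"
    have q: "?q \<in> coord_space {..<m}" "cinv c ?q = \<Gamma> u" using K[OF u] chart_coord[OF vf_atlas c] cinv_left[OF vf_atlas c] by auto
    have "cdist {..<m} (X c (cinv c ?x0)) (X c (cinv c ?q)) \<le> L * cdist {..<m} ?x0 ?q"
      using BD(4)[OF z_coord q(1)] K[OF u] BD(1) by simp
    moreover have "\<bar>X c (cinv c ?x0) i - X c (cinv c ?q) i\<bar> \<le> cdist {..<m} (X c (cinv c ?x0)) (X c (cinv c ?q))"
      by (rule abs_le_cdist[OF finite_lessThan i])
    ultimately have "\<bar>X c (\<Gamma> u) i\<bar> \<le> L * cdist {..<m} ?x0 ?q" using vf_zero i q(2) by simp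
    then have "\<bar>t\<bar> * \<bar>X c (\<Gamma> u) i\<bar> \<le> \<bar>t\<bar> * (L * cdist {..<m} ?x0 ?q)" by (intro mult_left_mono) auto
    then show "\<bar>t * X c (\<Gamma> u) i\<bar> \<le> \<bar>t\<bar> * L * cdist {..<m} (\<lambda>_. 0) (w u) + 0" by (simp add: nw abs_mult mult.assoc)
  qed
  then show ?thesis by (simp add: nw)
qed

text \<open>A continuity argument: while the curve stays in the closed ball of radius
  \<open>r\<close>, its distance from \<open>z\<close> is at most twice the initial one, hence below
  \<open>r\<close>. So the supremum of the times up to which it stays is 1.\<close>

lemma curve_stays:
  assumes B: "lip_box m c N X z r L" and t: "\<bar>t\<bar> * L \<le> 1/2" and G: "scaled_curve m A N X t \<Gamma>"
    and st: "\<Gamma> 0 \<in> fst c" "cdist {..<m} (snd c z) (snd c (\<Gamma> 0)) < r / 2" and th: "\<theta> \<in> {0..1}"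
  shows "\<Gamma> \<theta> \<in> fst c" "cdist {..<m} (snd c z) (snd c (\<Gamma> \<theta>)) \<le> 2 * cdist {..<m} (snd c z) (snd c (\<Gamma> 0))"
proof -
  note BD = lip_boxD[OF B]
  let ?T = "atlas_topology {..<m} A"
  let ?K = "{q\<in>fst c. cdist {..<m} (snd c z) (snd c q) \<le> r}"
  let ?O = "{q\<in>fst c. cdist {..<m} (snd c z) (snd c q) < r}"
  have clK: "closedin ?T ?K" by (rule closed_chart_ball) (use BD(3) in blast)
  have opO: "openin ?T ?O"
  proof (rule atlas_openI[OF vf_atlas c])
    have "snd c ` ?O = snd c ` fst c \<inter> {y\<in>coord_space {..<m}. cdist {..<m} (snd c z) y < r}"
      using chart_coord[OF vf_atlas c] by auto
    then show "copen {..<m} (snd c ` ?O)" using chart_copen[OF vf_atlas c] copen_ball[OF finite_lessThan] by auto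
  qed blast
  define P where "P \<theta> \<longleftrightarrow> (\<forall>s\<in>{0..\<theta>}. \<Gamma> s \<in> ?K)" for \<theta>
  have P0: "P 0" using st cdist_nonneg[of "{..<m}" "snd c z" "snd c (\<Gamma> 0)"] BD(1) by (auto simp: P_def)
  define Q where "Q = {\<theta>\<in>{0..1}. P \<theta>}"
  have Q: "0 \<in> Q" "Q \<subseteq> {0..1}" using P0 by (auto simp: Q_def)
  define u where "u = Sup Q"
  have bdd: "bdd_above Q" using Q(2) by (meson bdd_above.I2 bdd_above_Icc bdd_above_mono)
  have "0 \<le> u" using cSup_upper[OF Q(1) bdd] by (simp add: u_def)
  moreover have "u \<le> 1" unfolding u_def by (rule cSup_least) (use Q in auto)
  ultimately have u01: "u \<in> {0..1}" by simp
  have below: "\<Gamma> s \<in> ?K" if s: "0 \<le> s" "s < u" for s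
  proof -
    obtain \<theta> where "\<theta> \<in> Q" "s < \<theta>" using less_cSup_iff[OF _ bdd, of s] s Q(1) unfolding u_def by blast
    then show ?thesis using s by (auto simp: Q_def P_def)
  qed
  \<comment> \<open>The supremum is attained, because the complement of the closed ball is open and
    the curve is continuous.\<close>
  have uK: "\<Gamma> u \<in> ?K"
  proof (rule ccontr)
    assume n: "\<Gamma> u \<notin> ?K"
    have "\<Gamma> u \<in> N" using G u01 unfolding scaled_curve_def by blast
    then have "\<Gamma> u \<in> topspace ?T - ?K" using n openin_subset[OF vf_N] by blast
    moreover have "openin ?T (topspace ?T - ?K)" using clK by (simp add: closedin_def)
    ultimately have "\<forall>\<^sub>F r in nhds u. \<Gamma> r \<in> topspace ?T - ?K" using curve_continuous[OF G u01] by blast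
    then obtain d where d: "d > 0" "\<forall>r. dist r u < d \<longrightarrow> \<Gamma> r \<in> topspace ?T - ?K" unfolding eventually_nhds_metric by blast
    have "u \<noteq> 0" using n P0 by (auto simp: P_def)
    then have "u > 0" using u01 by auto
    then have "0 \<le> max 0 (u - d / 2)" "max 0 (u - d/2) < u" "dist (max 0 (u - d/2)) u < d" using d(1) by (auto simp: dist_real_def)
    then show False using below d(2) by blast
  qed
  have Pu: "P u" unfolding P_def
  proof
    fix s assume "s \<in> {0..u}"
    then show "\<Gamma> s \<in> ?K" using below uK by (cases "s = u") auto
  qed
  have est: "cdist {..<m} (snd c z) (snd c (\<Gamma> s)) \<le> 2 * cdist {..<m} (snd c z) (snd c (\<Gamma> 0))" if "s \<in> {0..u}" for s
    by (rule curve_estimate[OF B t G u01 _ that]) (use Pu in \<open>auto simp: P_def\<close>)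
  have "u = 1"
  proof (rule ccontr)
    assume "u \<noteq> 1"
    then have u1: "u < 1" using u01 by auto
    \<comment> \<open>The estimate is strict, so the curve remains in the open ball a little longer,
      contradicting the choice of \<open>u\<close>.\<close>
    have "\<Gamma> u \<in> ?O" using est[of u] st(2) uK u01 by auto
    then have "\<forall>\<^sub>F r in nhds u. \<Gamma> r \<in> ?O" using curve_continuous[OF G u01 opO] by blast
    then obtain d where d: "d > 0" "\<forall>r. dist r u < d \<longrightarrow> \<Gamma> r \<in> ?O" unfolding eventually_nhds_metric by blast
    define v where "v = min 1 (u + d / 2)"
    have v: "u < v" "v \<le> 1" "v - u < d" using u1 d(1) by (auto simp: v_def)
    have "P v" unfolding P_def
    proof
      fix s assume s: "s \<in> {0..v}"
      show "\<Gamma> s \<in> ?K"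
      proof (cases "s \<le> u")
        case True
        then show ?thesis using Pu s by (auto simp: P_def)
      next
        case False
        then have "dist s u < d" using s v by (auto simp: dist_real_def)
        then show ?thesis using d(2) by force
      qed
    qed
    then have "v \<in> Q" using v u01 by (auto simp: Q_def)
    then show False using cSup_upper[OF _ bdd, of v] v(1) by (simp add: u_def)
  qed
  then show "\<Gamma> \<theta> \<in> fst c" "cdist {..<m} (snd c z) (snd c (\<Gamma> \<theta>)) \<le> 2 * cdist {..<m} (snd c z) (snd c (\<Gamma> 0))"
    using Pu est[of \<theta>] th by (auto simp: P_def)
qed

text \<open>\<open>gronwall_small\<close> for the difference of the curves, with initial value 0 and
  \<open>b = 0\<close>.\<close>

lemma curve_unique:
  assumes B: "lip_box m c N X z r L" and t: "\<bar>t\<bar> * L \<le> 1/2"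
    and G: "scaled_curve m A N X t \<Gamma>" and G': "scaled_curve m A N X t \<Delta>" and e: "\<Gamma> 0 = \<Delta> 0"
    and st: "\<Gamma> 0 \<in> fst c" "cdist {..<m} (snd c z) (snd c (\<Gamma> 0)) < r / 2"
  shows "\<Gamma> 1 = \<Delta> 1"
proof -
  note BD = lip_boxD[OF B]
  note s1 = curve_stays[OF B t G st] and s2 = curve_stays[OF B t G' st[unfolded e]]
  define w where "w s = (\<lambda>i. snd c (\<Gamma> s) i - snd c (\<Delta> s) i)" for s
  have nw: "cdist {..<m} (\<lambda>_. 0) (w s) = cdist {..<m} (snd c (\<Delta> s)) (snd c (\<Gamma> s))" for s
    by (simp add: cdist_def w_def abs_minus_commute)
  have one: "1 \<in> {0..1::real}" by simp
  have "cdist {..<m} (\<lambda>_. 0) (w 1) \<le> 2 * (cdist {..<m} (\<lambda>_. 0) (w 0) + 0)"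
  proof (rule gronwall_small[OF finite_lessThan _ _ _ t order_refl _ _ one])
    show "0 \<le> \<bar>t\<bar> * L" using BD(2) by simp
    fix u :: real and i assume u: "u \<in> {0..1}" and i: "i \<in> {..<m}"
    show "((\<lambda>s. w s i) has_real_derivative t * X c (\<Gamma> u) i - t * X c (\<Delta> u) i) (at u)"
      unfolding w_def using curve_derivative[OF G u s1(1)[OF u]] curve_derivative[OF G' u s2(1)[OF u]] i by (auto intro!: DERIV_diff)
    let ?p = "snd c (\<Gamma> u)" and ?q = "snd c (\<Delta> u)"
    have pq: "?p \<in> coord_space {..<m}" "cinv c ?p = \<Gamma> u" "?q \<in> coord_space {..<m}" "cinv c ?q = \<Delta> u"
      using s1(1)[OF u] s2(1)[OF u] chart_coord[OF vf_atlas c] cinv_left[OF vf_atlas c] by auto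
    have "cdist {..<m} (X c (cinv c ?p)) (X c (cinv c ?q)) \<le> L * cdist {..<m} ?p ?q"
      by (rule BD(4)[OF pq(1,3)]) (use s1(2)[OF u] s2(2)[OF u] st e in auto)
    moreover have "\<bar>X c (cinv c ?p) i - X c (cinv c ?q) i\<bar> \<le> cdist {..<m} (X c (cinv c ?p)) (X c (cinv c ?q))"
      by (rule abs_le_cdist[OF finite_lessThan i])
    ultimately have "\<bar>X c (\<Gamma> u) i - X c (\<Delta> u) i\<bar> \<le> L * cdist {..<m} ?p ?q" using pq by simp
    then have "\<bar>t\<bar> * \<bar>X c (\<Gamma> u) i - X c (\<Delta> u) i\<bar> \<le> \<bar>t\<bar> * (L * cdist {..<m} ?p ?q)" by (intro mult_left_mono) auto
    then show "\<bar>t * X c (\<Gamma> u) i - t * X c (\<Delta> u) i\<bar> \<le> \<bar>t\<bar> * L * cdist {..<m} (\<lambda>_. 0) (w u) + 0"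
      by (simp add: nw abs_mult mult.assoc cdist_commute right_diff_distrib[symmetric])
  qed auto
  then have "cdist {..<m} (snd c (\<Delta> 1)) (snd c (\<Gamma> 1)) \<le> 0" unfolding nw e by simp
  then have "snd c (\<Delta> 1) = snd c (\<Gamma> 1)"
    using cdist_eq_0[OF finite_lessThan] chart_coord[OF vf_atlas c] s1(1)[OF one] s2(1)[OF one] by blast
  then show ?thesis using inj_onD[OF chart_inj[OF vf_atlas c]] s1(1)[OF one] s2(1)[OF one] by metis
qed

text \<open>\<open>flow_map\<close> selects the end point by a definite description, which says
  something only where end points are unique.\<close>

lemma flow_near:
  assumes B: "lip_box m c N X z r L" and t: "\<bar>t\<bar> * L \<le> 1/2"
    and x: "x \<in> fst c" "cdist {..<m} (snd c z) (snd c x) < r / 2"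
  shows "flow_map m A N X t x = Some y \<longleftrightarrow> flows_to m A N X t x y"
proof -
  have uniq: "y = y'" if f: "flows_to m A N X t x y" "flows_to m A N X t x y'" for y y'
  proof -
    obtain \<Gamma> where G: "scaled_curve m A N X t \<Gamma>" "\<Gamma> 0 = x" "\<Gamma> 1 = y" using flows_to_scaled_curve[OF f(1)] by blast
    obtain \<Delta> where D: "scaled_curve m A N X t \<Delta>" "\<Delta> 0 = x" "\<Delta> 1 = y'" using flows_to_scaled_curve[OF f(2)] by blast
    show ?thesis using curve_unique[OF B t G(1) D(1)] G D x by simp
  qed
  show ?thesis
  proof
    assume f: "flow_map m A N X t x = Some y"
    then obtain y' where y': "flows_to m A N X t x y'" unfolding flow_map_def by (auto split: if_splits)
    then have "(THE y. flows_to m A N X t x y) = y'" using uniq by blast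
    then show "flows_to m A N X t x y" using f y' unfolding flow_map_def by (auto split: if_splits)
  next
    assume f: "flows_to m A N X t x y"
    then have "(THE y. flows_to m A N X t x y) = y" using uniq by blast
    then show "flow_map m A N X t x = Some y" using f unfolding flow_map_def by auto
  qed
qed

text \<open>The constant curve is integral: components transform linearly, so the field vanishes at
  \<open>z\<close> in every chart.\<close>

lemma flow_fix:
  assumes B: "lip_box m c N X z r L" and t: "\<bar>t\<bar> * L \<le> 1/2"
  shows "flow_map m A N X t z = Some z"
proof -
  have zero: "X d z a = 0" if d: "d \<in> A" "z \<in> fst d" and a: "a < m" for d a
  proof -
    have "X d z = pushforward {..<m} c d (\<lambda>w. w) z (X c z)" using vf c d z zN unfolding vector_field_on_def by blast
    then show ?thesis using X0 by (simp add: pushforward_def)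
  qed
  have "integral_curve m A N X {min 0 t - 1<..<max 0 t + 1} (\<lambda>_. z)" unfolding integral_curve_def using zN zero by simp
  then have "flows_to m A N X t z z" unfolding flows_to_def
    by (intro exI[of _ "min 0 t - 1"] exI[of _ "max 0 t + 1"] exI[of _ "\<lambda>_. z"]) auto
  then show ?thesis using flow_near[OF B t z] lip_boxD(1)[OF B] cdist_self[OF finite_lessThan] by simp
qed

lemma flow_curve:
  assumes B: "lip_box m c N X z r L" and t: "\<bar>t\<bar> * L \<le> 1/2" and f: "flow_map m A N X t x = Some y"
    and x: "x \<in> fst c" "cdist {..<m} (snd c z) (snd c x) < r / 2"
  shows "\<exists>\<Gamma>. scaled_curve m A N X t \<Gamma> \<and> \<Gamma> 0 = x \<and> \<Gamma> 1 = y \<and> (\<forall>\<theta>\<in>{0..1}.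
    \<Gamma> \<theta> \<in> fst c \<and> cdist {..<m} (snd c z) (snd c (\<Gamma> \<theta>)) \<le> 2 * cdist {..<m} (snd c z) (snd c x))"
proof -
  obtain \<Gamma> where G: "scaled_curve m A N X t \<Gamma>" "\<Gamma> 0 = x" "\<Gamma> 1 = y"
    using flows_to_scaled_curve[OF flow_near[OF B t x, THEN iffD1, OF f]] by blast
  have "\<Gamma> \<theta> \<in> fst c \<and> cdist {..<m} (snd c z) (snd c (\<Gamma> \<theta>)) \<le> 2 * cdist {..<m} (snd c z) (snd c x)" if "\<theta> \<in> {0..1}" for \<theta>
    using curve_stays[OF B t G(1) _ _ that] G(2) x by simp
  then show ?thesis using G by blast
qed

text \<open>\<open>r / 4\<close>, because the distance from \<open>z\<close> may double along the
  flow and the way back must again start within \<open>r / 2\<close>.\<close>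

lemma flow_inverse:
  assumes B: "lip_box m c N X z r L" and t: "\<bar>t\<bar> * L \<le> 1/2" and f: "flow_map m A N X t x = Some y"
    and x: "x \<in> fst c" "cdist {..<m} (snd c z) (snd c x) < r / 4"
  shows "flow_map m A N X (- t) y = Some x"
proof -
  have x2: "cdist {..<m} (snd c z) (snd c x) < r / 2" using x(2) lip_boxD(1)[OF B] by simp
  obtain \<Gamma> where G: "scaled_curve m A N X t \<Gamma>" "\<Gamma> 0 = x" "\<Gamma> 1 = y" "\<And>\<theta>. \<theta> \<in> {0..1} \<Longrightarrow>
    \<Gamma> \<theta> \<in> fst c \<and> cdist {..<m} (snd c z) (snd c (\<Gamma> \<theta>)) \<le> 2 * cdist {..<m} (snd c z) (snd c x)"
    using flow_curve[OF B t f x(1) x2] by blast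
  have y: "y \<in> fst c" "cdist {..<m} (snd c z) (snd c y) < r / 2" using G(3) G(4)[of 1] x(2) by auto
  have "flows_to m A N X (- t) y x" by (rule flows_to_sym[OF flow_near[OF B t x(1) x2, THEN iffD1, OF f]])
  then show ?thesis using flow_near[OF B _ y, of "- t"] t by simp
qed

end

section \<open>Flows that almost preserve a submanifold\<close>

text \<open>\<open>P\<close> projects to the flat set in straightened coordinates; as
  \<open>\<sigma>\<close> is Lipschitz, a point moves by at most a multiple of its transverse
  coordinates.\<close>

lemma flat_retract:
  assumes I: "finite I" and d: "cdiffeo I V V' \<tau> \<sigma>" and x0: "x0 \<in> V" and flat0: "\<forall>l\<in>I-K. \<tau> x0 l = 0" and K: "K \<subseteq> I"
  defines "P \<equiv> \<lambda>x. \<sigma> (coord_proj K (\<tau> x))"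
  shows "\<exists>W L. copen I W \<and> x0 \<in> W \<and> W \<subseteq> V \<and> 0 < L \<and> P x0 = x0 \<and> (\<forall>i\<in>I. smooth_real_on I W (\<lambda>x. P x i)) \<and>
    (\<forall>x\<in>W. P x \<in> V \<and> (\<forall>l\<in>I-K. \<tau> (P x) l = 0) \<and> cdist I x (P x) \<le> L * cdist (I - K) (\<lambda>_. 0) (\<tau> x))"
proof -
  note D = cdiffeoD[OF d]
  have tc: "\<tau> x \<in> coord_space I" if "x \<in> V" for x using D(3,10) that by blast
  have pr0: "coord_proj K (\<tau> x0) = \<tau> x0" using flat0 tc[OF x0] K by (auto simp: coord_proj_def coord_space_def fun_eq_iff)
  have P0: "P x0 = x0" using pr0 D(4)[OF x0] by (simp add: P_def)
  obtain L e where L: "L > 0" "e > 0" "\<And>x y. x \<in> coord_space I \<Longrightarrow> y \<in> coord_space I \<Longrightarrow>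
    cdist I (\<tau> x0) x < e \<Longrightarrow> cdist I (\<tau> x0) y < e \<Longrightarrow> cdist I (\<sigma> x) (\<sigma> y) \<le> L * cdist I x y"
    using smooth_lipschitz[where \<tau> = \<sigma>, OF I D(2) I D(3)[OF x0] D(8)] by blast
  have smp: "smooth_real_on I V (\<lambda>x. coord_proj K (\<tau> x) i)" if "i \<in> I" for i
    using D(7)[OF that] by (cases "i \<in> K") (auto simp: coord_proj_def)
  have prc: "coord_proj K u \<in> coord_space I" for u using coord_space_mono[OF K] coord_proj_in by blast
  define B where "B = V' \<inter> {y\<in>coord_space I. cdist I (\<tau> x0) y < e}"
  have oB: "copen I B" unfolding B_def by (intro copen_Int D(2) copen_ball[OF I])
  define W1 where "W1 = {x\<in>V. \<tau> x \<in> B}"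
  define W2 where "W2 = {x\<in>V. coord_proj K (\<tau> x) \<in> B}"
  have o1: "copen I W1" unfolding W1_def by (rule copen_preimage[OF I I D(1) oB smooth_continuous[OF D(7)]]) (use tc in auto)
  have o2: "copen I W2" unfolding W2_def by (rule copen_preimage[OF I I D(1) oB smooth_continuous[OF smp]]) (use prc in auto)
  define W where "W = W1 \<inter> W2"
  have oW: "copen I W" unfolding W_def using o1 o2 by blast
  have x0W: "x0 \<in> W" using x0 D(3)[OF x0] tc[OF x0] pr0 L(2) cdist_self[OF I] by (simp add: W_def W1_def W2_def B_def)
  have WV: "W \<subseteq> V" by (auto simp: W_def W1_def)
  have sP: "smooth_real_on I W (\<lambda>x. P x i)" if "i \<in> I" for i unfolding P_def
    by (rule smooth_comp[OF I oW I D(2) _ D(8)[OF that] smooth_subset[OF smp WV]]) (auto simp: W_def W2_def B_def)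
  have main: "P x \<in> V \<and> (\<forall>l\<in>I-K. \<tau> (P x) l = 0) \<and> cdist I x (P x) \<le> L * cdist (I - K) (\<lambda>_. 0) (\<tau> x)" if x: "x \<in> W" for x
  proof (intro conjI)
    have v: "x \<in> V" "coord_proj K (\<tau> x) \<in> V'" "cdist I (\<tau> x0) (coord_proj K (\<tau> x)) < e" "cdist I (\<tau> x0) (\<tau> x) < e"
      using x by (auto simp: W_def W1_def W2_def B_def)
    show "P x \<in> V" using D(5)[OF v(2)] by (simp add: P_def)
    show "\<forall>l\<in>I-K. \<tau> (P x) l = 0" using D(6)[OF v(2)] by (simp add: P_def coord_proj_def)
    have "cdist I (\<sigma> (\<tau> x)) (\<sigma> (coord_proj K (\<tau> x))) \<le> L * cdist I (\<tau> x) (coord_proj K (\<tau> x))"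
      by (rule L(3)[OF tc[OF v(1)] prc v(4,3)])
    moreover have "cdist I (\<tau> x) (coord_proj K (\<tau> x)) \<le> cdist (I - K) (\<lambda>_. 0) (\<tau> x)"
    proof -
      have "\<bar>\<tau> x i - coord_proj K (\<tau> x) i\<bar> \<le> cdist (I - K) (\<lambda>_. 0) (\<tau> x)" if "i \<in> I" for i
        using abs_le_cdist[of "I - K" i "\<lambda>_. 0" "\<tau> x"] I that by (cases "i \<in> K") (auto simp: coord_proj_def)
      then show ?thesis using I by (simp add: cdist_le_iff)
    qed
    then have "L * cdist I (\<tau> x) (coord_proj K (\<tau> x)) \<le> L * cdist (I - K) (\<lambda>_. 0) (\<tau> x)" using L(1) by simp
    ultimately show "cdist I x (P x) \<le> L * cdist (I - K) (\<lambda>_. 0) (\<tau> x)"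
      unfolding P_def D(4)[OF v(1)] by (rule order_trans)
  qed
  show ?thesis by (rule exI[of _ W], rule exI[of _ L]) (use oW x0W WV L(1) P0 sP main in auto)
qed

text \<open>The partner is the image under the retraction of \<open>flat_retract\<close>; a converse
  to \<open>near_flat\<close>.\<close>

lemma flat_near:
  assumes I: "finite I" and d: "cdiffeo I V V' \<tau> \<sigma>" and x0: "x0 \<in> V" and K: "K \<subseteq> I" and x0T: "x0 \<in> T"
    and flat: "T \<inter> V = {x\<in>V. \<forall>j\<in>I-K. \<tau> x j = 0}" and C0: "0 \<le> C"
    and S: "\<forall>\<^sub>F x in cnh I x0. x \<in> S \<longrightarrow> (\<forall>j\<in>I-K. \<bar>\<tau> x j\<bar> \<le> C * cdist I x0 x ^ k)"
  shows "near I x0 k S T"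
proof -
  have f0: "\<forall>l\<in>I-K. \<tau> x0 l = 0" using flat x0 x0T by blast
  obtain W L where W: "copen I W" "x0 \<in> W" "0 < L"
    "\<forall>x\<in>W. \<sigma> (coord_proj K (\<tau> x)) \<in> V \<and> (\<forall>l\<in>I-K. \<tau> (\<sigma> (coord_proj K (\<tau> x))) l = 0) \<and>
      cdist I x (\<sigma> (coord_proj K (\<tau> x))) \<le> L * cdist (I - K) (\<lambda>_. 0) (\<tau> x)"
    using flat_retract[OF I d x0 f0 K] by blast
  have "\<forall>\<^sub>F x in cnh I x0. x \<in> S \<longrightarrow> (\<exists>y\<in>T. cdist I x y \<le> (L * C) * cdist I x0 x ^ k)"
    using S cnh_copen[OF I W(1,2)]
  proof eventually_elim
    case (elim x)
    show ?case
    proof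
      assume "x \<in> S"
      then have "\<forall>j\<in>I-K. \<bar>\<tau> x j\<bar> \<le> C * cdist I x0 x ^ k" using elim by blast
      then have "cdist (I - K) (\<lambda>_. 0) (\<tau> x) \<le> C * cdist I x0 x ^ k" using I C0 by (subst cdist_le_iff) auto
      then have "L * cdist (I - K) (\<lambda>_. 0) (\<tau> x) \<le> L * (C * cdist I x0 x ^ k)" using W(3) by simp
      moreover have "\<sigma> (coord_proj K (\<tau> x)) \<in> T" using W(4) elim(2) flat by blast
      ultimately show "\<exists>y\<in>T. cdist I x y \<le> (L * C) * cdist I x0 x ^ k"
        using W(4) elim(2) by (intro bexI[of _ "\<sigma> (coord_proj K (\<tau> x))"]) (auto simp: mult.assoc)
    qed
  qed
  then show ?thesis unfolding near_def by blast
qed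

text \<open>Compare \<open>E\<close> at \<open>x\<close> with \<open>E\<close> at the retraction of
  \<open>x\<close>. The Lipschitz bound gives a term proportional to the transverse coordinates,
  which a Gronwall argument absorbs; the bound on \<open>T\<close> gives the term of order
  \<open>k\<close>.\<close>

lemma flat_vector_bound:
  assumes I: "finite I" and d: "cdiffeo I V V' \<tau> \<sigma>" and x0: "x0 \<in> V" and K: "K \<subseteq> I" and x0T: "x0 \<in> T"
    and flat: "T \<inter> V = {x\<in>V. \<forall>j\<in>I-K. \<tau> x j = 0}"
    and U: "copen I U" "x0 \<in> U" and E: "\<And>l. l \<in> I - K \<Longrightarrow> smooth_real_on I U (E l)"
    and H: "\<forall>\<^sub>F x in cnh I x0. x \<in> T \<longrightarrow> (\<forall>l\<in>I-K. \<bar>E l x\<bar> \<le> C * cdist I x0 x ^ k)" and C0: "0 \<le> C"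
  shows "\<exists>a>0. \<exists>b>0. \<forall>\<^sub>F x in cnh I x0. \<forall>l\<in>I-K. \<bar>E l x\<bar> \<le> a * cdist (I - K) (\<lambda>_. 0) (\<tau> x) + b * cdist I x0 x ^ k"
proof -
  let ?P = "\<lambda>x. \<sigma> (coord_proj K (\<tau> x))"
  note D = cdiffeoD[OF d]
  have f0: "\<forall>l\<in>I-K. \<tau> x0 l = 0" using flat x0 x0T by blast
  obtain W L where W: "copen I W" "x0 \<in> W" "W \<subseteq> V" "0 < L" "?P x0 = x0" "\<forall>i\<in>I. smooth_real_on I W (\<lambda>x. ?P x i)"
    "\<forall>x\<in>W. ?P x \<in> V \<and> (\<forall>l\<in>I-K. \<tau> (?P x) l = 0) \<and> cdist I x (?P x) \<le> L * cdist (I - K) (\<lambda>_. 0) (\<tau> x)"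
    using flat_retract[OF I d x0 f0 K] by blast
  have Pc: "?P x \<in> coord_space I" if "x \<in> W" for x using W(7) D(9) that by blast
  have sP: "smooth_real_on I W (\<lambda>x. ?P x i)" if "i \<in> I" for i using W(6) that by blast
  have fl: "filterlim ?P (cnh I x0) (cnh I x0)" using smooth_map_filterlim[OF I W(1) I W(2) sP Pc] W(5) by simp
  obtain L1 e1 where L1: "L1 > 0" "e1 > 0" "\<And>x y. x \<in> coord_space I \<Longrightarrow> y \<in> coord_space I \<Longrightarrow>
    cdist I x0 x < e1 \<Longrightarrow> cdist I x0 y < e1 \<Longrightarrow> cdist I (?P x) (?P y) \<le> L1 * cdist I x y"
    using smooth_lipschitz[where \<tau> = ?P, OF I W(1) I W(2) sP] by blast
  have "\<exists>L>0. \<exists>e>0. \<forall>x\<in>coord_space I. \<forall>y\<in>coord_space I. cdist I x0 x < e \<longrightarrow> cdist I x0 y < e \<longrightarrow>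
    cdist (I - K) ((\<lambda>x l. E l x) x) ((\<lambda>x l. E l x) y) \<le> L * cdist I x y"
    by (rule smooth_lipschitz[OF I U(1) finite_Diff[OF I] U(2)]) (rule E)
  then obtain L2 e2 where L2: "L2 > 0" "e2 > 0" "\<And>x y. x \<in> coord_space I \<Longrightarrow> y \<in> coord_space I \<Longrightarrow>
    cdist I x0 x < e2 \<Longrightarrow> cdist I x0 y < e2 \<Longrightarrow> cdist (I - K) (\<lambda>l. E l x) (\<lambda>l. E l y) \<le> L2 * cdist I x y"
    by blast
  have x0c: "x0 \<in> coord_space I" using D(9) x0 by blast
  have "\<forall>\<^sub>F x in cnh I x0. \<forall>l\<in>I-K. \<bar>E l x\<bar> \<le> (L2 * L) * cdist (I - K) (\<lambda>_. 0) (\<tau> x) + ((C + 1) * L1 ^ k) * cdist I x0 x ^ k"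
    using cnh_copen[OF I W(1,2)] fl[unfolded filterlim_iff, rule_format, OF H]
      fl[unfolded filterlim_iff, rule_format, OF cnh_dist[OF L2(2)]] cnh_dist[OF L2(2)] cnh_dist[OF L1(2)] cnh_space[of I x0]
  proof eventually_elim
    case (elim x)
    show ?case
    proof
      fix l assume l: "l \<in> I - K"
      have "?P x \<in> T" using W(7) elim(1) flat by blast
      then have "\<bar>E l (?P x)\<bar> \<le> C * cdist I x0 (?P x) ^ k" using elim(2) l by blast
      also have "\<dots> \<le> C * (L1 * cdist I x0 x) ^ k"
      proof (intro mult_left_mono power_mono C0)
        have "cdist I (?P x0) (?P x) \<le> L1 * cdist I x0 x" by (rule L1(3)[OF x0c elim(6) _ elim(5)]) (use L1(2) I in simp)
        then show "cdist I x0 (?P x) \<le> L1 * cdist I x0 x" using W(5) by simp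
      qed (use I in simp)
      also have "\<dots> \<le> (C + 1) * (L1 * cdist I x0 x) ^ k" using L1(1) I by (intro mult_right_mono zero_le_power) auto
      finally have 1: "\<bar>E l (?P x)\<bar> \<le> (C + 1) * (L1 * cdist I x0 x) ^ k" .
      have "\<bar>E l x - E l (?P x)\<bar> \<le> cdist (I - K) (\<lambda>l. E l x) (\<lambda>l. E l (?P x))"
        using abs_le_cdist[of "I - K" l "\<lambda>l. E l x" "\<lambda>l. E l (?P x)"] I l by simp
      also have "\<dots> \<le> L2 * cdist I x (?P x)" by (rule L2(3)[OF elim(6) Pc[OF elim(1)] elim(4,3)])
      also have "\<dots> \<le> L2 * (L * cdist (I - K) (\<lambda>_. 0) (\<tau> x))" using W(7) elim(1) L2(1) by simp
      finally have 2: "\<bar>E l x - E l (?P x)\<bar> \<le> L2 * (L * cdist (I - K) (\<lambda>_. 0) (\<tau> x))" .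
      have "\<bar>E l x\<bar> \<le> \<bar>E l x - E l (?P x)\<bar> + \<bar>E l (?P x)\<bar>" by simp
      also note add_mono[OF 2 1]
      finally show "\<bar>E l x\<bar> \<le> (L2 * L) * cdist (I - K) (\<lambda>_. 0) (\<tau> x) + ((C + 1) * L1 ^ k) * cdist I x0 x ^ k"
        by (simp add: power_mult_distrib mult.assoc)
    qed
  qed
  moreover have "L2 * L > 0" "(C + 1) * L1 ^ k > 0" using L2(1) W(4) C0 L1(1) by auto
  ultimately show ?thesis by blast
qed

context
  fixes m :: nat and A :: "('a, nat) chart set" and c :: "('a, nat) chart" and z :: 'a and N :: "'a set" and X :: "'a vfield"
  assumes M: "smooth_manifold {..<m} A" and c: "c \<in> A" and z: "z \<in> fst c"
    and vf: "vector_field_on m A N X" and zN: "z \<in> N" and X0: "\<forall>i<m. X c z i = 0"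
    and LD: "\<And>t. flow_map m A N X t \<in> local_diffeos m A"
begin

section \<open>Expansion and rigidity of flows for short times\<close>

lemma lip_box_ex:
  assumes P: "eventually P (cnh {..<m} (snd c z))"
  shows "\<exists>r L. lip_box m c N X z r L \<and> (\<forall>x\<in>coord_space {..<m}. cdist {..<m} (snd c z) x \<le> r \<longrightarrow> P x)"
proof (rule lip_box_exists[OF M c z vf zN X0 P])
  fix r L assume "lip_box m c N X z r L" "\<And>x. x \<in> coord_space {..<m} \<Longrightarrow> cdist {..<m} (snd c z) x \<le> r \<Longrightarrow> P x"
  then show ?thesis by (intro exI[of _ r] exI[of _ L]) blast
qed

lemma flow_in_coords:
  assumes B: "lip_box m c N X z r L" and t: "\<bar>t\<bar> * L \<le> 1/2"
    and x: "x \<in> rep_dom c c (flow_map m A N X t)" "cdist {..<m} (snd c z) x < r / 2"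
  shows "\<exists>\<Gamma>. scaled_curve m A N X t \<Gamma> \<and> snd c (\<Gamma> 0) = x \<and> snd c (\<Gamma> 1) = coord_rep c c (flow_map m A N X t) x \<and>
    (\<forall>\<theta>\<in>{0..1}. \<Gamma> \<theta> \<in> fst c \<and> cdist {..<m} (snd c z) (snd c (\<Gamma> \<theta>)) \<le> 2 * cdist {..<m} (snd c z) x)"
proof -
  note q = rep_dom_cinv[OF vf_atlas[OF M c z vf zN X0] c z x(1)]
  obtain y where y: "flow_map m A N X t (cinv c x) = Some y" using q(3) by blast
  obtain \<Gamma> where G: "scaled_curve m A N X t \<Gamma>" "\<Gamma> 0 = cinv c x" "\<Gamma> 1 = y" "\<forall>\<theta>\<in>{0..1}.
    \<Gamma> \<theta> \<in> fst c \<and> cdist {..<m} (snd c z) (snd c (\<Gamma> \<theta>)) \<le> 2 * cdist {..<m} (snd c z) (snd c (cinv c x))"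
    using flow_curve[OF M c z vf zN X0 B t y q(1)] x(2) q(2) by auto
  then show ?thesis using q(2) y by (intro exI[of _ \<Gamma>]) (auto simp: coord_rep_def)
qed

text \<open>Distances at most double along the curve, so the field is at most
  \<open>C * (2 * r) ^ n\<close> there, with r the initial distance. Hence the curve moves by at
  most |t| times this, the field changes by at most \<open>L\<close> times that movement, and the
  mean value theorem contributes the second factor t.\<close>

lemma flow_expansion:
  assumes B: "lip_box m c N X z r L" and t: "\<bar>t\<bar> * L \<le> 1/2" and C: "0 \<le> C"
    and XC: "\<And>x i. x \<in> coord_space {..<m} \<Longrightarrow> cdist {..<m} (snd c z) x \<le> r \<Longrightarrow> i < m \<Longrightarrow>
      \<bar>X c (cinv c x) i\<bar> \<le> C * cdist {..<m} (snd c z) x ^ n"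
    and x: "x \<in> rep_dom c c (flow_map m A N X t)" "cdist {..<m} (snd c z) x < r / 2" and i: "i < m"
  shows "\<bar>coord_rep c c (flow_map m A N X t) x i - x i - t * X c (cinv c x) i\<bar>
    \<le> (L * C * 2 ^ n) * t\<^sup>2 * cdist {..<m} (snd c z) x ^ n"
proof -
  note at = vf_atlas[OF M c z vf zN X0]
  note BD = lip_boxD[OF B]
  let ?I = "{..<m}"
  let ?\<rho> = "cdist ?I (snd c z) x"
  obtain \<Gamma> where G: "scaled_curve m A N X t \<Gamma>" "snd c (\<Gamma> 0) = x" "snd c (\<Gamma> 1) = coord_rep c c (flow_map m A N X t) x"
    "\<And>\<theta>. \<theta> \<in> {0..1} \<Longrightarrow> \<Gamma> \<theta> \<in> fst c \<and> cdist ?I (snd c z) (snd c (\<Gamma> \<theta>)) \<le> 2 * ?\<rho>"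
    using flow_in_coords[OF B t x] by blast
  have xc: "x \<in> coord_space ?I" using G(2) G(4)[of 0] chart_coord[OF at c] by auto
  have pt: "snd c (\<Gamma> \<theta>) \<in> coord_space ?I" "cinv c (snd c (\<Gamma> \<theta>)) = \<Gamma> \<theta>" "cdist ?I (snd c z) (snd c (\<Gamma> \<theta>)) \<le> r"
    if "\<theta> \<in> {0..1}" for \<theta>
    using G(4)[OF that] chart_coord[OF at c] cinv_left[OF at c] x(2) by auto
  define E where "E = C * (2 * ?\<rho>) ^ n"
  have E0: "0 \<le> E" using C by (simp add: E_def)
  have XE: "\<bar>X c (\<Gamma> \<theta>) j\<bar> \<le> E" if th: "\<theta> \<in> {0..1}" "j < m" for \<theta> j
  proof -
    have "\<bar>X c (\<Gamma> \<theta>) j\<bar> \<le> C * cdist ?I (snd c z) (snd c (\<Gamma> \<theta>)) ^ n"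
      using XC[OF pt(1,3)[OF th(1)] th(2)] pt(2)[OF th(1)] by simp
    also have "\<dots> \<le> E" unfolding E_def using G(4)[OF th(1)] C by (intro mult_left_mono power_mono) auto
    finally show ?thesis .
  qed
  have der: "((\<lambda>r. snd c (\<Gamma> r) j) has_real_derivative t * X c (\<Gamma> \<theta>) j) (at \<theta>)" if "\<theta> \<in> {0..1}" "j < m" for \<theta> j
    by (rule curve_derivative[OF M c z vf zN X0 G(1) that(1) _ that(2)]) (use G(4)[OF that(1)] in blast)
  have mv: "\<exists>\<xi>\<in>{0..\<theta>}. snd c (\<Gamma> \<theta>) j - x j = t * X c (\<Gamma> \<xi>) j * \<theta>" if th: "\<theta> \<in> {0..1}" "j < m" for \<theta> j
  proof -
    have seg: "closed_segment 0 \<theta> = {0..\<theta>}" using th(1) by (simp add: closed_segment_eq_real_ivl)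
    have "((\<lambda>r. snd c (\<Gamma> r) j) has_real_derivative t * X c (\<Gamma> s) j) (at s)" if "s \<in> closed_segment 0 \<theta>" for s
      using der[of s j] th that unfolding seg by auto
    from mvt_segment[of 0 \<theta>, OF this] show ?thesis using G(2) unfolding seg by simp
  qed
  have close: "cdist ?I x (snd c (\<Gamma> \<theta>)) \<le> \<bar>t\<bar> * E" if th: "\<theta> \<in> {0..1}" for \<theta>
  proof (subst cdist_le_iff)
    show "\<forall>j\<in>?I. \<bar>x j - snd c (\<Gamma> \<theta>) j\<bar> \<le> \<bar>t\<bar> * E"
    proof
      fix j assume "j \<in> ?I"
      then have j: "j < m" by simp
      obtain \<xi> where \<xi>: "\<xi> \<in> {0..\<theta>}" "snd c (\<Gamma> \<theta>) j - x j = t * X c (\<Gamma> \<xi>) j * \<theta>" using mv[OF th j] by blast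
      have "\<bar>t\<bar> * \<bar>X c (\<Gamma> \<xi>) j\<bar> * \<theta> \<le> \<bar>t\<bar> * E * 1"
        using XE[of \<xi> j] \<xi>(1) th j E0 by (intro mult_mono mult_left_mono) auto
      then have "\<bar>snd c (\<Gamma> \<theta>) j - x j\<bar> \<le> \<bar>t\<bar> * E" unfolding \<xi>(2) using th by (simp add: abs_mult)
      then show "\<bar>x j - snd c (\<Gamma> \<theta>) j\<bar> \<le> \<bar>t\<bar> * E" by (simp only: abs_minus_commute)
    qed
  qed (use E0 in auto)
  obtain \<xi> where \<xi>: "\<xi> \<in> {0..1}" "snd c (\<Gamma> 1) i - x i = t * X c (\<Gamma> \<xi>) i * 1" using mv[of 1 i] i by auto
  have "\<bar>X c (cinv c (snd c (\<Gamma> \<xi>))) i - X c (cinv c x) i\<bar> \<le> cdist ?I (X c (cinv c (snd c (\<Gamma> \<xi>)))) (X c (cinv c x))"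
    using abs_le_cdist[of ?I i "X c (cinv c (snd c (\<Gamma> \<xi>)))" "X c (cinv c x)"] i by simp
  also have "\<dots> \<le> L * cdist ?I (snd c (\<Gamma> \<xi>)) x" by (rule BD(4)[OF pt(1)[OF \<xi>(1)] xc pt(3)[OF \<xi>(1)]]) (use x(2) BD(1) in simp)
  also have "\<dots> \<le> L * (\<bar>t\<bar> * E)" using close[OF \<xi>(1)] BD(2) by (simp add: cdist_commute)
  finally have "\<bar>X c (\<Gamma> \<xi>) i - X c (cinv c x) i\<bar> \<le> L * (\<bar>t\<bar> * E)" using pt(2)[OF \<xi>(1)] by simp
  then have "\<bar>t\<bar> * \<bar>X c (\<Gamma> \<xi>) i - X c (cinv c x) i\<bar> \<le> \<bar>t\<bar> * (L * (\<bar>t\<bar> * E))" by (intro mult_left_mono) auto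
  moreover have "coord_rep c c (flow_map m A N X t) x i - x i - t * X c (cinv c x) i = t * (X c (\<Gamma> \<xi>) i - X c (cinv c x) i)"
    using \<xi>(2) G(3) by (simp add: algebra_simps)
  ultimately show ?thesis by (simp add: abs_mult E_def power_mult_distrib power2_eq_square ac_simps)
qed

text \<open>Coefficientwise, the n-jet of the flow at time t is that of the identity plus t times
  the n-jet of the field, up to O(t^2). For small t it lies within \<open>e\<close> of the jet at
  time 0, so it equals that jet; dividing by t shows that the n-jet of the field is O(t).\<close>

lemma vfield_rigid:
  assumes n: "1 \<le> n" and O: "\<And>i. i < m \<Longrightarrow> Ovan {..<m} (snd c z) n (\<lambda>x. X c (cinv c x) i)"
    and T0: "T0 > 0" and e: "e > 0" and disc: "\<And>t. \<bar>t\<bar> \<le> T0 \<Longrightarrow>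
      cdist (djet_idx m n) (jcoord m c n (flow_map m A N X 0) (snd c z)) (jcoord m c n (flow_map m A N X t) (snd c z)) < e \<Longrightarrow>
      same_jet m A n z (flow_map m A N X 0) (flow_map m A N X t)"
    and i: "i < m"
  shows "Ovan {..<m} (snd c z) (Suc n) (\<lambda>x. X c (cinv c x) i)"
proof -
  note at = vf_atlas[OF M c z vf zN X0]
  let ?I = "{..<m}" and ?x0 = "snd c z" and ?J = "djet_idx m n"
  let ?\<phi> = "flow_map m A N X"
  have O': "Ovan ?I ?x0 n (\<lambda>x. X c (cinv c x) i)" if "i \<in> ?I" for i using O that by simp
  obtain C where C: "C > 0" "\<forall>\<^sub>F x in cnh ?I ?x0. \<forall>i\<in>?I. \<bar>X c (cinv c x) i\<bar> \<le> C * cdist ?I ?x0 x ^ n"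
    using Ovan_all[where F = "\<lambda>i x. X c (cinv c x) i", OF finite_lessThan finite_lessThan O'] by blast
  obtain r L where B: "lip_box m c N X z r L"
    "\<And>x. x \<in> coord_space ?I \<Longrightarrow> cdist ?I ?x0 x \<le> r \<Longrightarrow> \<forall>i\<in>?I. \<bar>X c (cinv c x) i\<bar> \<le> C * cdist ?I ?x0 x ^ n"
    using lip_box_ex[OF C(2)] by blast
  note BD = lip_boxD[OF B(1)]
  let ?D = "snd c ` (fst c \<inter> N)"
  note vd = vf_dom[OF M c z vf zN X0]
  define d where "d i bs = ipartial bs (\<lambda>x. X c (cinv c x) i) ?x0" for i bs
  define q where "q i bs = ipartial bs (\<lambda>x :: nat \<Rightarrow> real. x i) ?x0" for i bs
  \<comment> \<open>The product of the constants of \<open>ipartial_bound\<close> and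
    \<open>flow_expansion\<close>.\<close>
  define K where "K = (2 * real n) ^ n * (L * C * 2 ^ n)"
  have K0: "0 \<le> K" using BD(2) C(1) by (simp add: K_def)
  have fix_t: "?\<phi> t z = Some z" if "\<bar>t\<bar> * L \<le> 1/2" for t by (rule flow_fix[OF M c z vf zN X0 B(1) that])
  have dersK: "\<bar>ipartial bs (\<lambda>x. coord_rep c c (?\<phi> t) x i) ?x0 - q i bs - t * d i bs\<bar> \<le> K * t\<^sup>2"
    if t: "\<bar>t\<bar> * L \<le> 1/2" and i: "i < m" and bs: "set bs \<subseteq> ?I" "length bs \<le> n" for t i bs
  proof -
    note R = cdiffeoD[OF rep_cdiffeo[OF at LD c c, of t]]
    let ?U = "rep_dom c c (?\<phi> t) \<inter> ?D"
    have oU: "copen ?I ?U" using R(1) vd(1) by blast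
    have x0: "?x0 \<in> ?U" using rep_fix(1)[where \<phi> = "?\<phi> t", OF at c z fix_t[OF t]] vd(2) by blast
    have s1: "smooth_real_on ?I ?U (\<lambda>x. coord_rep c c (?\<phi> t) x i)" using smooth_subset[OF R(7)] i by auto
    have s2: "smooth_real_on ?I ?U (\<lambda>x. X c (cinv c x) i)" by (rule smooth_subset[OF vf_smooth[OF M c z vf zN X0 i]]) auto
    note F = finite_lessThan[of m]
    have s3: "smooth_real_on ?I ?U (\<lambda>x. coord_rep c c (?\<phi> t) x i - x i)" by (intro smooth_diff[OF F oU] s1 smooth_coord)
    have s4: "smooth_real_on ?I ?U (\<lambda>x. t * X c (cinv c x) i)" by (intro smooth_mult[OF F oU] smooth_const s2)
    have s5: "smooth_real_on ?I ?U (\<lambda>x. coord_rep c c (?\<phi> t) x i - x i - t * X c (cinv c x) i)"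
      by (rule smooth_diff[OF F oU s3 s4])
    have eq: "ipartial bs (\<lambda>x. coord_rep c c (?\<phi> t) x i - x i - t * X c (cinv c x) i) ?x0 =
        ipartial bs (\<lambda>x. coord_rep c c (?\<phi> t) x i) ?x0 - q i bs - t * d i bs"
      using ipartial_diff[OF F oU s3 s4 bs(1) x0] ipartial_diff[OF F oU s1 smooth_coord bs(1) x0]
        ipartial_cmult[OF F oU s2 bs(1) x0] by (simp add: q_def d_def)
    have ev: "\<forall>\<^sub>F x in cnh ?I ?x0. \<bar>coord_rep c c (?\<phi> t) x i - x i - t * X c (cinv c x) i\<bar> \<le> ((L * C * 2 ^ n) * t\<^sup>2) * cdist ?I ?x0 x ^ n"
      using cnh_copen[OF F oU x0] cnh_dist[of "r / 2" ?I ?x0, OF half_gt_zero[OF BD(1)]]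
    proof eventually_elim
      case (elim x)
      show ?case by (rule flow_expansion[OF B(1) t less_imp_le[OF C(1)] _ _ elim(2) i]) (use B(2) elim(1) in auto)
    qed
    have nn: "0 \<le> (L * C * 2 ^ n) * t\<^sup>2" using BD(2) C(1) by simp
    note ib = ipartial_bound[OF F oU x0 s5 bs nn ev]
    show ?thesis
    proof (cases "length bs < n")
      case True
      then show ?thesis using ib(1) K0 by (simp add: eq)
    next
      case False
      then have "length bs = n" using bs(2) by simp
      from ib(2)[OF this] show ?thesis by (simp add: eq K_def mult.assoc)
    qed
  qed
  define Dm where "Dm = (\<Sum>j\<in>?J. case j of Inl b \<Rightarrow> 0 | Inr (a, bs) \<Rightarrow> \<bar>d a bs\<bar>)"
  have fJ: "finite ?J" by (rule finite_djet_idx[OF at c z])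
  have Dm0: "0 \<le> Dm" unfolding Dm_def by (intro sum_nonneg) (auto split: sum.splits)
  have Dmi: "\<bar>d a bs\<bar> \<le> Dm" if "Inr (a, bs) \<in> ?J" for a bs
    using member_le_sum[of "Inr (a, bs)" ?J "\<lambda>j. case j of Inl b \<Rightarrow> 0 | Inr (a, bs) \<Rightarrow> \<bar>d a bs\<bar>"] that fJ
    unfolding Dm_def by (auto split: sum.splits)
  have z0: "\<bar>0::real\<bar> * L \<le> 1/2" by simp
  have q0: "ipartial bs (\<lambda>x. coord_rep c c (?\<phi> 0) x i) ?x0 = q i bs" if "i < m" "set bs \<subseteq> ?I" "length bs \<le> n" for i bs
    using dersK[OF z0 that] by simp
  \<comment> \<open>The bounds place t in the range where \<open>disc\<close> holds, give t^2 \<le>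
    t, meet the short-time condition of the flow estimates, and keep the movement of the jet, at
    most t (Dm + K), below \<open>e\<close>.\<close>
  define s where "s = min (min T0 1) (min (1 / (2 * L)) (e / (2 * (Dm + K + 1))))"
  have s0: "s > 0" using T0 BD(2) e Dm0 K0 by (simp add: s_def add_nonneg_pos)
  have small: "\<bar>d a bs\<bar> \<le> K * t" if t: "0 < t" "t \<le> s" and a: "a < m" and bs: "bs \<in> multi_idx m n" for t a bs
  proof -
    have tL: "\<bar>t\<bar> * L \<le> 1/2"
    proof -
      have "t \<le> 1 / (2 * L)" using t(2) by (simp add: s_def)
      then show ?thesis using BD(2) t(1) by (simp add: field_simps)
    qed
    have t1: "t \<le> 1" "t \<le> T0" "t \<le> e / (2 * (Dm + K + 1))" using t(2) by (auto simp: s_def)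
    have Kt: "K * t\<^sup>2 \<le> K * t" using t(1) t1(1) K0 by (intro mult_left_mono) (auto simp: power2_eq_square mult_le_cancel_right1)
    have "\<bar>jcoord m c n (?\<phi> 0) ?x0 j - jcoord m c n (?\<phi> t) ?x0 j\<bar> \<le> t * (Dm + K)" if j: "j \<in> ?J" for j
    proof (cases j)
      case (Inl b)
      then show ?thesis using j t(1) Dm0 K0 by (simp add: jcoord_def[OF at c z])
    next
      case (Inr p)
      obtain a bs where p: "p = (a, bs)" by (cases p)
      have ab: "a < m" "set bs \<subseteq> ?I" "length bs \<le> n" using j Inr p by (auto simp: djet_idx_def multi_idx_def)
      have "\<bar>ipartial bs (\<lambda>x. coord_rep c c (?\<phi> t) x a) ?x0 - q a bs - t * d a bs\<bar> \<le> K * t" using dersK[OF tL ab] Kt by linarith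
      moreover have "\<bar>t * d a bs\<bar> \<le> t * Dm" using Dmi[of a bs] j Inr p t(1) by (simp add: abs_mult)
      ultimately have "\<bar>q a bs - ipartial bs (\<lambda>x. coord_rep c c (?\<phi> t) x a) ?x0\<bar> \<le> t * Dm + K * t" by linarith
      then show ?thesis using j Inr p q0[OF ab] by (simp add: jcoord_def[OF at c z] algebra_simps)
    qed
    then have "cdist ?J (jcoord m c n (?\<phi> 0) ?x0) (jcoord m c n (?\<phi> t) ?x0) \<le> t * (Dm + K)"
      using fJ t(1) Dm0 K0 by (subst cdist_le_iff) auto
    also have "\<dots> \<le> e / (2 * (Dm + K + 1)) * (Dm + K)" using t1(3) Dm0 K0 by (intro mult_right_mono) auto
    also have "\<dots> < e"
    proof -
      have "0 < 2 * (Dm + K + 1)" using Dm0 K0 by simp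
      moreover have "e * (Dm + K) < e * (2 * (Dm + K + 1))" using e Dm0 K0 by (intro mult_strict_left_mono) auto
      ultimately show ?thesis by (simp add: pos_divide_less_eq)
    qed
    finally have "same_jet m A n z (?\<phi> 0) (?\<phi> t)" by (intro disc) (use t(1) t1(2) in auto)
    then have "ipartial bs (\<lambda>x. coord_rep c c (?\<phi> 0) x a) ?x0 = ipartial bs (\<lambda>x. coord_rep c c (?\<phi> t) x a) ?x0"
      unfolding same_jet_def using c z fix_t[OF z0] a bs by simp
    moreover have bb: "set bs \<subseteq> ?I" "length bs \<le> n" using bs by (auto simp: multi_idx_def)
    ultimately have "\<bar>t * d a bs\<bar> \<le> K * t\<^sup>2" using dersK[OF tL a bb] q0[OF a bb] by simp
    then have "t * \<bar>d a bs\<bar> \<le> t * (K * t)" using t(1) by (simp add: abs_mult power2_eq_square ac_simps)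
    then show ?thesis using t(1) by simp
  qed
  have dz: "d a bs = 0" if a: "a < m" and bs: "bs \<in> multi_idx m n" for a bs
  proof (rule ccontr)
    assume ne: "d a bs \<noteq> 0"
    define t where "t = min s (\<bar>d a bs\<bar> / (2 * (K + 1)))"
    have t: "0 < t" "t \<le> s" using s0 ne K0 by (auto simp: t_def)
    have "\<bar>d a bs\<bar> \<le> K * t" by (rule small[OF t a bs])
    also have "\<dots> \<le> (K + 1) * t" using t(1) by (simp add: algebra_simps)
    also have "\<dots> \<le> (K + 1) * (\<bar>d a bs\<bar> / (2 * (K + 1)))" using K0 by (intro mult_left_mono) (auto simp: t_def)
    also have "\<dots> = \<bar>d a bs\<bar> / 2" using K0 by (simp add: field_simps)
    finally show False using ne by simp
  qed
  show ?thesis unfolding Ovan_iff[OF finite_lessThan vd vf_smooth[OF M c z vf zN X0 i]]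
  proof (intro allI impI)
    fix bs :: "nat list" assume bs: "set bs \<subseteq> ?I \<and> length bs < Suc n"
    have "d i (sort bs) = 0" by (rule dz[OF i multi_idx_sort]) (use bs in auto)
    then show "ipartial bs (\<lambda>x. X c (cinv c x) i) ?x0 = 0"
      using ipartial_sort[OF finite_lessThan vd(1) vf_smooth[OF M c z vf zN X0 i] _ vd(2)] bs by (simp add: d_def)
  qed
qed

text \<open>The sum in \<open>H\<close> is the derivative of a transverse coordinate along the
  field. For a curve starting on \<open>S\<close> the transverse coordinates w begin at 0 and
  satisfy |w'| \<le> |t| (a |w| + b (2 r)^k) by \<open>flat_vector_bound\<close>, with r the initial
  distance, so Gronwall bounds them by O(r^k) at the end point.\<close>

lemma flow_near_flat:
  assumes d: "cdiffeo {..<m} V V' \<tau> \<sigma>" and x0: "snd c z \<in> V" and K: "K \<subseteq> {..<m}" and zS: "z \<in> S"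
    and flat: "cimg c S \<inter> V = {x\<in>V. \<forall>j\<in>{..<m}-K. \<tau> x j = 0}" and C0: "0 \<le> C"
    and H: "\<forall>\<^sub>F x in cnh {..<m} (snd c z). x \<in> cimg c S \<longrightarrow> (\<forall>l\<in>{..<m}-K.
      \<bar>\<Sum>b<m. pd b (\<lambda>x. \<tau> x l) x * X c (cinv c x) b\<bar> \<le> C * cdist {..<m} (snd c z) x ^ k)"
  shows "\<exists>T>0. \<forall>t. \<bar>t\<bar> \<le> T \<longrightarrow> flow_map m A N X t z = Some z \<and>
    near {..<m} (snd c z) k (cimg c (pimage (flow_map m A N X t) S)) (cimg c S)"
proof -
  note at = vf_atlas[OF M c z vf zN X0]
  note D = cdiffeoD[OF d]
  let ?I = "{..<m}" and ?x0 = "snd c z" and ?L = "{..<m} - K"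
  let ?\<phi> = "flow_map m A N X"
  note F = finite_lessThan[of m]
  let ?D = "snd c ` (fst c \<inter> N)"
  note vd = vf_dom[OF M c z vf zN X0]
  define E where "E l x = (\<Sum>b<m. pd b (\<lambda>x. \<tau> x l) x * X c (cinv c x) b)" for l x
  define U where "U = V \<inter> ?D"
  have oU: "copen ?I U" "?x0 \<in> U" using D(1) vd x0 by (auto simp: U_def)
  have sE: "smooth_real_on ?I U (E l)" if "l \<in> ?L" for l unfolding E_def
  proof (intro smooth_sum[OF F oU(1)] smooth_mult[OF F oU(1)])
    fix b assume b: "b \<in> ?I"
    show "smooth_real_on ?I U (pd b (\<lambda>x. \<tau> x l))"
      by (rule smooth_subset[OF smooth_pd[OF D(7) b]]) (use that in \<open>auto simp: U_def\<close>)
    show "smooth_real_on ?I U (\<lambda>x. X c (cinv c x) b)"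
      by (rule smooth_subset[OF vf_smooth[OF M c z vf zN X0]]) (use b in \<open>auto simp: U_def\<close>)
  qed
  have zc: "?x0 \<in> cimg c S" using zS z by (auto simp: cimg_def)
  have H': "\<forall>\<^sub>F x in cnh ?I ?x0. x \<in> cimg c S \<longrightarrow> (\<forall>l\<in>?L. \<bar>E l x\<bar> \<le> C * cdist ?I ?x0 x ^ k)" using H by (simp add: E_def)
  obtain a b where ab: "a > 0" "b > 0"
    "\<forall>\<^sub>F x in cnh ?I ?x0. \<forall>l\<in>?L. \<bar>E l x\<bar> \<le> a * cdist ?L (\<lambda>_. 0) (\<tau> x) + b * cdist ?I ?x0 x ^ k"
    using flat_vector_bound[OF F d x0 K zc flat oU sE H' C0] by blast
  obtain r L where B: "lip_box m c N X z r L"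
    "\<And>x. x \<in> coord_space ?I \<Longrightarrow> cdist ?I ?x0 x \<le> r \<Longrightarrow> x \<in> V \<and> (\<forall>l\<in>?L. \<bar>E l x\<bar> \<le> a * cdist ?L (\<lambda>_. 0) (\<tau> x) + b * cdist ?I ?x0 x ^ k)"
    using lip_box_ex[OF eventually_conj[OF cnh_copen[OF F D(1) x0] ab(3)]] by blast
  note BD = lip_boxD[OF B(1)]
  \<comment> \<open>Two Gronwall arguments are served: one keeps the curve in the box, with rate
    \<open>L\<close>; the other bounds its transverse coordinates, with rate
    \<open>a\<close>.\<close>
  define T where "T = min (1 / (2 * L)) (1 / (2 * a))"
  have T0: "T > 0" using BD(2) ab(1) by (simp add: T_def)
  have "?\<phi> t z = Some z \<and> near ?I ?x0 k (cimg c (pimage (?\<phi> t) S)) (cimg c S)" if tT: "\<bar>t\<bar> \<le> T" for t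
  proof
    have tL: "\<bar>t\<bar> * L \<le> 1/2" "\<bar>t\<bar> * a \<le> 1/2"
    proof -
      have "\<bar>t\<bar> \<le> 1 / (2 * L)" "\<bar>t\<bar> \<le> 1 / (2 * a)" using tT by (auto simp: T_def)
      then show "\<bar>t\<bar> * L \<le> 1/2" "\<bar>t\<bar> * a \<le> 1/2" using BD(2) ab(1) by (auto simp: field_simps)
    qed
    show fz: "?\<phi> t z = Some z" by (rule flow_fix[OF M c z vf zN X0 B(1) tL(1)])
    note R = rep_cdiffeo[OF at LD c c, of t]
    note RD = cdiffeoD[OF R]
    have est: "\<bar>\<tau> (coord_rep c c (?\<phi> t) x) l\<bar> \<le> (2 * \<bar>t\<bar> * b * 2 ^ k) * cdist ?I ?x0 x ^ k"
      if x: "x \<in> rep_dom c c (?\<phi> t)" "cdist ?I ?x0 x < r / 2" "x \<in> cimg c S" and l: "l \<in> ?L" for x l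
    proof -
      let ?\<rho> = "cdist ?I ?x0 x"
      obtain \<Gamma> where G: "scaled_curve m A N X t \<Gamma>" "snd c (\<Gamma> 0) = x" "snd c (\<Gamma> 1) = coord_rep c c (?\<phi> t) x"
        "\<And>\<theta>. \<theta> \<in> {0..1} \<Longrightarrow> \<Gamma> \<theta> \<in> fst c \<and> cdist ?I ?x0 (snd c (\<Gamma> \<theta>)) \<le> 2 * ?\<rho>"
        using flow_in_coords[OF B(1) tL(1) x(1,2)] by blast
      have pt: "snd c (\<Gamma> \<theta>) \<in> coord_space ?I" "cinv c (snd c (\<Gamma> \<theta>)) = \<Gamma> \<theta>" "snd c (\<Gamma> \<theta>) \<in> V"
        "\<And>l. l \<in> ?L \<Longrightarrow> \<bar>E l (snd c (\<Gamma> \<theta>))\<bar> \<le> a * cdist ?L (\<lambda>_. 0) (\<tau> (snd c (\<Gamma> \<theta>))) + b * cdist ?I ?x0 (snd c (\<Gamma> \<theta>)) ^ k"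
        if "\<theta> \<in> {0..1}" for \<theta>
      proof -
        show p: "snd c (\<Gamma> \<theta>) \<in> coord_space ?I" "cinv c (snd c (\<Gamma> \<theta>)) = \<Gamma> \<theta>"
          using G(4)[OF that] chart_coord[OF at c] cinv_left[OF at c] by auto
        have "cdist ?I ?x0 (snd c (\<Gamma> \<theta>)) \<le> r" using G(4)[OF that] x(2) by simp
        from B(2)[OF p(1) this] show "snd c (\<Gamma> \<theta>) \<in> V"
          "\<And>l. l \<in> ?L \<Longrightarrow> \<bar>E l (snd c (\<Gamma> \<theta>))\<bar> \<le> a * cdist ?L (\<lambda>_. 0) (\<tau> (snd c (\<Gamma> \<theta>))) + b * cdist ?I ?x0 (snd c (\<Gamma> \<theta>)) ^ k" by blast+
      qed
      define w where "w s = \<tau> (snd c (\<Gamma> s))" for s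
      have w0: "w 0 l = 0" if "l \<in> ?L" for l
      proof -
        have "x \<in> V" using pt(3)[of 0] G(2) by simp
        then show ?thesis using flat x(3) that G(2) unfolding w_def by blast
      qed
      have one: "1 \<in> {0..1::real}" by simp
      have 1: "cdist ?L (\<lambda>_. 0) (w 1) \<le> 2 * (cdist ?L (\<lambda>_. 0) (w 0) + \<bar>t\<bar> * (b * (2 * ?\<rho>) ^ k))"
      proof (rule gronwall_small[OF finite_Diff[OF F] _ _ _ tL(2) _ _ _ one])
        show "0 \<le> \<bar>t\<bar> * a" using ab by simp
        show "0 \<le> \<bar>t\<bar> * (b * (2 * ?\<rho>) ^ k)" using ab(2) by simp
        fix s :: real and l assume s: "s \<in> {0..1}" and l: "l \<in> ?L"
        have lI: "l \<in> ?I" using l by blast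
        have "((\<lambda>r. \<tau> (snd c (\<Gamma> r)) l) has_real_derivative (\<Sum>b\<in>?I. pd b (\<lambda>x. \<tau> x l) (snd c (\<Gamma> s)) * (t * X c (\<Gamma> s) b))) (at s)"
        proof (rule chain_curve[where V = V and F = "\<lambda>x. \<tau> x l" and \<gamma> = "\<lambda>r. snd c (\<Gamma> r)" and ?t0.0 = s and g = "\<lambda>b. t * X c (\<Gamma> s) b", OF F D(1) smooth_pdiff[OF D(7)[OF lI]] smooth_continuous[OF smooth_pd[OF D(7)[OF lI]]] pt(3)[OF s]])
          have "\<forall>\<^sub>F r in nhds s. \<Gamma> r \<in> fst c" using G(1) s c G(4)[OF s] unfolding scaled_curve_def by blast
          then show "\<forall>\<^sub>F r in nhds s. snd c (\<Gamma> r) \<in> coord_space ?I" by eventually_elim (rule chart_coord[OF at c])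
          show "((\<lambda>r. snd c (\<Gamma> r) j) has_real_derivative t * X c (\<Gamma> s) j) (at s)" if "j \<in> ?I" for j
            by (rule curve_derivative[OF M c z vf zN X0 G(1) s]) (use G(4)[OF s] that in auto)
        qed
        moreover have "(\<Sum>b\<in>?I. pd b (\<lambda>x. \<tau> x l) (snd c (\<Gamma> s)) * (t * X c (\<Gamma> s) b)) = t * E l (snd c (\<Gamma> s))"
          unfolding E_def pt(2)[OF s] by (simp add: sum_distrib_left mult.left_commute)
        ultimately show "((\<lambda>r. w r l) has_real_derivative t * E l (snd c (\<Gamma> s))) (at s)" by (simp add: w_def)
        have "\<bar>E l (snd c (\<Gamma> s))\<bar> \<le> a * cdist ?L (\<lambda>_. 0) (w s) + b * (2 * ?\<rho>) ^ k"
        proof -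
          have "b * cdist ?I ?x0 (snd c (\<Gamma> s)) ^ k \<le> b * (2 * ?\<rho>) ^ k"
            using G(4)[OF s] ab(2) by (intro mult_left_mono power_mono) auto
          then show ?thesis using pt(4)[OF s l] unfolding w_def by linarith
        qed
        then have "\<bar>t\<bar> * \<bar>E l (snd c (\<Gamma> s))\<bar> \<le> \<bar>t\<bar> * (a * cdist ?L (\<lambda>_. 0) (w s) + b * (2 * ?\<rho>) ^ k)" by (intro mult_left_mono) auto
        then show "\<bar>t * E l (snd c (\<Gamma> s))\<bar> \<le> \<bar>t\<bar> * a * cdist ?L (\<lambda>_. 0) (w s) + \<bar>t\<bar> * (b * (2 * ?\<rho>) ^ k)"
          by (simp add: abs_mult distrib_left mult.assoc)
      qed auto
      have 2: "cdist ?L (\<lambda>_. 0) (w 0) = 0" by (rule antisym) (use w0 F in \<open>auto simp: cdist_le_iff\<close>)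
      have "\<bar>w 1 l\<bar> \<le> cdist ?L (\<lambda>_. 0) (w 1)" using abs_le_cdist[of ?L l "\<lambda>_. 0" "w 1"] l by simp
      from order_trans[OF this 1] have "\<bar>w 1 l\<bar> \<le> 2 * (\<bar>t\<bar> * (b * (2 * ?\<rho>) ^ k))" unfolding 2 by simp
      then show ?thesis using G(3) by (simp add: w_def power_mult_distrib ac_simps)
    qed
    let ?\<psi> = "coord_rep c c (pmap_inv (?\<phi> t))" and ?U' = "rep_dom c c (pmap_inv (?\<phi> t))"
    have y0: "?x0 \<in> ?U'" "?\<psi> ?x0 = ?x0"
      using rep_fix[where \<phi> = "pmap_inv (?\<phi> t)", OF at c z pmap_inv_fix[OF at c z LD fz]] by auto
    obtain L' where L': "L' > 0" "\<forall>\<^sub>F y in cnh ?I ?x0. cdist ?I (?\<psi> ?x0) (?\<psi> y) \<le> L' * cdist ?I ?x0 y"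
      using cdiffeo_dist[OF F cdiffeo_sym[OF R] y0(1)] .
    have fl: "filterlim ?\<psi> (cnh ?I ?x0) (cnh ?I ?x0)" using cdiffeo_filterlim[OF F cdiffeo_sym[OF R] y0(1)] y0(2) by simp
    define c0 where "c0 = 2 * \<bar>t\<bar> * b * 2 ^ k"
    have c00: "0 \<le> c0" using ab by (simp add: c0_def)
    have "\<forall>\<^sub>F y in cnh ?I ?x0. y \<in> cimg c (pimage (?\<phi> t) S) \<longrightarrow> (\<forall>l\<in>?L. \<bar>\<tau> y l\<bar> \<le> (c0 * L' ^ k) * cdist ?I ?x0 y ^ k)"
      using L'(2) cnh_copen[OF F RD(2) y0(1)] fl[unfolded filterlim_iff, rule_format, OF cnh_dist[OF half_gt_zero[OF BD(1)]]]
    proof eventually_elim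
      case (elim y)
      show ?case
      proof (intro impI ballI)
        fix l assume y: "y \<in> cimg c (pimage (?\<phi> t) S)" and l: "l \<in> ?L"
        have "y \<in> coord_rep c c (?\<phi> t) ` (cimg c S \<inter> rep_dom c c (?\<phi> t))"
          using cimg_pimage[OF at c z LD, of t S] y elim(2) by blast
        then obtain x where x: "x \<in> cimg c S" "x \<in> rep_dom c c (?\<phi> t)" "y = coord_rep c c (?\<phi> t) x" by blast
        have xy: "?\<psi> y = x" using RD(4)[OF x(2)] x(3) by simp
        have "\<bar>\<tau> y l\<bar> \<le> c0 * cdist ?I ?x0 x ^ k" using est[OF x(2) _ x(1) l] elim(3) xy x(3) by (simp add: c0_def)
        also have "\<dots> \<le> c0 * (L' * cdist ?I ?x0 y) ^ k" using elim(1) xy y0(2) c00 by (intro mult_left_mono power_mono) auto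
        finally show "\<bar>\<tau> y l\<bar> \<le> (c0 * L' ^ k) * cdist ?I ?x0 y ^ k" by (simp add: power_mult_distrib mult.assoc)
      qed
    qed
    then show "near ?I ?x0 k (cimg c (pimage (?\<phi> t) S)) (cimg c S)"
      by (rule flat_near[OF F d x0 K zc flat, rotated]) (use c00 L'(1) in simp)
  qed
  then show ?thesis using T0 by blast
qed

text \<open>The missing direction comes from time -t: the flow at time t transports the nearness of
  the image at time -t to \<open>S\<close>, and near \<open>z\<close> the two flows undo each
  other.\<close>

lemma flow_capprox:
  assumes near: "\<And>t. \<bar>t\<bar> \<le> T \<Longrightarrow> flow_map m A N X t z = Some z \<and>
      near {..<m} (snd c z) k (cimg c (pimage (flow_map m A N X t) S)) (cimg c S)" and T: "0 < T" and k: "1 \<le> k"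
  shows "\<exists>T>0. \<forall>t. \<bar>t\<bar> \<le> T \<longrightarrow> flow_map m A N X t z = Some z \<and> capprox m c z k (pimage (flow_map m A N X t) S) S"
proof -
  note at = vf_atlas[OF M c z vf zN X0]
  let ?I = "{..<m}" and ?x0 = "snd c z"
  let ?\<phi> = "flow_map m A N X"
  note F = finite_lessThan[of m]
  have tr: "eventually (\<lambda>_. True) (cnh ?I ?x0)" by simp
  obtain r L where B: "lip_box m c N X z r L" using lip_box_ex[OF tr] by blast
  note BD = lip_boxD[OF B]
  define T' where "T' = min T (1 / (2 * L))"
  have T': "T' > 0" using T BD(2) by (simp add: T'_def)
  have "capprox m c z k (pimage (?\<phi> t) S) S" if tT: "\<bar>t\<bar> \<le> T'" for t
  proof -
    have tt: "\<bar>t\<bar> \<le> T" "\<bar>- t\<bar> \<le> T" using tT by (auto simp: T'_def)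
    have tL: "\<bar>- t\<bar> * L \<le> 1/2"
    proof -
      have "\<bar>t\<bar> \<le> 1 / (2 * L)" using tT by (simp add: T'_def)
      then show ?thesis using BD(2) by (simp add: field_simps)
    qed
    have n: "near ?I ?x0 k (cimg c (pimage (?\<phi> t) (pimage (?\<phi> (- t)) S))) (cimg c (pimage (?\<phi> t) S))"
      by (rule near_pimage[OF at c z LD _ k]) (use near tt in auto)
    have x0r: "?x0 \<in> rep_dom c c (?\<phi> (- t))"
      by (rule rep_fix(1)[where \<phi> = "?\<phi> (- t)", OF at c z]) (use near tt in auto)
    have r4: "0 < r / 4" using BD(1) by simp
    have ev: "\<forall>\<^sub>F x in cnh ?I ?x0. x \<in> cimg c S \<longrightarrow> x \<in> cimg c (pimage (?\<phi> t) (pimage (?\<phi> (- t)) S))"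
      using cnh_copen[OF F cdiffeoD(1)[OF rep_cdiffeo[OF at LD c c, of "- t"]] x0r] cnh_dist[of "r / 4" ?I ?x0, OF r4]
    proof eventually_elim
      case (elim x)
      show ?case
      proof
        assume xS: "x \<in> cimg c S"
        note q = rep_dom_cinv[OF at c z elim(1)]
        obtain y where y: "?\<phi> (- t) (cinv c x) = Some y" using q(3) by blast
        have "?\<phi> (- (- t)) y = Some (cinv c x)" by (rule flow_inverse[OF M c z vf zN X0 B tL y q(1)]) (use elim(2) q(2) in simp)
        moreover have "cinv c x \<in> S" using xS q(1,2) cimg_mem[OF at c z, of "cinv c x" S] by simp
        ultimately have "cinv c x \<in> pimage (?\<phi> t) (pimage (?\<phi> (- t)) S)" using y by (auto simp: pimage_def)
        then show "x \<in> cimg c (pimage (?\<phi> t) (pimage (?\<phi> (- t)) S))" using q(1,2) cimg_mem[OF at c z q(1)] by (metis)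
      qed
    qed
    obtain C where C: "\<forall>\<^sub>F x in cnh ?I ?x0. x \<in> cimg c (pimage (?\<phi> t) (pimage (?\<phi> (- t)) S)) \<longrightarrow>
      (\<exists>y\<in>cimg c (pimage (?\<phi> t) S). cdist ?I x y \<le> C * cdist ?I ?x0 x ^ k)" using n unfolding near_def by blast
    have "\<forall>\<^sub>F x in cnh ?I ?x0. x \<in> cimg c S \<longrightarrow> (\<exists>y\<in>cimg c (pimage (?\<phi> t) S). cdist ?I x y \<le> C * cdist ?I ?x0 x ^ k)"
      using ev C by eventually_elim blast
    then have "near ?I ?x0 k (cimg c S) (cimg c (pimage (?\<phi> t) S))" unfolding near_def by blast
    then show ?thesis using near[OF tt(1)] by (simp add: capprox_def[OF at c z])
  qed
  moreover have "?\<phi> t z = Some z" if "\<bar>t\<bar> \<le> T'" for t using near[of t] that by (simp add: T'_def)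
  ultimately show ?thesis using T' by blast
qed

end

section \<open>Determining equations along sections of jets\<close>

definition line_at :: "('i \<Rightarrow> real) \<Rightarrow> ('i \<Rightarrow> real) \<Rightarrow> real \<Rightarrow> 'i \<Rightarrow> real" where
  "line_at x0 v t = (\<lambda>i. x0 i + t * v i)"

lemma line_at_zero [simp]: "line_at x0 v 0 = x0" by (simp add: line_at_def)

lemma line_in_open:
  assumes I: "finite I" and U: "copen I U" "x0 \<in> U" and v: "v \<in> coord_space I"
  shows "\<exists>e>0. \<forall>t\<in>{-e<..<e}. line_at x0 v t \<in> U"
proof -
  obtain r where r: "r > 0" "\<forall>y\<in>coord_space I. cdist I x0 y < r \<longrightarrow> y \<in> U" using copenD[OF I U] by blast
  define S where "S = (\<Sum>i\<in>I. \<bar>v i\<bar>) + 1"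
  have S: "S > 0" unfolding S_def by (intro add_nonneg_pos sum_nonneg) auto
  have x0c: "x0 \<in> coord_space I" using copen_sub U by blast
  have "line_at x0 v t \<in> U" if t: "t \<in> {-(r / S)<..<r / S}" for t
  proof -
    have "\<bar>x0 i - line_at x0 v t i\<bar> < r" if i: "i \<in> I" for i
    proof -
      have "\<bar>v i\<bar> \<le> S" unfolding S_def using member_le_sum[OF i, of "\<lambda>i. \<bar>v i\<bar>"] I by simp
      then have "\<bar>t\<bar> * \<bar>v i\<bar> \<le> \<bar>t\<bar> * S" by (intro mult_left_mono) auto
      also have "\<dots> < r" using t S by (auto simp: abs_less_iff field_simps)
      finally show ?thesis by (simp add: line_at_def abs_mult)
    qed
    then have "cdist I x0 (line_at x0 v t) < r" using I r(1) by (subst cdist_less_iff) auto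
    moreover have "line_at x0 v t \<in> coord_space I" using x0c v by (simp add: line_at_def coord_space_def)
    ultimately show ?thesis using r(2) by blast
  qed
  moreover have "r / S > 0" using r(1) S by simp
  ultimately show ?thesis by blast
qed

text \<open>Derivatives along a line are directional derivatives of a smooth function, which are
  smooth again, so every order is reached by iteration.\<close>

lemma line_smooth:
  assumes I: "finite I" "copen I U" and F: "smooth_real_on I U F" and L: "\<And>t. t \<in> {-e<..<e} \<Longrightarrow> line_at x0 v t \<in> U"
    and t: "t \<in> {-e<..<e}"
  shows "((\<lambda>s. F (line_at x0 v s)) has_real_derivative (\<Sum>b\<in>I. v b * pd b F (line_at x0 v t))) (at t)"
    and "((deriv ^^ k) (\<lambda>s. F (line_at x0 v s))) differentiable (at t)"
proof -
  have ch: "((\<lambda>s. F (line_at x0 v s)) has_real_derivative (\<Sum>b\<in>I. v b * pd b F (line_at x0 v t))) (at t)"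
    if F: "smooth_real_on I U F" and t: "t \<in> {-e<..<e}" for F t
  proof -
    have "((\<lambda>s. F (line_at x0 v s)) has_real_derivative (\<Sum>b\<in>I. pd b F (line_at x0 v t) * v b)) (at t)"
    proof (rule chain_curve[where \<gamma> = "line_at x0 v" and F = F and V = U and g = v, OF I smooth_pdiff[OF F] smooth_continuous[OF smooth_pd[OF F]] L[OF t]])
      have "\<forall>\<^sub>F s in nhds t. s \<in> {-e<..<e}" by (rule eventually_nhds_in_open) (use t in auto)
      then show "\<forall>\<^sub>F s in nhds t. line_at x0 v s \<in> coord_space I" by eventually_elim (use L copen_sub[OF I(2)] in blast)
      show "((\<lambda>s. line_at x0 v s j) has_real_derivative v j) (at t)" if "j \<in> I" for j
        unfolding line_at_def by (auto intro!: derivative_eq_intros)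
    qed
    then show ?thesis by (simp add: mult.commute)
  qed
  then show "((\<lambda>s. F (line_at x0 v s)) has_real_derivative (\<Sum>b\<in>I. v b * pd b F (line_at x0 v t))) (at t)"
    using F t by blast
  define dv where "dv F = (\<lambda>x. \<Sum>b\<in>I. v b * pd b F x)" for F
  have sdv: "smooth_real_on I U ((dv ^^ k) F)" for k
  proof (induction k)
    case (Suc k)
    show ?case unfolding funpow.simps o_def dv_def[of "(dv ^^ k) F"]
      by (intro smooth_sum[OF I] smooth_mult[OF I] smooth_const smooth_pd[OF Suc])
  qed (simp add: F)
  have eq: "\<forall>t\<in>{-e<..<e}. (deriv ^^ k) (\<lambda>s. F (line_at x0 v s)) t = (dv ^^ k) F (line_at x0 v t)" for k
  proof (induction k)
    case (Suc k)
    show ?case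
    proof
      fix t assume t: "t \<in> {-e<..<e}"
      have "\<forall>\<^sub>F s in nhds t. s \<in> {-e<..<e}" by (rule eventually_nhds_in_open) (use t in auto)
      then have "\<forall>\<^sub>F s in nhds t. (deriv ^^ k) (\<lambda>s. F (line_at x0 v s)) s = (dv ^^ k) F (line_at x0 v s)"
        by eventually_elim (use Suc in blast)
      then have "deriv ((deriv ^^ k) (\<lambda>s. F (line_at x0 v s))) t = deriv (\<lambda>s. (dv ^^ k) F (line_at x0 v s)) t"
        by (rule deriv_cong_ev) simp
      also have "\<dots> = dv ((dv ^^ k) F) (line_at x0 v t)"
        unfolding dv_def[of "(dv ^^ k) F"] by (rule DERIV_imp_deriv[OF ch[OF sdv t]])
      finally show "(deriv ^^ Suc k) (\<lambda>s. F (line_at x0 v s)) t = (dv ^^ Suc k) F (line_at x0 v t)" by simp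
    qed
  qed simp
  have "(\<lambda>s. (dv ^^ k) F (line_at x0 v s)) differentiable (at t)" using ch[OF sdv t] real_differentiable_def by blast
  then obtain D where D: "((\<lambda>s. (dv ^^ k) F (line_at x0 v s)) has_real_derivative D) (at t)"
    using real_differentiable_def by blast
  have "((deriv ^^ k) (\<lambda>s. F (line_at x0 v s)) has_real_derivative D) (at t)"
    by (rule has_field_derivative_transform_within_open[OF D _ t]) (use eq[of k] in auto)
  then show "((deriv ^^ k) (\<lambda>s. F (line_at x0 v s))) differentiable (at t)" using real_differentiable_def by blast
qed

text \<open>In a slice chart for \<open>R\<close> the coordinates of points of \<open>R\<close> form a linear space, so the difference of
  two sections of \<open>R\<close> that agree at \<open>x0\<close> again moves inside \<open>R\<close>.\<close>

lemma submanifold_difference_tangent: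
  assumes at: "smooth_atlas J B" and C: "C \<in> B" and R: "embedded_submanifold J B q R"
    and I: "finite I" and U: "copen I U" "x0 \<in> U"
    and \<alpha>: "\<And>j. j \<in> J \<Longrightarrow> smooth_real_on I U (\<lambda>x. \<alpha> x j)" "\<And>x. x \<in> U \<Longrightarrow> \<alpha> x \<in> snd C ` (R \<inter> fst C)"
    and \<beta>: "\<And>j. j \<in> J \<Longrightarrow> smooth_real_on I U (\<lambda>x. \<beta> x j)" "\<And>x. x \<in> U \<Longrightarrow> \<beta> x \<in> snd C ` (R \<inter> fst C)"
    and eq: "\<alpha> x0 = \<beta> x0" and v: "v \<in> coord_space I"
  shows "(\<lambda>j. if j \<in> J then \<Sum>b\<in>I. v b * (pd b (\<lambda>x. \<alpha> x j) x0 - pd b (\<lambda>x. \<beta> x j) x0) else 0)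
    \<in> tangent_space J C R (cinv C (\<alpha> x0))"
proof -
  define r where "r = cinv C (\<alpha> x0)"
  have r: "r \<in> R" "r \<in> fst C" "snd C r = \<alpha> x0" using \<alpha>(2)[OF U(2)] cinv_left[OF at C] unfolding r_def by auto
  obtain \<kappa> K where k: "admissible_chart J B \<kappa>" "r \<in> fst \<kappa>" "snd \<kappa> ` (R \<inter> fst \<kappa>) = {y \<in> snd \<kappa> ` fst \<kappa>. \<forall>i\<in>J - K. y i = 0}"
    using R r(1) unfolding embedded_submanifold_def by blast
  have at': "smooth_atlas J (insert \<kappa> B)" using k(1) by (simp add: admissible_chart_def)
  have CB: "C \<in> insert \<kappa> B" and kB: "\<kappa> \<in> insert \<kappa> B" using C by auto
  note F = atlas_finite[OF at]
  let ?D = "snd C ` (fst C \<inter> fst \<kappa>)" and ?D' = "snd \<kappa> ` (fst C \<inter> fst \<kappa>)"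
  let ?t = "\<lambda>x. snd \<kappa> (cinv C x)" and ?s = "\<lambda>y. snd C (cinv \<kappa> y)"
  note d = transition[OF at' CB kB]
  note D = cdiffeoD[OF d]
  have ac: "\<alpha> x \<in> coord_space J" "\<beta> x \<in> coord_space J" if "x \<in> U" for x
    using \<alpha>(2)[OF that] \<beta>(2)[OF that] chart_coord[OF at C] by auto
  have zero: "?t y i = 0" if y: "y \<in> snd C ` (R \<inter> fst C)" "y \<in> ?D" and i: "i \<in> J - K" for y i
  proof -
    obtain p where p: "p \<in> R" "p \<in> fst C" "y = snd C p" using y(1) by blast
    have cp: "cinv C y = p" using p cinv_left[OF at C] by simp
    have "p \<in> fst \<kappa>" using y(2) p(2,3) chart_mem[OF at C p(2), of "fst C \<inter> fst \<kappa>"] by auto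
    then have "snd \<kappa> p \<in> snd \<kappa> ` (R \<inter> fst \<kappa>)" using p(1) by blast
    then have "snd \<kappa> p i = 0" unfolding k(3) using i by blast
    then show ?thesis unfolding cp .
  qed
  define U12 where "U12 = {x\<in>U. \<alpha> x \<in> ?D} \<inter> {x\<in>U. \<beta> x \<in> ?D}"
  have o12: "copen I U12" unfolding U12_def by (intro copen_Int copen_preimage[OF I F U(1) D(1) smooth_continuous[OF \<alpha>(1)]]
        copen_preimage[OF I F U(1) D(1) smooth_continuous[OF \<beta>(1)]]) (use ac in auto)
  have U12: "x \<in> U" "\<alpha> x \<in> ?D" "\<beta> x \<in> ?D" if "x \<in> U12" for x using that by (auto simp: U12_def)
  have sU: "U12 \<subseteq> U" using U12(1) by blast
  have x12: "x0 \<in> U12" using U(2) r k(2) eq by (auto simp: U12_def intro!: image_eqI[of _ _ r])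
  have gs: "\<alpha> ` U12 \<subseteq> ?D" "\<beta> ` U12 \<subseteq> ?D" using U12 by blast+
  have s\<alpha>: "smooth_real_on I U12 (\<lambda>x. \<alpha> x j)" and s\<beta>: "smooth_real_on I U12 (\<lambda>x. \<beta> x j)" if "j \<in> J" for j
    using smooth_subset[OF \<alpha>(1)[OF that] sU] smooth_subset[OF \<beta>(1)[OF that] sU] .
  have sta: "smooth_real_on I U12 (\<lambda>x. ?t (\<alpha> x) j)" and stb: "smooth_real_on I U12 (\<lambda>x. ?t (\<beta> x) j)" if "j \<in> J" for j
    by (rule smooth_comp[OF I o12 F D(1) gs(1) D(7)[OF that] s\<alpha>], assumption)
      (rule smooth_comp[OF I o12 F D(1) gs(2) D(7)[OF that] s\<beta>], assumption)
  \<comment> \<open>The constant \<open>?t (\<alpha> x0)\<close> brings the difference back to the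
    base point: \<open>w x0\<close> equals \<open>?t (\<alpha> x0)\<close>, since
    \<open>\<alpha>\<close> and \<open>\<beta>\<close> agree at \<open>x0\<close>.\<close>
  define w where "w x = (\<lambda>j. ?t (\<alpha> x) j - ?t (\<beta> x) j + ?t (\<alpha> x0) j)" for x
  have sw: "smooth_real_on I U12 (\<lambda>x. w x j)" if "j \<in> J" for j
    unfolding w_def by (intro smooth_add[OF I o12] smooth_diff[OF I o12] sta stb that smooth_const)
  have tc: "?t y \<in> coord_space J" if "y \<in> ?D" for y using D(3)[OF that] D(10) by blast
  have wc: "w ` U12 \<subseteq> coord_space J"
  proof
    fix y assume "y \<in> w ` U12"
    then obtain x where x: "x \<in> U12" "y = w x" by blast
    show "y \<in> coord_space J" unfolding x(2) w_def using tc[OF U12(2)[OF x(1)]] tc[OF U12(3)[OF x(1)]] tc[OF U12(2)[OF x12]]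
      by (simp add: coord_space_def)
  qed
  define U3 where "U3 = {x\<in>U12. w x \<in> ?D'}"
  have o3: "copen I U3" unfolding U3_def by (rule copen_preimage[OF I F o12 D(2) smooth_continuous[OF sw] wc])
  have w0: "w x0 = ?t (\<alpha> x0)" by (simp add: w_def eq)
  have x3: "x0 \<in> U3" using x12 D(3)[OF U12(2)[OF x12]] w0 by (simp add: U3_def)
  have s3: "U3 \<subseteq> U12" by (auto simp: U3_def)
  have g3: "w ` U3 \<subseteq> ?D'" by (auto simp: U3_def)
  have sw3: "smooth_real_on I U3 (\<lambda>x. w x j)" if "j \<in> J" for j using smooth_subset[OF sw[OF that] s3] .
  have sF: "smooth_real_on I U3 (\<lambda>x. ?s (w x) j)" if "j \<in> J" for j by (rule smooth_comp[OF I o3 F D(2) g3 D(8)[OF that] sw3])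
  have pt: "cinv \<kappa> (w x) \<in> R \<inter> fst C" if x: "x \<in> U3" for x
  proof -
    have wx: "w x \<in> ?D'" and xx: "x \<in> U12" using x by (auto simp: U3_def)
    have "\<forall>i\<in>J - K. w x i = 0"
      using zero[OF \<alpha>(2)[OF U12(1)[OF xx]] U12(2)[OF xx]] zero[OF \<beta>(2)[OF U12(1)[OF xx]] U12(3)[OF xx]]
        zero[OF \<alpha>(2)[OF U(2)] U12(2)[OF x12]] by (simp add: w_def)
    then have "w x \<in> snd \<kappa> ` (R \<inter> fst \<kappa>)" unfolding k(3) using wx by blast
    then obtain p where p: "p \<in> R" "p \<in> fst \<kappa>" "w x = snd \<kappa> p" by blast
    have cp: "cinv \<kappa> (w x) = p" using p cinv_left[OF at' kB] by simp
    have "p \<in> fst C" using wx p(2,3) chart_mem[OF at' kB p(2), of "fst C \<inter> fst \<kappa>"] by auto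
    then show ?thesis using p(1) cp by simp
  qed
  obtain e where e: "e > 0" "\<And>t. t \<in> {-e<..<e} \<Longrightarrow> line_at x0 v t \<in> U3" using line_in_open[OF I o3 x3 v] by blast
  define \<gamma> where "\<gamma> t = cinv \<kappa> (w (line_at x0 v t))" for t
  have g0: "\<gamma> 0 = r" using cinv_left[OF at' kB k(2)] cinv_left[OF at C r(2)] r(3) by (simp add: \<gamma>_def w0)
  have e0: "0 \<in> {-e<..<e}" using e(1) by simp
  \<comment> \<open>Both Jacobians of \<open>?t\<close> are taken at the common value
    \<open>\<alpha> x0\<close>, so they factor out of the difference and cancel against that of
    \<open>?s\<close>.\<close>
  have der: "(\<Sum>b\<in>I. v b * pd b (\<lambda>x. ?s (w x) j) x0) = (\<Sum>b\<in>I. v b * (pd b (\<lambda>x. \<alpha> x j) x0 - pd b (\<lambda>x. \<beta> x j) x0))"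
    if j: "j \<in> J" for j
  proof (rule sum.cong[OF refl])
    fix b assume b: "b \<in> I"
    have pw: "pd b (\<lambda>x. w x l) x0 = (\<Sum>i\<in>J. pd i (\<lambda>x. ?t x l) (\<alpha> x0) * (pd b (\<lambda>x. \<alpha> x i) x0 - pd b (\<lambda>x. \<beta> x i) x0))"
      if l: "l \<in> J" for l
    proof -
      have 1: "pd b (\<lambda>x. w x l) x0 = pd b (\<lambda>x. ?t (\<alpha> x) l - ?t (\<beta> x) l) x0"
        unfolding w_def using pd_add[OF I o12 smooth_pdiff[OF smooth_diff[OF I o12 sta[OF l] stb[OF l]]] smooth_pdiff[OF smooth_const] b x12]
        by simp
      have 2: "pd b (\<lambda>x. ?t (\<alpha> x) l - ?t (\<beta> x) l) x0 = pd b (\<lambda>x. ?t (\<alpha> x) l) x0 - pd b (\<lambda>x. ?t (\<beta> x) l) x0"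
        by (rule pd_diff[OF I o12 smooth_pdiff[OF sta[OF l]] smooth_pdiff[OF stb[OF l]] b x12])
      have 3: "pd b (\<lambda>x. ?t (\<alpha> x) l) x0 = (\<Sum>i\<in>J. pd i (\<lambda>x. ?t x l) (\<alpha> x0) * pd b (\<lambda>x. \<alpha> x i) x0)"
        by (rule pd_comp_smooth[OF I o12 F D(1) D(7)[OF l] s\<alpha> gs(1) b x12])
      have 4: "pd b (\<lambda>x. ?t (\<beta> x) l) x0 = (\<Sum>i\<in>J. pd i (\<lambda>x. ?t x l) (\<beta> x0) * pd b (\<lambda>x. \<beta> x i) x0)"
        by (rule pd_comp_smooth[OF I o12 F D(1) D(7)[OF l] s\<beta> gs(2) b x12])
      show ?thesis unfolding 1 2 3 4 eq[symmetric] by (simp add: right_diff_distrib sum_subtractf)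
    qed
    have "pd b (\<lambda>x. ?s (w x) j) x0 = (\<Sum>l\<in>J. pd l (\<lambda>y. ?s y j) (w x0) * pd b (\<lambda>x. w x l) x0)"
      by (rule pd_comp_smooth[OF I o3 F D(2) D(8)[OF j] sw3 g3 b x3])
    also have "\<dots> = (\<Sum>l\<in>J. \<Sum>i\<in>J. pd l (\<lambda>y. ?s y j) (?t (\<alpha> x0)) * pd i (\<lambda>x. ?t x l) (\<alpha> x0) * (pd b (\<lambda>x. \<alpha> x i) x0 - pd b (\<lambda>x. \<beta> x i) x0))"
      by (intro sum.cong[OF refl]) (simp add: pw w0 sum_distrib_left mult.assoc)
    also have "\<dots> = (\<Sum>i\<in>J. \<Sum>l\<in>J. pd l (\<lambda>y. ?s y j) (?t (\<alpha> x0)) * pd i (\<lambda>x. ?t x l) (\<alpha> x0) * (pd b (\<lambda>x. \<alpha> x i) x0 - pd b (\<lambda>x. \<beta> x i) x0))"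
      by (rule sum.swap)
    also have "\<dots> = (\<Sum>i\<in>J. (if i = j then 1 else 0) * (pd b (\<lambda>x. \<alpha> x i) x0 - pd b (\<lambda>x. \<beta> x i) x0))"
      by (intro sum.cong[OF refl]) (simp only: sum_distrib_right[symmetric] cdiffeo_pd_inverse[OF F d U12(2)[OF x12] j])
    also have "\<dots> = pd b (\<lambda>x. \<alpha> x j) x0 - pd b (\<lambda>x. \<beta> x j) x0" using j F by (simp add: if_distrib[where f = "\<lambda>a. a * _"] cong: if_cong)
    finally show "v b * pd b (\<lambda>x. ?s (w x) j) x0 = v b * (pd b (\<lambda>x. \<alpha> x j) x0 - pd b (\<lambda>x. \<beta> x j) x0)" by simp
  qed
  show ?thesis unfolding tangent_space_def r_def[symmetric]
  proof (rule CollectI, rule conjI)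
    show "(\<lambda>j. if j \<in> J then \<Sum>b\<in>I. v b * (pd b (\<lambda>x. \<alpha> x j) x0 - pd b (\<lambda>x. \<beta> x j) x0) else 0) \<in> coord_space J"
      by (simp add: coord_space_def)
    show "\<exists>e>0. \<exists>\<gamma>. \<gamma> 0 = r \<and> (\<forall>t\<in>{-e<..<e}. \<gamma> t \<in> R \<inter> fst C) \<and>
      (\<forall>i\<in>J. (\<forall>k. \<forall>t\<in>{-e<..<e}. ((deriv ^^ k) (\<lambda>s. snd C (\<gamma> s) i)) differentiable (at t)) \<and>
        ((\<lambda>s. snd C (\<gamma> s) i) has_real_derivative (if i \<in> J then \<Sum>b\<in>I. v b * (pd b (\<lambda>x. \<alpha> x i) x0 - pd b (\<lambda>x. \<beta> x i) x0) else 0)) (at 0))"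
    proof (rule exI[of _ e], rule conjI[OF e(1)], rule exI[of _ \<gamma>], intro conjI ballI allI)
      show "\<gamma> 0 = r" by (rule g0)
      show "\<gamma> t \<in> R \<inter> fst C" if "t \<in> {-e<..<e}" for t using pt[OF e(2)[OF that]] by (simp add: \<gamma>_def)
      fix i assume i: "i \<in> J"
      show "((deriv ^^ k) (\<lambda>s. snd C (\<gamma> s) i)) differentiable (at t)" if "t \<in> {-e<..<e}" for t k
        unfolding \<gamma>_def by (rule line_smooth(2)[OF I o3 sF[OF i] e(2) that])
      have "((\<lambda>s. ?s (w (line_at x0 v s)) i) has_real_derivative (\<Sum>b\<in>I. v b * pd b (\<lambda>x. ?s (w x) i) (line_at x0 v 0))) (at 0)"
        by (rule line_smooth(1)[OF I o3 sF[OF i] e(2) e0])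
      then show "((\<lambda>s. snd C (\<gamma> s) i) has_real_derivative (if i \<in> J then \<Sum>b\<in>I. v b * (pd b (\<lambda>x. \<alpha> x i) x0 - pd b (\<lambda>x. \<beta> x i) x0) else 0)) (at 0)"
        using i der[OF i] by (simp add: \<gamma>_def)
    qed
  qed
qed

lemma same_jet_of_agree:
  assumes at: "smooth_atlas {..<m} A" and W: "openin (atlas_topology {..<m} A) W" "z \<in> W"
    and eq: "\<forall>q\<in>W. \<phi> q = \<psi> q" and d: "z \<in> dom \<phi>"
  shows "same_jet m A n z \<phi> \<psi>"
  unfolding same_jet_def
proof (intro conjI ballI impI allI)
  show "z \<in> dom \<phi> \<inter> dom \<psi>" "\<phi> z = \<psi> z" using d eq W(2) by auto
  fix c e a bs assume c: "c \<in> A" "z \<in> fst c" and bs: "bs \<in> multi_idx m n"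
  have o: "copen {..<m} (snd c ` (W \<inter> fst c))" by (rule atlas_open_image[OF at W(1) c(1)])
  have "coord_rep c e \<phi> x a = coord_rep c e \<psi> x a" if "x \<in> snd c ` (W \<inter> fst c)" for x
    using that cinv_left[OF at c(1)] eq by (auto simp: coord_rep_def)
  then show "ipartial bs (\<lambda>x. coord_rep c e \<phi> x a) (snd c z) = ipartial bs (\<lambda>x. coord_rep c e \<psi> x a) (snd c z)"
    by (rule ipartial_cong[OF finite_lessThan o]) (use bs c(2) W(2) in \<open>auto simp: multi_idx_def\<close>)
qed

text \<open>A restriction of the identity that belongs to the pseudogroup by closure under
  quotients; in \<open>tame_field\<close> it supplies the section of identity jets.\<close>

lemma self_quotient:
  assumes "\<phi> \<in> local_diffeos m A"
  shows "(\<phi> \<circ>\<^sub>m pmap_inv \<phi>) y = (if y \<in> ran \<phi> then Some y else None)"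
proof (cases "y \<in> ran \<phi>")
  case True
  then obtain x where x: "\<phi> x = Some y" by (auto simp: ran_def)
  then have "pmap_inv \<phi> y = Some x" using pmap_inv_eq[OF assms] by blast
  then show ?thesis using x True by (simp add: map_comp_def)
qed (simp add: map_comp_def pmap_inv_def)

lemma smooth_atlas_subset: "smooth_atlas I B \<Longrightarrow> A \<subseteq> B \<Longrightarrow> smooth_atlas I A"
  unfolding smooth_atlas_def by blast

text \<open>Admissibility of a slice chart includes that the given charts form a smooth atlas. In
  this way the subbundle condition yields smooth transitions between jet coordinates.\<close>

lemma embedded_smooth_atlas:
  assumes "embedded_submanifold I A q S" "x \<in> S"
  shows "smooth_atlas I A"
proof -
  obtain c where "admissible_chart I A c" using assms unfolding embedded_submanifold_def by blast
  then show ?thesis using smooth_atlas_subset[of I "insert c A" A] by (auto simp: admissible_chart_def)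
qed

lemma sort_eqI: "mset xs = mset ys \<Longrightarrow> sort xs = sort ys" by (rule properties_for_sort) auto

lemma sort_snoc: "sort (xs @ [x]) = sort (x # xs)" by (rule sort_eqI) simp

text \<open>Applied to the jets of \<open>h\<close> and of the identity along a line with direction \<open>v\<close>, the previous lemma
  shows that the \<open>n\<close>-jet of the derivative of \<open>h - id\<close> along \<open>v\<close> solves the determining equations.\<close>

lemma tame_field:
  assumes M: "smooth_manifold {..<m} A" and LP: "lie_pseudogroup m A nstar G" and TG: "tame m A nstar G"
    and n: "nstar \<le> n" and c: "c \<in> A" and z: "z \<in> fst c" and h: "h \<in> G" "h z = Some z"
    and H: "\<forall>i<m. Ovan {..<m} (snd c z) (Suc n) (\<lambda>x. coord_rep c c h x i - x i)" and v: "v \<in> coord_space {..<m}"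
  shows "\<exists>N X. pseudogroup_vfield m A G N X \<and> z \<in> N \<and> (\<forall>a<m. Ovan {..<m} (snd c z) (Suc n)
    (\<lambda>x. X c (cinv c x) a - (\<Sum>b<m. v b * pd b (\<lambda>x. coord_rep c c h x a - x a) x)))"
proof -
  let ?I = "{..<m}" and ?x0 = "snd c z" and ?J = "djet_idx m n" and ?B = "djet_atlas m A n" and ?C = "djet_chart m A n c c"
    and ?R = "djets_of m A n G"
  note F = finite_lessThan[of m]
  have at: "smooth_atlas ?I A" using M by (simp add: smooth_manifold_def)
  have GL: "G \<subseteq> local_diffeos m A" and GC: "\<And>\<phi> \<psi>. \<phi> \<in> G \<Longrightarrow> \<psi> \<in> G \<Longrightarrow> \<phi> \<circ>\<^sub>m pmap_inv \<psi> \<in> G"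
    and SB: "smooth_subbundle m A n ?R"
    using LP n unfolding lie_pseudogroup_def by blast+
  define k where "k = h \<circ>\<^sub>m pmap_inv h"
  have hL: "h \<in> local_diffeos m A" using h(1) GL by blast
  have kG: "k \<in> G" unfolding k_def by (rule GC[OF h(1) h(1)])
  have kL: "k \<in> local_diffeos m A" using kG GL by blast
  have kq: "k y = (if y \<in> ran h then Some y else None)" for y unfolding k_def by (rule self_quotient[OF hL])
  have zr: "z \<in> ran h" using h(2) by (rule ranI)
  have kz: "k z = Some z" using kq zr by simp
  have kid: "coord_rep c c k x = x" if "x \<in> rep_dom c c k" for x
  proof -
    note q = rep_dom_cinv[OF at c z that]
    have "k (cinv c x) = Some (cinv c x)" using q(3) kq[of "cinv c x"] by (auto split: if_splits)
    then show ?thesis using q(2) by (simp add: coord_rep_def)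
  qed
  define U where "U = rep_dom c c h \<inter> rep_dom c c k"
  note Dh = cdiffeoD[OF rep_cdiffeo[OF at hL c c]] and Dk = cdiffeoD[OF rep_cdiffeo[OF at kL c c]]
  have oU: "copen ?I U" unfolding U_def using Dh(1) Dk(1) by blast
  have x0: "?x0 \<in> U" unfolding U_def
    using rep_fix(1)[where \<phi> = h, OF at c z h(2)] rep_fix(1)[where \<phi> = k, OF at c z kz] by blast
  have sh: "smooth_real_on ?I U (\<lambda>x. coord_rep c c h x a)" and sk: "smooth_real_on ?I U (\<lambda>x. coord_rep c c k x a)"
    if "a < m" for a
    using smooth_subset[OF Dh(7)] smooth_subset[OF Dk(7)] that unfolding U_def by auto
  have ranopen: "openin (atlas_topology ?I A) (ran h)" using hL by (simp add: local_diffeos_def)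
  \<comment> \<open>The determining equations are based at the jet of \<open>id_pmap A\<close>,
    whereas the section used is that of \<open>k\<close>.\<close>
  have idk: "same_jet m A n z k (id_pmap A)"
  proof (rule same_jet_of_agree[OF at ranopen zr])
    have "ran h \<subseteq> points A" using openin_subset[OF ranopen] atlas_topspace[OF at] by simp
    then show "\<forall>q\<in>ran h. k q = id_pmap A q" using kq by (auto simp: id_pmap_def)
    show "z \<in> dom k" using kz by blast
  qed
  have hk: "same_jet m A n z h k" unfolding same_jet_iff[OF at c z hL h(2) kL kz]
  proof (intro allI impI)
    fix i assume i: "i < m"
    have "\<forall>\<^sub>F x in cnh ?I ?x0. x \<in> U" by (rule cnh_copen[OF F oU x0])
    then have "\<forall>\<^sub>F x in cnh ?I ?x0. coord_rep c c h x i - x i = coord_rep c c h x i - coord_rep c c k x i"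
      by eventually_elim (simp add: kid U_def)
    then show "Ovan ?I ?x0 (Suc n) (\<lambda>x. coord_rep c c h x i - coord_rep c c k x i)" by (rule Ovan_cong) (use H i in blast)
  qed
  have hid: "same_jet m A n z h (id_pmap A)" by (rule same_jet_trans[OF hk idk])
  have jid: "djet m A n z h = djet m A n z (id_pmap A)"
    using same_jet_trans[OF hid] same_jet_trans[OF same_jet_sym[OF hid]] unfolding djet_def by blast
  obtain q where R: "embedded_submanifold ?J ?B q ?R" using SB unfolding smooth_subbundle_def by blast
  have rR: "djet m A n z h \<in> ?R" unfolding djets_of_def using h by blast
  have DA: "smooth_atlas ?J ?B" by (rule embedded_smooth_atlas[OF R rR])
  have CB: "?C \<in> ?B" by (rule djet_chart_in[OF at c z])
  let ?\<alpha> = "jcoord m c n h" and ?\<beta> = "jcoord m c n k"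
  note jd = jcoord_def[OF at c z]
  have sm: "smooth_real_on ?I U (\<lambda>x. jcoord m c n \<phi> x j)" if s: "\<And>a. a < m \<Longrightarrow> smooth_real_on ?I U (\<lambda>x. coord_rep c c \<phi> x a)"
    and j: "j \<in> ?J" for \<phi> j
  proof (cases j)
    case (Inl b)
    then show ?thesis using j by (simp add: jd)
  next
    case (Inr p)
    obtain a bs where p: "p = (a, bs)" by (cases p)
    have "a < m" "set bs \<subseteq> ?I" using j Inr p by (auto simp: djet_idx_def multi_idx_def)
    from smooth_ipartial[OF s[OF this(1)] this(2)] show ?thesis using j Inr p by (simp add: jd)
  qed
  have mem: "jcoord m c n \<phi> x \<in> snd ?C ` (?R \<inter> fst ?C)" if p: "\<phi> \<in> G" "x \<in> rep_dom c c \<phi>" for \<phi> x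
  proof -
    have pL: "\<phi> \<in> local_diffeos m A" using p(1) GL by blast
    note dc = djet_coords[OF at c z pL p(2), of n]
    have "djet m A n (cinv c x) \<phi> \<in> ?R" unfolding djets_of_def using p(1) rep_dom_cinv(3)[OF at c z p(2)] by blast
    then show ?thesis using dc by (intro image_eqI[of _ _ "djet m A n (cinv c x) \<phi>"]) auto
  qed
  have ma: "?\<alpha> x \<in> snd ?C ` (?R \<inter> fst ?C)" and mb: "?\<beta> x \<in> snd ?C ` (?R \<inter> fst ?C)" if "x \<in> U" for x
    using mem[OF h(1)] mem[OF kG] that unfolding U_def by blast+
  note fx = djet_coords_fix[OF at c z hL h(2), of n] djet_coords_fix[OF at c z kL kz, of n]
  have "djet m A n z h = djet m A n z k" using hk djet_eq_iff[OF hL kL] h(2) kz by blast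
  then have eq: "?\<alpha> ?x0 = ?\<beta> ?x0" using fx(2,4) by simp
  have base: "cinv ?C (?\<alpha> ?x0) = djet m A n z (id_pmap A)" using cinv_left[OF DA CB fx(1)] fx(2) jid by simp
  \<comment> \<open>\<open>b\<close> stands in front because the jet coordinate is differentiated
    last; commuting derivatives later move it to the inner end.\<close>
  define \<zeta> where "\<zeta> p = (if Inr p \<in> ?J then \<Sum>b<m. v b * ipartial (b # snd p) (\<lambda>x. coord_rep c c h x (fst p) - x (fst p)) ?x0 else 0)"
    for p :: "nat \<times> nat list"
  have sH: "smooth_real_on ?I U (\<lambda>x. coord_rep c c h x a - x a)" if "a < m" for a
    by (intro smooth_diff[OF F oU] sh that smooth_coord)
  \<comment> \<open>The two sections have the same base coordinates, so the difference has no
    \<open>Inl\<close> component, as \<open>inf_determining\<close> requires.\<close>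
  have co: "(if j \<in> ?J then \<Sum>b<m. v b * (pd b (\<lambda>x. ?\<alpha> x j) ?x0 - pd b (\<lambda>x. ?\<beta> x j) ?x0) else 0) = case_sum (\<lambda>b. 0) \<zeta> j" for j
  proof (cases j)
    case (Inl b)
    then show ?thesis by (simp add: jd)
  next
    case (Inr p)
    obtain a bs where p: "p = (a, bs)" by (cases p)
    show ?thesis
    proof (cases "j \<in> ?J")
      case True
      then have ab: "a < m" "set bs \<subseteq> ?I" using Inr p by (auto simp: djet_idx_def multi_idx_def)
      have "pd b (\<lambda>x. ?\<alpha> x j) ?x0 - pd b (\<lambda>x. ?\<beta> x j) ?x0 = ipartial (b # bs) (\<lambda>x. coord_rep c c h x a - x a) ?x0" if b: "b < m" for b
      proof -
        have bb: "set (b # bs) \<subseteq> ?I" using b ab(2) by simp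
        have "ipartial (b # bs) (\<lambda>x. coord_rep c c h x a - x a) ?x0
            = ipartial (b # bs) (\<lambda>x. coord_rep c c h x a - coord_rep c c k x a) ?x0"
          by (rule ipartial_cong[OF F oU _ bb x0]) (simp add: kid U_def)
        also have "\<dots> = ipartial (b # bs) (\<lambda>x. coord_rep c c h x a) ?x0 - ipartial (b # bs) (\<lambda>x. coord_rep c c k x a) ?x0"
          by (rule ipartial_diff[OF F oU sh[OF ab(1)] sk[OF ab(1)] bb x0])
        finally show ?thesis using True Inr p unfolding ipartial_Cons by (simp add: jd)
      qed
      then show ?thesis using True Inr p by (simp add: \<zeta>_def)
    next
      case False
      then show ?thesis using Inr by (simp add: \<zeta>_def)
    qed
  qed
  have "inf_determining m A G n z c \<zeta>"
    using submanifold_difference_tangent[where \<alpha> = ?\<alpha> and \<beta> = ?\<beta>, OF DA CB R F oU x0 sm[OF sh] ma sm[OF sk] mb eq v]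
    unfolding base co inf_determining_def by simp
  then obtain N X where NX: "pseudogroup_vfield m A G N X" "z \<in> N"
    "\<forall>a<m. \<forall>bs\<in>multi_idx m n. ipartial bs (\<lambda>y. X c (cinv c y) a) ?x0 = \<zeta> (a, bs)"
    using TG n c z unfolding tame_def by blast
  have vf: "vector_field_on m A N X" using NX(1) by (simp add: pseudogroup_vfield_def)
  have oN: "openin (atlas_topology ?I A) N" using vf by (simp add: vector_field_on_def)
  define V where "V = U \<inter> snd c ` (N \<inter> fst c)"
  have oV: "copen ?I V" unfolding V_def by (intro copen_Int oU atlas_open_image[OF at oN c])
  have x0V: "?x0 \<in> V" using x0 NX(2) z by (simp add: V_def)
  have sX: "smooth_real_on ?I V (\<lambda>x. X c (cinv c x) a)" if "a < m" for a
  proof -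
    have "smooth_real_on ?I (snd c ` (fst c \<inter> N)) (\<lambda>x. X c (cinv c x) a)"
      using vf c that unfolding vector_field_on_def smooth_map_on_def by blast
    then show ?thesis by (rule smooth_subset) (auto simp: V_def)
  qed
  have sHV: "smooth_real_on ?I V (\<lambda>x. coord_rep c c h x a - x a)" if "a < m" for a
    by (rule smooth_subset[OF sH[OF that]]) (auto simp: V_def)
  have "Ovan ?I ?x0 (Suc n) (\<lambda>x. X c (cinv c x) a - (\<Sum>b<m. v b * pd b (\<lambda>x. coord_rep c c h x a - x a) x))" if a: "a < m" for a
  proof -
    let ?H = "\<lambda>x. coord_rep c c h x a - x a"
    have s1: "smooth_real_on ?I V (\<lambda>x. v b * pd b ?H x)" if "b \<in> ?I" for b
      by (intro smooth_mult[OF F oV] smooth_const smooth_pd[OF sHV[OF a] that])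
    have s2: "smooth_real_on ?I V (\<lambda>x. \<Sum>b<m. v b * pd b ?H x)" by (rule smooth_sum[OF F oV s1])
    have s3: "smooth_real_on ?I V (\<lambda>x. X c (cinv c x) a - (\<Sum>b<m. v b * pd b ?H x))" by (rule smooth_diff[OF F oV sX[OF a] s2])
    show ?thesis unfolding Ovan_iff[OF F oV x0V s3]
    proof (intro allI impI)
      fix bs :: "nat list" assume "set bs \<subseteq> ?I \<and> length bs < Suc n"
      then have bs: "set bs \<subseteq> ?I" "length bs \<le> n" "set (sort bs) \<subseteq> ?I" by auto
      have mi: "sort bs \<in> multi_idx m n" by (rule multi_idx_sort[OF bs(1,2)])
      have Jm: "Inr (a, sort bs) \<in> ?J" using a mi unfolding djet_idx_def by (intro InrI) simp
      have tm: "ipartial (sort bs) (\<lambda>x. v b * pd b ?H x) ?x0 = v b * ipartial (b # sort bs) ?H ?x0" if b: "b \<in> ?I" for b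
      proof -
        have "ipartial (sort bs) (\<lambda>x. v b * pd b ?H x) ?x0 = v b * ipartial (sort bs) (pd b ?H) ?x0"
          by (rule ipartial_cmult[OF F oV smooth_pd[OF sHV[OF a] b] bs(3) x0V])
        also have "ipartial (sort bs) (pd b ?H) ?x0 = ipartial (sort bs @ [b]) ?H ?x0" by (simp only: ipartial_snoc)
        also have "\<dots> = ipartial (sort (sort bs @ [b])) ?H ?x0"
          by (rule ipartial_sort[OF F oV sHV[OF a] _ x0V, symmetric]) (use bs b in auto)
        also have "\<dots> = ipartial (b # sort bs) ?H ?x0"
          unfolding sort_snoc by (rule ipartial_sort[OF F oV sHV[OF a] _ x0V]) (use bs b in auto)
        finally show ?thesis .
      qed
      have "ipartial bs (\<lambda>x. X c (cinv c x) a - (\<Sum>b<m. v b * pd b ?H x)) ?x0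
          = ipartial (sort bs) (\<lambda>x. X c (cinv c x) a - (\<Sum>b<m. v b * pd b ?H x)) ?x0"
        by (rule ipartial_sort[OF F oV s3 bs(1) x0V, symmetric])
      also have "\<dots> = ipartial (sort bs) (\<lambda>x. X c (cinv c x) a) ?x0 - ipartial (sort bs) (\<lambda>x. \<Sum>b<m. v b * pd b ?H x) ?x0"
        by (rule ipartial_diff[OF F oV sX[OF a] s2 bs(3) x0V])
      also have "ipartial (sort bs) (\<lambda>x. \<Sum>b<m. v b * pd b ?H x) ?x0 = (\<Sum>b<m. ipartial (sort bs) (\<lambda>x. v b * pd b ?H x) ?x0)"
        by (rule ipartial_sum[OF F oV F s1 bs(3) x0V])
      also have "\<dots> = (\<Sum>b<m. v b * ipartial (b # sort bs) ?H ?x0)" by (rule sum.cong[OF refl tm])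
      also have "ipartial (sort bs) (\<lambda>x. X c (cinv c x) a) ?x0 = \<zeta> (a, sort bs)" using NX(3) a mi by blast
      finally show "ipartial bs (\<lambda>x. X c (cinv c x) a - (\<Sum>b<m. v b * pd b ?H x)) ?x0 = 0" using Jm by (simp add: \<zeta>_def)
    qed
  qed
  then show ?thesis using NX(1,2) by blast
qed

section \<open>Maps tangent to the identity, in straightened coordinates\<close>

lemma Ovan_cdiffeo:
  assumes I: "finite I" and d: "cdiffeo I V V' \<tau> \<sigma>" and x0: "x0 \<in> V" and O: "Ovan I (\<tau> x0) k F"
  shows "Ovan I x0 k (\<lambda>x. F (\<tau> x))"
proof (rule Ovan_compose[OF I I O])
  note D = cdiffeoD[OF d]
  show "Ovan I x0 1 (\<lambda>x. \<tau> x j - \<tau> x0 j)" if "j \<in> I" for j by (rule Ovan_smooth1[OF I D(1) x0 D(7)[OF that]])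
  show "\<forall>\<^sub>F x in cnh I x0. \<tau> x \<in> coord_space I"
    using cnh_copen[OF I D(1) x0] by eventually_elim (use D(3,10) in blast)
  show "filterlim \<tau> (cnh I (\<tau> x0)) (cnh I x0)" by (rule cdiffeo_filterlim[OF I d x0])
qed

lemma Ovan_sub:
  assumes I: "finite I" and K: "K \<subseteq> I" and x: "x \<in> coord_space K" and F: "Ovan I x k F"
  shows "Ovan K x k F"
proof -
  obtain C where C: "\<forall>\<^sub>F y in cnh I x. \<bar>F y\<bar> \<le> C * cdist I x y ^ k" using F unfolding Ovan_def by blast
  have "\<forall>\<^sub>F y in cnh K x. \<bar>F y\<bar> \<le> C * cdist K x y ^ k"
    using cnh_sub[OF I K x C] cnh_space[of K x] by eventually_elim (simp add: cdist_sub[OF I K x])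
  then show ?thesis unfolding Ovan_def by blast
qed

lemma cnh_sub_iff:
  assumes I: "finite I" and K: "K \<subseteq> I" and x: "x \<in> coord_space K"
  shows "eventually P (cnh K x) \<longleftrightarrow> (\<forall>\<^sub>F y in cnh I x. y \<in> coord_space K \<longrightarrow> P y)"
proof
  assume "eventually P (cnh K x)"
  then obtain e where e: "e > 0" "\<forall>y\<in>coord_space K. cdist K x y < e \<longrightarrow> P y" unfolding eventually_cnh by blast
  show "\<forall>\<^sub>F y in cnh I x. y \<in> coord_space K \<longrightarrow> P y"
    using cnh_dist[OF e(1), of I x] by eventually_elim (use e(2) cdist_sub[OF I K x] in auto)
next
  assume "\<forall>\<^sub>F y in cnh I x. y \<in> coord_space K \<longrightarrow> P y"
  from cnh_sub[OF I K x this] cnh_space[of K x] show "eventually P (cnh K x)" by eventually_elim blast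
qed

text \<open>On \<open>T\<close> the flattening map takes values in \<open>coord_space K\<close>, so
  vanishing in the variables of \<open>K\<close> alone bounds \<open>Y\<close> along
  \<open>T\<close>.\<close>

lemma slice_bound:
  assumes I: "finite I" and d: "cdiffeo I V V' \<tau> \<sigma>" and x0: "x0 \<in> V" "x0 \<in> T" and K: "K \<subseteq> I"
    and flat: "T \<inter> V = {x\<in>V. \<forall>j\<in>I-K. \<tau> x j = 0}" and J: "finite J"
    and O: "\<And>j. j \<in> J \<Longrightarrow> Ovan K (\<tau> x0) k (\<lambda>u. Y j (\<sigma> u))"
  shows "\<exists>C\<ge>0. \<forall>\<^sub>F x in cnh I x0. x \<in> T \<longrightarrow> (\<forall>j\<in>J. \<bar>Y j x\<bar> \<le> C * cdist I x0 x ^ k)"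
proof -
  note D = cdiffeoD[OF d]
  have tK: "\<tau> x \<in> coord_space K" if "x \<in> V" "x \<in> T" for x
  proof -
    have "\<tau> x \<in> coord_space I" using D(3)[OF that(1)] D(10) by blast
    moreover have "\<forall>j\<in>I-K. \<tau> x j = 0" using flat that by blast
    ultimately show ?thesis using K by (auto simp: coord_space_def)
  qed
  note uK = tK[OF x0]
  obtain C where C: "C > 0" "\<forall>\<^sub>F u in cnh K (\<tau> x0). \<forall>j\<in>J. \<bar>Y j (\<sigma> u)\<bar> \<le> C * cdist K (\<tau> x0) u ^ k"
    using Ovan_all[where F = "\<lambda>j u. Y j (\<sigma> u)", OF finite_subset[OF K I] J O] by blast
  note C2 = C(2)[unfolded cnh_sub_iff[OF I K uK]]
  obtain L where L: "L > 0" "\<forall>\<^sub>F x in cnh I x0. cdist I (\<tau> x0) (\<tau> x) \<le> L * cdist I x0 x" using cdiffeo_dist[OF I d x0(1)] .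
  have "\<forall>\<^sub>F x in cnh I x0. x \<in> T \<longrightarrow> (\<forall>j\<in>J. \<bar>Y j x\<bar> \<le> (C * L ^ k) * cdist I x0 x ^ k)"
    using cdiffeo_filterlim[OF I d x0(1), unfolded filterlim_iff, rule_format, OF C2] L(2) cnh_copen[OF I D(1) x0(1)]
  proof eventually_elim
    case (elim x)
    show ?case
    proof (intro impI ballI)
      fix j assume xT: "x \<in> T" and j: "j \<in> J"
      note t = tK[OF elim(3) xT]
      have "\<bar>Y j x\<bar> \<le> C * cdist I (\<tau> x0) (\<tau> x) ^ k"
        using elim(1) t j D(4)[OF elim(3)] cdist_sub[OF I K uK t] by fastforce
      also have "\<dots> \<le> C * (L * cdist I x0 x) ^ k" using elim(2) C(1) I by (intro mult_left_mono power_mono) auto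
      finally show "\<bar>Y j x\<bar> \<le> (C * L ^ k) * cdist I x0 x ^ k" by (simp add: power_mult_distrib mult.assoc)
    qed
  qed
  moreover have "C * L ^ k \<ge> 0" using C(1) L(1) by simp
  ultimately show ?thesis by blast
qed

context
  fixes I :: "'i set" and V V' \<tau> \<sigma> x0 U \<psi> and n :: nat
  assumes I: "finite I" and d: "cdiffeo I V V' \<tau> \<sigma>" and x0: "x0 \<in> V" and U: "copen I U" "x0 \<in> U"
    and s\<psi>: "\<forall>i\<in>I. smooth_real_on I U (\<lambda>x. \<psi> x i)" and c\<psi>: "\<psi> ` U \<subseteq> coord_space I" and f\<psi>: "\<psi> x0 = x0"
    and H: "\<forall>i\<in>I. Ovan I x0 (Suc n) (\<lambda>x. \<psi> x i - x i)"
begin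

text \<open>The domain of \<open>\<psi>\<close> read in straightened coordinates: after
  \<open>\<sigma>\<close> the map \<open>\<psi>\<close> must be defined, and its value must lie
  where \<open>\<tau>\<close> is.\<close>

definition conj_dom :: "('i \<Rightarrow> real) set" where
  "conj_dom = {u\<in>{u\<in>V'. \<sigma> u \<in> U}. \<psi> (\<sigma> u) \<in> V}"

lemma conj_dom:
  shows "copen I conj_dom" "\<tau> x0 \<in> conj_dom" "conj_dom \<subseteq> V'" "\<sigma> ` conj_dom \<subseteq> U" "\<sigma> ` conj_dom \<subseteq> V"
    "(\<lambda>u. \<psi> (\<sigma> u)) ` conj_dom \<subseteq> V" "\<sigma> (\<tau> x0) = x0"
proof -
  note D = cdiffeoD[OF d]
  have sc: "\<sigma> ` V' \<subseteq> coord_space I" using D(5,9) by blast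
  have o1: "copen I {u\<in>V'. \<sigma> u \<in> U}" by (rule copen_preimage[OF I I D(2) U(1) smooth_continuous[OF D(8)] sc])
  have "smooth_real_on I {u\<in>V'. \<sigma> u \<in> U} (\<lambda>u. \<psi> (\<sigma> u) i)" if i: "i \<in> I" for i
  proof (rule smooth_comp[where g = \<sigma> and F = "\<lambda>x. \<psi> x i", OF I o1 I U(1)])
    show "smooth_real_on I U (\<lambda>x. \<psi> x i)" using s\<psi> i by blast
    show "smooth_real_on I {u\<in>V'. \<sigma> u \<in> U} (\<lambda>x. \<sigma> x j)" if "j \<in> I" for j
      by (rule smooth_subset[OF D(8)[OF that]]) auto
  qed auto
  then have 1: "copen I conj_dom" unfolding conj_dom_def by (intro copen_preimage[OF I I o1 D(1)] smooth_continuous) (use c\<psi> in auto)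
  have 2: "\<sigma> (\<tau> x0) = x0" by (rule D(4)[OF x0])
  then have 3: "\<tau> x0 \<in> conj_dom" using D(3)[OF x0] x0 U(2) f\<psi> by (simp add: conj_dom_def)
  have 4: "conj_dom \<subseteq> V'" "\<sigma> ` conj_dom \<subseteq> U" "\<sigma> ` conj_dom \<subseteq> V" "(\<lambda>u. \<psi> (\<sigma> u)) ` conj_dom \<subseteq> V"
    using D(5) by (auto simp: conj_dom_def)
  from 1 3 4 2 show "copen I conj_dom" "\<tau> x0 \<in> conj_dom" "conj_dom \<subseteq> V'" "\<sigma> ` conj_dom \<subseteq> U" "\<sigma> ` conj_dom \<subseteq> V"
    "(\<lambda>u. \<psi> (\<sigma> u)) ` conj_dom \<subseteq> V" "\<sigma> (\<tau> x0) = x0" by this+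
qed

lemma sigma_conj_smooth: "j \<in> I \<Longrightarrow> smooth_real_on I conj_dom (\<lambda>u. \<sigma> u j)"
  by (rule smooth_subset[OF cdiffeoD(8)[OF d] conj_dom(3)])

lemma psi_sigma_smooth: "j \<in> I \<Longrightarrow> smooth_real_on I conj_dom (\<lambda>u. \<psi> (\<sigma> u) j)"
  by (rule smooth_comp[OF I conj_dom(1) I U(1) conj_dom(4)]) (use s\<psi> sigma_conj_smooth in auto)

lemma conj_smooth: "l \<in> I \<Longrightarrow> smooth_real_on I conj_dom (\<lambda>u. \<tau> (\<psi> (\<sigma> u)) l - u l)"
  by (intro smooth_diff[OF I conj_dom(1)] smooth_coord
      smooth_comp[OF I conj_dom(1) I cdiffeoD(1)[OF d] conj_dom(6) cdiffeoD(7)[OF d]] psi_sigma_smooth)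

lemma sigma_lim: "filterlim \<sigma> (cnh I x0) (cnh I (\<tau> x0))"
  using cdiffeo_filterlim[OF I cdiffeo_sym[OF d] cdiffeoD(3)[OF d x0]] conj_dom(7) by simp

lemma psi_sigma_lim: "filterlim (\<lambda>u. \<psi> (\<sigma> u)) (cnh I x0) (cnh I (\<tau> x0))"
proof (rule filterlim_compose[OF _ sigma_lim])
  show "filterlim \<psi> (cnh I x0) (cnh I x0)"
    using smooth_map_filterlim[where \<tau> = \<psi>, OF I U(1) I U(2)] s\<psi> c\<psi> f\<psi> by (simp add: image_subset_iff)
qed

lemma Ovan_sigma: "Ovan I x0 k F \<Longrightarrow> Ovan I (\<tau> x0) k (\<lambda>u. F (\<sigma> u))"
  by (rule Ovan_cdiffeo[OF I cdiffeo_sym[OF d] cdiffeoD(3)[OF d x0]]) (simp add: conj_dom(7))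

lemma Ovan_outer:
  assumes F: "smooth_real_on I V F"
  shows "Ovan I (\<tau> x0) (Suc n) (\<lambda>u. F (\<psi> (\<sigma> u)) - F (\<sigma> u))"
proof (rule Ovan_comp_diff[where g = "\<lambda>u. \<psi> (\<sigma> u)" and h = \<sigma>, OF I I cdiffeoD(1)[OF d] F x0 psi_sigma_lim sigma_lim])
  fix j assume "j \<in> I"
  with H have "Ovan I x0 (Suc n) (\<lambda>x. \<psi> x j - x j)" by blast
  from Ovan_sigma[OF this] show "Ovan I (\<tau> x0) (Suc n) (\<lambda>u. \<psi> (\<sigma> u) j - \<sigma> u j)" .
qed

lemma conj_Ovan:
  assumes l: "l \<in> I"
  shows "Ovan I (\<tau> x0) (Suc n) (\<lambda>u. \<tau> (\<psi> (\<sigma> u)) l - u l)"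
proof (rule Ovan_cong[OF _ Ovan_outer[OF cdiffeoD(7)[OF d l]]])
  show "\<forall>\<^sub>F u in cnh I (\<tau> x0). \<tau> (\<psi> (\<sigma> u)) l - \<tau> (\<sigma> u) l = \<tau> (\<psi> (\<sigma> u)) l - u l"
    using cnh_copen[OF I cdiffeoD(2)[OF d] cdiffeoD(3)[OF d x0]] by eventually_elim (simp add: cdiffeoD(6)[OF d])
qed

text \<open>The derivative of the conjugated h - id in a straightened direction is, up to order n +
  1, the Jacobian of \<open>\<tau>\<close> applied to the derivative of \<open>\<psi>\<close> - id
  along a constant vector, the form in which \<open>tame_field\<close> provides fields. The vector
  is frozen at the base point: the O(r) error multiplies a derivative that is O(r^n).\<close>

lemma conj_pd:
  assumes i: "i \<in> I" and l: "l \<in> I"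
  shows "Ovan I (\<tau> x0) (Suc n) (\<lambda>u. pd i (\<lambda>u. \<tau> (\<psi> (\<sigma> u)) l - u l) u -
    (\<Sum>b\<in>I. pd b (\<lambda>x. \<tau> x l) (\<sigma> u) * (\<Sum>a\<in>I. pd i (\<lambda>u. \<sigma> u a) (\<tau> x0) * pd a (\<lambda>x. \<psi> x b - x b) (\<sigma> u))))"
proof -
  note D = cdiffeoD[OF d] and W = conj_dom(1)
  let ?u0 = "\<tau> x0"
  let ?T = "\<lambda>b x. pd b (\<lambda>x. \<tau> x l) x" and ?S = "\<lambda>b u. pd i (\<lambda>u. \<sigma> u b) u"
    and ?P = "\<lambda>b u. pd i (\<lambda>u. \<psi> (\<sigma> u) b) u" and ?H = "\<lambda>a b x. pd a (\<lambda>x. \<psi> x b - x b) x"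
  have sH: "smooth_real_on I U (\<lambda>x. \<psi> x b - x b)" if "b \<in> I" for b
    by (intro smooth_diff[OF I U(1)] smooth_coord) (use s\<psi> that in blast)
  have P: "?P b u = (\<Sum>a\<in>I. ?H a b (\<sigma> u) * ?S a u) + ?S b u" if b: "b \<in> I" and u: "u \<in> conj_dom" for b u
  proof -
    have sc: "smooth_real_on I conj_dom (\<lambda>u. \<psi> (\<sigma> u) b - \<sigma> u b)"
      by (intro smooth_diff[OF I W] psi_sigma_smooth sigma_conj_smooth b)
    have "?P b u = pd i (\<lambda>u. (\<psi> (\<sigma> u) b - \<sigma> u b) + \<sigma> u b) u" by simp
    also have "\<dots> = pd i (\<lambda>u. \<psi> (\<sigma> u) b - \<sigma> u b) u + ?S b u"
      by (rule pd_add[OF I W smooth_pdiff[OF sc] smooth_pdiff[OF sigma_conj_smooth[OF b]] i u])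
    also have "pd i (\<lambda>u. \<psi> (\<sigma> u) b - \<sigma> u b) u = (\<Sum>a\<in>I. ?H a b (\<sigma> u) * ?S a u)"
      by (rule pd_comp_smooth[OF I W I U(1) sH[OF b] sigma_conj_smooth conj_dom(4) i u])
    finally show ?thesis .
  qed
  have E: "pd i (\<lambda>u. \<tau> (\<psi> (\<sigma> u)) l - u l) u = (\<Sum>b\<in>I. ?T b (\<psi> (\<sigma> u)) * ?P b u) - (\<Sum>b\<in>I. ?T b (\<sigma> u) * ?S b u)"
    if u: "u \<in> conj_dom" for u
  proof -
    have s1: "smooth_real_on I conj_dom (\<lambda>u. \<tau> (\<psi> (\<sigma> u)) l)"
      by (rule smooth_comp[OF I W I D(1) conj_dom(6) D(7)[OF l] psi_sigma_smooth])
    have 1: "pd i (\<lambda>u. \<tau> (\<psi> (\<sigma> u)) l - u l) u = pd i (\<lambda>u. \<tau> (\<psi> (\<sigma> u)) l) u - pd i (\<lambda>u. u l) u"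
      by (rule pd_diff[OF I W smooth_pdiff[OF s1] smooth_pdiff[OF smooth_coord] i u])
    have 2: "pd i (\<lambda>u. \<tau> (\<psi> (\<sigma> u)) l) u = (\<Sum>b\<in>I. ?T b (\<psi> (\<sigma> u)) * ?P b u)"
      by (rule pd_comp_smooth[OF I W I D(1) D(7)[OF l] psi_sigma_smooth conj_dom(6) i u])
    have 3: "pd i (\<lambda>u. u l) u = pd i (\<lambda>u. \<tau> (\<sigma> u) l) u"
      by (rule pd_cong(1)[OF I W i _ u]) (use D(6) conj_dom(3) in auto)
    have 4: "pd i (\<lambda>u. \<tau> (\<sigma> u) l) u = (\<Sum>b\<in>I. ?T b (\<sigma> u) * ?S b u)"
      by (rule pd_comp_smooth[OF I W I D(1) D(7)[OF l] sigma_conj_smooth conj_dom(5) i u])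
    show ?thesis unfolding 1 2 3 4 ..
  qed
  \<comment> \<open>The two errors: evaluating the Jacobian of \<open>\<tau>\<close> at
    \<open>\<sigma> u\<close> instead of \<open>\<psi> (\<sigma> u)\<close>, and freezing that of
    \<open>\<sigma>\<close> at \<open>?u0\<close>.\<close>
  let ?R = "\<lambda>u. (\<Sum>b\<in>I. (?T b (\<psi> (\<sigma> u)) - ?T b (\<sigma> u)) * ?P b u) +
    (\<Sum>b\<in>I. ?T b (\<sigma> u) * (\<Sum>a\<in>I. (?S a u - ?S a ?u0) * ?H a b (\<sigma> u)))"
  have R: "Ovan I ?u0 (Suc n) ?R"
  proof (intro Ovan_add[OF I] Ovan_sum[OF I])
    fix b assume b: "b \<in> I"
    note sT = smooth_pd[OF D(7)[OF l] b]
    have "Ovan I ?u0 0 (?P b)" by (rule Ovan_smooth0[OF I W smooth_pd[OF psi_sigma_smooth[OF b] i] conj_dom(2)])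
    from Ovan_mult[OF I Ovan_outer[OF sT] this]
    show "Ovan I ?u0 (Suc n) (\<lambda>u. (?T b (\<psi> (\<sigma> u)) - ?T b (\<sigma> u)) * ?P b u)" by simp
    have "Ovan I ?u0 (Suc n) (\<lambda>u. (?S a u - ?S a ?u0) * ?H a b (\<sigma> u))" if a: "a \<in> I" for a
    proof -
      have 1: "Ovan I ?u0 1 (\<lambda>u. ?S a u - ?S a ?u0)"
        by (rule Ovan_smooth1[OF I W conj_dom(2) smooth_pd[OF sigma_conj_smooth[OF a] i]])
      have "Ovan I x0 (Suc n) (\<lambda>x. \<psi> x b - x b)" using H b by blast
      from Ovan_sigma[OF Ovan_pd[OF I U sH[OF b] this a]]
      have "Ovan I ?u0 n (\<lambda>u. ?H a b (\<sigma> u))" .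
      from Ovan_mult[OF I 1 this] show ?thesis by simp
    qed
    then have "Ovan I ?u0 (Suc n) (\<lambda>u. \<Sum>a\<in>I. (?S a u - ?S a ?u0) * ?H a b (\<sigma> u))" by (rule Ovan_sum[OF I])
    from Ovan_mult[OF I Ovan_sigma[OF Ovan_smooth0[OF I D(1) sT x0]] this]
    show "Ovan I ?u0 (Suc n) (\<lambda>u. ?T b (\<sigma> u) * (\<Sum>a\<in>I. (?S a u - ?S a ?u0) * ?H a b (\<sigma> u)))" by simp
  qed
  show ?thesis
  proof (rule Ovan_cong[OF _ R])
    show "\<forall>\<^sub>F u in cnh I ?u0. ?R u = pd i (\<lambda>u. \<tau> (\<psi> (\<sigma> u)) l - u l) u -
      (\<Sum>b\<in>I. ?T b (\<sigma> u) * (\<Sum>a\<in>I. ?S a ?u0 * ?H a b (\<sigma> u)))"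
      using cnh_copen[OF I conj_dom(1,2)]
    proof eventually_elim
      case (elim u)
      have "(?T b (\<psi> (\<sigma> u)) - ?T b (\<sigma> u)) * ?P b u + ?T b (\<sigma> u) * (\<Sum>a\<in>I. (?S a u - ?S a ?u0) * ?H a b (\<sigma> u)) =
        ?T b (\<psi> (\<sigma> u)) * ?P b u - ?T b (\<sigma> u) * ?S b u - ?T b (\<sigma> u) * (\<Sum>a\<in>I. ?S a ?u0 * ?H a b (\<sigma> u))" if b: "b \<in> I" for b
      proof -
        have 1: "(\<Sum>a\<in>I. (?S a u - ?S a ?u0) * ?H a b (\<sigma> u)) = (?P b u - ?S b u) - (\<Sum>a\<in>I. ?S a ?u0 * ?H a b (\<sigma> u))"
          unfolding P[OF b elim] by (simp add: sum_subtractf[symmetric] algebra_simps)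
        show ?thesis unfolding 1 by (simp add: algebra_simps)
      qed
      then show ?case unfolding E[OF elim] by (simp add: sum.distrib[symmetric] sum_subtractf[symmetric] cong: sum.cong)
    qed
  qed
qed

lemma conj_back:
  assumes O: "\<And>l. l \<in> I \<Longrightarrow> Ovan I (\<tau> x0) k (\<lambda>u. \<tau> (\<psi> (\<sigma> u)) l - u l)" and a: "a \<in> I"
  shows "Ovan I x0 k (\<lambda>x. \<psi> x a - x a)"
proof -
  note D = cdiffeoD[OF d]
  have flp: "filterlim \<psi> (cnh I x0) (cnh I x0)"
    using smooth_map_filterlim[where \<tau> = \<psi>, OF I U(1) I U(2)] s\<psi> c\<psi> f\<psi> by (simp add: image_subset_iff)
  note flt = cdiffeo_filterlim[OF I d x0]
  have ev: "\<forall>\<^sub>F x in cnh I x0. x \<in> V \<and> \<psi> x \<in> V"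
    using cnh_copen[OF I D(1) x0] flp[unfolded filterlim_iff, rule_format, OF cnh_copen[OF I D(1) x0]] by eventually_elim blast
  have O2: "Ovan I x0 k (\<lambda>x. \<tau> (\<psi> x) l - \<tau> x l)" if l: "l \<in> I" for l
  proof (rule Ovan_cong[OF _ Ovan_cdiffeo[OF I d x0 O[OF l]]])
    show "\<forall>\<^sub>F x in cnh I x0. \<tau> (\<psi> (\<sigma> (\<tau> x))) l - \<tau> x l = \<tau> (\<psi> x) l - \<tau> x l"
      using ev by eventually_elim (simp add: D(4))
  qed
  have "Ovan I x0 k (\<lambda>x. \<sigma> (\<tau> (\<psi> x)) a - \<sigma> (\<tau> x) a)"
    by (rule Ovan_comp_diff[where g = "\<lambda>x. \<tau> (\<psi> x)" and h = \<tau>, OF I I D(2) D(8)[OF a] D(3)[OF x0] filterlim_compose[OF flt flp] flt O2])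
  then show ?thesis by (rule Ovan_cong[rotated]) (use ev in eventually_elim, simp add: D(4))
qed

end

section \<open>Passing to the next order\<close>

lemma copen_Int_sub:
  assumes "copen I W" "K \<subseteq> I"
  shows "copen K (W \<inter> coord_space K)"
proof -
  obtain Q where Q: "open Q" "W = coord_space I \<inter> Q" using assms(1) unfolding openin_open by blast
  then have "W \<inter> coord_space K = coord_space K \<inter> Q" using coord_space_mono[OF assms(2)] by blast
  then show ?thesis using Q(1) by (simp add: openin_open_Int)
qed

lemma lie_pseudogroup_atlas:
  assumes LP: "lie_pseudogroup m A nstar G" and n: "nstar \<le> n" and z: "z \<in> points A"
  shows "smooth_atlas (djet_idx m n) (djet_atlas m A n)"
proof -
  have SB: "smooth_subbundle m A n (djets_of m A n G)" using LP n unfolding lie_pseudogroup_def by blast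
  obtain q where q: "embedded_submanifold (djet_idx m n) (djet_atlas m A n) q (djets_of m A n G)"
    using SB[unfolded smooth_subbundle_def, THEN conjunct1] by (rule exE)
  have "djet_source ` djets_of m A n G = points A" by (rule SB[unfolded smooth_subbundle_def, THEN conjunct2, THEN conjunct1])
  then obtain r where "r \<in> djets_of m A n G" using z by blast
  from embedded_smooth_atlas[OF q this] show ?thesis .
qed

text \<open>In coordinates flattening \<open>S\<close> the hypothesis on \<open>pimage h S\<close>
  says that the transverse components of h - id vanish to order n + 2 along \<open>S\<close>; this
  is the input for the tangential directions, and the transverse directions follow from
  them.\<close>

lemma next_order_identity:
  assumes M: "smooth_manifold {..<m} A" and LP: "lie_pseudogroup m A nstar G" and TG: "tame m A nstar G"
    and n: "nstar \<le> n" and S: "embedded_submanifold {..<m} A p S" "z \<in> S" and c: "c \<in> A" and z: "z \<in> fst c"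
    and LF: "locally_free_at m A G p n (sjet m A p n z S)" and h: "h \<in> G" "h z = Some z"
    and H: "\<forall>i<m. Ovan {..<m} (snd c z) (Suc n) (\<lambda>x. coord_rep c c h x i - x i)"
    and nr: "near {..<m} (snd c z) (Suc (Suc n)) (cimg c (pimage h S)) (cimg c S)"
  shows "\<forall>i<m. Ovan {..<m} (snd c z) (Suc (Suc n)) (\<lambda>x. coord_rep c c h x i - x i)"
proof -
  let ?I = "{..<m}" and ?x0 = "snd c z"
  note F = finite_lessThan[of m]
  have at: "smooth_atlas ?I A" using M by (simp add: smooth_manifold_def)
  have GL: "G \<subseteq> local_diffeos m A" and n1: "1 \<le> n" using LP n by (auto simp: lie_pseudogroup_def)
  have zA: "z \<in> points A" unfolding points_def using c z by blast
  note DA = lie_pseudogroup_atlas[OF LP n zA]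
  obtain e K where e: "admissible_chart ?I A e" "z \<in> fst e" "K \<subseteq> ?I" "card K = p"
    "cimg c S \<inter> snd c ` (fst c \<inter> fst e) = {x \<in> snd c ` (fst c \<inter> fst e). \<forall>i\<in>?I-K. snd e (cinv c x) i = 0}"
    by (rule embedded_slice[OF at c z S])
  note K = e(3) and flat = e(5)
  let ?V = "snd c ` (fst c \<inter> fst e)" and ?V' = "snd e ` (fst c \<inter> fst e)"
  let ?\<tau> = "\<lambda>x. snd e (cinv c x)" and ?\<sigma> = "\<lambda>y. snd c (cinv e y)"
  let ?u0 = "?\<tau> ?x0"
  note d = admissible_transition[OF at c z e(1)]
  note D = cdiffeoD[OF d]
  have x0V: "?x0 \<in> ?V" using z e(2) by blast
  have x0S: "?x0 \<in> cimg c S" using S(2) z by (simp add: cimg_def)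
  have x0c: "?x0 \<in> coord_space ?I" by (rule chart_coord[OF at c z])
  have finK: "finite K" using finite_subset[OF K F] .
  let ?\<psi> = "coord_rep c c h" and ?U = "rep_dom c c h"
  have hL: "h \<in> local_diffeos m A" using h(1) GL by blast
  note dh = rep_cdiffeo[OF at hL c c]
  note Dh = cdiffeoD[OF dh]
  have x0U: "?x0 \<in> ?U" and fpsi: "?\<psi> ?x0 = ?x0" using rep_fix[where \<phi> = h, OF at c z h(2)] by auto
  have spsi: "\<forall>i\<in>?I. smooth_real_on ?I ?U (\<lambda>x. ?\<psi> x i)" using Dh(7) by blast
  have cpsi: "?\<psi> ` ?U \<subseteq> coord_space ?I" using Dh(3,10) by blast
  have H': "\<forall>i\<in>?I. Ovan ?I ?x0 (Suc n) (\<lambda>x. ?\<psi> x i - x i)" using H by simp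
  note conj_facts = conj_dom[OF F d x0V Dh(1) x0U spsi cpsi fpsi H']
    and cs = conj_smooth[OF F d x0V Dh(1) x0U spsi cpsi fpsi H']
    and cO = conj_Ovan[OF F d x0V Dh(1) x0U spsi cpsi fpsi H']
    and cpd = conj_pd[OF F d x0V Dh(1) x0U spsi cpsi fpsi H']
    and cback = conj_back[OF F d x0V Dh(1) x0U spsi cpsi fpsi H']
    and slim = sigma_lim[OF F d x0V Dh(1) x0U spsi cpsi fpsi H']
    and pslim = psi_sigma_lim[OF F d x0V Dh(1) x0U spsi cpsi fpsi H']
    and Osig = Ovan_sigma[OF F d x0V Dh(1) x0U spsi cpsi fpsi H']
  define E where "E l = (\<lambda>u. ?\<tau> (?\<psi> (?\<sigma> u)) l - u l)" for l
  obtain W where W: "copen ?I W" "?u0 \<in> W" "\<forall>l\<in>?I. smooth_real_on ?I W (E l)"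
    using conj_facts(1,2) cs unfolding E_def by blast
  have EO: "Ovan ?I ?u0 (Suc n) (E l)" if "l \<in> ?I" for l using cO[OF that] unfolding E_def .
  have uV: "?u0 \<in> ?V'" by (rule D(3)[OF x0V])
  have uK: "?u0 \<in> coord_space K"
  proof -
    have "?u0 \<in> coord_space ?I" using uV D(10) by blast
    moreover have "\<forall>j\<in>?I-K. ?u0 j = 0" using flat x0V x0S by blast
    ultimately show ?thesis unfolding coord_space_def by blast
  qed
  have su: "?\<sigma> ?u0 = ?x0" by (rule D(4)[OF x0V])
  define WK where "WK = W \<inter> coord_space K"
  have WK: "copen K WK" "?u0 \<in> WK" unfolding WK_def using copen_Int_sub[OF W(1) K] W(2) uK by auto
  have toK: "smooth_real_on K WK Q" if "smooth_real_on ?I W Q" for Q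
    by (rule smooth_subset[OF smooth_fewer_coords[OF that K]]) (simp add: WK_def)
  \<comment> \<open>On \<open>coord_space K\<close> the coordinate \<open>u j\<close> is 0, so
    \<open>E j u\<close> is the transverse coordinate of the image of a point of \<open>S\<close>,
    which \<open>near_flat\<close> estimates.\<close>
  have EK: "Ovan K ?u0 (Suc (Suc n)) (E j)" if j: "j \<in> ?I - K" for j
  proof -
    have k1: "1 \<le> Suc (Suc n)" by simp
    obtain C where C: "C > 0" "\<forall>\<^sub>F x in cnh ?I ?x0. x \<in> cimg c (pimage h S) \<longrightarrow>
      (\<forall>j\<in>?I-K. \<bar>?\<tau> x j\<bar> \<le> C * cdist ?I ?x0 x ^ Suc (Suc n))"
      by (rule near_flat[OF F d x0V k1 nr cimg_coord[OF at c z] flat])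
    obtain L1 where L1: "L1 > 0" "\<forall>\<^sub>F x in cnh ?I ?x0. cdist ?I (?\<psi> ?x0) (?\<psi> x) \<le> L1 * cdist ?I ?x0 x"
      by (rule cdiffeo_dist[OF F dh x0U])
    obtain L2 where L2: "L2 > 0" "\<forall>\<^sub>F u in cnh ?I ?u0. cdist ?I (?\<sigma> ?u0) (?\<sigma> u) \<le> L2 * cdist ?I ?u0 u"
      by (rule cdiffeo_dist[OF F cdiffeo_sym[OF d] uV])
    have "\<forall>\<^sub>F u in cnh ?I ?u0. u \<in> coord_space K \<longrightarrow>
      \<bar>E j u\<bar> \<le> (C * (L1 * L2) ^ Suc (Suc n)) * cdist K ?u0 u ^ Suc (Suc n)"
      using pslim[unfolded filterlim_iff, rule_format, OF C(2)] slim[unfolded filterlim_iff, rule_format, OF L1(2)]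
        L2(2) cnh_copen[OF F D(2) uV] slim[unfolded filterlim_iff, rule_format, OF cnh_copen[OF F Dh(1) x0U]]
    proof eventually_elim
      case (elim u)
      show ?case
      proof
        assume u: "u \<in> coord_space K"
        have ts: "?\<tau> (?\<sigma> u) = u" by (rule D(6)[OF elim(4)])
        have "\<forall>j\<in>?I-K. ?\<tau> (?\<sigma> u) j = 0" unfolding ts using u by (auto simp: coord_space_def)
        then have "?\<sigma> u \<in> cimg c S" using D(5)[OF elim(4)] flat by blast
        then have "?\<psi> (?\<sigma> u) \<in> cimg c (pimage h S)" using elim(5) cimg_pimage[OF at c z hL, of S] by blast
        then have "\<bar>?\<tau> (?\<psi> (?\<sigma> u)) j\<bar> \<le> C * cdist ?I ?x0 (?\<psi> (?\<sigma> u)) ^ Suc (Suc n)" using elim(1) j by blast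
        also have "\<dots> \<le> C * ((L1 * L2) * cdist ?I ?u0 u) ^ Suc (Suc n)"
        proof (intro mult_left_mono power_mono)
          have "cdist ?I ?x0 (?\<psi> (?\<sigma> u)) \<le> L1 * cdist ?I ?x0 (?\<sigma> u)" using elim(2) fpsi by simp
          also have "\<dots> \<le> L1 * (L2 * cdist ?I ?u0 u)" using elim(3) L1(1) su by simp
          finally show "cdist ?I ?x0 (?\<psi> (?\<sigma> u)) \<le> (L1 * L2) * cdist ?I ?u0 u" by (simp add: mult.assoc)
        qed (use C(1) in auto)
        also have "cdist ?I ?u0 u = cdist K ?u0 u" by (rule cdist_sub[OF F K uK u])
        finally have "\<bar>?\<tau> (?\<psi> (?\<sigma> u)) j\<bar> \<le> (C * (L1 * L2) ^ Suc (Suc n)) * cdist K ?u0 u ^ Suc (Suc n)"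
          by (simp only: power_mult_distrib mult.assoc)
        moreover have "u j = 0" using u j by (simp add: coord_space_def)
        ultimately show "\<bar>E j u\<bar> \<le> (C * (L1 * L2) ^ Suc (Suc n)) * cdist K ?u0 u ^ Suc (Suc n)" by (simp add: E_def)
      qed
    qed
    then show ?thesis unfolding Ovan_def cnh_sub_iff[OF F K uK] by blast
  qed
  \<comment> \<open>A pseudogroup field with the \<open>n\<close>-jet of the \<open>i\<close>-th derivative of \<open>h - id\<close> is tangent to \<open>S\<close> to order
    \<open>n\<close>, so its flow fixes the jet of \<open>S\<close> and local freeness annihilates the \<open>n\<close>-jet of the field.\<close>
  have rigid: "Ovan ?I ?u0 (Suc n) (pd i (E l))"
    if i: "i \<in> ?I" and flatE: "\<And>j. j \<in> ?I - K \<Longrightarrow> Ovan K ?u0 (Suc n) (pd i (E j))" and l: "l \<in> ?I" for i l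
  proof -
    \<comment> \<open>The \<open>i\<close>-th straightened coordinate direction at the base point,
      expressed in the chart \<open>c\<close>.\<close>
    define v where "v b = (if b < m then pd i (\<lambda>u. ?\<sigma> u b) ?u0 else 0)" for b
    have vc: "v \<in> coord_space ?I" by (simp add: v_def coord_space_def)
    obtain N X where NX: "pseudogroup_vfield m A G N X" "z \<in> N" "\<forall>a<m. Ovan ?I ?x0 (Suc n)
      (\<lambda>x. X c (cinv c x) a - (\<Sum>b<m. v b * pd b (\<lambda>x. ?\<psi> x a - x a) x))"
      using tame_field[OF M LP TG n c z h H vc] by blast
    have vf: "vector_field_on m A N X" and FG: "flow_map m A N X t \<in> G" for t using NX(1) by (auto simp: pseudogroup_vfield_def)
    have LD: "flow_map m A N X t \<in> local_diffeos m A" for t using FG GL by blast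
    have sH: "smooth_real_on ?I ?U (\<lambda>x. ?\<psi> x a - x a)" if "a \<in> ?I" for a
      by (intro smooth_diff[OF F Dh(1)] smooth_coord) (use spsi that in blast)
    \<comment> \<open>First derivatives of h - id are O(r^n), and the field agrees with a
      combination of them to order n + 1.\<close>
    have Xn: "Ovan ?I ?x0 n (\<lambda>x. X c (cinv c x) a)" if a: "a < m" for a
    proof -
      have aI: "a \<in> ?I" using a by simp
      have "Ovan ?I ?x0 (Suc n) (\<lambda>x. ?\<psi> x a - x a)" using H a by blast
      then have "Ovan ?I ?x0 n (pd b (\<lambda>x. ?\<psi> x a - x a))" if "b \<in> ?I" for b
        using Ovan_pd[OF F Dh(1) x0U sH[OF aI] _ that] by blast
      then have "Ovan ?I ?x0 n (\<lambda>x. \<Sum>b<m. v b * pd b (\<lambda>x. ?\<psi> x a - x a) x)"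
        by (intro Ovan_sum[OF F] Ovan_cmult[OF F])
      moreover have "Ovan ?I ?x0 n (\<lambda>x. X c (cinv c x) a - (\<Sum>b<m. v b * pd b (\<lambda>x. ?\<psi> x a - x a) x))"
        by (rule Ovan_mono[OF F]) (use NX(3) a in auto)
      ultimately have "Ovan ?I ?x0 n (\<lambda>x. (X c (cinv c x) a - (\<Sum>b<m. v b * pd b (\<lambda>x. ?\<psi> x a - x a) x)) +
        (\<Sum>b<m. v b * pd b (\<lambda>x. ?\<psi> x a - x a) x))" by (intro Ovan_add[OF F])
      then show ?thesis by simp
    qed
    \<comment> \<open>As \<open>n \<ge> 1\<close>, the field vanishes at \<open>z\<close>, which all
      flow estimates presuppose.\<close>
    have X0: "\<forall>a<m. X c z a = 0"
    proof (intro allI impI)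
      fix a assume "a < m"
      from Xn[OF this] obtain C where "\<forall>\<^sub>F x in cnh ?I ?x0. \<bar>X c (cinv c x) a\<bar> \<le> C * cdist ?I ?x0 x ^ n" unfolding Ovan_def by blast
      from cnh_center[OF F x0c this] show "X c z a = 0" using n1 cinv_left[OF at c z] F by (simp add: power_0_left)
    qed
    \<comment> \<open>Component \<open>l\<close> of the field in straightened coordinates; by
      \<open>conj_pd\<close> it agrees with \<open>pd i (E l)\<close> to order n + 1.\<close>
    define Y where "Y l = (\<lambda>x. \<Sum>b<m. pd b (\<lambda>x. ?\<tau> x l) x * X c (cinv c x) b)" for l
    have YE: "Ovan ?I ?u0 (Suc n) (\<lambda>u. pd i (E l) u - Y l (?\<sigma> u))" if l: "l \<in> ?I" for l
    proof -
      let ?T = "\<lambda>b x. pd b (\<lambda>x. ?\<tau> x l) x" and ?Q = "\<lambda>b x. \<Sum>a<m. v a * pd a (\<lambda>x. ?\<psi> x b - x b) x"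
      have "Ovan ?I ?x0 (Suc n) (\<lambda>x. \<Sum>b<m. ?T b x * (X c (cinv c x) b - ?Q b x))"
      proof (rule Ovan_sum[OF F])
        fix b assume b: "b \<in> ?I"
        have "Ovan ?I ?x0 0 (?T b)" by (rule Ovan_smooth0[OF F D(1) smooth_pd[OF D(7)[OF l] b] x0V])
        moreover have "Ovan ?I ?x0 (Suc n) (\<lambda>x. X c (cinv c x) b - ?Q b x)" using NX(3) b by blast
        ultimately show "Ovan ?I ?x0 (Suc n) (\<lambda>x. ?T b x * (X c (cinv c x) b - ?Q b x))" using Ovan_mult[OF F] by fastforce
      qed
      note 1 = Osig[OF this]
      have v: "(\<Sum>a<m. pd i (\<lambda>u. ?\<sigma> u a) ?u0 * q a) = (\<Sum>a<m. v a * q a)" for q :: "nat \<Rightarrow> real"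
        by (intro sum.cong) (auto simp: v_def)
      have 2: "Ovan ?I ?u0 (Suc n) (\<lambda>u. pd i (E l) u - (\<Sum>b<m. ?T b (?\<sigma> u) * ?Q b (?\<sigma> u)))"
        using cpd[OF i l] unfolding v E_def .
      have eq: "(pd i (E l) u - (\<Sum>b<m. ?T b (?\<sigma> u) * ?Q b (?\<sigma> u))) - (\<Sum>b<m. ?T b (?\<sigma> u) * (X c (cinv c (?\<sigma> u)) b - ?Q b (?\<sigma> u)))
          = pd i (E l) u - Y l (?\<sigma> u)" for u
        unfolding Y_def by (simp add: right_diff_distrib sum_subtractf)
      from Ovan_diff[OF F 2 1] show ?thesis unfolding eq .
    qed
    have YK: "Ovan K ?u0 (Suc n) (\<lambda>u. Y j (?\<sigma> u))" if j: "j \<in> ?I - K" for j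
    proof -
      have "j \<in> ?I" using j by blast
      from Ovan_diff[OF finK flatE[OF j] Ovan_sub[OF F K uK YE[OF this]]] show ?thesis by simp
    qed
    have "\<exists>C\<ge>0. \<forall>\<^sub>F x in cnh ?I ?x0. x \<in> cimg c S \<longrightarrow> (\<forall>j\<in>?I-K. \<bar>Y j x\<bar> \<le> C * cdist ?I ?x0 x ^ Suc n)"
      by (rule slice_bound[where Y = Y, OF F d x0V x0S K flat finite_Diff[OF F]]) (rule YK)
    then obtain C where C: "0 \<le> C" "\<forall>\<^sub>F x in cnh ?I ?x0. x \<in> cimg c S \<longrightarrow> (\<forall>j\<in>?I-K. \<bar>Y j x\<bar> \<le> C * cdist ?I ?x0 x ^ Suc n)"
      by blast
    have "\<exists>T>0. \<forall>t. \<bar>t\<bar> \<le> T \<longrightarrow> flow_map m A N X t z = Some z \<and>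
      near ?I ?x0 (Suc n) (cimg c (pimage (flow_map m A N X t) S)) (cimg c S)"
      by (rule flow_near_flat[OF M c z vf NX(2) X0 LD d x0V K S(2) flat C(1) C(2)[unfolded Y_def]])
    then obtain T where T: "0 < T" "\<forall>t. \<bar>t\<bar> \<le> T \<longrightarrow> flow_map m A N X t z = Some z \<and>
      near ?I ?x0 (Suc n) (cimg c (pimage (flow_map m A N X t) S)) (cimg c S)"
      by blast
    have "\<exists>T>0. \<forall>t. \<bar>t\<bar> \<le> T \<longrightarrow> flow_map m A N X t z = Some z \<and> capprox m c z (Suc n) (pimage (flow_map m A N X t) S) S"
      by (rule flow_capprox[OF M c z vf NX(2) X0 LD _ T(1)], rule T(2)[rule_format], assumption, simp)
    then obtain T' where T': "0 < T'" "\<forall>t. \<bar>t\<bar> \<le> T' \<longrightarrow> flow_map m A N X t z = Some z \<and> capprox m c z (Suc n) (pimage (flow_map m A N X t) S) S"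
      by blast
    have fl: "flow_map m A N X t z = Some z" "capprox m c z (Suc n) (pimage (flow_map m A N X t) S) S" if "\<bar>t\<bar> \<le> T'" for t
      using T'(2) that by blast+
    have z0: "\<bar>0\<bar> \<le> T'" using T'(1) by simp
    \<comment> \<open>Discreteness is invoked at the flow map for time 0, itself an isotropy
      element, so that its neighbours are the flow maps for small times.\<close>
    have "\<exists>e>0. \<forall>\<psi>\<in>G. \<psi> z = Some z \<longrightarrow> capprox m c z (Suc n) (pimage \<psi> S) S \<longrightarrow>
        cdist (djet_idx m n) (jcoord m c n (flow_map m A N X 0) ?x0) (jcoord m c n \<psi> ?x0) < e \<longrightarrow> same_jet m A n z (flow_map m A N X 0) \<psi>"
      by (rule LF[unfolded locally_free_iff[OF at c z DA n1 S GL], rule_format, OF FG fl[OF z0]])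
    then obtain \<epsilon> where eps: "\<epsilon> > 0" "\<forall>\<psi>\<in>G. \<psi> z = Some z \<longrightarrow> capprox m c z (Suc n) (pimage \<psi> S) S \<longrightarrow>
        cdist (djet_idx m n) (jcoord m c n (flow_map m A N X 0) ?x0) (jcoord m c n \<psi> ?x0) < \<epsilon> \<longrightarrow> same_jet m A n z (flow_map m A N X 0) \<psi>"
      by blast
    have XR: "Ovan ?I ?x0 (Suc n) (\<lambda>x. X c (cinv c x) a)" if a: "a < m" for a
    proof (rule vfield_rigid[OF M c z vf NX(2) X0 LD n1 _ T'(1) eps(1) _ a])
      show "Ovan ?I ?x0 n (\<lambda>x. X c (cinv c x) i)" if "i < m" for i by (rule Xn[OF that])
      show "same_jet m A n z (flow_map m A N X 0) (flow_map m A N X t)" if "\<bar>t\<bar> \<le> T'"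
        "cdist (djet_idx m n) (jcoord m c n (flow_map m A N X 0) ?x0) (jcoord m c n (flow_map m A N X t) ?x0) < \<epsilon>" for t
        by (rule eps(2)[rule_format, OF FG fl[OF that(1)] that(2)])
    qed
    have "Ovan ?I ?x0 (Suc n) (Y l)" unfolding Y_def
    proof (rule Ovan_sum[OF F])
      fix b assume b: "b \<in> ?I"
      have "Ovan ?I ?x0 0 (pd b (\<lambda>x. ?\<tau> x l))" by (rule Ovan_smooth0[OF F D(1) smooth_pd[OF D(7)[OF l] b] x0V])
      moreover have "Ovan ?I ?x0 (Suc n) (\<lambda>x. X c (cinv c x) b)" using XR b by simp
      ultimately show "Ovan ?I ?x0 (Suc n) (\<lambda>x. pd b (\<lambda>x. ?\<tau> x l) x * X c (cinv c x) b)"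
        using Ovan_mult[OF F] by fastforce
    qed
    from Ovan_add[OF F YE[OF l] Osig[OF this]] show ?thesis by simp
  qed
  \<comment> \<open>For \<open>i\<close> in \<open>K\<close> the derivative may be taken after
    restriction to \<open>coord_space K\<close>, where \<open>EK\<close> leaves order n + 1.\<close>
  have pdK: "Ovan ?I ?u0 (Suc n) (pd i (E l))" if i: "i \<in> K" and l: "l \<in> ?I" for i l
  proof (rule rigid[OF _ _ l])
    show "i \<in> ?I" using i K by blast
    fix j assume j: "j \<in> ?I - K"
    have "smooth_real_on ?I W (E j)" using W(3) j by blast
    from Ovan_pd[OF finK WK toK[OF this] EK[OF j] i] show "Ovan K ?u0 (Suc n) (pd i (E j))" .
  qed
  \<comment> \<open>For \<open>i\<close> transverse to \<open>S\<close>, the derivatives of order \<open>n \<ge> 1\<close> along \<open>S\<close> contain a tangential one,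
    which can be performed first.\<close>
  have pdall: "Ovan ?I ?u0 (Suc n) (pd i (E l))" if i: "i \<in> ?I" and l: "l \<in> ?I" for i l
  proof (rule rigid[OF i _ l])
    fix j assume j: "j \<in> ?I - K"
    then have jI: "j \<in> ?I" by blast
    have sE: "smooth_real_on ?I W (E j)" using W(3) jI by blast
    note spE = smooth_pd[OF sE]
    show "Ovan K ?u0 (Suc n) (pd i (E j))" unfolding Ovan_iff[OF finK WK toK[OF spE[OF i]]]
    proof (intro allI impI)
      fix bs assume bs: "set bs \<subseteq> K \<and> length bs < Suc n"
      have all0: "ipartial cs (E j) ?u0 = 0" if "set cs \<subseteq> ?I" "length cs < Suc n" for cs
        using EO[OF jI] that unfolding Ovan_iff[OF F W(1,2) sE] by blast
      show "ipartial bs (pd i (E j)) ?u0 = 0"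
      proof (cases "length bs < n")
        case True
        \<comment> \<open>Together with \<open>i\<close> these are at most \<open>n\<close>
          derivatives, which vanish because h - id is O(r^(n+1)).\<close>
        then have "ipartial (bs @ [i]) (E j) ?u0 = 0" by (intro all0) (use bs K i in auto)
        then show ?thesis by (simp only: ipartial_snoc)
      next
        case False
        then have len: "length bs = n" using bs by simp
        then obtain bs' k where bk: "bs = bs' @ [k]" using n1 by (cases bs rule: rev_cases) auto
        have kK: "k \<in> K" and b': "set bs' \<subseteq> ?I" using bs bk K by auto
        have "ipartial bs (pd i (E j)) ?u0 = ipartial ((bs' @ [k]) @ [i]) (E j) ?u0" by (simp only: ipartial_snoc bk)
        also have "\<dots> = ipartial (sort ((bs' @ [k]) @ [i])) (E j) ?u0"
          by (rule ipartial_sort[OF F W(1) sE _ W(2), symmetric]) (use b' kK K i in auto)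
        also have "sort ((bs' @ [k]) @ [i]) = sort ((bs' @ [i]) @ [k])" by (rule sort_eqI) simp
        also have "ipartial (sort ((bs' @ [i]) @ [k])) (E j) ?u0 = ipartial ((bs' @ [i]) @ [k]) (E j) ?u0"
          by (rule ipartial_sort[OF F W(1) sE _ W(2)]) (use b' kK K i in auto)
        also have "\<dots> = ipartial (bs' @ [i]) (pd k (E j)) ?u0" by (simp only: ipartial_snoc)
        also have "\<dots> = 0"
        proof -
          have kI: "k \<in> ?I" using kK K by blast
          have "set (bs' @ [i]) \<subseteq> ?I \<and> length (bs' @ [i]) < Suc n" using b' i len bk by simp
          then show ?thesis using pdK[OF kK jI] unfolding Ovan_iff[OF F W(1,2) spE[OF kI]] by blast
        qed
        finally show ?thesis .
      qed
    qed
  qed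
  have "Ovan ?I ?u0 (Suc (Suc n)) (E l)" if l: "l \<in> ?I" for l
  proof (rule Ovan_Suc_pd[OF F W(1,2)])
    show "smooth_real_on ?I W (E l)" using W(3) l by blast
    show "E l ?u0 = 0" unfolding E_def su fpsi by simp
    show "Ovan ?I ?u0 (Suc n) (pd i (E l))" if "i \<in> ?I" for i by (rule pdall[OF that l])
  qed
  then show ?thesis using cback[of "Suc (Suc n)"] unfolding E_def by simp
qed

section \<open>Quotients of isotropy elements\<close>

lemma djet_idx_mono: "k \<le> n \<Longrightarrow> djet_idx m k \<subseteq> djet_idx m n" unfolding djet_idx_def multi_idx_def by auto

lemma quotient_in_coords:
  assumes at: "smooth_atlas {..<m} A" and c: "c \<in> A" and z: "z \<in> fst c" and \<phi>: "\<phi> \<in> local_diffeos m A"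
    and x: "x \<in> rep_dom c c \<phi>"
  shows "coord_rep c c (\<psi> \<circ>\<^sub>m pmap_inv \<phi>) (coord_rep c c \<phi> x) = coord_rep c c \<psi> x"
proof -
  note q = rep_dom_cinv[OF at c z x]
  obtain y where y: "\<phi> (cinv c x) = Some y" using q(3) by blast
  have "cinv c (snd c y) = y" using q(4) y cinv_left[OF at c] by simp
  moreover have "pmap_inv \<phi> y = Some (cinv c x)" using pmap_inv_eq[OF \<phi>] y by blast
  ultimately show ?thesis using y by (simp add: coord_rep_def map_comp_def)
qed

text \<open>The substitution of \<open>\<phi>\<close> of x for y turns h(y) - y into
  \<open>\<psi>\<close> - \<open>\<phi>\<close> at x, and diffeomorphisms preserve orders of
  vanishing.\<close>

lemma quotient_Ovan_iff:
  assumes at: "smooth_atlas {..<m} A" and c: "c \<in> A" and z: "z \<in> fst c" and \<phi>: "\<phi> \<in> local_diffeos m A" "\<phi> z = Some z"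
  shows "Ovan {..<m} (snd c z) k (\<lambda>y. coord_rep c c (\<psi> \<circ>\<^sub>m pmap_inv \<phi>) y i - y i) \<longleftrightarrow>
    Ovan {..<m} (snd c z) k (\<lambda>x. coord_rep c c \<phi> x i - coord_rep c c \<psi> x i)"
proof -
  let ?I = "{..<m}" and ?x0 = "snd c z" and ?h = "\<psi> \<circ>\<^sub>m pmap_inv \<phi>"
  let ?f = "coord_rep c c \<phi>" and ?g = "coord_rep c c (pmap_inv \<phi>)"
  note F = finite_lessThan[of m]
  note d = rep_cdiffeo[OF at \<phi>(1) c c]
  note D = cdiffeoD[OF d]
  have x0: "?x0 \<in> rep_dom c c \<phi>" "?f ?x0 = ?x0" using rep_fix[where \<phi> = \<phi>, OF at c z \<phi>(2)] .
  have y0: "?x0 \<in> rep_dom c c (pmap_inv \<phi>)" "?g ?x0 = ?x0"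
    using rep_fix[where \<phi> = "pmap_inv \<phi>", OF at c z pmap_inv_fix[OF at c z \<phi>]] .
  note qc = quotient_in_coords[OF at c z \<phi>(1)]
  show ?thesis
  proof
    assume "Ovan ?I ?x0 k (\<lambda>y. coord_rep c c ?h y i - y i)"
    then have "Ovan ?I (?f ?x0) k (\<lambda>y. coord_rep c c ?h y i - y i)" unfolding x0(2) .
    from Ovan_uminus[OF F Ovan_cdiffeo[OF F d x0(1) this]]
    show "Ovan ?I ?x0 k (\<lambda>x. ?f x i - coord_rep c c \<psi> x i)"
      by (rule Ovan_cong[rotated]) (use cnh_copen[OF F D(1) x0(1)] in eventually_elim, simp add: qc)
  next
    assume "Ovan ?I ?x0 k (\<lambda>x. ?f x i - coord_rep c c \<psi> x i)"
    then have "Ovan ?I (?g ?x0) k (\<lambda>x. ?f x i - coord_rep c c \<psi> x i)" unfolding y0(2) .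
    from Ovan_uminus[OF F Ovan_cdiffeo[OF F cdiffeo_sym[OF d] y0(1) this]]
    show "Ovan ?I ?x0 k (\<lambda>y. coord_rep c c ?h y i - y i)"
    proof (rule Ovan_cong[rotated])
      show "\<forall>\<^sub>F y in cnh ?I ?x0. - (?f (?g y) i - coord_rep c c \<psi> (?g y) i) = coord_rep c c ?h y i - y i"
        using cnh_copen[OF F D(2) y0(1)]
      proof eventually_elim
        case (elim y)
        have "coord_rep c c ?h y = coord_rep c c \<psi> (?g y)" using qc[OF D(5)[OF elim], of \<psi>] D(6)[OF elim] by simp
        then show ?case using D(6)[OF elim] by simp
      qed
    qed
  qed
qed

text \<open>Two isotropy elements of order \<open>n + 1\<close> with close coordinates agree to order \<open>n\<close>; their quotient
  is then the identity to order \<open>n\<close>, and hence to order \<open>n + 1\<close>.\<close>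

lemma locally_free_Suc:
  assumes M: "smooth_manifold {..<m} A" and LP: "lie_pseudogroup m A nstar G" and TG: "tame m A nstar G"
    and n: "nstar \<le> n" and S: "embedded_submanifold {..<m} A p S" "z \<in> S"
    and LF: "locally_free_at m A G p n (sjet m A p n z S)"
  shows "locally_free_at m A G p (Suc n) (sjet m A p (Suc n) z S)"
proof -
  let ?I = "{..<m}"
  note F = finite_lessThan[of m]
  have at: "smooth_atlas ?I A" using M by (simp add: smooth_manifold_def)
  have GL: "G \<subseteq> local_diffeos m A" and GC: "\<And>\<phi> \<psi>. \<phi> \<in> G \<Longrightarrow> \<psi> \<in> G \<Longrightarrow> \<phi> \<circ>\<^sub>m pmap_inv \<psi> \<in> G"
    and n1: "1 \<le> n" using LP n unfolding lie_pseudogroup_def by auto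
  have zA: "z \<in> points A" using S unfolding embedded_submanifold_def by blast
  then obtain c where c: "c \<in> A" and z: "z \<in> fst c" unfolding points_def by blast
  have n': "nstar \<le> Suc n" "1 \<le> Suc n" "1 \<le> Suc (Suc n)" using n by auto
  note DA = lie_pseudogroup_atlas[OF LP n zA] and DA' = lie_pseudogroup_atlas[OF LP n'(1) zA]
  note LF' = LF[unfolded locally_free_iff[OF at c z DA n1 S GL], rule_format]
  show ?thesis unfolding locally_free_iff[OF at c z DA' n'(2) S GL]
  proof (intro ballI impI)
    fix \<phi> assume \<phi>: "\<phi> \<in> G" "\<phi> z = Some z" and a\<phi>: "capprox m c z (Suc (Suc n)) (pimage \<phi> S) S"
    have a\<phi>': "capprox m c z (Suc n) (pimage \<phi> S) S" by (rule capprox_mono[OF at c z a\<phi>]) simp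
    have \<phi>L: "\<phi> \<in> local_diffeos m A" using \<phi>(1) GL by blast
    obtain e where e: "e > 0" "\<forall>\<psi>\<in>G. \<psi> z = Some z \<longrightarrow> capprox m c z (Suc n) (pimage \<psi> S) S \<longrightarrow>
      cdist (djet_idx m n) (jcoord m c n \<phi> (snd c z)) (jcoord m c n \<psi> (snd c z)) < e \<longrightarrow> same_jet m A n z \<phi> \<psi>"
      using LF'[OF \<phi> a\<phi>'] by (elim exE conjE)
    have "same_jet m A (Suc n) z \<phi> \<psi>"
      if \<psi>: "\<psi> \<in> G" "\<psi> z = Some z" and a\<psi>: "capprox m c z (Suc (Suc n)) (pimage \<psi> S) S"
        and cl: "cdist (djet_idx m (Suc n)) (jcoord m c (Suc n) \<phi> (snd c z)) (jcoord m c (Suc n) \<psi> (snd c z)) < e" for \<psi>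
    proof -
      have \<psi>L: "\<psi> \<in> local_diffeos m A" using \<psi>(1) GL by blast
      have a\<psi>': "capprox m c z (Suc n) (pimage \<psi> S) S" by (rule capprox_mono[OF at c z a\<psi>]) simp
      \<comment> \<open>The coordinates of order \<open>n\<close> are among those of order
        \<open>n + 1\<close>, so the radius \<open>e\<close> obtained at order \<open>n\<close>
        serves at order \<open>n + 1\<close> as well.\<close>
      have "\<bar>jcoord m c n \<phi> (snd c z) j - jcoord m c n \<psi> (snd c z) j\<bar> < e" if j: "j \<in> djet_idx m n" for j
      proof -
        have j': "j \<in> djet_idx m (Suc n)" using j djet_idx_mono[of n "Suc n" m] by auto
        have "\<bar>jcoord m c (Suc n) \<phi> (snd c z) j - jcoord m c (Suc n) \<psi> (snd c z) j\<bar> < e"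
          using cl j' unfolding cdist_less_iff[OF finite_djet_idx[OF at c z] e(1)] by blast
        then show ?thesis using j j' by (simp add: jcoord_def[OF at c z])
      qed
      then have "cdist (djet_idx m n) (jcoord m c n \<phi> (snd c z)) (jcoord m c n \<psi> (snd c z)) < e"
        unfolding cdist_less_iff[OF finite_djet_idx[OF at c z] e(1)] by blast
      then have sj: "same_jet m A n z \<phi> \<psi>" by (rule e(2)[rule_format, OF \<psi> a\<psi>'])
      let ?h = "\<psi> \<circ>\<^sub>m pmap_inv \<phi>"
      have hG: "?h \<in> G" by (rule GC[OF \<psi>(1) \<phi>(1)])
      then have hL: "?h \<in> local_diffeos m A" using GL by blast
      have hz: "?h z = Some z" using pmap_inv_fix[OF at c z \<phi>L \<phi>(2)] \<psi>(2) by (simp add: map_comp_def)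
      note qO = quotient_Ovan_iff[OF at c z \<phi>L \<phi>(2)]
      have H: "\<forall>i<m. Ovan ?I (snd c z) (Suc n) (\<lambda>x. coord_rep c c ?h x i - x i)"
        unfolding qO using sj unfolding same_jet_iff[OF at c z \<phi>L \<phi>(2) \<psi>L \<psi>(2)] .
      \<comment> \<open>The quotient takes \<open>S\<close> close to its image of
        \<open>pimage \<phi> S\<close>, which lies in \<open>pimage \<psi> S\<close>, and that is
        close to \<open>S\<close>. Inclusion suffices in the middle; points of \<open>S\<close>
        outside the domain of \<open>\<phi>\<close> may prevent equality.\<close>
      have ap: "near ?I (snd c z) (Suc (Suc n)) (cimg c S) (cimg c (pimage \<phi> S))"
        using a\<phi> unfolding capprox_def[OF at c z] by blast
      have ps: "near ?I (snd c z) (Suc (Suc n)) (cimg c (pimage \<psi> S)) (cimg c S)"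
        using a\<psi> unfolding capprox_def[OF at c z] by blast
      have "pimage ?h (pimage \<phi> S) \<subseteq> pimage \<psi> S"
      proof
        fix y assume "y \<in> pimage ?h (pimage \<phi> S)"
        then obtain x w where x: "x \<in> S" "\<phi> x = Some w" "?h w = Some y" by (auto simp: pimage_def)
        have "pmap_inv \<phi> w = Some x" using pmap_inv_eq[OF \<phi>L] x(2) by blast
        then have "\<psi> x = Some y" using x(3) by (simp add: map_comp_def)
        then show "y \<in> pimage \<psi> S" using x(1) by (auto simp: pimage_def)
      qed
      then have sub: "cimg c (pimage ?h (pimage \<phi> S)) \<subseteq> cimg c (pimage \<psi> S)" unfolding cimg_def by blast
      have "near ?I (snd c z) (Suc (Suc n)) (cimg c (pimage ?h S)) (cimg c (pimage \<psi> S))"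
        by (rule near_superset[OF near_pimage[OF at c z hL hz n'(3) ap] sub])
      then have nr: "near ?I (snd c z) (Suc (Suc n)) (cimg c (pimage ?h S)) (cimg c S)"
        by (rule near_trans[OF F _ ps n'(3) cimg_coord[OF at c z]])
      show ?thesis using next_order_identity[OF M LP TG n S c z LF hG hz H nr]
        unfolding qO same_jet_iff[OF at c z \<phi>L \<phi>(2) \<psi>L \<psi>(2)] .
    qed
    then show "\<exists>e>0. \<forall>\<psi>\<in>G. \<psi> z = Some z \<longrightarrow> capprox m c z (Suc (Suc n)) (pimage \<psi> S) S \<longrightarrow>
      cdist (djet_idx m (Suc n)) (jcoord m c (Suc n) \<phi> (snd c z)) (jcoord m c (Suc n) \<psi> (snd c z)) < e \<longrightarrow>
      same_jet m A (Suc n) z \<phi> \<psi>"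
      by (intro exI[of _ e] conjI e(1) ballI impI)
  qed
qed

theorem theorem5p1:
  fixes A :: "('a, nat) chart set" and m p nstar n :: nat
    and G :: "'a pmap set" and zo :: "'a sjet"
  assumes "smooth_manifold {..<m} A"
    and "lie_pseudogroup m A nstar G"
    and "tame m A nstar G"
    and "n \<ge> nstar"
    and "zo \<in> sjets m A p n"
    and "locally_free_at m A G p n zo"
  shows "\<forall>k::nat. \<forall>zk \<in> sjets m A p (n + k).
           sjet_proj m A p n zk = zo \<longrightarrow> locally_free_at m A G p (n + k) zk"
proof (intro allI ballI impI)
  fix k zk assume "zk \<in> sjets m A p (n + k)" and proj: "sjet_proj m A p n zk = zo"
  then obtain z S where zk: "zk = sjet m A p (n + k) z S" and S: "embedded_submanifold {..<m} A p S" "z \<in> S"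
    unfolding sjets_def by blast
  have at: "smooth_atlas {..<m} A" using assms(1) by (simp add: smooth_manifold_def)
  have "z \<in> points A" using S unfolding embedded_submanifold_def by blast
  then obtain c where c: "c \<in> A" and z: "z \<in> fst c" unfolding points_def by blast
  have n1: "1 \<le> n + k" using assms(2,4) unfolding lie_pseudogroup_def by linarith
  \<comment> \<open>\<open>sjet_proj\<close> goes through the chosen representative of
    \<open>zk\<close>, so this very choice must represent the jets of all intermediate
    orders.\<close>
  define R where "R = sjet_rep zk"
  note R = sjet_rep_props[OF at c z n1 S, folded zk, folded R_def]
  have zkR: "sjet m A p (n + k) z S = sjet m A p (n + k) z R"
    using sjet_eq_iff[OF at c z n1 slice_embedded[OF at c z S] S(2) R(1,2)] R(3) by blast
  have "zo = sjet m A p n z R" using proj zk by (simp add: sjet_proj_def R_def sjet_def)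
  then have L0: "locally_free_at m A G p n (sjet m A p n z R)" using assms(6) by simp
  have "locally_free_at m A G p (n + j) (sjet m A p (n + j) z R)" for j
  proof (induction j)
    case (Suc j)
    have "nstar \<le> n + j" using assms(4) by simp
    from locally_free_Suc[OF assms(1-3) this R(1,2) Suc] show ?case by simp
  qed (simp add: L0)
  then show "locally_free_at m A G p (n + k) zk" unfolding zk zkR .
qed

end
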